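(* Let $\mathrm{HYP}$ be the $\omega$-model of second-order arithmetic whose sets are exactly the hyperarithmetic subsets of $\omega$, and recall $L_{\omega_1^{ck}}\cap 2^\omega=\mathrm{HYP}$. For any $A\subseteq \mathrm{HYP}\cap 2^\omega$, the following are equivalent: (1) there is a completely determined Borel code for $A$ in $\mathrm{HYP}$; (2) there is a determined Borel code for $A$ in $\mathrm{HYP}$; (3) $A$ is $\Delta_1(L_{\omega_1^{ck}})$, i.e. both $A$ and $(\mathrm{HYP}\cap 2^\omega)\setminus A$ are $\Sigma_1$-definable over $L_{\omega_1^{ck}}$ (with parameters from $L_{\omega_1^{ck}}$).
   Context: A labeled Borel code is a tree $T\subseteq\omega^{<\omega}$ (closed under initial segments) with no infinite path, together with a labeling $\ell$ on $T$ such that each interior node is labeled $\bigcup$ (union node) or $\bigcap$ (intersection node), and each leaf is labeled by a standard code for a clopen subset of $2^\omega$. A labeled Borel code in $\mathrm{HYP}$ is a pair $(T,\ell)$ of hyperarithmetic sets satisfying these conditions except that $T$ is only required to have no hyperarithmetic infinite path. For $X\in2^\omega$, an evaluation map for $X$ in $T$ is $f:T\to\{0,1\}$ such that: at a leaf $\eta$, $f(\eta)=1$ iff $X$ is in the clopen set $\ell(\eta)$; at a union node $\sigma$, $f(\sigma)=1$ iff $f(\sigma^\frown n)=1$ for some $n$; at an intersection node $\sigma$, $f(\sigma)=1$ iff $f(\sigma^\frown n)=1$ for all $n$ with $\sigma^\frown n\in T$. A winning strategy for $X$ in $T$ is a partial function $f:\subseteq T\to\{0,1\}$ with $f(\langle\rangle)$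 defined such that: if $\sigma$ is a leaf and $f(\sigma)$ is defined then $f(\sigma)=1$ iff $X\in\ell(\sigma)$; if $\sigma$ is a union node, $f(\sigma)=1$ implies $f(\sigma^\frown n)=1$ for some $n$, and $f(\sigma)=0$ implies $f(\sigma^\frown n)=0$ for all $n$ with $\sigma^\frown n\in T$; if $\sigma$ is an intersection node, $f(\sigma)=0$ implies $f(\sigma^\frown n)=0$ for some $n$, and $f(\sigma)=1$ implies $f(\sigma^\frown n)=1$ for all $n$ with $\sigma^\frown n\in T$. In $\mathrm{HYP}$: a code is completely determined if every $X\in\mathrm{HYP}$ has an evaluation map in $\mathrm{HYP}$, and determined if every $X\in\mathrm{HYP}$ has a winning strategy in $\mathrm{HYP}$. A (completely) determined code $T$ in $\mathrm{HYP}$ is a code for $A$ if for every $X\in\mathrm{HYP}$: $X\in A$ iff there is an evaluation map (resp. winning strategy) $f\in\mathrm{HYP}$ for $X$ in $T$ with $f(\langle\rangle)=1$. *)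

theory Defs
  imports "HOL-Library.Nat_Bijection" "HOL-Library.Countable_Set_Type"
begin

section \<open>Oracle computability\<close>

text \<open>
  Partial recursive functions relative to an oracle, presented as unary functions on the naturals
  with the pairing function \<^const>\<open>prod_encode\<close> as the means of having several arguments.
\<close>

datatype prog =
    Zer
  | Succ
  | Fst
  | Snd
  | Oracle
  | Pairing prog prog
  | Comp prog prog
  | Prec prog prog
  | Mu prog

instance prog :: countable
  by countable_datatype

text \<open>\<open>eval X c n y\<close>: program \<open>c\<close> with oracle \<open>X\<close> halts on input \<open>n\<close> with output \<open>y\<close>.\<close>

inductive eval :: "nat set \<Rightarrow> prog \<Rightarrow> nat \<Rightarrow> nat \<Rightarrow> bool" for X where
  Zer: "eval X Zer n 0"
| Succ: "eval X Succ n (Suc n)"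
| Fst: "eval X Fst (prod_encode (m, n)) m"
| Snd: "eval X Snd (prod_encode (m, n)) n"
| Oracle: "eval X Oracle n (of_bool (n \<in> X))"
| Pairing: "\<lbrakk>eval X c n a; eval X d n b\<rbrakk> \<Longrightarrow> eval X (Pairing c d) n (prod_encode (a, b))"
| Comp: "\<lbrakk>eval X d n a; eval X c a b\<rbrakk> \<Longrightarrow> eval X (Comp c d) n b"
| Prec_0: "eval X c n a \<Longrightarrow> eval X (Prec c d) (prod_encode (n, 0)) a"
| Prec_Suc: "\<lbrakk>eval X (Prec c d) (prod_encode (n, k)) a;
              eval X d (prod_encode (n, prod_encode (k, a))) b\<rbrakk>
             \<Longrightarrow> eval X (Prec c d) (prod_encode (n, Suc k)) b"
| Mu: "\<lbrakk>eval X c (prod_encode (n, m)) 0;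
        \<And>k. k < m \<Longrightarrow> \<exists>v. eval X c (prod_encode (n, k)) (Suc v)\<rbrakk>
       \<Longrightarrow> eval X (Mu c) n m"

primrec goedel :: "prog \<Rightarrow> nat" where
  "goedel Zer = prod_encode (0, 0)"
| "goedel Succ = prod_encode (1, 0)"
| "goedel Fst = prod_encode (2, 0)"
| "goedel Snd = prod_encode (3, 0)"
| "goedel Oracle = prod_encode (4, 0)"
| "goedel (Pairing c d) = prod_encode (5, prod_encode (goedel c, goedel d))"
| "goedel (Comp c d) = prod_encode (6, prod_encode (goedel c, goedel d))"
| "goedel (Prec c d) = prod_encode (7, prod_encode (goedel c, goedel d))"
| "goedel (Mu c) = prod_encode (8, goedel c)"

definition turing_le :: "nat set \<Rightarrow> nat set \<Rightarrow> bool" (infix "\<le>\<^sub>T" 50) where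
  "Y \<le>\<^sub>T X \<longleftrightarrow> (\<exists>c. \<forall>n. eval X c n (of_bool (n \<in> Y)))"

definition computable :: "nat set \<Rightarrow> bool" where
  "computable Y \<longleftrightarrow> Y \<le>\<^sub>T {}"

definition turing_jump :: "nat set \<Rightarrow> nat set" where
  "turing_jump X = {goedel c | c. \<exists>y. eval X c (goedel c) y}"

definition computable_wellorder :: "nat rel \<Rightarrow> bool" where
  "computable_wellorder R \<longleftrightarrow> Well_order R \<and> computable (prod_encode ` R)"


section \<open>Hyperarithmetic sets\<close>

definition effective_join :: "nat set \<Rightarrow> (nat \<Rightarrow> nat set) \<Rightarrow> nat set" where
  "effective_join I H = {prod_encode (b, x) | b x. b \<in> I \<and> x \<in> H b}"

text \<open>
  \<open>H\<close> iterates the Turing jump along \<open>R\<close>; \<^const>\<open>underS\<close> is the set of strict predecessors.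
\<close>

definition jump_hierarchy :: "nat rel \<Rightarrow> (nat \<Rightarrow> nat set) \<Rightarrow> bool" where
  "jump_hierarchy R H \<longleftrightarrow>
     (\<forall>a \<in> Field R. H a = turing_jump (effective_join (underS R a) H))"

definition HYP :: "nat set set" where
  "HYP = {Y. \<exists>R H. computable_wellorder R \<and> jump_hierarchy R H \<and>
                   Y \<le>\<^sub>T effective_join (Field R) H}"


section \<open>Hereditarily countable sets and the constructible hierarchy\<close>

text \<open>
  Every set occurring in \<open>L\<close> below the first uncountable ordinal is hereditarily countable, so
  the datatype of hereditarily countable sets is a large enough universe for \<open>L\<close> at
  \<open>\<omega>\<^sub>1\<^sup>c\<^sup>k\<close>. Equality is extensional and membership is well-founded.
\<close>

datatype hc = HC (celts: "hc cset")

definition elts :: "hc \<Rightarrow> hc set" where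
  "elts x = rcset (celts x)"

lemma countable_elts [simp]: "countable (elts x)"
  by (simp add: elts_def)

lemma elts_HC_acset [simp]: "countable S \<Longrightarrow> elts (HC (acset S)) = S"
  by (simp add: elts_def)

lemma hc_eqI: "elts x = elts y \<Longrightarrow> x = y"
  by (metis elts_def hc.collapse rcset_inverse)

text \<open>
  The language of set theory with de Bruijn indices: a free variable \<open>i\<close> refers to position \<open>i\<close>
  of the environment.
\<close>

datatype fm = Mem nat nat | Equ nat nat | Neg fm | Conj fm fm | Exi fm

instance fm :: countable
  by countable_datatype

primrec arity :: "fm \<Rightarrow> nat" where
  "arity (Mem i j) = max (Suc i) (Suc j)"
| "arity (Equ i j) = max (Suc i) (Suc j)"
| "arity (Neg p) = arity p"
| "arity (Conj p q) = max (arity p) (arity q)"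
| "arity (Exi p) = arity p - 1"

primrec sats :: "hc set \<Rightarrow> hc list \<Rightarrow> fm \<Rightarrow> bool" where
  "sats M env (Mem i j) \<longleftrightarrow> env ! i \<in> elts (env ! j)"
| "sats M env (Equ i j) \<longleftrightarrow> env ! i = env ! j"
| "sats M env (Neg p) \<longleftrightarrow> \<not> sats M env p"
| "sats M env (Conj p q) \<longleftrightarrow> sats M env p \<and> sats M env q"
| "sats M env (Exi p) \<longleftrightarrow> (\<exists>x \<in> M. sats M (x # env) p)"

text \<open>The subset of \<open>M\<close> defined over \<open>(M, \<in>)\<close> by the formula \<open>p\<close> with parameters \<open>ps\<close>.\<close>

definition defined_by :: "hc set \<Rightarrow> fm \<Rightarrow> hc list \<Rightarrow> hc set" where
  "defined_by M p ps = {y \<in> M. sats M (y # ps) p}"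

definition DPow :: "hc set \<Rightarrow> hc set" where
  "DPow M = {x. \<exists>p ps. set ps \<subseteq> M \<and> arity p \<le> Suc (length ps) \<and> elts x = defined_by M p ps}"

text \<open>
  \<open>L\<^sub>\<alpha>\<close> is the union of the definable power sets of \<open>L\<^sub>\<beta>\<close> for \<open>\<beta> \<in> \<alpha>\<close>, see \<open>Lset_eq\<close> below.
\<close>

primrec Lset :: "hc \<Rightarrow> hc set" where
  "Lset (HC A) = \<Union> (DPow ` rcset (cimage Lset A))"

lemma Lset_eq: "Lset x = (\<Union>y \<in> elts x. DPow (Lset y))"
  by (cases x) (simp add: elts_def cimage.rep_eq)

lemma countable_DPow:
  assumes "countable M"
  shows "countable (DPow M)"
proof -
  have "countable ((UNIV :: fm set) \<times> lists M)"
    using assms by (intro countable_SIGMA) auto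
  moreover have "elts ` DPow M \<subseteq> (\<lambda>(p, ps). defined_by M p ps) ` (UNIV \<times> lists M)"
    by (fastforce simp: DPow_def image_iff in_lists_conv_set)
  ultimately have "countable (elts ` DPow M)"
    by (meson countable_image countable_subset)
  moreover have "inj_on elts (DPow M)"
    by (simp add: inj_on_def hc_eqI)
  ultimately show ?thesis
    using countable_image_inj_on by blast
qed

lemma countable_Lset: "countable (Lset x)"
  by (induction x) (auto simp: cimage.rep_eq intro!: countable_UN countable_DPow)

definition transitive :: "hc \<Rightarrow> bool" where
  "transitive x \<longleftrightarrow> (\<forall>y \<in> elts x. elts y \<subseteq> elts x)"

definition ordinal :: "hc \<Rightarrow> bool" where
  "ordinal x \<longleftrightarrow> transitive x \<and> (\<forall>y \<in> elts x. transitive y)"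

definition is_order_type :: "nat rel \<Rightarrow> hc \<Rightarrow> bool" where
  "is_order_type R x \<longleftrightarrow> ordinal x \<and>
     (\<exists>f. bij_betw f (Field R) (elts x) \<and>
          (\<forall>a \<in> Field R. \<forall>b \<in> Field R. a \<in> underS R b \<longleftrightarrow> f a \<in> elts (f b)))"

definition computable_ordinal :: "hc \<Rightarrow> bool" where
  "computable_ordinal x \<longleftrightarrow> (\<exists>R. computable_wellorder R \<and> is_order_type R x)"

lemma eval_deterministic: "eval X c n y \<Longrightarrow> eval X c n z \<Longrightarrow> y = z"
proof (induction arbitrary: z rule: eval.induct)
  case (Mu c n m)
  from Mu.prems obtain m' where z: "z = m'" "eval X c (prod_encode (n, m')) 0"
    "\<And>k. k < m' \<Longrightarrow> \<exists>v. eval X c (prod_encode (n, k)) (Suc v)"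
    by (cases rule: eval.cases) auto
  have "\<not> m < m'" using z(3) Mu.IH(1) by fastforce
  moreover have "\<not> m' < m" using z(2) Mu.IH(2) by fastforce
  ultimately show ?case using z(1) by simp
next
  case (Prec_0 c n a d)
  from Prec_0.prems show ?case
    by (cases rule: eval.cases) (auto dest: Prec_0.IH)
next
  case (Prec_Suc c d n k a b)
  from Prec_Suc.prems show ?case
    by (cases rule: eval.cases) (auto dest: Prec_Suc.IH)
next
  case (Pairing c n a d b)
  from Pairing.prems show ?case
    by (cases rule: eval.cases) (auto dest: Pairing.IH)
next
  case (Comp d n a c b)
  from Comp.prems show ?case
    by (cases rule: eval.cases) (auto dest: Comp.IH)
qed (auto elim: eval.cases)

lemma countable_computable: "countable {Y. computable Y}"
proof -
  have "{Y. computable Y} \<subseteq> range (\<lambda>c. {n. eval {} c n 1})"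
  proof
    fix Y assume "Y \<in> {Y. computable Y}"
    then obtain c where c: "\<And>n. eval {} c n (of_bool (n \<in> Y))"
      by (auto simp: computable_def turing_le_def)
    have "n \<in> Y \<longleftrightarrow> eval {} c n 1" for n
    proof
      assume "n \<in> Y" then show "eval {} c n 1" using c[of n] by simp
    next
      assume "eval {} c n 1"
      then have "1 = (of_bool (n \<in> Y) :: nat)" using c eval_deterministic by blast
      then show "n \<in> Y" by (cases "n \<in> Y") auto
    qed
    then have "Y = {n. eval {} c n 1}" by blast
    then show "Y \<in> range (\<lambda>c. {n. eval {} c n 1})" by blast
  qed
  then show ?thesis
    by (meson countable_subset countableI_type countable_image)
qed

lemma is_order_type_unique:
  assumes R: "Well_order R" and x: "is_order_type R x" and y: "is_order_type R y"
  shows "x = y"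
proof -
  obtain f where f: "bij_betw f (Field R) (elts x)"
    "\<And>a b. a \<in> Field R \<Longrightarrow> b \<in> Field R \<Longrightarrow> a \<in> underS R b \<longleftrightarrow> f a \<in> elts (f b)"
    and tx: "transitive x"
    using x by (auto simp: is_order_type_def ordinal_def)
  obtain g where g: "bij_betw g (Field R) (elts y)"
    "\<And>a b. a \<in> Field R \<Longrightarrow> b \<in> Field R \<Longrightarrow> a \<in> underS R b \<longleftrightarrow> g a \<in> elts (g b)"
    and ty: "transitive y"
    using y by (auto simp: is_order_type_def ordinal_def)
  have below: "elts (h b) = h ` underS R b"
    if h: "bij_betw h (Field R) (elts z)"
      "\<And>a b. a \<in> Field R \<Longrightarrow> b \<in> Field R \<Longrightarrow> a \<in> underS R b \<longleftrightarrow> h a \<in> elts (h b)"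
      and tz: "transitive z" and b: "b \<in> Field R" for h z b
  proof
    have hb: "elts (h b) \<subseteq> h ` Field R"
      using tz b h(1) by (auto simp: transitive_def bij_betw_def)
    show "elts (h b) \<subseteq> h ` underS R b"
      using hb h(2) b by blast
    show "h ` underS R b \<subseteq> elts (h b)"
      using h(2) b by (auto simp: underS_def Field_def)
  qed
  have wf: "wf (R - Id)"
    using R by (simp add: well_order_on_def)
  have "a \<in> Field R \<longrightarrow> f a = g a" for a
  proof (induction a rule: wf_induct_rule[OF wf])
    case (1 a)
    show ?case
    proof
      assume a: "a \<in> Field R"
      have "f ` underS R a = g ` underS R a"
        using 1 by (intro image_cong) (auto simp: underS_def Field_def)
      then show "f a = g a"
        using below[OF f tx a] below[OF g ty a] by (intro hc_eqI) simp
    qed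
  qed
  then have "f ` Field R = g ` Field R" by (intro image_cong) auto
  then show ?thesis
    using f(1) g(1) by (intro hc_eqI) (simp add: bij_betw_def)
qed

lemma countable_computable_ordinals: "countable {x. computable_ordinal x}"
proof -
  define W where "W = {R. computable_wellorder R}"
  have "inj_on (image prod_encode) W"
    by (meson inj_on_image_eq_iff inj_onI inj_prod_encode subset_UNIV)
  moreover have "image prod_encode ` W \<subseteq> {Y. computable Y}"
    by (auto simp: W_def computable_wellorder_def)
  ultimately have "countable W"
    by (meson countable_computable countable_subset countable_image_inj_on)
  moreover have "{x. computable_ordinal x} \<subseteq> (\<lambda>R. THE x. is_order_type R x) ` W"
  proof
    fix x assume "x \<in> {x. computable_ordinal x}"
    then obtain R where R: "computable_wellorder R" "is_order_type R x"
      by (auto simp: computable_ordinal_def)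
    then have "(THE x. is_order_type R x) = x"
      by (meson computable_wellorder_def is_order_type_unique the_equality)
    then show "x \<in> (\<lambda>R. THE x. is_order_type R x) ` W"
      using R(1) by (auto simp: W_def)
  qed
  ultimately show ?thesis
    by (meson countable_image countable_subset)
qed

text \<open>The computable ordinals form an initial segment, so their set is the least non-computable ordinal.\<close>

definition omega1ck :: hc where
  "omega1ck = HC (acset {x. computable_ordinal x})"

lemma elts_omega1ck: "elts omega1ck = {x. computable_ordinal x}"
  by (simp add: omega1ck_def countable_computable_ordinals)


section \<open>\<open>\<Sigma>\<^sub>1\<close> and \<open>\<Delta>\<^sub>1\<close> definability\<close>

inductive delta0_fm :: "fm \<Rightarrow> bool" where
  "delta0_fm (Mem i j)"
| "delta0_fm (Equ i j)"
| "delta0_fm p \<Longrightarrow> delta0_fm (Neg p)"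
| "\<lbrakk>delta0_fm p; delta0_fm q\<rbrakk> \<Longrightarrow> delta0_fm (Conj p q)"
| bounded_Exi: "delta0_fm p \<Longrightarrow> delta0_fm (Exi (Conj (Mem 0 (Suc i)) p))"

inductive sigma1_fm :: "fm \<Rightarrow> bool" where
  "delta0_fm p \<Longrightarrow> sigma1_fm p"
| "sigma1_fm p \<Longrightarrow> sigma1_fm (Exi p)"

definition sigma1_definable :: "hc set \<Rightarrow> hc set \<Rightarrow> bool" where
  "sigma1_definable M S \<longleftrightarrow>
     (\<exists>p ps. sigma1_fm p \<and> set ps \<subseteq> M \<and> arity p \<le> Suc (length ps) \<and> S = defined_by M p ps)"

primrec hc_of_nat :: "nat \<Rightarrow> hc" where
  "hc_of_nat 0 = HC cempty"
| "hc_of_nat (Suc n) = HC (cinsert (hc_of_nat n) (celts (hc_of_nat n)))"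

definition hc_of_nat_set :: "nat set \<Rightarrow> hc" where
  "hc_of_nat_set X = HC (acset (hc_of_nat ` X))"

definition delta1_L_omega1ck :: "nat set set \<Rightarrow> bool" where
  "delta1_L_omega1ck A \<longleftrightarrow>
     sigma1_definable (Lset omega1ck) (hc_of_nat_set ` A) \<and>
     sigma1_definable (Lset omega1ck) (hc_of_nat_set ` (HYP - A))"


section \<open>Labeled Borel codes in \<open>HYP\<close>\<close>

text \<open>
  A clopen subset of Cantor space is coded by a finite list of binary strings, standing for the
  union of the corresponding basic open sets. Points of Cantor space are subsets of the naturals.
\<close>

datatype label = Union_node | Inter_node | Clopen "bool list list"

definition clopen_set :: "bool list list \<Rightarrow> nat set set" where
  "clopen_set F = {X. \<exists>s \<in> set F. \<forall>i < length s. s ! i \<longleftrightarrow> i \<in> X}"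

primrec label_encode :: "label \<Rightarrow> nat" where
  "label_encode Union_node = 0"
| "label_encode Inter_node = 1"
| "label_encode (Clopen F) = 2 + list_encode (map (\<lambda>s. list_encode (map of_bool s)) F)"

definition tree_in_HYP :: "nat list set \<Rightarrow> bool" where
  "tree_in_HYP T \<longleftrightarrow> list_encode ` T \<in> HYP"

definition labeling_in_HYP :: "(nat list \<rightharpoonup> label) \<Rightarrow> bool" where
  "labeling_in_HYP l \<longleftrightarrow>
     {prod_encode (list_encode s, label_encode k) | s k. l s = Some k} \<in> HYP"

definition map_in_HYP :: "(nat list \<rightharpoonup> bool) \<Rightarrow> bool" where
  "map_in_HYP f \<longleftrightarrow> {prod_encode (list_encode s, of_bool b) | s b. f s = Some b} \<in> HYP"

definition path_in_HYP :: "(nat \<Rightarrow> nat) \<Rightarrow> bool" where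
  "path_in_HYP g \<longleftrightarrow> {prod_encode (n, g n) | n. True} \<in> HYP"

definition leaf :: "nat list set \<Rightarrow> nat list \<Rightarrow> bool" where
  "leaf T s \<longleftrightarrow> s \<in> T \<and> (\<forall>n. s @ [n] \<notin> T)"

definition borel_code_in_HYP :: "nat list set \<Rightarrow> (nat list \<rightharpoonup> label) \<Rightarrow> bool" where
  "borel_code_in_HYP T l \<longleftrightarrow>
     tree_in_HYP T \<and> labeling_in_HYP l \<and>
     [] \<in> T \<and> (\<forall>s t. s @ t \<in> T \<longrightarrow> s \<in> T) \<and>
     \<not> (\<exists>g. path_in_HYP g \<and> (\<forall>n. map g [0..<n] \<in> T)) \<and>
     dom l = T \<and>
     (\<forall>s \<in> T. if leaf T s then \<exists>F. l s = Some (Clopen F)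
              else l s = Some Union_node \<or> l s = Some Inter_node)"

text \<open>
  The functions into \<open>{0,1}\<close> below take values in \<^typ>\<open>bool\<close>, with \<^const>\<open>True\<close> for \<open>1\<close>.
\<close>

definition evaluation_map ::
    "nat list set \<Rightarrow> (nat list \<rightharpoonup> label) \<Rightarrow> nat set \<Rightarrow> (nat list \<rightharpoonup> bool) \<Rightarrow> bool" where
  "evaluation_map T l X f \<longleftrightarrow>
     dom f = T \<and>
     (\<forall>s \<in> T.
        (\<forall>F. l s = Some (Clopen F) \<longrightarrow> (f s = Some True \<longleftrightarrow> X \<in> clopen_set F)) \<and>
        (l s = Some Union_node \<longrightarrow>
           (f s = Some True \<longleftrightarrow> (\<exists>n. f (s @ [n]) = Some True))) \<and>
        (l s = Some Inter_node \<longrightarrow>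
           (f s = Some True \<longleftrightarrow> (\<forall>n. s @ [n] \<in> T \<longrightarrow> f (s @ [n]) = Some True))))"

definition winning_strategy ::
    "nat list set \<Rightarrow> (nat list \<rightharpoonup> label) \<Rightarrow> nat set \<Rightarrow> (nat list \<rightharpoonup> bool) \<Rightarrow> bool" where
  "winning_strategy T l X f \<longleftrightarrow>
     dom f \<subseteq> T \<and> [] \<in> dom f \<and>
     (\<forall>s \<in> T.
        (\<forall>F. l s = Some (Clopen F) \<longrightarrow> s \<in> dom f \<longrightarrow>
           (f s = Some True \<longleftrightarrow> X \<in> clopen_set F)) \<and>
        (l s = Some Union_node \<longrightarrow>
           (f s = Some True \<longrightarrow> (\<exists>n. f (s @ [n]) = Some True)) \<and>
           (f s = Some False \<longrightarrow> (\<forall>n. s @ [n] \<in> T \<longrightarrow> f (s @ [n]) = Some False))) \<and>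
        (l s = Some Inter_node \<longrightarrow>
           (f s = Some False \<longrightarrow> (\<exists>n. f (s @ [n]) = Some False)) \<and>
           (f s = Some True \<longrightarrow> (\<forall>n. s @ [n] \<in> T \<longrightarrow> f (s @ [n]) = Some True))))"

definition completely_determined_in_HYP :: "nat list set \<Rightarrow> (nat list \<rightharpoonup> label) \<Rightarrow> bool" where
  "completely_determined_in_HYP T l \<longleftrightarrow> borel_code_in_HYP T l \<and>
     (\<forall>X \<in> HYP. \<exists>f. map_in_HYP f \<and> evaluation_map T l X f)"

definition determined_in_HYP :: "nat list set \<Rightarrow> (nat list \<rightharpoonup> label) \<Rightarrow> bool" where
  "determined_in_HYP T l \<longleftrightarrow> borel_code_in_HYP T l \<and>
     (\<forall>X \<in> HYP. \<exists>f. map_in_HYP f \<and> winning_strategy T l X f)"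

definition completely_determined_code_for ::
    "nat list set \<Rightarrow> (nat list \<rightharpoonup> label) \<Rightarrow> nat set set \<Rightarrow> bool" where
  "completely_determined_code_for T l A \<longleftrightarrow> completely_determined_in_HYP T l \<and>
     (\<forall>X \<in> HYP. X \<in> A \<longleftrightarrow>
        (\<exists>f. map_in_HYP f \<and> evaluation_map T l X f \<and> f [] = Some True))"

definition determined_code_for ::
    "nat list set \<Rightarrow> (nat list \<rightharpoonup> label) \<Rightarrow> nat set set \<Rightarrow> bool" where
  "determined_code_for T l A \<longleftrightarrow> determined_in_HYP T l \<and>
     (\<forall>X \<in> HYP. X \<in> A \<longleftrightarrow>
        (\<exists>f. map_in_HYP f \<and> winning_strategy T l X f \<and> f [] = Some True))"

end

theory Submission
  imports Defs "HOL-Library.Multiset"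
begin

text \<open>
  The hyperarithmetic sets are the sets of winning positions of computable well-founded games in
  which a player without a move loses: a jump hierarchy decides such games, and conversely both
  computations along a jump hierarchy and truth in the levels of \<open>L\<close> along a computable well-order
  are such games. The key closure property is that the unique path of a computable tree is
  game-definable, because the rank comparison game between subtrees finds it; this makes game
  values with respect to game-definable moves again game-definable. So \<open>HYP\<close> consists of the sets
  of naturals in \<open>L\<close> at \<open>\<omega>\<^sub>1\<^sup>c\<^sup>k\<close>.

  An evaluation map is a winning strategy. Two winning strategies in \<open>HYP\<close> with different values
  at the root would yield a path in \<open>HYP\<close>, and being a winning strategy is a \<open>\<Delta>\<^sub>0\<close> condition
  on a set of naturals with parameters in \<open>L\<close>; hence a determined code gives a \<open>\<Delta>\<^sub>1\<close> set.
  Conversely, membership of \<open>X\<close> in a \<open>\<Sigma>\<^sub>1\<close> set means that a tree \<open>T\<^sub>X\<close>, hyperarithmetic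
  uniformly in \<open>X\<close>, has no path: a path gives, for every computable linear order, a descending
  sequence or the truth values of the levels of \<open>L\<close> along it together with a refutation of
  every witness. For a \<open>\<Delta>\<^sub>1\<close> set exactly one of two such trees has a path, and the
  Borel code unfolds the game comparing their ranks. That game has no hyperarithmetic infinite
  play, and for each \<open>X\<close> in \<open>HYP\<close> the positions compatible with \<open>X\<close> form a well-founded game,
  so its values are an evaluation map in \<open>HYP\<close>.
\<close>

section \<open>Total recursive functions\<close>

text \<open>The obstacle is that \<open>HYP\<close> cannot decide which indices of computable orders
  are well-founded, nor at which stage a set appears. Three constructions avoid asking. Games with
  recursive moves carry no ordinal, yet can be nested: demanding least winning moves makes the
  record of a game unique, hence the only path of a recursive tree. In the tree of a \<Sigma>1 set,
  every index of a linear order may be treated either way and a path has to justify its choice; some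
  ill-founded orders have no hyperarithmetic descending sequence, so these paths are of arbitrary
  complexity. Finally, the comparison game must be one tree for all \<open>X\<close>: a play builds
  its own approximation to \<open>X\<close>, and leaving it is settled at a leaf. A set outside
  \<open>HYP\<close> may have paths in both trees, so this tree may be ill-founded; but a
  hyperarithmetic play would yield an \<open>X\<close> in \<open>HYP\<close> with paths in both,
  which is impossible. This is the slack that the notion of a code in \<open>HYP\<close>
  allows.\<close>

abbreviation pe :: "nat \<Rightarrow> nat \<Rightarrow> nat" where
  "pe a b \<equiv> prod_encode (a, b)"

definition pfst :: "nat \<Rightarrow> nat" where "pfst n = fst (prod_decode n)"
definition psnd :: "nat \<Rightarrow> nat" where "psnd n = snd (prod_decode n)"

lemma pfst_pe [simp]: "pfst (pe a b) = a"
  and psnd_pe [simp]: "psnd (pe a b) = b"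
  by (simp_all add: pfst_def psnd_def)

lemma pe_pfst_psnd [simp]: "pe (pfst n) (psnd n) = n"
  by (simp add: pfst_def psnd_def)

lemma pe_eq_iff: "pe a b = n \<longleftrightarrow> a = pfst n \<and> b = psnd n"
  by auto

lemma psnd_le: "psnd n \<le> n" and pfst_le: "pfst n \<le> n"
  using le_prod_encode_2[of "psnd n" "pfst n"] le_prod_encode_1[of "pfst n" "psnd n"] by auto

lemma pe_mono2: "b < c \<Longrightarrow> pe a b < pe a c"
proof (induction c)
  case (Suc c)
  have "pe a c < pe a (Suc c)" by (simp add: prod_encode_def)
  then show ?case using Suc by (cases "b = c") auto
qed simp

lemma less_pe_2: "0 < a \<Longrightarrow> b < pe a b"
proof -
  have "b \<le> triangle b" by (induction b) auto
  moreover have "triangle b \<le> triangle (a + b)" by (induction a) auto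
  ultimately show "0 < a \<Longrightarrow> b < pe a b" by (simp add: prod_encode_def)
qed

lemma psnd_less: "0 < pfst n \<Longrightarrow> psnd n < n"
  by (metis less_pe_2 pe_pfst_psnd)

text \<open>One program serves all oracles, so a recursive function may be used inside a computation
  relative to any stage of a jump hierarchy.\<close>

definition recfn :: "(nat \<Rightarrow> nat) \<Rightarrow> bool" where
  "recfn f \<longleftrightarrow> (\<exists>c. \<forall>X n. eval X c n (f n))"

definition recp :: "(nat \<Rightarrow> bool) \<Rightarrow> bool" where
  "recp P \<longleftrightarrow> recfn (\<lambda>n. of_bool (P n))"

named_theorems rec_intros

lemma recfn_cong: "(\<And>n. f n = g n) \<Longrightarrow> recfn g \<Longrightarrow> recfn f"
  by (simp add: recfn_def)

lemma recp_cong: "(\<And>n. P n \<longleftrightarrow> Q n) \<Longrightarrow> recp Q \<Longrightarrow> recp P"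
  by (simp add: recp_def)

lemma eval_Fst: "eval X Fst n (pfst n)"
  by (metis eval.Fst pe_pfst_psnd)

lemma eval_Snd: "eval X Snd n (psnd n)"
  by (metis eval.Snd pe_pfst_psnd)

lemma rec_comp: "recfn f \<Longrightarrow> recfn g \<Longrightarrow> recfn (\<lambda>n. f (g n))"
  unfolding recfn_def by (meson eval.Comp)

lemma rec_pe [rec_intros]: "recfn f \<Longrightarrow> recfn g \<Longrightarrow> recfn (\<lambda>n. pe (f n) (g n))"
  unfolding recfn_def by (meson eval.Pairing)

lemma rec_pfst [rec_intros]: "recfn f \<Longrightarrow> recfn (\<lambda>n. pfst (f n))"
  by (rule rec_comp) (use eval_Fst in \<open>auto simp: recfn_def\<close>)

lemma rec_psnd [rec_intros]: "recfn f \<Longrightarrow> recfn (\<lambda>n. psnd (f n))"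
  by (rule rec_comp) (use eval_Snd in \<open>auto simp: recfn_def\<close>)

lemma rec_id [rec_intros]: "recfn (\<lambda>n. n)"
proof -
  have "recfn (\<lambda>n. pe (pfst n) (psnd n))"
    using eval.Pairing[OF eval_Fst eval_Snd] unfolding recfn_def by blast
  then show ?thesis by simp
qed

lemma rec_Suc [rec_intros]: "recfn f \<Longrightarrow> recfn (\<lambda>n. Suc (f n))"
  by (rule rec_comp) (use eval.Succ in \<open>auto simp: recfn_def\<close>)

primrec const_prog :: "nat \<Rightarrow> prog" where
  "const_prog 0 = Zer"
| "const_prog (Suc n) = Comp Succ (const_prog n)"

lemma eval_const_prog: "eval X (const_prog k) n k"
  by (induction k) (auto intro: eval.intros)

lemma rec_const [rec_intros]: "recfn (\<lambda>n. k)"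
  unfolding recfn_def using eval_const_prog by blast

lemma rec_prec_aux:
  assumes "recfn g" "recfn h"
  shows "recfn (\<lambda>n. rec_nat (g (pfst n)) (\<lambda>k a. h (pe (pfst n) (pe k a))) (psnd n))"
proof -
  obtain c d where c: "\<And>X n. eval X c n (g n)" and d: "\<And>X n. eval X d n (h n)"
    using assms by (auto simp: recfn_def)
  have "eval X (Prec c d) (pe m k) (rec_nat (g m) (\<lambda>k a. h (pe m (pe k a))) k)" for X m k
    by (induction k) (auto intro: eval.Prec_0 eval.Prec_Suc c d)
  then have "eval X (Prec c d) n (rec_nat (g (pfst n)) (\<lambda>k a. h (pe (pfst n) (pe k a))) (psnd n))" for X n
    by (metis pe_pfst_psnd)
  then show ?thesis unfolding recfn_def by blast
qed

lemma rec_rec_nat [rec_intros]: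
  assumes "recfn g" "recfn m" "recfn (\<lambda>z. h (pfst z) (pfst (psnd z)) (psnd (psnd z)))"
  shows "recfn (\<lambda>n. rec_nat (g n) (\<lambda>k a. h n k a) (m n))"
proof -
  have "recfn (\<lambda>n. pe n (m n))" by (intro rec_intros assms)
  from rec_comp[OF rec_prec_aux[OF assms(1,3)] this] show ?thesis by simp
qed

lemma rec_add [rec_intros]: "recfn f \<Longrightarrow> recfn g \<Longrightarrow> recfn (\<lambda>n. f n + g n)"
proof (rule recfn_cong[where g = "\<lambda>n. rec_nat (f n) (\<lambda>k a. Suc a) (g n)"])
  show "f n + g n = rec_nat (f n) (\<lambda>k a. Suc a) (g n)" for n
  proof -
    have "f n + m = rec_nat (f n) (\<lambda>k a. Suc a) m" for m by (induction m) simp_all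
    then show ?thesis by simp
  qed
qed (intro rec_intros)

lemma rec_pred: "recfn f \<Longrightarrow> recfn (\<lambda>n. f n - 1)"
proof (rule recfn_cong[where g = "\<lambda>n. rec_nat 0 (\<lambda>k a. k) (f n)"])
  show "f n - 1 = rec_nat 0 (\<lambda>k a. k) (f n)" for n by (cases "f n") simp_all
qed (intro rec_intros)

lemma rec_diff [rec_intros]:
  assumes "recfn f" "recfn g" shows "recfn (\<lambda>n. f n - g n)"
proof (rule recfn_cong[where g = "\<lambda>n. rec_nat (f n) (\<lambda>k a. a - 1) (g n)"])
  have "rec_nat a (\<lambda>k a. a - 1) b = a - b" for a b :: nat by (induction b) simp_all
  then show "f n - g n = rec_nat (f n) (\<lambda>k a. a - 1) (g n)" for n by simp
  show "recfn (\<lambda>n. rec_nat (f n) (\<lambda>k a. a - 1) (g n))"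
    by (intro rec_intros rec_pred assms)
qed

lemma rec_mult [rec_intros]:
  assumes "recfn f" "recfn g" shows "recfn (\<lambda>n. f n * g n)"
proof (rule recfn_cong[where g = "\<lambda>n. rec_nat 0 (\<lambda>k a. a + f n) (g n)"])
  have "rec_nat 0 (\<lambda>k c. c + a) b = a * b" for a b :: nat by (induction b) simp_all
  then show "f n * g n = rec_nat 0 (\<lambda>k a. a + f n) (g n)" for n by simp
  have "recfn (\<lambda>z. f (pfst z))" by (rule rec_comp[OF assms(1)]) (intro rec_intros)
  then show "recfn (\<lambda>n. rec_nat 0 (\<lambda>k a. a + f n) (g n))"
    by (intro rec_intros assms)
qed

lemma rec_of_bool [rec_intros]: "recp P \<Longrightarrow> recfn (\<lambda>n. of_bool (P n))"
  by (simp add: recp_def)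

lemma rec_if [rec_intros]:
  assumes "recp P" "recfn f" "recfn g"
  shows "recfn (\<lambda>n. if P n then f n else g n)"
proof (rule recfn_cong[where g = "\<lambda>n. of_bool (P n) * f n + (1 - of_bool (P n)) * g n"])
  show "recfn (\<lambda>n. of_bool (P n) * f n + (1 - of_bool (P n)) * g n)"
    by (intro rec_intros assms)
qed simp

lemma recp_not [rec_intros]: "recp P \<Longrightarrow> recp (\<lambda>n. \<not> P n)"
  unfolding recp_def by (rule recfn_cong[where g = "\<lambda>n. 1 - of_bool (P n)"]) (auto intro!: rec_intros)

lemma recp_conj [rec_intros]: "recp P \<Longrightarrow> recp Q \<Longrightarrow> recp (\<lambda>n. P n \<and> Q n)"
  unfolding recp_def by (rule recfn_cong[where g = "\<lambda>n. of_bool (P n) * of_bool (Q n)"]) (auto intro!: rec_intros)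

lemma recp_disj [rec_intros]: "recp P \<Longrightarrow> recp Q \<Longrightarrow> recp (\<lambda>n. P n \<or> Q n)"
  by (rule recp_cong[where Q = "\<lambda>n. \<not> (\<not> P n \<and> \<not> Q n)"], blast) (intro rec_intros)

lemma recp_imp [rec_intros]: "recp P \<Longrightarrow> recp Q \<Longrightarrow> recp (\<lambda>n. P n \<longrightarrow> Q n)"
  by (rule recp_cong[where Q = "\<lambda>n. \<not> P n \<or> Q n"], blast) (intro rec_intros)

lemma recp_const [rec_intros]: "recp (\<lambda>n. b)"
  by (simp add: recp_def rec_const)

lemma recp_le [rec_intros]: "recfn f \<Longrightarrow> recfn g \<Longrightarrow> recp (\<lambda>n. f n \<le> g n)"
  unfolding recp_def by (rule recfn_cong[where g = "\<lambda>n. 1 - (f n - g n)"]) (auto intro!: rec_intros)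

lemma recp_less [rec_intros]: "recfn f \<Longrightarrow> recfn g \<Longrightarrow> recp (\<lambda>n. f n < g n)"
  by (rule recp_cong[where Q = "\<lambda>n. \<not> g n \<le> f n"]) (auto intro!: rec_intros)

lemma recp_eq [rec_intros]: "recfn f \<Longrightarrow> recfn g \<Longrightarrow> recp (\<lambda>n. f n = g n)"
  by (rule recp_cong[where Q = "\<lambda>n. f n \<le> g n \<and> g n \<le> f n"]) (auto intro!: rec_intros)

lemma recp_comp: "recp P \<Longrightarrow> recfn f \<Longrightarrow> recp (\<lambda>n. P (f n))"
  unfolding recp_def by (rule rec_comp)

lemma recp_all_less [rec_intros]:
  assumes "recfn b" "recp (\<lambda>z. P (pfst z) (psnd z))"
  shows "recp (\<lambda>n. \<forall>k<b n. P n k)"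
  unfolding recp_def
proof (rule recfn_cong[where g = "\<lambda>n. rec_nat 1 (\<lambda>k a. a * of_bool (P n k)) (b n)"])
  have "rec_nat (1::nat) (\<lambda>k a. a * of_bool (P n k)) m = of_bool (\<forall>k<m. P n k)" for n m
    by (induction m) (auto simp: less_Suc_eq)
  then show "of_bool (\<forall>k<b n. P n k) = rec_nat (1::nat) (\<lambda>k a. a * of_bool (P n k)) (b n)" for n by simp
  have "recp (\<lambda>z. P (pfst z) (pfst (psnd z)))"
    using recp_comp[OF assms(2), of "\<lambda>z. pe (pfst z) (pfst (psnd z))"] by (simp add: rec_intros)
  then show "recfn (\<lambda>n. rec_nat 1 (\<lambda>k a. a * of_bool (P n k)) (b n))"
    by (intro rec_intros assms)
qed

lemma recp_ex_less [rec_intros]: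
  assumes "recfn b" "recp (\<lambda>z. P (pfst z) (psnd z))"
  shows "recp (\<lambda>n. \<exists>k<b n. P n k)"
  by (rule recp_cong[where Q = "\<lambda>n. \<not> (\<forall>k<b n. \<not> P n k)"], blast) (intro rec_intros assms)

lemma rec_mod2 [rec_intros]: assumes "recfn f" shows "recfn (\<lambda>n. f n mod 2)"
proof (rule recfn_cong[where g = "\<lambda>n. rec_nat 0 (\<lambda>k a. 1 - a) (f n)"])
  have "rec_nat 0 (\<lambda>k a. 1 - a) m = m mod (2::nat)" for m by (induction m) (auto, presburger)
  then show "f n mod 2 = rec_nat 0 (\<lambda>k a. 1 - a) (f n)" for n by simp
qed (intro rec_intros assms)

lemma rec_div2 [rec_intros]: assumes "recfn f" shows "recfn (\<lambda>n. f n div 2)"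
proof (rule recfn_cong[where g = "\<lambda>n. rec_nat 0 (\<lambda>k a. a + k mod 2) (f n)"])
  have "rec_nat 0 (\<lambda>k a. a + k mod 2) m = m div (2::nat)" for m by (induction m) (auto, presburger)
  then show "f n div 2 = rec_nat 0 (\<lambda>k a. a + k mod 2) (f n)" for n by simp
qed (intro rec_intros assms)

lemma recp_even [rec_intros]: assumes "recfn f" shows "recp (\<lambda>n. even (f n))"
  by (rule recp_cong[where Q = "\<lambda>n. f n mod 2 = 0"]) (auto intro!: rec_intros assms simp: even_iff_mod_2_eq_zero)

subsection \<open>Lists\<close>

definition hdc :: "nat \<Rightarrow> nat" where "hdc s = pfst (s - 1)"
definition tlc :: "nat \<Rightarrow> nat" where "tlc s = psnd (s - 1)"
definition consc :: "nat \<Rightarrow> nat \<Rightarrow> nat" where "consc x s = Suc (pe x s)"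
definition dropc :: "nat \<Rightarrow> nat \<Rightarrow> nat" where "dropc k s = rec_nat s (\<lambda>_ a. tlc a) k"
definition nthc :: "nat \<Rightarrow> nat \<Rightarrow> nat" where "nthc s k = hdc (dropc k s)"
text \<open>The code of a list bounds its length, so it is enough to count the nonempty tails among
  the first \<open>s\<close>.\<close>

definition lenc :: "nat \<Rightarrow> nat" where "lenc s = rec_nat 0 (\<lambda>k a. a + of_bool (dropc k s \<noteq> 0)) s"

lemma hdc_consc [simp]: "hdc (consc x s) = x" and tlc_consc [simp]: "tlc (consc x s) = s"
  and consc_nz [simp]: "consc x s \<noteq> 0" "0 < consc x s"
  by (simp_all add: hdc_def tlc_def consc_def)

lemma consc_hdc_tlc: "s \<noteq> 0 \<Longrightarrow> consc (hdc s) (tlc s) = s"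
  by (simp add: consc_def hdc_def tlc_def)

lemma consc_inject [simp]: "consc x s = consc y t \<longleftrightarrow> x = y \<and> s = t"
  by (simp add: consc_def)

lemma list_encode_Cons [simp]: "list_encode (x # xs) = consc x (list_encode xs)"
  by (simp add: consc_def)

declare list_encode.simps(2) [simp del]

lemma list_encode_surj: "\<exists>xs. s = list_encode xs"
  by (metis list_decode_inverse)

lemma list_encode_0_iff [simp]: "list_encode xs = 0 \<longleftrightarrow> xs = []"
  by (cases xs) auto

lemma tlc_0 [simp]: "tlc 0 = 0"
  by (simp add: tlc_def psnd_def prod_decode_def prod_decode_aux.simps)

lemma hdc_0 [simp]: "hdc 0 = 0"
  by (simp add: hdc_def pfst_def prod_decode_def prod_decode_aux.simps)

lemma tlc_list_encode: "tlc (list_encode xs) = list_encode (tl xs)"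
  by (cases xs) auto

lemma dropc_list_encode: "dropc k (list_encode xs) = list_encode (drop k xs)"
  by (induction k) (auto simp: dropc_def tlc_list_encode tl_drop drop_Suc)

lemma nthc_list_encode: "k < length xs \<Longrightarrow> nthc (list_encode xs) k = xs ! k"
  unfolding nthc_def dropc_list_encode by (metis Cons_nth_drop_Suc hdc_consc list_encode_Cons)

lemma consc_gt: "s < consc x s" "x < consc x s"
  by (simp_all add: consc_def less_Suc_eq_le le_prod_encode_1 le_prod_encode_2)

lemma length_le_list_encode: "length xs \<le> list_encode xs"
proof (induction xs)
  case (Cons x xs)
  then show ?case using consc_gt(1)[of "list_encode xs" x] by simp
qed simp

lemma lenc_list_encode [simp]: "lenc (list_encode xs) = length xs"
proof -
  have "rec_nat 0 (\<lambda>k a. a + of_bool (dropc k (list_encode xs) \<noteq> 0)) m = min m (length xs)" for m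
    by (induction m) (auto simp: dropc_list_encode)
  then show ?thesis using length_le_list_encode[of xs] by (simp add: lenc_def)
qed

lemma lenc_0 [simp]: "lenc 0 = 0"
  by (simp add: lenc_def)

lemma lenc_consc [simp]: "lenc (consc x s) = Suc (lenc s)"
  by (metis lenc_list_encode length_Cons list_encode_Cons list_encode_surj)

lemma nthc_consc_0 [simp]: "nthc (consc x s) 0 = x"
  by (simp add: nthc_def dropc_def)

lemma nthc_consc_Suc [simp]: "nthc (consc x s) (Suc k) = nthc s k"
proof -
  have "dropc (Suc k) (consc x s) = dropc k s"
    by (induction k) (auto simp: dropc_def)
  then show ?thesis by (simp add: nthc_def)
qed

lemma nthc_less: "x \<in> set xs \<Longrightarrow> x < list_encode xs"
proof (induction xs)
  case (Cons a xs)
  then show ?case using consc_gt[of "list_encode xs" a] consc_gt[of a "list_encode xs"] by auto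
qed simp

lemma rec_hdc [rec_intros]: "recfn f \<Longrightarrow> recfn (\<lambda>n. hdc (f n))"
  unfolding hdc_def by (intro rec_intros)

lemma rec_tlc [rec_intros]: "recfn f \<Longrightarrow> recfn (\<lambda>n. tlc (f n))"
  unfolding tlc_def by (intro rec_intros)

lemma rec_consc [rec_intros]: "recfn f \<Longrightarrow> recfn g \<Longrightarrow> recfn (\<lambda>n. consc (f n) (g n))"
  unfolding consc_def by (intro rec_intros)

lemma rec_dropc [rec_intros]: "recfn f \<Longrightarrow> recfn g \<Longrightarrow> recfn (\<lambda>n. dropc (f n) (g n))"
  unfolding dropc_def by (intro rec_intros)

lemma rec_nthc [rec_intros]: "recfn f \<Longrightarrow> recfn g \<Longrightarrow> recfn (\<lambda>n. nthc (f n) (g n))"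
  unfolding nthc_def by (intro rec_intros)

lemma rec_lenc [rec_intros]: assumes "recfn f" shows "recfn (\<lambda>n. lenc (f n))"
proof -
  have "recfn lenc" unfolding lenc_def by (intro rec_intros)
  from rec_comp[OF this assms] show ?thesis .
qed

text \<open>Approximations to a function are stored with the latest value first, so that
  \<open>consc\<close> extends them; counting from the far end gives each value the argument to
  which it belongs.\<close>

definition nthr :: "nat \<Rightarrow> nat \<Rightarrow> nat" where "nthr s k = nthc s (lenc s - Suc k)"

lemma rec_nthr [rec_intros]: "recfn f \<Longrightarrow> recfn g \<Longrightarrow> recfn (\<lambda>n. nthr (f n) (g n))"
  unfolding nthr_def by (intro rec_intros)

lemma nthr_consc: "k \<le> lenc s \<Longrightarrow> nthr (consc x s) k = (if k = lenc s then x else nthr s k)"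
  by (cases "lenc s - k") (auto simp: nthr_def Suc_diff_Suc, metis One_nat_def Suc_diff_Suc diff_Suc_eq_diff_pred diff_commute diff_Suc_1)

primrec segc :: "(nat \<Rightarrow> nat) \<Rightarrow> nat \<Rightarrow> nat" where
  "segc f 0 = 0"
| "segc f (Suc n) = consc (f n) (segc f n)"

lemma lenc_segc [simp]: "lenc (segc f n) = n"
  by (induction n) auto

lemma nthr_segc [simp]: "k < n \<Longrightarrow> nthr (segc f n) k = f k"
  by (induction n) (auto simp: nthr_consc)

lemma segc_unique: "lenc s = n \<Longrightarrow> (\<And>k. k < n \<Longrightarrow> nthr s k = f k) \<Longrightarrow> s = segc f n"
proof (induction n arbitrary: s)
  case 0
  then show ?case by (metis lenc_list_encode length_0_conv list_encode.simps(1) list_encode_surj segc.simps(1))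
next
  case (Suc n)
  then have "s \<noteq> 0" by (metis lenc_0 nat.distinct(1))
  then obtain x t where s: "s = consc x t" by (metis consc_hdc_tlc)
  with Suc.prems have "lenc t = n" by simp
  moreover have "nthr t k = f k" if "k < n" for k
    using Suc.prems(2)[of k] that s \<open>lenc t = n\<close> by (simp add: nthr_consc)
  moreover have "x = f n" using Suc.prems(2)[of n] s \<open>lenc t = n\<close> by (simp add: nthr_consc)
  ultimately show ?case using Suc.IH s by simp
qed

lemma nthr_eqI: "lenc s = lenc t \<Longrightarrow> (\<And>k. k < lenc s \<Longrightarrow> nthr s k = nthr t k) \<Longrightarrow> s = t"
  using segc_unique[of s "lenc s" "nthr s"] segc_unique[of t "lenc t" "nthr s"] by simp

subsection \<open>Computable sets\<close>

primrec oracle_free :: "prog \<Rightarrow> prog" where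
  "oracle_free Zer = Zer"
| "oracle_free Succ = Succ"
| "oracle_free Fst = Fst"
| "oracle_free Snd = Snd"
| "oracle_free Oracle = Zer"
| "oracle_free (Pairing c d) = Pairing (oracle_free c) (oracle_free d)"
| "oracle_free (Comp c d) = Comp (oracle_free c) (oracle_free d)"
| "oracle_free (Prec c d) = Prec (oracle_free c) (oracle_free d)"
| "oracle_free (Mu c) = Mu (oracle_free c)"

text \<open>The empty oracle answers 0 to every query, as \<open>Zer\<close> does, so a program for
  a computable set can be made indifferent to the oracle.\<close>

lemma eval_oracle_free: "eval {} c n y \<Longrightarrow> eval X (oracle_free c) n y"
proof (induction rule: eval.induct)
  case (Mu c n m)
  then show ?case by (auto intro!: eval.Mu)
qed (auto intro: eval.intros)

lemma computable_iff_recp: "computable Y \<longleftrightarrow> recp (\<lambda>n. n \<in> Y)"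
  unfolding computable_def turing_le_def recp_def recfn_def
  by (meson eval_oracle_free)

section \<open>Well-founded games\<close>

definition gwf :: "(nat \<Rightarrow> nat \<Rightarrow> bool) \<Rightarrow> bool" where
  "gwf mv \<longleftrightarrow> wf {(q, p). mv p q}"

definition win :: "(nat \<Rightarrow> nat \<Rightarrow> bool) \<Rightarrow> nat \<Rightarrow> bool" where
  "win mv = wfrec {(q, p). mv p q} (\<lambda>W p. \<exists>q. mv p q \<and> \<not> W q)"

lemma win_iff: "gwf mv \<Longrightarrow> win mv p \<longleftrightarrow> (\<exists>q. mv p q \<and> \<not> win mv q)"
  unfolding gwf_def win_def by (subst wfrec) (auto simp: cut_apply)

lemma gwf_induct [consumes 1, case_names step]:
  assumes "gwf mv" "\<And>p. (\<And>q. mv p q \<Longrightarrow> P q) \<Longrightarrow> P p"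
  shows "P p"
  using wf_induct_rule[of "{(q, p). mv p q}" P p] assms by (auto simp: gwf_def)

lemma gwf_accI: "(\<And>p. p \<in> Wellfounded.acc {(q, p). mv p q}) \<Longrightarrow> gwf mv"
  by (simp add: gwf_def wf_iff_acc)

definition rec2 :: "(nat \<Rightarrow> nat \<Rightarrow> bool) \<Rightarrow> bool" where
  "rec2 mv \<longleftrightarrow> recp (\<lambda>z. mv (pfst z) (psnd z))"

lemma rec2_comp: "rec2 mv \<Longrightarrow> recfn f \<Longrightarrow> recfn g \<Longrightarrow> recp (\<lambda>n. mv (f n) (g n))"
  unfolding rec2_def using recp_comp[of "\<lambda>z. mv (pfst z) (psnd z)" "\<lambda>n. pe (f n) (g n)"]
  by (simp add: rec_intros)

text \<open>
  Sets of winning positions of computable well-founded games are the common ground between jump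
  hierarchies, the constructible hierarchy and unique paths of computable trees.
\<close>

definition ebp :: "(nat \<Rightarrow> bool) \<Rightarrow> bool" where
  "ebp P \<longleftrightarrow> (\<exists>mv k. rec2 mv \<and> gwf mv \<and> recfn k \<and> (\<forall>n. P n \<longleftrightarrow> win mv (k n)))"

lemma ebp_cong: "(\<And>n. P n \<longleftrightarrow> Q n) \<Longrightarrow> ebp Q \<Longrightarrow> ebp P"
  by (simp add: ebp_def)

lemma ebpI: "rec2 mv \<Longrightarrow> gwf mv \<Longrightarrow> recfn k \<Longrightarrow> ebp (\<lambda>n. win mv (k n))"
  by (auto simp: ebp_def)

subsection \<open>Closure properties\<close>

text \<open>Games may call a predicate already known to be game-definable: a move to
  \<open>2 * q\<close> continues at the position \<open>q\<close>, while a move to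
  \<open>2 * z + 1\<close> stops at a position with the value of \<open>Z z\<close>.\<close>

lemma ebp_game:
  assumes Z: "ebp Z" and mv: "rec2 mv" and wf: "gwf (\<lambda>p q. mv p (2 * q))" and k: "recfn k"
    and W: "\<And>p. W p \<longleftrightarrow> (\<exists>q. mv p (2 * q) \<and> \<not> W q) \<or> (\<exists>z. mv p (2 * z + 1) \<and> \<not> Z z)"
  shows "ebp (\<lambda>n. W (k n))"
proof -
  obtain m h where m: "rec2 m" "gwf m" and h: "recfn h" and Zm: "\<And>n. Z n \<longleftrightarrow> win m (h n)"
    using Z unfolding ebp_def by blast
  \<comment> \<open>A call of \<open>Z\<close> passes through the tags 2 and 3 before the game
    \<open>m\<close> starts at tag 1. The stop at tag 2 records \<open>z\<close> itself, which keeps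
    the moves decidable (guessing some \<open>z\<close> from \<open>h z\<close> would not); the
    second forced move restores whose turn it is.\<close>
  define g where "g p q \<longleftrightarrow>
     pfst p = 0 \<and> pfst q = 0 \<and> mv (psnd p) (2 * psnd q) \<or>
     pfst p = 0 \<and> pfst q = 2 \<and> mv (psnd p) (2 * psnd q + 1) \<or>
     pfst p = 2 \<and> q = pe 3 (psnd p) \<or>
     pfst p = 3 \<and> q = pe 1 (h (psnd p)) \<or>
     pfst p = 1 \<and> pfst q = 1 \<and> m (psnd p) (psnd q)" for p q
  note [rec_intros] = rec2_comp[OF mv] rec2_comp[OF m(1)] rec_comp[OF h]
  have g: "rec2 g"
    unfolding rec2_def g_def by (intro rec_intros)
  let ?A = "Wellfounded.acc {(q, p). g p q}"
  have a1: "pe 1 x \<in> ?A" for x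
  proof (induction x rule: gwf_induct[OF m(2)])
    case (1 p)
    show ?case
    proof (rule accI)
      fix y assume "(y, pe 1 p) \<in> {(q, p). g p q}"
      then have "pfst y = 1" "m p (psnd y)" by (auto simp: g_def)
      then show "y \<in> ?A" using 1[of "psnd y"] by (metis pe_pfst_psnd)
    qed
  qed
  have a3: "pe 3 x \<in> ?A" for x
    by (rule accI) (use a1 in \<open>auto simp: g_def\<close>)
  have a2: "pe 2 x \<in> ?A" for x
    by (rule accI) (use a3 in \<open>auto simp: g_def\<close>)
  have a0: "pe 0 x \<in> ?A" for x
  proof (induction x rule: gwf_induct[OF wf])
    case (1 p)
    show ?case
    proof (rule accI)
      fix y assume "(y, pe 0 p) \<in> {(q, p). g p q}"
      then have "pfst y = 0 \<and> mv p (2 * psnd y) \<or> pfst y = 2" by (auto simp: g_def)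
      then show "y \<in> ?A" using 1[of "psnd y"] a2 by (metis pe_pfst_psnd)
    qed
  qed
  have "p \<in> ?A" for p
  proof (cases "pfst p \<in> {0,1,2,3}")
    case True
    then have "pe (pfst p) (psnd p) \<in> ?A"
      by (elim insertE emptyE) (simp_all only: a0 a1 a2 a3)
    then show ?thesis by simp
  next
    case False
    then show ?thesis by - (rule accI, auto simp: g_def)
  qed
  then have gg: "gwf g" by (rule gwf_accI)
  have w1: "win g (pe 1 x) \<longleftrightarrow> win m x" for x
  proof (induction x rule: gwf_induct[OF m(2)])
    case (1 p)
    have "win g (pe 1 p) \<longleftrightarrow> (\<exists>q. pfst q = 1 \<and> m p (psnd q) \<and> \<not> win g q)"
      by (subst win_iff[OF gg]) (auto simp: g_def)
    also have "\<dots> \<longleftrightarrow> (\<exists>q. m p q \<and> \<not> win g (pe 1 q))"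
      by (metis pe_pfst_psnd pfst_pe psnd_pe)
    also have "\<dots> \<longleftrightarrow> win m p"
      using 1 by (subst win_iff[OF m(2)]) auto
    finally show ?case .
  qed
  have w3: "win g (pe 3 x) \<longleftrightarrow> \<not> Z x" for x
    by (subst win_iff[OF gg]) (auto simp: g_def w1[unfolded One_nat_def] Zm)
  have w2: "win g (pe 2 x) \<longleftrightarrow> Z x" for x
    by (subst win_iff[OF gg]) (auto simp: g_def w3)
  have w0: "win g (pe 0 x) \<longleftrightarrow> W x" for x
  proof (induction x rule: gwf_induct[OF wf])
    case (1 p)
    have "win g (pe 0 p) \<longleftrightarrow> (\<exists>q. (pfst q = 0 \<and> mv p (2 * psnd q) \<or> pfst q = 2 \<and> mv p (2 * psnd q + 1)) \<and> \<not> win g q)"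
      by (subst win_iff[OF gg]) (auto simp: g_def)
    also have "\<dots> \<longleftrightarrow> (\<exists>q. mv p (2 * q) \<and> \<not> win g (pe 0 q)) \<or> (\<exists>q. mv p (2 * q + 1) \<and> \<not> win g (pe 2 q))"
      by (metis pe_pfst_psnd pfst_pe psnd_pe)
    also have "\<dots> \<longleftrightarrow> W p"
      using 1 by (subst W) (auto simp: w2)
    finally show ?case .
  qed
  have "recfn (\<lambda>n. pe 0 (k n))" by (intro rec_intros k)
  from ebpI[OF g gg this] show ?thesis by (simp add: w0)
qed

lemma ebp_game1:
  assumes Z: "ebp Z" and mv: "rec2 mv"
  shows "ebp (\<lambda>n. \<exists>z. mv n z \<and> \<not> Z z)"
proof -
  note [rec_intros] = rec2_comp[OF mv]
  have r: "rec2 (\<lambda>p q. odd q \<and> mv p (q div 2))" unfolding rec2_def by (intro rec_intros)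
  have g: "gwf (\<lambda>p q. odd (2 * q) \<and> mv p (2 * q div 2))" by (simp add: gwf_def)
  show ?thesis
    by (rule ebp_game[OF Z r g rec_id, where W = "\<lambda>n. \<exists>z. mv n z \<and> \<not> Z z"]) simp
qed

named_theorems eb_intros

lemma ebp_not_comp: "ebp Z \<Longrightarrow> recfn f \<Longrightarrow> ebp (\<lambda>n. \<not> Z (f n))"
  using ebp_game1[of Z "\<lambda>n z. z = f n"]
  by (simp add: rec2_def rec_intros rec_comp[of f])

lemma ebp_not [eb_intros]: "ebp Z \<Longrightarrow> ebp (\<lambda>n. \<not> Z n)"
  using ebp_not_comp[OF _ rec_id] .

lemma ebp_comp: "ebp Z \<Longrightarrow> recfn f \<Longrightarrow> ebp (\<lambda>n. Z (f n))"
  using ebp_not_comp[OF ebp_not_comp[OF _ rec_id]] by simp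

lemma ebp_ex [eb_intros]:
  assumes "ebp (\<lambda>z. P (pfst z) (psnd z))"
  shows "ebp (\<lambda>n. \<exists>m. P n m)"
proof -
  have "rec2 (\<lambda>n z. n = pfst z)" unfolding rec2_def by (intro rec_intros)
  from ebp_game1[OF ebp_not[OF assms] this]
  have e: "ebp (\<lambda>n. \<exists>z. n = pfst z \<and> P (pfst z) (psnd z))" by simp
  show ?thesis by (rule ebp_cong[OF _ e]) (metis pfst_pe psnd_pe)
qed

lemma ebp_all [eb_intros]:
  assumes "ebp (\<lambda>z. P (pfst z) (psnd z))"
  shows "ebp (\<lambda>n. \<forall>m. P n m)"
  by (rule ebp_cong[where Q = "\<lambda>n. \<not> (\<exists>m. \<not> P n m)"], blast) (intro eb_intros assms)

text \<open>\<open>ebp_game\<close> can call one predicate, so \<open>Q\<close> is called and the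
  game of \<open>P\<close> is copied into the new one.\<close>

lemma ebp_conj [eb_intros]:
  assumes "ebp P" "ebp Q"
  shows "ebp (\<lambda>n. P n \<and> Q n)"
proof -
  obtain m h where m: "rec2 m" "gwf m" and h: "recfn h" and Pm: "\<And>n. P n \<longleftrightarrow> win m (h n)"
    using assms(1) unfolding ebp_def by blast
  note [rec_intros] = rec2_comp[OF m(1)] rec_comp[OF h]
  define W where "W x \<longleftrightarrow> (if pfst x = 0 then win m (psnd x) else if pfst x = 1 then \<not> Q (psnd x) else
       if pfst x = 2 then \<not> P (psnd x) \<or> \<not> Q (psnd x)  else if pfst x = 3 then P (psnd x) \<and> Q (psnd x) else Q (psnd x))" for x
  define g where "g p q \<longleftrightarrow> pfst p = 0 \<and> even q \<and> pfst (q div 2) = 0 \<and> m (psnd p) (psnd (q div 2)) \<or>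
     pfst p = 1 \<and> q = 2 * psnd p + 1 \<or>
     pfst p = 2 \<and> (q = 2 * (pe 0 (h (psnd p))) \<or> q = 2 * pe 4 (psnd p)) \<or>
     pfst p = 3 \<and> q = 2 * (pe 2 (psnd p)) \<or>
     pfst p \<ge> 4 \<and> q = 2 * pe 1 (psnd p)" for p q
  have g: "rec2 g" unfolding rec2_def g_def by (intro rec_intros)
  let ?A = "Wellfounded.acc {(q, p). g p (2 * q)}"
  have a0: "pe 0 x \<in> ?A" for x
  proof (induction x rule: gwf_induct[OF m(2)])
    case (1 p)
    show ?case
    proof (rule accI)
      fix y assume "(y, pe 0 p) \<in> {(q, p). g p (2 * q)}"
      then have "pfst y = 0" "m p (psnd y)" by (auto simp: g_def)
      then show "y \<in> ?A" using 1[of "psnd y"] by (metis pe_pfst_psnd)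
    qed
  qed
  have a1: "pe 1 x \<in> ?A" for x
    by (rule accI) (auto simp: g_def dest: arg_cong[of _ _ even])
  have a4: "k \<ge> 4 \<Longrightarrow> pe k x \<in> ?A" for k x
    by (rule accI) (use a1 in \<open>auto simp: g_def\<close>)
  have a2: "pe 2 x \<in> ?A" for x
    by (rule accI) (use a0 a4 in \<open>auto simp: g_def\<close>)
  have a3: "pe 3 x \<in> ?A" for x
    by (rule accI) (use a2 in \<open>auto simp: g_def\<close>)
  have "p \<in> ?A" for p
  proof -
    have "pfst p \<in> {0,1,2,3} \<or> pfst p \<ge> 4" by auto
    then have "pe (pfst p) (psnd p) \<in> ?A"
      by (elim disjE insertE emptyE) (simp_all only: a0 a1 a2 a3 a4)
    then show ?thesis by simp
  qed
  then have wf: "gwf (\<lambda>p q. g p (2 * q))" by (rule gwf_accI)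
  have k: "recfn (\<lambda>n. pe 3 n)" by (intro rec_intros)
  have W: "W p \<longleftrightarrow> (\<exists>q. g p (2 * q) \<and> \<not> W q) \<or> (\<exists>z. g p (2 * z + 1) \<and> \<not> Q z)" for p
  proof -
    have "pfst p = 0 \<or> pfst p = 1 \<or> pfst p = 2 \<or> pfst p = 3 \<or> pfst p \<ge> 4" by linarith
    then show ?thesis
    proof (elim disjE)
      assume p: "pfst p = 0"
      have "W p \<longleftrightarrow> (\<exists>q. m (psnd p) q \<and> \<not> win m q)"
        using p by (simp add: W_def) (rule win_iff[OF m(2)])
      also have "\<dots> \<longleftrightarrow> (\<exists>q. pfst q = 0 \<and> m (psnd p) (psnd q) \<and> \<not> W q)"
      proof -
        have "W q \<longleftrightarrow> win m (psnd q)" if "pfst q = 0" for q using that by (simp add: W_def)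
        then show ?thesis by (metis pfst_pe psnd_pe)
      qed
      finally show ?thesis using p by (auto simp: g_def)
    next
      assume "pfst p = 1"
      moreover have "2 * y \<noteq> Suc (2 * z)" for z y :: nat by presburger
      ultimately show ?thesis by (auto simp: W_def g_def)
    next
      assume "pfst p = 2"
      moreover have "2 * z + 1 \<noteq> 2 * y" for z y :: nat by presburger
      ultimately show ?thesis by (auto simp: W_def g_def Pm)
    next
      assume "pfst p = 3"
      moreover have "2 * z + 1 \<noteq> 2 * y" for z y :: nat by presburger
      ultimately show ?thesis by (auto simp: W_def g_def Pm)
    next
      assume "pfst p \<ge> 4"
      moreover have "2 * z + 1 \<noteq> 2 * y" for z y :: nat by presburger
      ultimately show ?thesis by (auto simp: W_def g_def Pm)
    qed
  qed
  from ebp_game[OF assms(2) g wf k W] show ?thesis by (simp add: W_def)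
qed

lemma ebp_disj [eb_intros]: "ebp P \<Longrightarrow> ebp Q \<Longrightarrow> ebp (\<lambda>n. P n \<or> Q n)"
  by (rule ebp_cong[where Q = "\<lambda>n. \<not> (\<not> P n \<and> \<not> Q n)"], blast) (intro eb_intros)

lemma ebp_imp [eb_intros]: "ebp P \<Longrightarrow> ebp Q \<Longrightarrow> ebp (\<lambda>n. P n \<longrightarrow> Q n)"
  by (rule ebp_cong[where Q = "\<lambda>n. \<not> P n \<or> Q n"], blast) (intro eb_intros)

lemma ebp_iff [eb_intros]: "ebp P \<Longrightarrow> ebp Q \<Longrightarrow> ebp (\<lambda>n. P n \<longleftrightarrow> Q n)"
  by (rule ebp_cong[where Q = "\<lambda>n. (P n \<longrightarrow> Q n) \<and> (Q n \<longrightarrow> P n)"], blast) (intro eb_intros)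

lemma ebp_rec: assumes "recp P" shows "ebp P"
proof -
  note [rec_intros] = recp_comp[OF assms]
  have "rec2 (\<lambda>p q. pfst p = 0 \<and> P (psnd p) \<and> q = pe 1 0)" unfolding rec2_def by (intro rec_intros)
  moreover have g: "gwf (\<lambda>p q. pfst p = 0 \<and> P (psnd p) \<and> q = pe 1 0)"
    by (rule gwf_accI, rule accI) (auto intro: accI)
  moreover have "recfn (\<lambda>n. pe 0 n)" by (intro rec_intros)
  ultimately have "ebp (\<lambda>n. win (\<lambda>p q. pfst p = 0 \<and> P (psnd p) \<and> q = pe 1 0) (pe 0 n))" by (rule ebpI)
  moreover have "\<not> win (\<lambda>p q. pfst p = 0 \<and> P (psnd p) \<and> q = pe 1 0) (pe 1 0)"
    by (subst win_iff[OF g]) simp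
  then have "win (\<lambda>p q. pfst p = 0 \<and> P (psnd p) \<and> q = pe 1 0) (pe 0 n) \<longleftrightarrow> P n" for n
    by (subst win_iff[OF g]) simp
  ultimately show ?thesis by simp
qed

lemma ebp_eq [eb_intros]: "recfn f \<Longrightarrow> recfn g \<Longrightarrow> ebp (\<lambda>n. f n = g n)"
  and ebp_le [eb_intros]: "recfn f \<Longrightarrow> recfn g \<Longrightarrow> ebp (\<lambda>n. f n \<le> g n)"
  and ebp_less [eb_intros]: "recfn f \<Longrightarrow> recfn g \<Longrightarrow> ebp (\<lambda>n. f n < g n)"
  and ebp_even [eb_intros]: "recfn f \<Longrightarrow> ebp (\<lambda>n. even (f n))"
  and ebp_const [eb_intros]: "ebp (\<lambda>n. b)"
  by (intro ebp_rec rec_intros; assumption)+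

definition ebp2 :: "(nat \<Rightarrow> nat \<Rightarrow> bool) \<Rightarrow> bool" where
  "ebp2 r \<longleftrightarrow> ebp (\<lambda>z. r (pfst z) (psnd z))"

lemma ebp2_comp: "ebp2 r \<Longrightarrow> recfn f \<Longrightarrow> recfn g \<Longrightarrow> ebp (\<lambda>n. r (f n) (g n))"
  unfolding ebp2_def using ebp_comp[of "\<lambda>z. r (pfst z) (psnd z)" "\<lambda>n. pe (f n) (g n)"]
  by (simp add: rec_intros)

subsection \<open>Unique paths of computable trees\<close>

lemma nthr_tlc: "s \<noteq> 0 \<Longrightarrow> k < lenc (tlc s) \<Longrightarrow> nthr s k = nthr (tlc s) k"
  by (metis consc_hdc_tlc less_imp_le nat_neq_iff nthr_consc)

lemma lenc_tlc: "s \<noteq> 0 \<Longrightarrow> lenc s = Suc (lenc (tlc s))"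
  by (metis consc_hdc_tlc lenc_consc)

text \<open>The chain may start at any node; closure under initial segments supplies the shorter
  segments of the limit.\<close>

lemma path_of_chain:
  assumes T: "\<And>i. T (s i)" and ext: "\<And>i. s (Suc i) \<noteq> 0 \<and> tlc (s (Suc i)) = s i"
    and closed: "\<And>x s. T (consc x s) \<Longrightarrow> T s"
  shows "\<exists>f. (\<forall>n. T (segc f n)) \<and> (\<forall>i. s i = segc f (lenc (s i)))"
proof -
  have len: "lenc (s i) = lenc (s 0) + i" for i
    by (induction i) (use ext lenc_tlc in auto)
  have step: "k < lenc (s i) \<Longrightarrow> nthr (s (Suc i)) k = nthr (s i) k" for i k
    using nthr_tlc[of "s (Suc i)" k] ext[of i] by simp
  have coh: "k < lenc (s i) \<Longrightarrow> nthr (s (i + j)) k = nthr (s i) k" for i j k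
  proof (induction j)
    case (Suc j)
    then have "k < lenc (s (i + j))" using len[of i] len[of "i + j"] by simp
    then show ?case using step[of k "i + j"] Suc by simp
  qed simp
  define f where "f k = nthr (s (Suc k)) k" for k
  have f: "nthr (s i) k = f k" if "k < lenc (s i)" for i k
  proof -
    have "k < lenc (s (Suc k))" using len[of "Suc k"] by simp
    then show ?thesis using coh[of k "Suc k" i] coh[of k i "Suc k"] that
      by (simp add: f_def add.commute)
  qed
  have si: "s i = segc f (lenc (s i))" for i
    by (rule segc_unique) (use f in auto)
  have down: "T (segc f (n + m)) \<Longrightarrow> T (segc f n)" for n m
    by (induction m) (auto dest: closed)
  have "T (segc f n)" for n
  proof -
    have "T (segc f (n + lenc (s 0)))" using T[of n] si[of n] len[of n] by (simp add: add.commute)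
    then show ?thesis by (rule down)
  qed
  then show ?thesis using si by blast
qed

text \<open>
  If a tree has the single path \<open>\<zeta>\<close>, then comparing the ranks of the subtrees above two different
  nodes of the same length is a well-founded game, and \<open>\<zeta>\<close> passes through the node of larger rank.
\<close>

theorem ebp_unique_path:
  assumes T: "recp T" and closed: "\<And>x s. T (consc x s) \<Longrightarrow> T s"
    and path: "\<And>n. T (segc \<zeta> n)" and unique: "\<And>f. (\<And>n. T (segc f n)) \<Longrightarrow> f = \<zeta>"
  shows "ebp2 (\<lambda>k j. \<zeta> k = j)"
proof -
  note [rec_intros] = recp_comp[OF T]
  define ok where "ok s t \<longleftrightarrow> T s \<and> T t \<and> lenc s = lenc t \<and> s \<noteq> t" for s t
  \<comment> \<open>At tag 0 the player to move extends the first node, at tag 1 the opponent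
    extends the second one; whoever cannot extend loses.\<close>
  define mv where "mv p q \<longleftrightarrow>
     pfst p = 0 \<and> pfst q = 1 \<and> ok (pfst (psnd p)) (psnd (psnd p)) \<and> pfst (psnd q) \<noteq> 0 \<and>
       tlc (pfst (psnd q)) = pfst (psnd p) \<and> psnd (psnd q) = psnd (psnd p) \<and> T (pfst (psnd q)) \<or>
     pfst p = 1 \<and> pfst q = 0 \<and> pfst (psnd p) \<noteq> 0 \<and> ok (tlc (pfst (psnd p))) (psnd (psnd p)) \<and>
       T (pfst (psnd p)) \<and> pfst (psnd q) = pfst (psnd p) \<and> psnd (psnd q) \<noteq> 0 \<and>
       tlc (psnd (psnd q)) = psnd (psnd p) \<and> T (psnd (psnd q))" for p q
  have mv: "rec2 mv" unfolding rec2_def mv_def ok_def by (intro rec_intros)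
  \<comment> \<open>An infinite play extends both nodes forever. Both limits are paths, hence equal,
    although the play started from different nodes of the same length.\<close>
  have wf: "gwf mv"
    unfolding gwf_def
  proof (rule ccontr)
    assume "\<not> wf {(q, p). mv p q}"
    then obtain F where F: "\<And>i. mv (F i) (F (Suc i))"
      unfolding wf_iff_no_infinite_down_chain by auto
    obtain d where d: "pfst (F d) = 0"
      using F[of 0] F[of 1] by (auto simp: mv_def)
    define s where "s i = pfst (psnd (F (d + 2 * i)))" for i
    define t where "t i = psnd (psnd (F (d + 2 * i)))" for i
    have ev: "pfst (F (d + 2 * i)) = 0" for i
    proof (induction i)
      case (Suc i)
      then show ?case using F[of "d + 2 * i"] F[of "Suc (d + 2 * i)"] by (auto simp: mv_def)
    qed (simp add: d)
    have ok: "ok (s i) (t i)" for i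
      using F[of "d + 2 * i"] ev[of i] by (auto simp: mv_def s_def t_def)
    have ext: "s (Suc i) \<noteq> 0 \<and> tlc (s (Suc i)) = s i" "t (Suc i) \<noteq> 0 \<and> tlc (t (Suc i)) = t i" for i
      using F[of "d + 2 * i"] F[of "Suc (d + 2 * i)"] ev[of i] by (auto simp: mv_def s_def t_def)
    obtain f where f: "\<forall>n. T (segc f n)" "\<forall>i. s i = segc f (lenc (s i))"
      using path_of_chain[of T s] ok ext closed unfolding ok_def by blast
    obtain g where g: "\<forall>n. T (segc g n)" "\<forall>i. t i = segc g (lenc (t i))"
      using path_of_chain[of T t] ok ext closed unfolding ok_def by blast
    have "f = g" using f(1) g(1) unique by blast
    then have "s 0 = t 0" using f(2) g(2) ok[of 0] unfolding ok_def by metis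
    then show False using ok[of 0] by (simp add: ok_def)
  qed
  have w0: "win mv (pe 0 (pe s t)) \<longleftrightarrow> (\<exists>x. T (consc x s) \<and> \<not> win mv (pe 1 (pe (consc x s) t)))"
    if "ok s t" for s t
  proof -
    have "win mv (pe 0 (pe s t)) \<longleftrightarrow> (\<exists>q. pfst q = 1 \<and> pfst (psnd q) \<noteq> 0 \<and> tlc (pfst (psnd q)) = s \<and>
        psnd (psnd q) = t \<and> T (pfst (psnd q)) \<and> \<not> win mv q)"
      using that by (subst win_iff[OF wf]) (auto simp: mv_def)
    also have "\<dots> \<longleftrightarrow> (\<exists>s'. s' \<noteq> 0 \<and> tlc s' = s \<and> T s' \<and> \<not> win mv (pe 1 (pe s' t)))"
      by (metis pe_pfst_psnd pfst_pe psnd_pe)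
    also have "\<dots> \<longleftrightarrow> (\<exists>x. T (consc x s) \<and> \<not> win mv (pe 1 (pe (consc x s) t)))"
      by (metis consc_hdc_tlc consc_nz(1) tlc_consc)
    finally show ?thesis .
  qed
  have w1: "win mv (pe 1 (pe (consc x s) t)) \<longleftrightarrow> (\<exists>y. T (consc y t) \<and> \<not> win mv (pe 0 (pe (consc x s) (consc y t))))"
    if "ok s t" "T (consc x s)" for s t x
  proof -
    have "win mv (pe 1 (pe (consc x s) t)) \<longleftrightarrow> (\<exists>q. pfst q = 0 \<and> pfst (psnd q) = consc x s \<and> psnd (psnd q) \<noteq> 0 \<and>
       tlc (psnd (psnd q)) = t \<and> T (psnd (psnd q)) \<and> \<not> win mv q)"
      using that by (subst win_iff[OF wf]) (auto simp: mv_def)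
    also have "\<dots> \<longleftrightarrow> (\<exists>t'. t' \<noteq> 0 \<and> tlc t' = t \<and> T t' \<and> \<not> win mv (pe 0 (pe (consc x s) t')))"
      by (metis pe_pfst_psnd pfst_pe psnd_pe)
    also have "\<dots> \<longleftrightarrow> (\<exists>y. T (consc y t) \<and> \<not> win mv (pe 0 (pe (consc x s) (consc y t))))"
      by (metis consc_hdc_tlc consc_nz(1) tlc_consc)
    finally show ?thesis .
  qed
  have ok': "ok (consc x s) (consc y t)" if "ok s t" "T (consc x s)" "T (consc y t)" for s t x y
    using that by (auto simp: ok_def)
  have m2: "mv (pe 0 (pe s t)) (pe 1 (pe (consc x s) t))" if "ok s t" "T (consc x s)" for s t x
    using that by (auto simp: mv_def)
  have m3: "mv (pe 1 (pe (consc x s) t)) (pe 0 (pe (consc x s) (consc y t)))"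
    if "ok s t" "T (consc x s)" "T (consc y t)" for s t x y
    using that by (auto simp: mv_def)
  let ?r = "{(q, p). mv p q}"
  have wf2: "wf ((trancl ?r))" using wf by (simp add: gwf_def wf_trancl)
  \<comment> \<open>The player whose node lies on \<zeta> extends it along \<zeta> and never gets
    stuck. Nothing is claimed when neither node lies on \<zeta>. A round is two moves, so the
    induction runs over the transitive closure.\<close>
  have main: "\<forall>s t. p = pe 0 (pe s t) \<longrightarrow> ok s t \<longrightarrow> (t = segc \<zeta> (lenc t) \<longrightarrow> \<not> win mv p) \<and> (s = segc \<zeta> (lenc s) \<longrightarrow> win mv p)" for p
  proof (induction p rule: wf_induct_rule[OF wf2])
    case (1 p)
    show ?case
    proof (intro allI impI)
      fix s t assume p: "p = pe 0 (pe s t)" and ok: "ok s t"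
      have IH: "(consc y t = segc \<zeta> (lenc (consc y t)) \<longrightarrow> \<not> win mv (pe 0 (pe (consc x s) (consc y t))))
         \<and> (consc x s = segc \<zeta> (lenc (consc x s)) \<longrightarrow> win mv (pe 0 (pe (consc x s) (consc y t))))"
        if "T (consc x s)" "T (consc y t)" for x y
      proof -
        have "(pe 0 (pe (consc x s) (consc y t)), p) \<in> (trancl ?r)"
          using r_into_trancl[of _ _ ?r] m2[OF ok that(1)] m3[OF ok that] p
          by (meson CollectI case_prodI trancl_trans)
        from 1[OF this] show ?thesis using ok'[OF ok that] by blast
      qed
      show "(t = segc \<zeta> (lenc t) \<longrightarrow> \<not> win mv p) \<and> (s = segc \<zeta> (lenc s) \<longrightarrow> win mv p)"
      proof (intro conjI impI)
        assume t: "t = segc \<zeta> (lenc t)"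
        let ?y = "\<zeta> (lenc t)"
        have y: "T (consc ?y t)" "consc ?y t = segc \<zeta> (lenc (consc ?y t))"
          using path[of "Suc (lenc t)"] t by auto
        have "win mv (pe 1 (pe (consc x s) t))" if "T (consc x s)" for x
          using w1[OF ok that] IH[OF that y(1)] y by blast
        then show "\<not> win mv p" unfolding p w0[OF ok] by blast
      next
        assume s: "s = segc \<zeta> (lenc s)"
        let ?x = "\<zeta> (lenc s)"
        have x: "T (consc ?x s)" "consc ?x s = segc \<zeta> (lenc (consc ?x s))"
          using path[of "Suc (lenc s)"] s by auto
        have "\<not> win mv (pe 1 (pe (consc ?x s) t))"
          unfolding w1[OF ok x(1)] using IH[OF x(1)] x(2) by blast
        then show "win mv p" unfolding p w0[OF ok] using x(1) by blast
      qed
    qed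
  qed
  \<comment> \<open>A node off the path loses against the node of \<zeta> of the same
    length.\<close>
  have on: "s = segc \<zeta> (lenc s) \<longleftrightarrow> (\<forall>t. T t \<and> lenc t = lenc s \<and> t \<noteq> s \<longrightarrow> \<not> win mv (pe 0 (pe t s)))"
    if "T s" for s
    using main that path unfolding ok_def by (metis lenc_segc)
  have eq: "\<zeta> k = j \<longleftrightarrow> (\<exists>s. T s \<and> lenc s = Suc k \<and> hdc s = j \<and>
      (\<forall>t. T t \<and> lenc t = lenc s \<and> t \<noteq> s \<longrightarrow> \<not> win mv (pe 0 (pe t s))))" for k j
  proof
    assume "\<zeta> k = j"
    then show "\<exists>s. T s \<and> lenc s = Suc k \<and> hdc s = j \<and>
      (\<forall>t. T t \<and> lenc t = lenc s \<and> t \<noteq> s \<longrightarrow> \<not> win mv (pe 0 (pe t s)))"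
      using path[of "Suc k"] on[OF path, of "Suc k"] by (intro exI[of _ "segc \<zeta> (Suc k)"]) simp
  next
    assume "\<exists>s. T s \<and> lenc s = Suc k \<and> hdc s = j \<and>
      (\<forall>t. T t \<and> lenc t = lenc s \<and> t \<noteq> s \<longrightarrow> \<not> win mv (pe 0 (pe t s)))"
    then obtain s where "lenc s = Suc k" "hdc s = j" "s = segc \<zeta> (lenc s)" using on by blast
    then show "\<zeta> k = j" by (metis hdc_consc segc.simps(2))
  qed
  note [eb_intros] = ebp_comp[OF ebp_rec[OF T]] ebp_comp[OF ebpI[OF mv wf rec_id]]
  show ?thesis unfolding ebp2_def eq by (intro eb_intros rec_intros)
qed

subsection \<open>Games relative to game-definable sets\<close>

text \<open>The value 0 marks a lost position, \<open>Suc q\<close> a won one with least winning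
  move \<open>q\<close>. Leastness makes evidence unique, so that it can be the only path of a
  tree.\<close>

definition evidence :: "(nat \<Rightarrow> nat \<Rightarrow> bool) \<Rightarrow> (nat \<Rightarrow> nat) \<Rightarrow> bool" where
  "evidence mv g \<longleftrightarrow> (\<forall>p q. (g p = Suc q \<longrightarrow> mv p q \<and> g q = 0 \<and> (\<forall>r<q. mv p r \<longrightarrow> g r \<noteq> 0)) \<and>
     (g p = 0 \<longrightarrow> mv p q \<longrightarrow> g q \<noteq> 0))"

lemma evidence_exists:
  assumes "gwf mv" shows "\<exists>g. evidence mv g"
proof -
  define g where "g p = (if win mv p then Suc (LEAST q. mv p q \<and> \<not> win mv q) else 0)" for p
  have z: "g p = 0 \<longleftrightarrow> \<not> win mv p" for p by (simp add: g_def)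
  have "mv p q \<and> \<not> win mv q \<and> (\<forall>r<q. mv p r \<longrightarrow> win mv r)" if "g p = Suc q" for p q
  proof -
    have w: "win mv p" and q: "q = (LEAST q. mv p q \<and> \<not> win mv q)"
      using that by (auto simp: g_def split: if_splits)
    from w have "\<exists>q. mv p q \<and> \<not> win mv q" using win_iff[OF assms] by blast
    then show ?thesis unfolding q by (metis (mono_tags, lifting) LeastI_ex not_less_Least)
  qed
  moreover have "win mv q" if "\<not> win mv p" "mv p q" for p q using win_iff[OF assms] that by blast
  ultimately have "evidence mv g" unfolding evidence_def z[symmetric] by (metis z)
  then show ?thesis by blast
qed

lemma evidence_win:
  assumes "gwf mv" "\<And>p q. g p = Suc q \<Longrightarrow> mv p q \<and> g q = 0" "\<And>p q. g p = 0 \<Longrightarrow> mv p q \<Longrightarrow> g q \<noteq> 0"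
  shows "g p \<noteq> 0 \<longleftrightarrow> win mv p"
proof (induction p rule: gwf_induct[OF assms(1)])
  case (1 p)
  show ?case
    using 1 assms(2,3) win_iff[OF assms(1), of p] by (metis not0_implies_Suc)
qed

lemma evidence_unique:
  assumes wf: "gwf mv" and g: "evidence mv g" and h: "evidence mv h"
  shows "g = h"
proof
  fix p
  have w: "g p \<noteq> 0 \<longleftrightarrow> win mv p" "h p \<noteq> 0 \<longleftrightarrow> win mv p" for p
    using evidence_win[OF wf] g h unfolding evidence_def by blast+
  have "x = y" if "g p = Suc x" "h p = Suc y" for x y
  proof (rule ccontr)
    assume "x \<noteq> y"
    then consider "x < y" | "y < x" by linarith
    then show False
      using that g h w unfolding evidence_def by cases metis+
  qed
  then show "g p = h p" using w by (metis not0_implies_Suc)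
qed

text \<open>Evidence for the game \<open>m\<close> that decides the moves of \<open>mv\<close> is
  interleaved with evidence for \<open>mv\<close> itself. Reading the moves of \<open>mv\<close> off
  the first half makes the pair the only path of a recursive tree.\<close>

theorem ebp_win:
  assumes mv: "ebp2 mv" and wf: "gwf mv"
  shows "ebp (win mv)"
proof -
  obtain m k where m: "rec2 m" "gwf m" and k: "recfn k"
    and mvm: "\<And>z. mv (pfst z) (psnd z) \<longleftrightarrow> win m (k z)"
    using mv unfolding ebp2_def ebp_def by blast
  note [rec_intros] = rec2_comp[OF m(1)] rec_comp[OF k]
  \<comment> \<open>Even places hold the evidence for \<open>m\<close>, odd places that for
    \<open>mv\<close>; a move from \<open>p\<close> to \<open>q\<close> counts as allowed when the
    entry at \<open>2 * k (pe p q)\<close> is nonzero. A condition is imposed only once the entries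
    it inspects exist, which makes \<open>T\<close> closed under initial segments.\<close>
  define T where "T s \<longleftrightarrow> (\<forall>p<lenc s. \<forall>q<lenc s.
     (2 * p < lenc s \<and> 2 * q < lenc s \<longrightarrow>
        (nthr s (2 * p) = Suc q \<longrightarrow> m p q \<and> nthr s (2 * q) = 0 \<and> (\<forall>r<q. m p r \<longrightarrow> nthr s (2 * r) \<noteq> 0)) \<and>
        (nthr s (2 * p) = 0 \<longrightarrow> m p q \<longrightarrow> nthr s (2 * q) \<noteq> 0)) \<and>
     (2 * p + 1 < lenc s \<and> 2 * q + 1 < lenc s \<longrightarrow>
        (nthr s (2 * p + 1) = Suc q \<longrightarrow> (2 * k (pe p q) < lenc s \<longrightarrow> nthr s (2 * k (pe p q)) \<noteq> 0) \<and>
           nthr s (2 * q + 1) = 0 \<and>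
           (\<forall>r<q. 2 * k (pe p r) < lenc s \<longrightarrow> nthr s (2 * k (pe p r)) \<noteq> 0 \<longrightarrow> nthr s (2 * r + 1) \<noteq> 0)) \<and>
        (nthr s (2 * p + 1) = 0 \<longrightarrow> 2 * k (pe p q) < lenc s \<longrightarrow> nthr s (2 * k (pe p q)) \<noteq> 0 \<longrightarrow>
           nthr s (2 * q + 1) \<noteq> 0)))" for s
  have rT: "recp T" unfolding T_def by (intro rec_intros)
  have closed: "T s" if "T (consc x s)" for x s
  proof -
    have e: "nthr (consc x s) j = nthr s j" if "j < lenc s" for j using that by (simp add: nthr_consc)
    show ?thesis unfolding T_def
    proof (intro allI impI)
      fix p q assume "p < lenc s" "q < lenc s"
      then have "p < lenc (consc x s)" "q < lenc (consc x s)" by auto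
      note K = that[unfolded T_def, THEN spec, THEN mp, OF this(1), THEN spec, THEN mp, OF this(2)]
      show "(2 * p < lenc s \<and> 2 * q < lenc s \<longrightarrow>
        (nthr s (2 * p) = Suc q \<longrightarrow> m p q \<and> nthr s (2 * q) = 0 \<and> (\<forall>r<q. m p r \<longrightarrow> nthr s (2 * r) \<noteq> 0)) \<and>
        (nthr s (2 * p) = 0 \<longrightarrow> m p q \<longrightarrow> nthr s (2 * q) \<noteq> 0)) \<and>
       (2 * p + 1 < lenc s \<and> 2 * q + 1 < lenc s \<longrightarrow>
        (nthr s (2 * p + 1) = Suc q \<longrightarrow> (2 * k (pe p q) < lenc s \<longrightarrow> nthr s (2 * k (pe p q)) \<noteq> 0) \<and>
           nthr s (2 * q + 1) = 0 \<and>
           (\<forall>r<q. 2 * k (pe p r) < lenc s \<longrightarrow> nthr s (2 * k (pe p r)) \<noteq> 0 \<longrightarrow> nthr s (2 * r + 1) \<noteq> 0)) \<and>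
        (nthr s (2 * p + 1) = 0 \<longrightarrow> 2 * k (pe p q) < lenc s \<longrightarrow> nthr s (2 * k (pe p q)) \<noteq> 0 \<longrightarrow>
           nthr s (2 * q + 1) \<noteq> 0))"
        using K by (intro conjI impI allI; elim conjE; simp add: e)
    qed
  qed
  define mf where "mf f p q \<longleftrightarrow> f (2 * k (pe p q)) \<noteq> (0::nat)" for f p q
  have path_iff: "(\<forall>n. T (segc f n)) \<longleftrightarrow> evidence m (\<lambda>p. f (2 * p)) \<and> evidence (mf f) (\<lambda>p. f (2 * p + 1))" for f
  proof
    assume A: "\<forall>n. T (segc f n)"
    have "(f (2 * p) = Suc q \<longrightarrow> m p q \<and> f (2 * q) = 0 \<and> (\<forall>r<q. m p r \<longrightarrow> f (2 * r) \<noteq> 0)) \<and>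
          (f (2 * p) = 0 \<longrightarrow> m p q \<longrightarrow> f (2 * q) \<noteq> 0)" for p q
    proof -
      obtain n where n: "2 * p < n" "2 * q < n" "p < n" "q < n"
        by (rule that[of "2 * p + 2 * q + 1"]) auto
      note K = A[rule_format, of n, unfolded T_def lenc_segc, THEN spec, THEN mp, OF n(3), THEN spec, THEN mp, OF n(4)]
      show ?thesis using K n by simp
    qed
    moreover have "(f (2 * p + 1) = Suc q \<longrightarrow> mf f p q \<and> f (2 * q + 1) = 0 \<and> (\<forall>r<q. mf f p r \<longrightarrow> f (2 * r + 1) \<noteq> 0)) \<and>
          (f (2 * p + 1) = 0 \<longrightarrow> mf f p q \<longrightarrow> f (2 * q + 1) \<noteq> 0)" for p q
    proof -
      \<comment> \<open>The length must also exceed the finitely many places at which the moves from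
        \<open>p\<close> to some \<open>r \<le> q\<close> are recorded; a sum bounds them.\<close>
      obtain n where n: "2 * p + 1 < n" "2 * q + 1 < n" "p < n" "q < n"
        and n': "\<And>r. r \<le> q \<Longrightarrow> 2 * k (pe p r) < n"
      proof
        let ?n = "2 * p + 2 * q + 2 + (\<Sum>r\<le>q. 2 * k (pe p r) + 1)"
        show "2 * p + 1 < ?n" "2 * q + 1 < ?n" "p < ?n" "q < ?n" by auto
        show "2 * k (pe p r) < ?n" if "r \<le> q" for r
          using member_le_sum[of r "{..q}" "\<lambda>r. 2 * k (pe p r) + 1"] that by simp
      qed
      note K = A[rule_format, of n, unfolded T_def lenc_segc, THEN spec, THEN mp, OF n(3), THEN spec, THEN mp, OF n(4)]
      show ?thesis
        using K n n' unfolding mf_def by simp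
    qed
    ultimately show "evidence m (\<lambda>p. f (2 * p)) \<and> evidence (mf f) (\<lambda>p. f (2 * p + 1))"
      unfolding evidence_def by blast
  next
    assume "evidence m (\<lambda>p. f (2 * p)) \<and> evidence (mf f) (\<lambda>p. f (2 * p + 1))"
    then show "\<forall>n. T (segc f n)"
      unfolding T_def evidence_def mf_def by simp
  qed
  have mf: "mf f = mv" if "evidence m (\<lambda>p. f (2 * p))" for f
  proof -
    have "f (2 * p) \<noteq> 0 \<longleftrightarrow> win m p" for p
      using evidence_win[OF m(2), of "\<lambda>p. f (2 * p)"] that unfolding evidence_def by blast
    then show ?thesis using mvm by (intro ext) (metis mf_def pfst_pe psnd_pe)
  qed
  obtain a b where a: "evidence m a" and b: "evidence mv b" using evidence_exists m(2) wf by blast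
  define z where "z n = (if even n then a (n div 2) else b (n div 2))" for n
  have z0: "(\<lambda>p. z (2 * p)) = a" "(\<lambda>p. z (2 * p + 1)) = b" by (auto simp: z_def)
  have path: "T (segc z n)" for n
    using path_iff[of z] mf[of z] a b unfolding z0 by simp
  have unique: "f = z" if "\<And>n. T (segc f n)" for f
  proof -
    have e: "evidence m (\<lambda>p. f (2 * p))" "evidence (mf f) (\<lambda>p. f (2 * p + 1))" using path_iff that by auto
    have "(\<lambda>p. f (2 * p)) = a" "(\<lambda>p. f (2 * p + 1)) = b"
      using evidence_unique[OF m(2) e(1) a] evidence_unique[OF wf _ b] e mf[OF e(1)] by auto
    then have "f (2 * p) = z (2 * p)" "f (2 * p + 1) = z (2 * p + 1)" for p using z0 by metis+
    then show ?thesis by (metis ext evenE oddE)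
  qed
  have "ebp2 (\<lambda>k j. z k = j)" by (rule ebp_unique_path[OF rT closed path unique])
  then have "ebp (\<lambda>n. \<not> z (2 * n + 1) = 0)" by (intro eb_intros rec_intros ebp2_comp)
  moreover have "z (2 * n + 1) \<noteq> 0 \<longleftrightarrow> win mv n" for n
    using evidence_win[OF wf, of b] b z0(2) unfolding evidence_def by metis
  ultimately show ?thesis by simp
qed

section \<open>Game-definable sets are hyperarithmetic\<close>

subsection \<open>The Kleene--Brouwer order\<close>

definition kb_less :: "nat \<Rightarrow> nat \<Rightarrow> bool" where
  "kb_less s t \<longleftrightarrow> (\<exists>k<lenc s. k \<le> lenc t \<and> (\<forall>j<k. nthr s j = nthr t j) \<and> (k < lenc t \<longrightarrow> nthr s k < nthr t k))"

lemma nthr_last: "s \<noteq> 0 \<Longrightarrow> nthr s (lenc (tlc s)) = hdc s"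
  using nthr_consc[of "lenc (tlc s)" "tlc s" "hdc s"] by (simp add: consc_hdc_tlc)

lemma kb_irrefl: "\<not> kb_less s s"
  by (auto simp: kb_less_def)

lemma kb_trans: assumes "kb_less s t" "kb_less t u" shows "kb_less s u"
proof -
  obtain k where k: "k < lenc s" "k \<le> lenc t" "\<forall>j<k. nthr s j = nthr t j" "k < lenc t \<longrightarrow> nthr s k < nthr t k"
    using assms(1) by (auto simp: kb_less_def)
  obtain l where l: "l < lenc t" "l \<le> lenc u" "\<forall>j<l. nthr t j = nthr u j" "l < lenc u \<longrightarrow> nthr t l < nthr u l"
    using assms(2) by (auto simp: kb_less_def)
  consider "k < l" | "l < k" | "k = l" by linarith
  then show ?thesis
  proof cases
    case 1
    then show ?thesis using k l unfolding kb_less_def by (intro exI[of _ k]) auto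
  next
    case 2
    then show ?thesis using k l unfolding kb_less_def by (intro exI[of _ l]) auto
  next
    case 3
    then show ?thesis using k l unfolding kb_less_def by (intro exI[of _ k]) auto
  qed
qed

lemma kb_total: assumes "s \<noteq> t" shows "kb_less s t \<or> kb_less t s"
proof -
  define P where "P k \<longleftrightarrow> \<not> (k < lenc s \<and> k < lenc t \<and> nthr s k = nthr t k)" for k
  define k where "k = (LEAST k. P k)"
  have "P (lenc s)" by (simp add: P_def)
  then have k: "P k" and less: "\<And>j. j < k \<Longrightarrow> \<not> P j"
    unfolding k_def by (auto intro: LeastI dest: not_less_Least)
  have j: "j < lenc s \<and> j < lenc t \<and> nthr s j = nthr t j" if "j < k" for j using less[OF that] by (simp add: P_def)
  then have le: "k \<le> lenc s" "k \<le> lenc t" by (meson le_less_linear less_irrefl)+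
  have "k < lenc s \<or> k < lenc t"
  proof (rule ccontr)
    assume "\<not> ?thesis"
    then have "lenc s = k" "lenc t = k" using le by auto
    then have "s = t" using j nthr_eqI[of s t] by auto
    then show False using assms by simp
  qed
  then show ?thesis
    using k le j unfolding P_def kb_less_def by (metis nat_neq_iff)
qed

text \<open>\<open>Min s\<close> says that every nonempty set of plays extending \<open>s\<close>
  has a least element. It passes from all one-step extensions of \<open>s\<close> to
  \<open>s\<close>, so an induction over the game, on the last position of \<open>s\<close>, gives
  it for every play.\<close>

lemma kb_wf:
  assumes base: "gwf mv"
    and ch: "\<And>s. ch s \<longleftrightarrow> (\<forall>k. Suc k < lenc s \<longrightarrow> mv (nthr s k) (nthr s (Suc k)))"
  shows "wf {(s, t). ch s \<and> ch t \<and> kb_less s t}"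
proof -
  define ext where "ext s u \<longleftrightarrow> lenc s \<le> lenc u \<and> (\<forall>j<lenc s. nthr u j = nthr s j)" for s u
  define Min where "Min s \<longleftrightarrow> (\<forall>Q. Q \<noteq> {} \<longrightarrow> (\<forall>u\<in>Q. ch u \<and> ext s u) \<longrightarrow> (\<exists>z\<in>Q. \<forall>y\<in>Q. \<not> kb_less y z))" for s
  have step: "Min s" if IH: "\<And>x. ch (consc x s) \<Longrightarrow> Min (consc x s)" for s
    unfolding Min_def
  proof (intro allI impI)
    fix Q assume Q: "Q \<noteq> {}" "\<forall>u\<in>Q. ch u \<and> ext s u"
    show "\<exists>z\<in>Q. \<forall>y\<in>Q. \<not> kb_less y z"
    proof (cases "\<exists>u\<in>Q. lenc s < lenc u")
      case False
      then have "u = s" if "u \<in> Q" for u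
        using Q(2) that nthr_eqI[of u s] by (auto simp: ext_def le_less)
      then show ?thesis using Q(1) kb_irrefl by blast
    next
      case True
      \<comment> \<open>Proper extensions precede \<open>s\<close> itself, so the least element is
        sought among the plays whose next entry after \<open>s\<close> is smallest.\<close>
      define P where "P x \<longleftrightarrow> (\<exists>u\<in>Q. lenc s < lenc u \<and> nthr u (lenc s) = x)" for x
      define x where "x = (LEAST x. P x)"
      have "\<exists>x. P x" using True by (auto simp: P_def)
      then have x: "P x" and less: "\<And>y. P y \<Longrightarrow> x \<le> y"
        unfolding x_def by (auto intro: LeastI_ex Least_le)
      obtain u where u: "u \<in> Q" "lenc s < lenc u" "nthr u (lenc s) = x" using x by (auto simp: P_def)
      have cu: "nthr (consc x s) j = nthr u j" if "j \<le> lenc s" for j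
        using Q(2) u that by (auto simp: nthr_consc ext_def)
      have "ch (consc x s)"
        using Q(2) u cu unfolding ch by (auto simp: less_Suc_eq_le)
      from IH[OF this] have M: "Min (consc x s)" .
      let ?Q = "{u \<in> Q. ext (consc x s) u}"
      have uQ: "u \<in> ?Q" using u cu by (auto simp: ext_def less_Suc_eq_le)
      obtain z where z: "z \<in> ?Q" "\<forall>y\<in>?Q. \<not> kb_less y z"
        using M[unfolded Min_def, rule_format, of ?Q] uQ Q(2) by blast
      have zs: "lenc s < lenc z" "nthr z (lenc s) = x" "\<And>j. j < lenc s \<Longrightarrow> nthr z j = nthr s j"
        using z(1) by (auto simp: ext_def nthr_consc less_Suc_eq_le)
      have "\<not> kb_less y z" if y: "y \<in> Q" for y
      proof
        assume l: "kb_less y z"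
        then have yQ: "y \<notin> ?Q" using z(2) by blast
        obtain k where k: "k < lenc y" "k \<le> lenc z" "\<forall>j<k. nthr y j = nthr z j" "k < lenc z \<longrightarrow> nthr y k < nthr z k"
          using l by (auto simp: kb_less_def)
        have ey: "lenc s \<le> lenc y" "\<And>j. j < lenc s \<Longrightarrow> nthr y j = nthr s j"
          using Q(2) y by (auto simp: ext_def)
        have "\<not> k < lenc s" using k zs ey by fastforce
        then have ky: "lenc s < lenc y" using k(1) by simp
        then have "x \<le> nthr y (lenc s)" using less y by (auto simp: P_def)
        moreover have "nthr y (lenc s) \<noteq> x"
          using yQ y ey ky by (auto simp: ext_def nthr_consc less_Suc_eq_le Suc_le_eq split: if_splits)
        ultimately show False
          using k zs \<open>\<not> k < lenc s\<close> by (metis le_neq_implies_less linorder_not_le)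
      qed
      then show ?thesis using z(1) by blast
    qed
  qed
  have "\<forall>s. s \<noteq> 0 \<longrightarrow> hdc s = p \<longrightarrow> Min s" for p
  proof (induction p rule: gwf_induct[OF base])
    case (1 p)
    show ?case
    proof (intro allI impI)
      fix s assume s: "s \<noteq> 0" "hdc s = p"
      show "Min s"
      proof (rule step)
        fix x assume c: "ch (consc x s)"
        obtain l where l: "lenc s = Suc l" using lenc_tlc[OF s(1)] by blast
        have "nthr (consc x s) l = p"
          using s l nthr_last[of s] lenc_tlc[of s] by (simp add: nthr_consc)
        moreover have "nthr (consc x s) (Suc l) = x" using l by (simp add: nthr_consc)
        ultimately have "mv p x" using c l unfolding ch by (metis lenc_consc lessI)
        then show "Min (consc x s)" using 1 by simp
      qed
    qed
  qed
  then have nz: "s \<noteq> 0 \<Longrightarrow> Min s" for s by blast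
  have M0: "Min 0" by (rule step, rule nz) simp
  show ?thesis
  proof (rule wfI_min)
    fix x :: nat and Q assume x: "x \<in> Q"
    show "\<exists>z\<in>Q. \<forall>y. (y, z) \<in> {(s, t). ch s \<and> ch t \<and> kb_less s t} \<longrightarrow> y \<notin> Q"
    proof (cases "\<exists>u\<in>Q. ch u")
      case True
      have "\<exists>z\<in>{u\<in>Q. ch u}. \<forall>y\<in>{u\<in>Q. ch u}. \<not> kb_less y z"
        by (rule M0[unfolded Min_def, rule_format]) (use True in \<open>auto simp: ext_def\<close>)
      then obtain z where "z \<in> {u\<in>Q. ch u}" "\<forall>y\<in>{u\<in>Q. ch u}. \<not> kb_less y z" by blast
      then show ?thesis by (intro bexI[of _ z]) auto
    next
      case False
      then show ?thesis using x by blast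
    qed
  qed
qed

text \<open>Unravelling a game to the tree of its finite plays makes the moves descend in a computable well-order.\<close>

lemma ebp_wellorder:
  assumes "ebp P"
  obtains R m k where "computable_wellorder R" "rec2 m" "gwf m" "recfn k"
    "\<And>p q. m p q \<Longrightarrow> p \<in> Field R \<and> q \<in> underS R p" "\<And>n. k n \<in> Field R" "\<And>n. P n \<longleftrightarrow> win m (k n)"
proof -
  obtain mv h where mv: "rec2 mv" "gwf mv" and h: "recfn h" and Pm: "\<And>n. P n \<longleftrightarrow> win mv (h n)"
    using assms unfolding ebp_def by blast
  note [rec_intros] = rec2_comp[OF mv(1)] rec_comp[OF h]
  define ch where "ch s \<longleftrightarrow> (\<forall>k<lenc s. Suc k < lenc s \<longrightarrow> mv (nthr s k) (nthr s (Suc k)))" for s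
  have ch: "ch s \<longleftrightarrow> (\<forall>k. Suc k < lenc s \<longrightarrow> mv (nthr s k) (nthr s (Suc k)))" for s
    by (auto simp: ch_def)
  have rch: "recp ch" unfolding ch_def by (intro rec_intros)
  note [rec_intros] = recp_comp[OF rch]
  define R where "R = {(s, t). ch s \<and> ch t \<and> (s = t \<or> kb_less s t)}"
  have F: "Field R = {s. ch s}" by (auto simp: R_def Field_def)
  have "R - Id = {(s, t). ch s \<and> ch t \<and> kb_less s t}"
    using kb_irrefl by (auto simp: R_def)
  then have "wf (R - Id)" using kb_wf[OF mv(2) ch] by simp
  moreover have "trans R" unfolding R_def by (rule transI) (auto intro: kb_trans)
  moreover have "antisym R" unfolding R_def by (rule antisymI) (auto dest: kb_trans simp: kb_irrefl)
  ultimately have WO: "Well_order R"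
    using kb_total unfolding order_on_defs F
    by (auto simp: R_def refl_on_def total_on_def)
  have "recp (\<lambda>n. n \<in> prod_encode ` R)"
  proof (rule recp_cong)
    show "n \<in> prod_encode ` R \<longleftrightarrow> ch (pfst n) \<and> ch (psnd n) \<and> (pfst n = psnd n \<or> kb_less (pfst n) (psnd n))" for n
      by (auto simp: R_def image_iff) (metis pe_pfst_psnd)+
    show "recp (\<lambda>n. ch (pfst n) \<and> ch (psnd n) \<and> (pfst n = psnd n \<or> kb_less (pfst n) (psnd n)))"
      unfolding kb_less_def by (intro rec_intros)
  qed
  then have R: "computable_wellorder R"
    using WO by (simp add: computable_wellorder_def computable_iff_recp)
  define m where "m s t \<longleftrightarrow> s \<noteq> 0 \<and> t \<noteq> 0 \<and> ch t \<and> tlc t = s" for s t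
  have m: "rec2 m" unfolding rec2_def m_def by (intro rec_intros)
  have ch_cons: "ch (consc x s) \<longleftrightarrow> ch s \<and> mv (hdc s) x" if nz: "s \<noteq> 0" for x s
  proof -
    obtain l where l: "lenc s = Suc l" using lenc_tlc[OF nz] by blast
    have hd: "nthr s l = hdc s"
      using nz l nthr_last[of s] lenc_tlc[of s] by simp
    have "ch (consc x s) \<longleftrightarrow> (\<forall>k. k < Suc l \<longrightarrow> mv (nthr (consc x s) k) (nthr (consc x s) (Suc k)))"
      unfolding ch using l by simp
    also have "\<dots> \<longleftrightarrow> (\<forall>k<l. mv (nthr s k) (nthr s (Suc k))) \<and> mv (hdc s) x"
      using l hd by (auto simp: nthr_consc less_Suc_eq)
    finally show ?thesis unfolding ch using l by simp
  qed
  have m_iff: "m s t \<longleftrightarrow> (\<exists>x. s \<noteq> 0 \<and> t = consc x s \<and> ch s \<and> mv (hdc s) x)" for s t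
    unfolding m_def using ch_cons by (metis consc_hdc_tlc consc_nz(1) tlc_consc)
  have "kb_less (consc x s) s" for x s
    unfolding kb_less_def by (intro exI[of _ "lenc s"]) (auto simp: nthr_consc)
  then have mR: "m p q \<Longrightarrow> p \<in> Field R \<and> q \<in> underS R p" for p q
    unfolding F using consc_gt(1) by (auto simp: m_iff underS_def R_def ch_cons) (metis less_irrefl)
  have wfm: "gwf m"
    unfolding gwf_def
    by (rule wf_subset[OF \<open>wf (R - Id)\<close>]) (auto dest!: mR simp: underS_def)
  have win: "s \<noteq> 0 \<longrightarrow> ch s \<longrightarrow> win m s = win mv (hdc s)" for s
  proof (induction s rule: gwf_induct[OF wfm])
    case (1 s)
    show ?case
    proof (intro impI)
      assume s: "s \<noteq> 0" "ch s"
      have "win m s \<longleftrightarrow> (\<exists>t. m s t \<and> \<not> win m t)" by (rule win_iff[OF wfm])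
      also have "\<dots> \<longleftrightarrow> (\<exists>x. mv (hdc s) x \<and> \<not> win m (consc x s))"
        using s by (auto simp: m_iff[of s])
      also have "\<dots> \<longleftrightarrow> (\<exists>x. mv (hdc s) x \<and> \<not> win mv x)"
      proof -
        have "win m (consc x s) = win mv x" if "mv (hdc s) x" for x
          using 1[of "consc x s"] s that by (simp add: m_iff[of s] ch_cons)
        then show ?thesis by blast
      qed
      finally show "win m s = win mv (hdc s)" using win_iff[OF mv(2), of "hdc s"] by blast
    qed
  qed
  have k: "recfn (\<lambda>n. consc (h n) 0)" by (intro rec_intros)
  have chk: "ch (consc (h n) 0)" for n by (simp add: ch)
  show thesis
    by (rule that[OF R m wfm k mR]) (use F chk win Pm in auto)
qed

subsection \<open>Jump hierarchies decide games\<close>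

lemma jump_hierarchy_exists:
  assumes "Well_order R" shows "\<exists>H. jump_hierarchy R H"
proof -
  have wf: "wf (R - Id)" using assms by (simp add: well_order_on_def)
  define H where "H = wfrec (R - Id) (\<lambda>H a. turing_jump (effective_join (underS R a) H))"
  have "H a = turing_jump (effective_join (underS R a) H)" for a
  proof -
    have "effective_join (underS R a) (cut H (R - Id) a) = effective_join (underS R a) H"
      by (auto simp: effective_join_def underS_def cut_apply)
    then show ?thesis unfolding H_def by (subst wfrec[OF wf]) simp
  qed
  then show ?thesis by (auto simp: jump_hierarchy_def)
qed

lemma goedel_inject: "goedel c = goedel d \<Longrightarrow> c = d"
proof (induction c arbitrary: d)
  case (Pairing c1 c2) then show ?case by (cases d) auto
next
  case (Comp c1 c2) then show ?case by (cases d) auto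
next
  case (Prec c1 c2) then show ?case by (cases d) auto
next
  case (Mu c) then show ?case by (cases d) auto
qed (case_tac d; auto)+

inductive_cases eval_PairingE: "eval X (Pairing c d) n y"
inductive_cases eval_CompE: "eval X (Comp c d) n y"
inductive_cases eval_PrecE: "eval X (Prec c d) n y"
inductive_cases eval_MuE: "eval X (Mu c) n y"
inductive_cases eval_ZerE: "eval X Zer n y"
inductive_cases eval_SuccE: "eval X Succ n y"
inductive_cases eval_FstE: "eval X Fst n y"
inductive_cases eval_SndE: "eval X Snd n y"
inductive_cases eval_OracleE: "eval X Oracle n y"

lemma Mu_halts_iff:
  assumes "\<And>t. eval X D (pe n t) (f t)"
  shows "(\<exists>y. eval X (Mu D) n y) \<longleftrightarrow> (\<exists>t. f t = 0)"
proof
  assume "\<exists>y. eval X (Mu D) n y"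
  then show "\<exists>t. f t = 0"
    by (metis assms eval_MuE eval_deterministic)
next
  assume "\<exists>t. f t = 0"
  then have "f (LEAST t. f t = 0) = 0" by (rule LeastI_ex)
  moreover have "f k \<noteq> 0" if "k < (LEAST t. f t = 0)" for k using that not_less_Least by blast
  ultimately have "eval X (Mu D) n (LEAST t. f t = 0)"
    using assms by (intro eval.Mu) (metis, metis not0_implies_Suc)
  then show "\<exists>y. eval X (Mu D) n y" ..
qed

text \<open>
  A program in the jump runs on its own code, so it can compute the codes of the programs for the
  later positions from its input: no recursion theorem is needed.
\<close>

lemma ebp_in_HYP:
  assumes "ebp P" shows "{n. P n} \<in> HYP"
proof -
  obtain R m k where R: "computable_wellorder R" and m: "rec2 m" "gwf m" and k: "recfn k"
    and mR: "\<And>p q. m p q \<Longrightarrow> p \<in> Field R \<and> q \<in> underS R p" and kR: "\<And>n. k n \<in> Field R"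
    and Pm: "\<And>n. P n \<longleftrightarrow> win m (k n)"
    using ebp_wellorder[OF assms] by blast
  have WO: "Well_order R" using R by (simp add: computable_wellorder_def)
  obtain H where H: "jump_hierarchy R H" using jump_hierarchy_exists[OF WO] by blast
  define idp where "idp = Pairing Fst Snd"
  have idp: "eval X idp n n" for X n
    unfolding idp_def using eval.Pairing[OF eval_Fst eval_Snd] by simp
  \<comment> \<open>Turns the code of any \<open>cs s\<close> into the code of \<open>cs t\<close>:
    \<open>pfst (psnd g)\<close> is the code of the outer program, which is kept, and only the
    constant changes. The tags 6 and 5 are those of \<open>Comp\<close> and
    \<open>Pairing\<close>.\<close>
  define kk where "kk g t = pe 6 (pe (pfst (psnd g)) (pe 5 (pe (goedel idp)
      (rec_nat (goedel Zer) (\<lambda>k a. pe 6 (pe (goedel Succ) a)) t))))" for g t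
  note [rec_intros] = rec2_comp[OF m(1)]
  have gconst: "rec_nat (goedel Zer) (\<lambda>k a. pe 6 (pe (goedel Succ) a)) t = goedel (const_prog t)" for t
    by (induction t) auto
  have "recfn (\<lambda>z. pe (psnd z) (kk (pfst (pfst z)) (psnd z)))" unfolding kk_def by (intro rec_intros)
  then obtain P2 where P2: "\<And>X z. eval X P2 z (pe (psnd z) (kk (pfst (pfst z)) (psnd z)))"
    unfolding recfn_def by blast
  have "recfn (\<lambda>z. of_bool (m (psnd (pfst z)) (psnd z)))" by (intro rec_intros)
  then obtain P1 where P1: "\<And>X z. eval X P1 z (of_bool (m (psnd (pfst z)) (psnd z)))"
    unfolding recfn_def by blast
  have "recfn (\<lambda>z. if pfst z = 0 then 1 else psnd z)" by (intro rec_intros)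
  then obtain M2 where M2: "\<And>X z. eval X M2 z (if pfst z = 0 then 1 else psnd z)"
    unfolding recfn_def by blast
  \<comment> \<open>The value is 0 exactly when \<open>t\<close> is a legal move and the oracle does
    not contain \<open>t\<close> paired with the code of its program; so \<open>Mu D\<close>
    searches for a winning move.\<close>
  define D where "D = Comp M2 (Pairing P1 (Comp Oracle P2))"
  have D: "eval X D (pe (pe g s) t) (if m s t then of_bool (pe t (kk g t) \<in> X) else 1)" for X g s t
  proof -
    have "eval X (Comp Oracle P2) (pe (pe g s) t) (of_bool (pe t (kk g t) \<in> X))"
      using eval.Comp[OF P2[of X "pe (pe g s) t"] eval.Oracle] by simp
    moreover have "eval X P1 (pe (pe g s) t) (of_bool (m s t))"
      using P1[of X "pe (pe g s) t"] by simp
    ultimately have "eval X (Pairing P1 (Comp Oracle P2)) (pe (pe g s) t)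
        (pe (of_bool (m s t)) (of_bool (pe t (kk g t) \<in> X)))" by (intro eval.Pairing)
    from eval.Comp[OF this M2] show ?thesis unfolding D_def by (cases "m s t") simp_all
  qed
  define cs where "cs s = Comp (Mu D) (Pairing idp (const_prog s))" for s
  have kk: "kk (goedel (cs s)) t = goedel (cs t)" for s t
    unfolding kk_def gconst cs_def by simp
  have jump: "goedel (cs s) \<in> turing_jump X \<longleftrightarrow> (\<exists>t. m s t \<and> pe t (goedel (cs t)) \<notin> X)" for s X
  proof -
    let ?g = "goedel (cs s)"
    have "?g \<in> turing_jump X \<longleftrightarrow> (\<exists>y. eval X (cs s) ?g y)"
      unfolding turing_jump_def using goedel_inject by blast
    also have "\<dots> \<longleftrightarrow> (\<exists>y. eval X (Mu D) (pe ?g s) y)"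
    proof -
      have "eval X (Pairing idp (const_prog s)) ?g (pe ?g s)"
        by (intro eval.Pairing idp eval_const_prog)
      then show ?thesis unfolding cs_def by (metis eval.Comp eval_CompE eval_deterministic)
    qed
    also have "\<dots> \<longleftrightarrow> (\<exists>t. (if m s t then of_bool (pe t (kk ?g t) \<in> X) else 1) = (0::nat))"
      by (rule Mu_halts_iff) (rule D)
    also have "\<dots> \<longleftrightarrow> (\<exists>t. m s t \<and> pe t (goedel (cs t)) \<notin> X)" by (auto simp: kk)
    finally show ?thesis .
  qed
  have key: "s \<in> Field R \<longrightarrow> (goedel (cs s) \<in> H s \<longleftrightarrow> win m s)" for s
  proof (induction s rule: gwf_induct[OF m(2)])
    case (1 s)
    show ?case
    proof
      assume s: "s \<in> Field R"
      have Hs: "H s = turing_jump (effective_join (underS R s) H)" using H s by (simp add: jump_hierarchy_def)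
      have "goedel (cs s) \<in> H s \<longleftrightarrow> (\<exists>t. m s t \<and> \<not> (t \<in> underS R s \<and> goedel (cs t) \<in> H t))"
        unfolding Hs jump by (auto simp: effective_join_def)
      also have "\<dots> \<longleftrightarrow> (\<exists>t. m s t \<and> \<not> win m t)"
      proof -
        have "t \<in> underS R s \<and> (goedel (cs t) \<in> H t \<longleftrightarrow> win m t)" if "m s t" for t
          using mR[OF that] 1[OF that] by (auto simp: underS_def Field_def)
        then show ?thesis by blast
      qed
      finally show "goedel (cs s) \<in> H s \<longleftrightarrow> win m s" using win_iff[OF m(2), of s] by blast
    qed
  qed
  have "recfn (\<lambda>n. pe (k n) (kk (goedel (cs 0)) (k n)))" unfolding kk_def by (intro rec_intros k rec_comp[OF k])
  then obtain Q where Q: "\<And>X n. eval X Q n (pe (k n) (goedel (cs (k n))))"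
    unfolding recfn_def kk by blast
  have "eval (effective_join (Field R) H) (Comp Oracle Q) n (of_bool (n \<in> {n. P n}))" for n
  proof -
    have "pe (k n) (goedel (cs (k n))) \<in> effective_join (Field R) H \<longleftrightarrow> P n"
      using key[of "k n"] kR[of n] Pm by (auto simp: effective_join_def)
    then show ?thesis using eval.Comp[OF Q eval.Oracle, of "effective_join (Field R) H" n] by simp
  qed
  then show ?thesis using R H unfolding HYP_def turing_le_def by blast
qed

section \<open>Rule systems\<close>

text \<open>
  A statement \<open>p\<close> holds iff it has an instance \<open>w\<close> whose two premises \<open>A p w\<close> and \<open>B p w\<close> are
  correct. The premise \<open>2 * q\<close> says that \<open>q\<close> holds, and \<open>2 * q + 1\<close> that \<open>q\<close> fails.
\<close>

definition rule_mv :: "(nat \<Rightarrow> nat \<Rightarrow> bool) \<Rightarrow> (nat \<Rightarrow> nat \<Rightarrow> nat) \<Rightarrow> (nat \<Rightarrow> nat \<Rightarrow> nat) \<Rightarrow> nat \<Rightarrow> nat \<Rightarrow> bool" where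
  "rule_mv I A B p q \<longleftrightarrow>
     pfst p = 0 \<and> pfst q = 1 \<and> pfst (psnd q) = psnd p \<and> I (psnd p) (psnd (psnd q)) \<or>
     pfst p = 1 \<and> I (pfst (psnd p)) (psnd (psnd p)) \<and>
       (\<exists>a. (a = A (pfst (psnd p)) (psnd (psnd p)) \<or> a = B (pfst (psnd p)) (psnd (psnd p))) \<and>
          q = pe (if even a then 0 else 2) (a div 2)) \<or>
     pfst p = 2 \<and> q = pe 0 (psnd p)"

definition rule_rel :: "(nat \<Rightarrow> nat \<Rightarrow> bool) \<Rightarrow> (nat \<Rightarrow> nat \<Rightarrow> nat) \<Rightarrow> (nat \<Rightarrow> nat \<Rightarrow> nat) \<Rightarrow> nat rel" where
  "rule_rel I A B = {(q, p). \<exists>w. I p w \<and> (q = A p w div 2 \<or> q = B p w div 2)}"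

definition rule_holds :: "(nat \<Rightarrow> nat \<Rightarrow> bool) \<Rightarrow> (nat \<Rightarrow> nat \<Rightarrow> nat) \<Rightarrow> (nat \<Rightarrow> nat \<Rightarrow> nat) \<Rightarrow> nat \<Rightarrow> bool" where
  "rule_holds I A B x \<longleftrightarrow> win (rule_mv I A B) (pe 0 x)"

lemma gwf_rule_mv:
  assumes "wf (rule_rel I A B)" shows "gwf (rule_mv I A B)"
proof -
  \<comment> \<open>The second component orders the stages spent on one statement: from its negation
    (3) to the statement (2) to a chosen instance (1). After that only smaller statements
    follow.\<close>
  define f where "f p = (if pfst p = 1 then (pfst (psnd p), 1::nat) else if pfst p = 2 then (psnd p, 3)
     else (psnd p, 2))" for p
  have "wf (inv_image (rule_rel I A B <*lex*> less_than) f)" using assms by auto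
  then show ?thesis
    unfolding gwf_def
    by (rule wf_subset) (auto simp: rule_mv_def f_def rule_rel_def)
qed

lemma rule_holds_iff:
  assumes "wf (rule_rel I A B)"
  shows "rule_holds I A B x \<longleftrightarrow> (\<exists>w. I x w \<and> (rule_holds I A B (A x w div 2) \<longleftrightarrow> even (A x w)) \<and>
     (rule_holds I A B (B x w div 2) \<longleftrightarrow> even (B x w)))"
proof -
  let ?W = "win (rule_mv I A B)"
  note wf = gwf_rule_mv[OF assms]
  have w2: "?W (pe 2 q) \<longleftrightarrow> \<not> ?W (pe 0 q)" for q
    by (subst win_iff[OF wf]) (simp add: rule_mv_def)
  have neg: "\<not> ?W (pe (if even a then 0 else 2) q) \<longleftrightarrow> (?W (pe 0 q) \<longleftrightarrow> odd a)" for a q :: nat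
    by (simp add: w2)
  have w1: "?W (pe 1 (pe x w)) \<longleftrightarrow> \<not> ((?W (pe 0 (A x w div 2)) \<longleftrightarrow> even (A x w)) \<and> (?W (pe 0 (B x w div 2)) \<longleftrightarrow> even (B x w)))"
    if "I x w" for w
  proof -
    have mv: "rule_mv I A B (pe 1 (pe x w)) q \<longleftrightarrow>
        (\<exists>a. (a = A x w \<or> a = B x w) \<and> q = pe (if even a then 0 else 2) (a div 2))" for q
      using that by (simp add: rule_mv_def)
    have "?W (pe 1 (pe x w)) \<longleftrightarrow> (\<exists>a. (a = A x w \<or> a = B x w) \<and> \<not> ?W (pe (if even a then 0 else 2) (a div 2)))"
      using win_iff[OF wf, of "pe 1 (pe x w)"] unfolding mv by blast
    then show ?thesis unfolding neg by blast
  qed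
  have "?W (pe 0 x) \<longleftrightarrow> (\<exists>q. pfst q = 1 \<and> pfst (psnd q) = x \<and> I x (psnd (psnd q)) \<and> \<not> ?W q)"
    by (subst win_iff[OF wf]) (auto simp: rule_mv_def)
  also have "\<dots> \<longleftrightarrow> (\<exists>w. I x w \<and> \<not> ?W (pe 1 (pe x w)))"
    by (metis pe_pfst_psnd pfst_pe psnd_pe)
  also have "\<dots> \<longleftrightarrow> (\<exists>w. I x w \<and> (?W (pe 0 (A x w div 2)) \<longleftrightarrow> even (A x w)) \<and> (?W (pe 0 (B x w div 2)) \<longleftrightarrow> even (B x w)))"
    using w1 by blast
  finally show ?thesis by (simp add: rule_holds_def)
qed

lemma ebp2_rule_mv:
  assumes I: "ebp2 I" and A: "recfn (\<lambda>z. A (pfst z) (psnd z))" and B: "recfn (\<lambda>z. B (pfst z) (psnd z))"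
  shows "ebp2 (rule_mv I A B)"
proof -
  have [rec_intros]: "recfn f \<Longrightarrow> recfn g \<Longrightarrow> recfn (\<lambda>n. A (f n) (g n))" for f g
    using rec_comp[OF A, of "\<lambda>n. pe (f n) (g n)"] by (simp add: rec_intros)
  have [rec_intros]: "recfn f \<Longrightarrow> recfn g \<Longrightarrow> recfn (\<lambda>n. B (f n) (g n))" for f g
    using rec_comp[OF B, of "\<lambda>n. pe (f n) (g n)"] by (simp add: rec_intros)
  note [eb_intros] = ebp2_comp[OF I]
  show ?thesis unfolding ebp2_def rule_mv_def by (intro eb_intros rec_intros)
qed

lemma ebp_rule_holds:
  assumes "ebp2 I" "recfn (\<lambda>z. A (pfst z) (psnd z))" "recfn (\<lambda>z. B (pfst z) (psnd z))"
    "wf (rule_rel I A B)"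
  shows "ebp (rule_holds I A B)"
proof -
  have "recfn (\<lambda>x. pe 0 x)" by (intro rec_intros)
  from ebp_comp[OF ebp_win[OF ebp2_rule_mv gwf_rule_mv] this, of I A B]
  show ?thesis using assms unfolding rule_holds_def by blast
qed

section \<open>Hyperarithmetic sets are game-definable\<close>

text \<open>
  Truth of \<open>eval\<close> along a jump hierarchy is a rule system: \<open>Ep a c n y\<close> says that the program with
  code \<open>c\<close> and oracle the join below level \<open>a\<close> maps \<open>n\<close> to \<open>y\<close>, \<open>Vp a c\<close> that \<open>c\<close> is a code,
  \<open>Jp b x\<close> that \<open>x\<close> is in the jump at \<open>b\<close>, and \<open>Mp a c n m\<close> that \<open>c\<close> has nonzero values at
  \<open>(n, j)\<close> for \<open>j < m\<close>. Level \<open>0\<close> is the top level and \<open>Suc b\<close> stands for \<open>b\<close>.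
\<close>

abbreviation (input) Ep :: "nat \<Rightarrow> nat \<Rightarrow> nat \<Rightarrow> nat \<Rightarrow> nat" where "Ep a c n y \<equiv> pe 0 (pe a (pe c (pe n y)))"
abbreviation (input) Vp :: "nat \<Rightarrow> nat \<Rightarrow> nat" where "Vp a c \<equiv> pe 1 (pe a (pe c 0))"
abbreviation (input) Jp :: "nat \<Rightarrow> nat \<Rightarrow> nat" where "Jp b x \<equiv> pe 2 (pe (Suc b) (pe x 0))"
abbreviation (input) Mp :: "nat \<Rightarrow> nat \<Rightarrow> nat \<Rightarrow> nat \<Rightarrow> nat" where "Mp a c n m \<equiv> pe 3 (pe a (pe c (pe n m)))"
text \<open>Tag 4 has no instances, so the premise that \<open>pe 4 0\<close> fails is always
  correct; it fills the place of an absent premise.\<close>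

abbreviation (input) tt :: nat where "tt \<equiv> 2 * pe 4 0 + 1"

context
  fixes below :: "nat \<Rightarrow> nat \<Rightarrow> bool"
begin

text \<open>\<open>w\<close> is the value that has to be guessed: an intermediate result of a
  composition or recursion, an output that shows halting, or the predecessor of a nonzero value met
  in a search.\<close>

definition evI :: "nat \<Rightarrow> nat \<Rightarrow> bool" where
  "evI p w \<longleftrightarrow> (let k = pfst p; a = pfst (psnd p); c = pfst (psnd (psnd p)); n = pfst (psnd (psnd (psnd p)));
       y = psnd (psnd (psnd (psnd p))); t = pfst c; r = psnd c in
     k = 0 \<and> (t = 0 \<and> r = 0 \<and> y = 0 \<or> t = 1 \<and> r = 0 \<and> y = Suc n \<or> t = 2 \<and> r = 0 \<and> y = pfst n \<or>
        t = 3 \<and> r = 0 \<and> y = psnd n \<or> t = 4 \<and> r = 0 \<and> (y = 1 \<and> below a (pfst n) \<or> y = 0) \<or>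
        5 \<le> t \<and> t \<le> 8) \<or>
     k = 1 \<and> (t \<le> 4 \<and> r = 0 \<or> 5 \<le> t \<and> t \<le> 8) \<or> k = 2 \<and> 0 < a \<or> k = 3)"

text \<open>For an oracle query with claimed answer \<open>y\<close>, the term \<open>1 - y\<close>
  sets the parity of the premise, so that the jump statement is asked to hold or to fail as
  claimed.\<close>

definition evA :: "nat \<Rightarrow> nat \<Rightarrow> nat" where
  "evA p w = (let k = pfst p; a = pfst (psnd p); c = pfst (psnd (psnd p)); n = pfst (psnd (psnd (psnd p)));
       y = psnd (psnd (psnd (psnd p))); t = pfst c; r = psnd c in
     if k = 0 then
       (if t \<le> 3 then tt
        else if t = 4 then (if below a (pfst n) then 2 * Jp (pfst n) (psnd n) + (1 - y) else tt)
        else if t = 5 then 2 * Ep a (pfst r) n (pfst y)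
        else if t = 6 then 2 * Ep a (psnd r) n w
        else if t = 7 then (if psnd n = 0 then 2 * Ep a (pfst r) (pfst n) y else 2 * Ep a c (pe (pfst n) (psnd n - 1)) w)
        else 2 * Ep a r (pe n y) 0)
     else if k = 1 then (if t \<le> 4 then tt else if t < 8 then 2 * Vp a (pfst r) else 2 * Vp a r)
     else if k = 2 then 2 * Ep a c c w
     else if y = 0 then tt else 2 * Ep a c (pe n (y - 1)) (Suc w))"

text \<open>At the base of a primitive recursion the step program is not run; \<open>Vp\<close> then
  still asks that it be the code of a program.\<close>

definition evB :: "nat \<Rightarrow> nat \<Rightarrow> nat" where
  "evB p w = (let k = pfst p; a = pfst (psnd p); c = pfst (psnd (psnd p)); n = pfst (psnd (psnd (psnd p)));
       y = psnd (psnd (psnd (psnd p))); t = pfst c; r = psnd c in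
     if k = 0 then
       (if t \<le> 4 then tt
        else if t = 5 then 2 * Ep a (psnd r) n (psnd y)
        else if t = 6 then 2 * Ep a (pfst r) w y
        else if t = 7 then (if psnd n = 0 then 2 * Vp a (psnd r) else 2 * Ep a (psnd r) (pe (pfst n) (pe (psnd n - 1) w)) y)
        else 2 * Mp a r n y)
     else if k = 1 then (if t \<le> 4 then tt else if t < 8 then 2 * Vp a (psnd r) else 2 * Vp a r)
     else if k = 2 then 2 * Ep a c c w
     else if y = 0 then tt else 2 * Mp a c n (y - 1))"

lemma ev_recfn:
  assumes "rec2 below"
  shows "ebp2 evI" "recfn (\<lambda>z. evA (pfst z) (psnd z))" "recfn (\<lambda>z. evB (pfst z) (psnd z))"
proof -
  note [rec_intros] = rec2_comp[OF assms]
  show "ebp2 evI" unfolding ebp2_def evI_def Let_def by (intro ebp_rec rec_intros)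
  show "recfn (\<lambda>z. evA (pfst z) (psnd z))" unfolding evA_def Let_def by (intro rec_intros)
  show "recfn (\<lambda>z. evB (pfst z) (psnd z))" unfolding evB_def Let_def by (intro rec_intros)
qed

lemma evI_simps:
  "evI (Ep a (pe t r) n y) w \<longleftrightarrow> (t = 0 \<and> r = 0 \<and> y = 0 \<or> t = 1 \<and> r = 0 \<and> y = Suc n \<or> t = 2 \<and> r = 0 \<and> y = pfst n \<or>
        t = 3 \<and> r = 0 \<and> y = psnd n \<or> t = 4 \<and> r = 0 \<and> (y = 1 \<and> below a (pfst n) \<or> y = 0) \<or>
        5 \<le> t \<and> t \<le> 8)"
  "evI (Vp a (pe t r)) w \<longleftrightarrow> t \<le> 4 \<and> r = 0 \<or> 5 \<le> t \<and> t \<le> 8"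
  "evI (Jp b x) w" "evI (Mp a c n m) w" "\<not> evI (pe 4 x) w"
  by (simp_all add: evI_def)

lemma wf_ev:
  assumes "wf {(Suc b, a) | b a. below a b}"
  shows "wf (rule_rel evI evA evB)"
proof -
  \<comment> \<open>Premises descend lexicographically: in the oracle level, then the code of the
    program, then the kind of statement, and last the argument of a recursion or the bound of a
    search. The leading component puts the filler \<open>tt\<close> below everything else.\<close>
  define f where "f p = (if pfst p = 4 then 0 else 1::nat, pfst (psnd p), pfst (psnd (psnd p)), pfst p,
     if pfst p = 0 then pfst (psnd (psnd (psnd p))) else psnd (psnd (psnd (psnd p))))" for p
  have c1: "pfst (psnd c) < c" "psnd (psnd c) < c" "psnd c < c" if "0 < pfst c" for c
    using psnd_less[OF that] pfst_le[of "psnd c"] psnd_le[of "psnd c"] by auto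
  have n1: "pe (pfst n) (psnd n - Suc 0) < n" if "psnd n \<noteq> 0" for n
    using pe_mono2[of "psnd n - 1" "psnd n" "pfst n"] that by simp
  let ?r = "less_than <*lex*> ({(Suc b, a) | b a. below a b} <*lex*> (less_than <*lex*> (less_than <*lex*> less_than)))"
  have "wf (inv_image ?r f)" using assms by auto
  moreover have "(evA p w div 2, p) \<in> inv_image ?r f \<and> (evB p w div 2, p) \<in> inv_image ?r f" if I: "evI p w" for p w
  proof -
    obtain k a c n y where p: "p = pe k (pe a (pe c (pe n y)))" by (metis pe_pfst_psnd)
    consider "k = 0" "pfst c \<le> 3" | "k = 0" "pfst c = 4" | "k = 0" "pfst c = 5" | "k = 0" "pfst c = 6"
      | "k = 0" "pfst c = 7" | "k = 0" "pfst c = 8" | "k = 1" | "k = 2" | "k = 3"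
      using I unfolding p evI_def Let_def by simp linarith
    then show ?thesis
      by cases (use I c1[of c] n1[of n] in \<open>auto simp: p f_def evI_def evA_def evB_def Let_def\<close>)
  qed
  ultimately show ?thesis
    by (rule_tac wf_subset[of "inv_image ?r f"]) (auto simp: rule_rel_def)
qed

end

lemma goedel_tag_iff:
  "goedel g = pe 0 r \<longleftrightarrow> g = Zer \<and> r = 0" "goedel g = pe (Suc 0) r \<longleftrightarrow> g = Succ \<and> r = 0"
  "goedel g = pe 2 r \<longleftrightarrow> g = Fst \<and> r = 0" "goedel g = pe 3 r \<longleftrightarrow> g = Snd \<and> r = 0"
  "goedel g = pe 4 r \<longleftrightarrow> g = Oracle \<and> r = 0"
  "goedel g = pe 5 r \<longleftrightarrow> (\<exists>c d. g = Pairing c d \<and> goedel c = pfst r \<and> goedel d = psnd r)"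
  "goedel g = pe 6 r \<longleftrightarrow> (\<exists>c d. g = Comp c d \<and> goedel c = pfst r \<and> goedel d = psnd r)"
  "goedel g = pe 7 r \<longleftrightarrow> (\<exists>c d. g = Prec c d \<and> goedel c = pfst r \<and> goedel d = psnd r)"
  "goedel g = pe 8 r \<longleftrightarrow> (\<exists>c. g = Mu c \<and> goedel c = r)"
  "8 < t \<Longrightarrow> goedel g \<noteq> pe t r"
  by (cases g; auto simp: pe_eq_iff)+

lemma eval_iffs:
  "eval X Zer n y \<longleftrightarrow> y = 0" "eval X Succ n y \<longleftrightarrow> y = Suc n" "eval X Fst n y \<longleftrightarrow> y = pfst n"
  "eval X Snd n y \<longleftrightarrow> y = psnd n" "eval X Oracle n y \<longleftrightarrow> y = of_bool (n \<in> X)"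
  "eval X (Pairing c d) n y \<longleftrightarrow> eval X c n (pfst y) \<and> eval X d n (psnd y)"
  "eval X (Comp c d) n y \<longleftrightarrow> (\<exists>v. eval X d n v \<and> eval X c v y)"
  "eval X (Prec c d) (pe m 0) y \<longleftrightarrow> eval X c m y"
  "eval X (Prec c d) (pe m (Suc k)) y \<longleftrightarrow>
     (\<exists>v. eval X (Prec c d) (pe m k) v \<and> eval X d (pe m (pe k v)) y)"
  "eval X (Mu c) n y \<longleftrightarrow> eval X c (pe n y) 0 \<and> (\<forall>j<y. \<exists>v. eval X c (pe n j) (Suc v))"
proof -
  show "eval X (Pairing c d) n y \<longleftrightarrow> eval X c n (pfst y) \<and> eval X d n (psnd y)"
    by (auto elim: eval_PairingE) (metis eval.Pairing pe_pfst_psnd)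
  show "eval X Oracle n y \<longleftrightarrow> y = of_bool (n \<in> X)"
    by (rule iffI, erule eval_OracleE, simp, simp only: eval.Oracle)
  show "eval X (Prec c d) (pe m (Suc k)) y \<longleftrightarrow>
     (\<exists>v. eval X (Prec c d) (pe m k) v \<and> eval X d (pe m (pe k v)) y)"
    by (rule iffI, erule eval_PrecE) (auto intro: eval.Prec_Suc)
qed (auto elim: eval_ZerE eval_SuccE eval_FstE eval_SndE eval_OracleE eval_CompE eval_PrecE eval_MuE
      intro: eval.intros eval_Fst eval_Snd)

text \<open>Evaluation at a level needs the jumps below it, and the jump at \<open>b\<close> needs
  evaluation at level \<open>Suc b\<close>. So \<open>E\<close>, an induction on program codes,
  takes the jumps below as an assumption, and \<open>JH\<close> discharges it by induction along the
  order.\<close>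

lemma ebp_eval_jump:
  assumes R: "computable_wellorder R" and H: "jump_hierarchy R H"
  shows "ebp (\<lambda>z. \<exists>g. goedel g = pfst z \<and> eval (effective_join (Field R) H) g (pfst (psnd z)) (psnd (psnd z)))"
proof -
  have WO: "Well_order R" and Rrec: "recp (\<lambda>n. n \<in> prod_encode ` R)"
    using R by (simp_all add: computable_wellorder_def computable_iff_recp)
  have wf: "wf (R - Id)" using WO by (simp add: well_order_on_def)
  have Field: "b \<in> Field R \<longleftrightarrow> (b, b) \<in> R" for b
    using WO by (auto simp: order_on_defs refl_on_def Field_def)
  have inR: "pe a b \<in> prod_encode ` R \<longleftrightarrow> (a, b) \<in> R" for a b
    by (auto simp: inj_image_mem_iff[OF inj_prod_encode[of UNIV]])
  define below where "below a b \<longleftrightarrow> (if a = 0 then pe b b \<in> prod_encode ` R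
      else b \<noteq> a - 1 \<and> pe b (a - 1) \<in> prod_encode ` R)" for a b
  have below0: "below 0 b \<longleftrightarrow> b \<in> Field R" and belowS: "below (Suc a) b \<longleftrightarrow> b \<in> underS R a" for a b
    by (auto simp: below_def inR Field underS_def)
  note [rec_intros] = recp_comp[OF Rrec]
  have "rec2 below"
  proof -
    have "rec2 (\<lambda>a b. (a = 0 \<and> pe b b \<in> prod_encode ` R) \<or> (a \<noteq> 0 \<and> b \<noteq> a - 1 \<and> pe b (a - 1) \<in> prod_encode ` R))"
      unfolding rec2_def by (intro rec_intros)
    moreover have "below = (\<lambda>a b. (a = 0 \<and> pe b b \<in> prod_encode ` R) \<or> (a \<noteq> 0 \<and> b \<noteq> a - 1 \<and> pe b (a - 1) \<in> prod_encode ` R))"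
      by (intro ext) (simp add: below_def)
    ultimately show ?thesis by simp
  qed
  have "wf {(Suc b, a) | b a. below a b}"
  proof -
    let ?r = "{(Suc b, a) | b a. below a b}"
    have S: "Suc a \<in> Wellfounded.acc ?r" for a
    proof (induction a rule: wf_induct_rule[OF wf])
      case (1 a)
      then show ?case by - (rule accI, auto simp: belowS underS_def)
    qed
    have "0 \<in> Wellfounded.acc ?r" by (rule accI) (use S in auto)
    then have "a \<in> Wellfounded.acc ?r" for a using S by (cases a) auto
    then show ?thesis by (simp add: wf_iff_acc)
  qed
  from wf_ev[OF this] have wfr: "wf (rule_rel (evI below) (evA below) evB)" .
  define T where "T = rule_holds (evI below) (evA below) evB"
  have ebT: "ebp T" unfolding T_def by (rule ebp_rule_holds[OF ev_recfn[OF \<open>rec2 below\<close>] wfr])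
  note T_iff = rule_holds_iff[OF wfr, folded T_def]
  have dead: "\<not> T (pe 4 x)" for x
    by (subst T_iff) (simp add: evI_simps)
  note evI_simps = evI_simps[unfolded One_nat_def]
  have half: "Suc (2 * n) div 2 = n" for n :: nat by simp
  have V_small: "T (Vp a (pe t r)) \<longleftrightarrow> r = 0" if "t \<le> 4" for a t r
    using that by (subst T_iff) (simp add: evI_simps evA_def evB_def dead half)
  have V_mid: "T (Vp a (pe t r)) \<longleftrightarrow> T (Vp a (pfst r)) \<and> T (Vp a (psnd r))" if "5 \<le> t" "t < 8" for a t r
    using that by (subst T_iff) (simp add: evI_simps evA_def evB_def)
  have V8: "T (Vp a (pe 8 r)) \<longleftrightarrow> T (Vp a r)" for a r
    by (subst T_iff) (simp add: evI_simps evA_def evB_def)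
  have V_big: "\<not> T (Vp a (pe t r))" if "8 < t" for a t r
    using that by (subst T_iff) (simp add: evI_simps)
  have V: "T (Vp a c) \<longleftrightarrow> (\<exists>g. goedel g = c)" for a c
  proof (induction c rule: less_induct)
    case (less c)
    obtain t r where c: "c = pe t r" by (metis pe_pfst_psnd)
    have small: "pfst r < c" "psnd r < c" "r < c" if "0 < t"
      using less_pe_2[OF that, of r] pfst_le[of r] psnd_le[of r] c by auto
    consider "t = 0 \<or> t = 1 \<or> t = 2 \<or> t = 3 \<or> t = 4" | "t = 5 \<or> t = 6 \<or> t = 7" | "t = 8" | "8 < t" by linarith
    then show ?case
    proof cases
      case 1
      then show ?thesis unfolding c by (subst V_small) (auto simp: goedel_tag_iff)
    next
      case 2
      then show ?thesis
        using less[OF small(1)] less[OF small(2)] unfolding c by (subst V_mid) (auto simp: goedel_tag_iff)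
    next
      case 3
      then show ?thesis
        using less[OF small(3)] unfolding c by (auto simp: goedel_tag_iff V8[unfolded One_nat_def])
    next
      case 4
      then show ?thesis unfolding c using V_big goedel_tag_iff(10) by blast
    qed
  qed
  define Or where "Or a = effective_join {b. below a b} H" for a
  define G where "G a c n y \<longleftrightarrow> (\<exists>g. goedel g = c \<and> eval (Or a) g n y)" for a c n y
  have G5: "G a (pe 5 r) n y \<longleftrightarrow> G a (pfst r) n (pfst y) \<and> G a (psnd r) n (psnd y)" for a r n y
  proof -
    have "G a (pe 5 r) n y \<longleftrightarrow> (\<exists>c d. goedel c = pfst r \<and> goedel d = psnd r \<and> eval (Or a) (Pairing c d) n y)"
      unfolding G_def goedel_tag_iff by blast
    then show ?thesis unfolding eval_iffs G_def by blast
  qed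
  have G6: "G a (pe 6 r) n y \<longleftrightarrow> (\<exists>v. G a (psnd r) n v \<and> G a (pfst r) v y)" for a r n y
  proof -
    have "G a (pe 6 r) n y \<longleftrightarrow> (\<exists>c d. goedel c = pfst r \<and> goedel d = psnd r \<and> eval (Or a) (Comp c d) n y)"
      unfolding G_def goedel_tag_iff by blast
    then show ?thesis unfolding eval_iffs G_def by blast
  qed
  have G7: "G a (pe 7 r) n y \<longleftrightarrow> (\<exists>c d. goedel c = pfst r \<and> goedel d = psnd r \<and> eval (Or a) (Prec c d) n y)" for a r n y
    unfolding G_def goedel_tag_iff by blast
  have G7S: "G a (pe 7 r) (pe m (Suc k)) y \<longleftrightarrow> (\<exists>v. G a (pe 7 r) (pe m k) v \<and> G a (psnd r) (pe m (pe k v)) y)" for a r m k y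
    unfolding G7 eval_iffs unfolding G_def by (metis goedel_inject)
  have G8: "G a (pe 8 r) n y \<longleftrightarrow> G a r (pe n y) 0 \<and> (\<forall>j<y. \<exists>w. G a r (pe n j) (Suc w))" for a r n y
  proof -
    have "G a (pe 8 r) n y \<longleftrightarrow> (\<exists>c. goedel c = r \<and> eval (Or a) (Mu c) n y)"
      unfolding G_def goedel_tag_iff by blast
    then show ?thesis unfolding eval_iffs G_def by (metis goedel_inject)
  qed
  have E03: "T (Ep a (pe t r) n y) \<longleftrightarrow> r = 0 \<and> (t = 0 \<and> y = 0 \<or> t = 1 \<and> y = Suc n \<or> t = 2 \<and> y = pfst n \<or> t = 3 \<and> y = psnd n)"
    if "t \<le> 3" for a t r n y
    using that by (subst T_iff) (auto simp: evI_simps evA_def evB_def dead half)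
  have E4: "T (Ep a (pe 4 r) n y) \<longleftrightarrow> r = 0 \<and> (if below a (pfst n) then y = of_bool (T (Jp (pfst n) (psnd n))) else y = 0)"
    for a r n y
    by (subst T_iff) (auto simp: evI_simps evA_def evB_def dead half)
  have E5: "T (Ep a (pe 5 r) n y) \<longleftrightarrow> T (Ep a (pfst r) n (pfst y)) \<and> T (Ep a (psnd r) n (psnd y))" for a r n y
    by (subst T_iff) (simp add: evI_simps evA_def evB_def)
  have E6: "T (Ep a (pe 6 r) n y) \<longleftrightarrow> (\<exists>w. T (Ep a (psnd r) n w) \<and> T (Ep a (pfst r) w y))" for a r n y
    by (subst T_iff) (simp add: evI_simps evA_def evB_def)
  have E7: "T (Ep a (pe 7 r) (pe m 0) y) \<longleftrightarrow> T (Ep a (pfst r) m y) \<and> T (Vp a (psnd r))" for a r m y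
    by (subst T_iff) (simp add: evI_simps evA_def evB_def)
  have E7S: "T (Ep a (pe 7 r) (pe m (Suc k)) y) \<longleftrightarrow> (\<exists>w. T (Ep a (pe 7 r) (pe m k) w) \<and> T (Ep a (psnd r) (pe m (pe k w)) y))" for a r m k y
    by (subst T_iff) (simp add: evI_simps evA_def evB_def)
  have E8: "T (Ep a (pe 8 r) n y) \<longleftrightarrow> T (Ep a r (pe n y) 0) \<and> T (Mp a r n y)" for a r n y
    by (subst T_iff) (simp add: evI_simps evA_def evB_def)
  have E_big: "\<not> T (Ep a (pe t r) n y)" if "8 < t" for a t r n y
    using that by (subst T_iff) (simp add: evI_simps)
  have M0: "T (Mp a c n 0)" for a c n
    by (subst T_iff) (simp add: evI_simps evA_def evB_def dead half)
  have MS: "T (Mp a c n (Suc m)) \<longleftrightarrow> (\<exists>w. T (Ep a c (pe n m) (Suc w))) \<and> T (Mp a c n m)" for a c n m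
    by (subst T_iff) (simp add: evI_simps evA_def evB_def)
  have M: "T (Mp a c n m) \<longleftrightarrow> (\<forall>j<m. \<exists>w. T (Ep a c (pe n j) (Suc w)))" for a c n m
    by (induction m) (auto simp: M0 MS less_Suc_eq)
  have J: "T (Jp b x) \<longleftrightarrow> (\<exists>w. T (Ep (Suc b) x x w))" for b x
    by (subst T_iff) (simp add: evI_simps evA_def evB_def)
  have E: "T (Ep a c n y) \<longleftrightarrow> G a c n y" if Jb: "\<And>b x. below a b \<Longrightarrow> T (Jp b x) \<longleftrightarrow> x \<in> H b" for a c n y
  proof (induction c arbitrary: n y rule: less_induct)
    case (less c)
    obtain t r where c: "c = pe t r" by (metis pe_pfst_psnd)
    have small: "pfst r < c" "psnd r < c" "r < c" if "0 < t"
      using less_pe_2[OF that, of r] pfst_le[of r] psnd_le[of r] c by auto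
    consider "t = 0 \<or> t = 1 \<or> t = 2 \<or> t = 3" | "t = 4" | "t = 5" | "t = 6" | "t = 7" | "t = 8" | "8 < t" by linarith
    then show ?case
    proof cases
      case 1
      then show ?thesis unfolding c G_def by (subst E03) (auto simp: goedel_tag_iff eval_iffs)
    next
      case 2
      have "n \<in> Or a \<longleftrightarrow> below a (pfst n) \<and> psnd n \<in> H (pfst n)"
        by (auto simp: Or_def effective_join_def) (metis pe_pfst_psnd)
      then show ?thesis unfolding c G_def using 2 Jb
        by (auto simp: goedel_tag_iff eval_iffs E4)
    next
      case 3
      then show ?thesis using less[OF small(1)] less[OF small(2)] by (simp add: c E5 G5)
    next
      case 4
      then show ?thesis using less[OF small(1)] less[OF small(2)] by (simp add: c E6 G6)
    next
      case 5
      have sm: "pfst r < c" "psnd r < c" using small 5 by auto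
      \<comment> \<open>A recursion refers to itself with the same code, so a second induction, on
        the recursion argument, runs inside the one on codes.\<close>
      have "T (Ep a (pe 7 r) (pe m k) y) \<longleftrightarrow> G a (pe 7 r) (pe m k) y" for m k y
      proof (induction k arbitrary: y)
        case 0
        show ?case unfolding E7 less[OF sm(1)] V G7 eval_iffs unfolding G_def by blast
      next
        case (Suc k)
        show ?case unfolding E7S G7S Suc less[OF sm(2)] ..
      qed
      then show ?thesis using 5 c by (metis pe_pfst_psnd)
    next
      case 6
      then show ?thesis using less[OF small(3)] by (simp add: c E8 M G8)
    next
      case 7
      then show ?thesis unfolding c G_def using E_big goedel_tag_iff(10) by blast
    qed
  qed
  have JH: "b \<in> Field R \<longrightarrow> (\<forall>x. T (Jp b x) \<longleftrightarrow> x \<in> H b)" for b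
  proof (induction b rule: wf_induct_rule[OF wf])
    case (1 b)
    show ?case
    proof (intro impI allI)
      fix x assume b: "b \<in> Field R"
      have "T (Ep (Suc b) c n y) \<longleftrightarrow> G (Suc b) c n y" for c n y
        by (rule E) (use 1 in \<open>auto simp: belowS underS_def Field_def\<close>)
      then have "T (Jp b x) \<longleftrightarrow> (\<exists>w. G (Suc b) x x w)" by (simp add: J)
      also have "\<dots> \<longleftrightarrow> x \<in> turing_jump (effective_join (underS R b) H)"
      proof -
        have "Or (Suc b) = effective_join (underS R b) H" by (simp add: Or_def belowS)
        then show ?thesis unfolding G_def turing_jump_def by auto
      qed
      also have "\<dots> \<longleftrightarrow> x \<in> H b" using H b by (simp add: jump_hierarchy_def)
      finally show "T (Jp b x) \<longleftrightarrow> x \<in> H b" .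
    qed
  qed
  have "T (Ep 0 c n y) \<longleftrightarrow> G 0 c n y" for c n y
    by (rule E) (use JH below0 in auto)
  moreover have "Or 0 = effective_join (Field R) H" by (simp add: Or_def below0)
  ultimately have TG: "T (Ep 0 c n y) \<longleftrightarrow> (\<exists>g. goedel g = c \<and> eval (effective_join (Field R) H) g n y)" for c n y
    by (simp add: G_def)
  have "recfn (\<lambda>z. Ep 0 (pfst z) (pfst (psnd z)) (psnd (psnd z)))" by (intro rec_intros)
  from ebp_comp[OF ebT this] show ?thesis unfolding TG .
qed

lemma HYP_imp_ebp:
  assumes "Y \<in> HYP" shows "ebp (\<lambda>n. n \<in> Y)"
proof -
  obtain R H c where R: "computable_wellorder R" and H: "jump_hierarchy R H"
    and c: "\<And>n. eval (effective_join (Field R) H) c n (of_bool (n \<in> Y))"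
    using assms unfolding HYP_def turing_le_def by blast
  let ?O = "effective_join (Field R) H"
  have "recfn (\<lambda>n. pe (goedel c) (pe n 1))" by (intro rec_intros)
  from ebp_comp[OF ebp_eval_jump[OF R H] this]
  have e: "ebp (\<lambda>n. \<exists>g. goedel g = goedel c \<and> eval ?O g n 1)" by simp
  show ?thesis
  proof (rule ebp_cong[OF _ e])
    fix n
    have "eval ?O c n 1 \<longleftrightarrow> n \<in> Y" using c[of n] eval_deterministic by (cases "n \<in> Y") fastforce+
    then show "n \<in> Y \<longleftrightarrow> (\<exists>g. goedel g = goedel c \<and> eval ?O g n 1)" using goedel_inject by auto
  qed
qed

text \<open>Along the empty order the join of the hierarchy is the empty set. This instance is a
  universal evaluation predicate, used later to list the computable orders by index.\<close>

lemma ebp_eval: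
  "ebp (\<lambda>z. \<exists>g. goedel g = pfst z \<and> eval {} g (pfst (psnd z)) (psnd (psnd z)))"
proof -
  have "computable_wellorder {}"
    by (simp add: computable_wellorder_def computable_iff_recp recp_const)
  moreover have "jump_hierarchy {} (\<lambda>_. {})" by (simp add: jump_hierarchy_def)
  moreover have "effective_join {} (\<lambda>_. {}) = {}" by (simp add: effective_join_def)
  ultimately show ?thesis using ebp_eval_jump[of "{}" "\<lambda>_. {}"] by simp
qed

theorem HYP_iff_ebp: "Y \<in> HYP \<longleftrightarrow> ebp (\<lambda>n. n \<in> Y)"
  using HYP_imp_ebp ebp_in_HYP[of "\<lambda>n. n \<in> Y"] by auto

section \<open>Definability over transitive sets\<close>

lemma elts_induct [case_names step]:
  assumes "\<And>x. (\<And>y. y \<in> elts x \<Longrightarrow> P y) \<Longrightarrow> P x" shows "P (x :: hc)"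
proof (induction x)
  case (HC A)
  show ?case by (rule assms) (use HC in \<open>auto simp: elts_def\<close>)
qed

lemma elts_irrefl: "x \<notin> elts x"
  by (induction x rule: elts_induct) blast

lemma elts_asym: "x \<in> elts y \<Longrightarrow> y \<notin> elts x"
proof (induction x arbitrary: y rule: elts_induct)
  case (step x) then show ?case by blast
qed

definition hcset :: "hc set \<Rightarrow> hc" where "hcset S = HC (acset S)"

lemma elts_hcset: "countable S \<Longrightarrow> elts (hcset S) = S"
  by (simp add: hcset_def)

text \<open>With functions as environments there are no length conditions and quantifiers shift by
  \<open>case_nat\<close>; \<open>satsf_cong\<close> recovers that only finitely many entries
  matter.\<close>

primrec satsf :: "hc set \<Rightarrow> (nat \<Rightarrow> hc) \<Rightarrow> fm \<Rightarrow> bool" where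
  "satsf M e (Mem i j) \<longleftrightarrow> e i \<in> elts (e j)"
| "satsf M e (Equ i j) \<longleftrightarrow> e i = e j"
| "satsf M e (Neg p) \<longleftrightarrow> \<not> satsf M e p"
| "satsf M e (Conj p q) \<longleftrightarrow> satsf M e p \<and> satsf M e q"
| "satsf M e (Exi p) \<longleftrightarrow> (\<exists>x \<in> M. satsf M (case_nat x e) p)"

lemma nth_Cons_case_nat: "(!) (x # env) = case_nat x ((!) env)"
  by (auto split: nat.split)

lemma sats_eq_satsf: "sats M env p = satsf M ((!) env) p"
  by (induction p arbitrary: env) (simp_all add: nth_Cons_case_nat)

lemma satsf_cong: "(\<And>i. i < arity p \<Longrightarrow> e i = e' i) \<Longrightarrow> satsf M e p = satsf M e' p"
proof (induction p arbitrary: e e')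
  case (Exi p)
  have "satsf M (case_nat x e) p = satsf M (case_nat x e') p" for x
    by (rule Exi.IH) (use Exi.prems in \<open>auto split: nat.split\<close>)
  then show ?case by simp
next
  case (Conj p q)
  then show ?case by (metis arity.simps(4) less_max_iff_disj satsf.simps(4))
next
  case (Neg p)
  then show ?case by (metis arity.simps(3) satsf.simps(3))
qed simp_all

primrec rename_fm :: "(nat \<Rightarrow> nat) \<Rightarrow> fm \<Rightarrow> fm" where
  "rename_fm f (Mem i j) = Mem (f i) (f j)"
| "rename_fm f (Equ i j) = Equ (f i) (f j)"
| "rename_fm f (Neg p) = Neg (rename_fm f p)"
| "rename_fm f (Conj p q) = Conj (rename_fm f p) (rename_fm f q)"
| "rename_fm f (Exi p) = Exi (rename_fm (case_nat 0 (\<lambda>i. Suc (f i))) p)"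

lemma satsf_rename: "satsf M e (rename_fm f p) = satsf M (\<lambda>i. e (f i)) p"
proof (induction p arbitrary: e f)
  case (Exi p)
  have "(\<lambda>i. case_nat x e (case_nat 0 (\<lambda>i. Suc (f i)) i)) = case_nat x (\<lambda>i. e (f i))" for x
    by (auto split: nat.split)
  then show ?case by (simp add: Exi)
qed auto

text \<open>Definability is stated for predicates on environments, so that closure rules replace the
  writing of formulas with de Bruijn indices.\<close>

definition dfb :: "hc set \<Rightarrow> ((nat \<Rightarrow> hc) \<Rightarrow> bool) \<Rightarrow> bool" where
  "dfb M P \<longleftrightarrow> (\<exists>p. \<forall>e. range e \<subseteq> M \<longrightarrow> (satsf M e p \<longleftrightarrow> P e))"

named_theorems df_intros

lemma dfb_cong: "dfb M Q \<Longrightarrow> (\<And>e. range e \<subseteq> M \<Longrightarrow> P e \<longleftrightarrow> Q e) \<Longrightarrow> dfb M P"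
  by (simp add: dfb_def)

lemma dfb_mem [df_intros]: "dfb M (\<lambda>e. e i \<in> elts (e j))"
  unfolding dfb_def by (rule exI[of _ "Mem i j"]) simp

lemma dfb_eq [df_intros]: "dfb M (\<lambda>e. e i = e j)"
  unfolding dfb_def by (rule exI[of _ "Equ i j"]) simp

lemma dfb_not [df_intros]: "dfb M P \<Longrightarrow> dfb M (\<lambda>e. \<not> P e)"
  unfolding dfb_def by (metis satsf.simps(3))

lemma dfb_conj [df_intros]: "dfb M P \<Longrightarrow> dfb M Q \<Longrightarrow> dfb M (\<lambda>e. P e \<and> Q e)"
  unfolding dfb_def by (metis satsf.simps(4))

lemma dfb_disj [df_intros]: "dfb M P \<Longrightarrow> dfb M Q \<Longrightarrow> dfb M (\<lambda>e. P e \<or> Q e)"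
  by (rule dfb_cong[where Q = "\<lambda>e. \<not> (\<not> P e \<and> \<not> Q e)"]) ((intro df_intros; assumption), blast)

lemma dfb_imp [df_intros]: "dfb M P \<Longrightarrow> dfb M Q \<Longrightarrow> dfb M (\<lambda>e. P e \<longrightarrow> Q e)"
  by (rule dfb_cong[where Q = "\<lambda>e. \<not> P e \<or> Q e"]) ((intro df_intros; assumption), blast)

lemma dfb_iff [df_intros]: "dfb M P \<Longrightarrow> dfb M Q \<Longrightarrow> dfb M (\<lambda>e. P e \<longleftrightarrow> Q e)"
  by (rule dfb_cong[where Q = "\<lambda>e. (P e \<longrightarrow> Q e) \<and> (Q e \<longrightarrow> P e)"]) ((intro df_intros; assumption), blast)

lemma dfb_ex [df_intros]:
  assumes "dfb M (\<lambda>e. P (e 0) (\<lambda>i. e (Suc i)))" shows "dfb M (\<lambda>e. \<exists>x\<in>M. P x e)"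
proof -
  obtain p where p: "\<And>e. range e \<subseteq> M \<Longrightarrow> satsf M e p \<longleftrightarrow> P (e 0) (\<lambda>i. e (Suc i))"
    using assms unfolding dfb_def by blast
  have "satsf M e (Exi p) \<longleftrightarrow> (\<exists>x\<in>M. P x e)" if "range e \<subseteq> M" for e
  proof -
    have "range (case_nat x e) \<subseteq> M" if "x \<in> M" for x
      using that \<open>range e \<subseteq> M\<close> by (simp add: image_subset_iff split: nat.split)
    then show ?thesis using p by auto
  qed
  then show ?thesis unfolding dfb_def by blast
qed

lemma dfb_all [df_intros]:
  assumes "dfb M (\<lambda>e. P (e 0) (\<lambda>i. e (Suc i)))" shows "dfb M (\<lambda>e. \<forall>x\<in>M. P x e)"
  by (rule dfb_cong[where Q = "\<lambda>e. \<not> (\<exists>x\<in>M. \<not> P x e)"]) (intro df_intros assms, blast)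

lemma dfb_rename: "dfb M P \<Longrightarrow> dfb M (\<lambda>e. P (\<lambda>i. e (f i)))"
proof -
  assume "dfb M P"
  then obtain p where p: "\<And>e. range e \<subseteq> M \<Longrightarrow> satsf M e p \<longleftrightarrow> P e" unfolding dfb_def by blast
  have "satsf M e (rename_fm f p) \<longleftrightarrow> P (\<lambda>i. e (f i))" if "range e \<subseteq> M" for e
    using p[of "\<lambda>i. e (f i)"] that by (auto simp: satsf_rename)
  then show ?thesis unfolding dfb_def by blast
qed

lemma DPow_iff:
  "x \<in> DPow M \<longleftrightarrow> (\<exists>p ps. set ps \<subseteq> M \<and> arity p \<le> Suc (length ps) \<and>
     elts x = {y \<in> M. satsf M (case_nat y ((!) ps)) p})"
  unfolding DPow_def defined_by_def by (simp add: sats_eq_satsf nth_Cons_case_nat)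

lemma DPow_satsfI:
  assumes "\<And>i. Suc i < arity p \<Longrightarrow> e i \<in> M" "elts x = {y \<in> M. satsf M (case_nat y e) p}"
  shows "x \<in> DPow M"
proof -
  let ?ps = "map e [0..<arity p - 1]"
  have "satsf M (case_nat y ((!) ?ps)) p = satsf M (case_nat y e) p" for y
    by (rule satsf_cong) (auto split: nat.splits)
  then show ?thesis unfolding DPow_iff using assms
    by (intro exI[of _ p] exI[of _ ?ps]) auto
qed

lemma DPow_dfbI:
  assumes "dfb M P" "range e \<subseteq> M" "elts x = {y \<in> M. P (case_nat y e)}"
  shows "x \<in> DPow M"
proof -
  obtain p where p: "\<And>e. range e \<subseteq> M \<Longrightarrow> satsf M e p \<longleftrightarrow> P e" using assms(1) unfolding dfb_def by blast
  have "range (case_nat y e) \<subseteq> M" if "y \<in> M" for y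
    using that assms(2) by (simp add: image_subset_iff split: nat.split)
  then show ?thesis
    by (intro DPow_satsfI[of p e]) (use assms p in auto)
qed

lemma DPow_subset: "x \<in> DPow M \<Longrightarrow> elts x \<subseteq> M"
  by (auto simp: DPow_iff)

lemma empty_in_DPow: "elts x = {} \<Longrightarrow> x \<in> DPow M"
  by (rule DPow_satsfI[of "Conj (Mem 0 0) (Neg (Mem 0 0))" "\<lambda>_. x"]) auto

definition transM :: "hc set \<Rightarrow> bool" where "transM M \<longleftrightarrow> (\<forall>y\<in>M. elts y \<subseteq> M)"

lemma transM_subset_DPow: assumes "transM M" shows "M \<subseteq> DPow M"
proof
  fix x assume x: "x \<in> M"
  show "x \<in> DPow M"
    by (rule DPow_satsfI[of "Mem 0 1" "\<lambda>_. x"]) (use x assms in \<open>auto simp: transM_def\<close>)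
qed

lemma finite_in_DPow:
  assumes "finite (elts x)" "elts x \<subseteq> M" shows "x \<in> DPow M"
proof (cases "elts x = {}")
  case True then show ?thesis by (rule empty_in_DPow)
next
  case False
  obtain xs where xs: "set xs = elts x" using assms(1) finite_list by blast
  \<comment> \<open>Beyond the list the parameters repeat an element of \<open>x\<close>, so the
    whole environment stays inside \<open>M\<close>.\<close>
  define e where "e i = (if i < length xs then xs ! i else hd xs)" for i
  have "xs \<noteq> []" using False xs by auto
  then have e: "range e \<subseteq> M" using xs assms(2) by (auto simp: e_def)
  have "dfb M (\<lambda>e. \<exists>i<k. e 0 = e (Suc i))" for k
  proof (induction k)
    case 0 then show ?case using dfb_not[OF dfb_eq[of M 0 0]] by simp
  next
    case (Suc k)
    show ?case
      by (rule dfb_cong[OF dfb_disj[OF Suc dfb_eq[of M 0 "Suc k"]]]) (auto simp: less_Suc_eq)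
  qed
  moreover have "(\<exists>i<length xs. y = e i) \<longleftrightarrow> y \<in> elts x" for y
    by (auto simp: e_def xs[symmetric] in_set_conv_nth)
  then have "elts x = {y \<in> M. \<exists>i<length xs. case_nat y e 0 = case_nat y e (Suc i)}"
    using assms(2) by auto
  ultimately show ?thesis by (rule DPow_dfbI[OF _ e])
qed

lemma transM_Lset: "transM (Lset x)"
proof (induction x rule: elts_induct)
  case (step x)
  show ?case
    unfolding transM_def
  proof
    fix y assume "y \<in> Lset x"
    then obtain z where z: "z \<in> elts x" "y \<in> DPow (Lset z)" by (auto simp: Lset_eq[of x])
    then have "elts y \<subseteq> Lset z" by (simp add: DPow_subset)
    also have "\<dots> \<subseteq> DPow (Lset z)" using step z transM_subset_DPow by blast
    also have "\<dots> \<subseteq> Lset x" using z by (auto simp: Lset_eq[of x])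
    finally show "elts y \<subseteq> Lset x" .
  qed
qed

lemma DPow_subset_Lset: "z \<in> elts x \<Longrightarrow> DPow (Lset z) \<subseteq> Lset x"
  by (auto simp: Lset_eq[of x])

lemma Lset_mono_mem: "z \<in> elts x \<Longrightarrow> Lset z \<subseteq> Lset x"
  using transM_subset_DPow[OF transM_Lset] DPow_subset_Lset by blast

lemma Lset_mono: "elts z \<subseteq> elts x \<Longrightarrow> Lset z \<subseteq> Lset x"
  by (auto simp: Lset_eq[of x] Lset_eq[of z])

subsection \<open>Natural numbers\<close>

lemma elts_hc_of_nat: "elts (hc_of_nat n) = hc_of_nat ` {..<n}"
proof (induction n)
  case 0 then show ?case by (simp add: elts_def bot_cset.rep_eq)
next
  case (Suc n)
  have "elts (hc_of_nat (Suc n)) = insert (hc_of_nat n) (elts (hc_of_nat n))"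
    by (simp add: elts_def cinsert.rep_eq)
  then show ?case using Suc by (auto simp: lessThan_Suc)
qed

declare hc_of_nat.simps [simp del]

lemma hc_of_nat_inject [simp]: "hc_of_nat m = hc_of_nat n \<longleftrightarrow> m = n"
proof -
  have "m < n \<Longrightarrow> hc_of_nat m \<noteq> hc_of_nat n" for m n
    using elts_irrefl elts_hc_of_nat by (metis image_eqI lessThan_iff)
  then show ?thesis by (metis nat_neq_iff)
qed

lemma elts_hc_of_nat_set: "elts (hc_of_nat_set X) = hc_of_nat ` X"
  by (simp add: hc_of_nat_set_def countable_image)

lemma inj_hc_of_nat: "inj hc_of_nat" by (simp add: inj_def)

lemma hc_of_nat_set_inject: "hc_of_nat_set X = hc_of_nat_set Y \<longleftrightarrow> X = Y"
  by (metis elts_hc_of_nat_set inj_hc_of_nat inj_image_eq_iff)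

definition Lomega :: "hc set" where "Lomega = (\<Union>n. Lset (hc_of_nat n))"

lemma finite_in_Lomega:
  assumes "finite (elts x)" "elts x \<subseteq> Lomega" shows "x \<in> Lomega"
proof -
  have mono: "m \<le> n \<Longrightarrow> Lset (hc_of_nat m) \<subseteq> Lset (hc_of_nat n)" for m n
    by (rule Lset_mono) (auto simp: elts_hc_of_nat)
  have "\<exists>n. elts x \<subseteq> Lset (hc_of_nat n)"
    using assms
  proof (induction "elts x" arbitrary: x rule: finite_induct)
    case (insert y F)
    have "elts (hcset F) = F" using insert.hyps(1) by (simp add: elts_hcset countable_finite)
    then obtain n where n: "F \<subseteq> Lset (hc_of_nat n)" using insert by (metis insert_subset)
    obtain m where "y \<in> Lset (hc_of_nat m)" using insert by (auto simp: Lomega_def)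
    then have "elts x \<subseteq> Lset (hc_of_nat (max m n))"
      unfolding insert.hyps(4)[symmetric] using n mono[of m "max m n"] mono[of n "max m n"] by auto
    then show ?case by blast
  qed auto
  then obtain n where "elts x \<subseteq> Lset (hc_of_nat n)" by blast
  then have "x \<in> DPow (Lset (hc_of_nat n))" using finite_in_DPow assms(1) by blast
  also have "\<dots> \<subseteq> Lset (hc_of_nat (Suc n))" by (rule DPow_subset_Lset) (simp only: elts_hc_of_nat, auto)
  finally show ?thesis by (auto simp: Lomega_def)
qed

lemma hc_of_nat_in_Lomega: "hc_of_nat n \<in> Lomega"
  by (induction n rule: less_induct) (rule finite_in_Lomega, auto simp: elts_hc_of_nat)

definition hpair :: "hc \<Rightarrow> hc \<Rightarrow> hc" where
  "hpair x y = hcset {hcset {x}, hcset {x, y}}"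

lemma elts_hcset_finite [simp]: "finite S \<Longrightarrow> elts (hcset S) = S"
  by (simp add: elts_hcset countable_finite)

lemma hcset_inject_finite: "finite S \<Longrightarrow> finite T \<Longrightarrow> hcset S = hcset T \<longleftrightarrow> S = T"
  by (metis elts_hcset_finite)

lemma hpair_inject: "hpair x y = hpair u v \<longleftrightarrow> x = u \<and> y = v"
  by (auto simp: hpair_def hcset_inject_finite doubleton_eq_iff)

lemma hpair_in_Lomega: "x \<in> Lomega \<Longrightarrow> y \<in> Lomega \<Longrightarrow> hpair x y \<in> Lomega"
proof -
  assume "x \<in> Lomega" "y \<in> Lomega"
  then have "hcset {x} \<in> Lomega" "hcset {x, y} \<in> Lomega" by (auto intro: finite_in_Lomega)
  then show ?thesis unfolding hpair_def by (auto intro: finite_in_Lomega)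
qed

text \<open>The hereditarily finite sets include all finite relations between naturals, so
  recursions have witnesses in \<open>M\<close> and arithmetic is definable over \<open>M\<close>,
  even when \<omega> is not an element of it.\<close>

locale goodM =
  fixes M :: "hc set"
  assumes trans: "transM M" and Lomega: "Lomega \<subseteq> M"
begin

abbreviation N :: "hc set" where "N \<equiv> range hc_of_nat"

lemma N_subset: "N \<subseteq> M" using Lomega hc_of_nat_in_Lomega by blast

lemma hn_M [simp]: "hc_of_nat n \<in> M" using N_subset by blast

lemma elts_M: "x \<in> M \<Longrightarrow> y \<in> elts x \<Longrightarrow> y \<in> M" using trans by (auto simp: transM_def)

definition emptyM :: "hc \<Rightarrow> bool" where "emptyM z \<longleftrightarrow> \<not> (\<exists>u\<in>M. u \<in> elts z)"
definition succM :: "hc \<Rightarrow> hc \<Rightarrow> bool" where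
  "succM z y \<longleftrightarrow> z \<in> elts y \<and> (\<forall>u\<in>M. u \<in> elts y \<longleftrightarrow> u \<in> elts z \<or> u = z)"
definition tranM :: "hc \<Rightarrow> bool" where
  "tranM x \<longleftrightarrow> (\<forall>y\<in>M. y \<in> elts x \<longrightarrow> (\<forall>u\<in>M. u \<in> elts y \<longrightarrow> u \<in> elts x))"
definition natM :: "hc \<Rightarrow> bool" where
  "natM x \<longleftrightarrow> tranM x \<and> (emptyM x \<or> (\<exists>z\<in>M. succM z x)) \<and>
     (\<forall>y\<in>M. y \<in> elts x \<longrightarrow> tranM y \<and> (emptyM y \<or> (\<exists>z\<in>M. succM z y)))"

lemma emptyM_iff: assumes "x \<in> M" shows "emptyM x \<longleftrightarrow> x = hc_of_nat 0"
proof -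
  have "emptyM x \<longleftrightarrow> elts x = {}" using elts_M[OF assms] by (auto simp: emptyM_def)
  also have "\<dots> \<longleftrightarrow> x = hc_of_nat 0" using hc_eqI[of x "hc_of_nat 0"] by (auto simp: elts_hc_of_nat)
  finally show ?thesis .
qed

lemma succM_nat: "y \<in> M \<Longrightarrow> succM (hc_of_nat n) y \<longleftrightarrow> y = hc_of_nat (Suc n)"
proof
  assume y: "y \<in> M" "succM (hc_of_nat n) y"
  have "u \<in> elts y \<longleftrightarrow> u \<in> elts (hc_of_nat (Suc n))" for u
  proof -
    have "u \<in> elts (hc_of_nat (Suc n)) \<longleftrightarrow> u \<in> elts (hc_of_nat n) \<or> u = hc_of_nat n"
      by (auto simp: elts_hc_of_nat lessThan_Suc)
    then show ?thesis
      using y elts_M[OF y(1), of u] elts_M[OF hn_M, of u "Suc n"] unfolding succM_def by metis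
  qed
  then have "elts y = elts (hc_of_nat (Suc n))" by blast
  then show "y = hc_of_nat (Suc n)" by (rule hc_eqI)
next
  assume y: "y = hc_of_nat (Suc n)"
  show "succM (hc_of_nat n) y"
    unfolding succM_def y elts_hc_of_nat lessThan_Suc by auto
qed

text \<open>Well-founded membership does the work: the predecessor of such a set is one of its
  elements and again such a set, so the descent ends at 0.\<close>

lemma natM_iff: "x \<in> M \<Longrightarrow> natM x \<longleftrightarrow> x \<in> N"
proof
  show "x \<in> M \<Longrightarrow> natM x \<Longrightarrow> x \<in> N"
  proof (induction x rule: elts_induct)
    case (step x)
    show ?case
    proof (cases "emptyM x")
      case True then show ?thesis using emptyM_iff step.prems by auto
    next
      case False
      then obtain z where z: "z \<in> M" "succM z x" using step.prems by (auto simp: natM_def)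
      then have zx: "z \<in> elts x" by (simp add: succM_def)
      have "natM z"
        unfolding natM_def
      proof (intro conjI ballI impI)
        show "tranM z" "emptyM z \<or> (\<exists>y\<in>M. succM y z)" using step.prems z zx by (auto simp: natM_def)
        fix y assume "y \<in> M" "y \<in> elts z"
        then have "y \<in> elts x" using step.prems(2) z(1) zx unfolding natM_def tranM_def by metis
        then show "tranM y" "emptyM y \<or> (\<exists>z\<in>M. succM z y)" using step.prems \<open>y \<in> M\<close> by (auto simp: natM_def)
      qed
      then obtain n where "z = hc_of_nat n" using step.IH[OF zx z(1)] by blast
      then show ?thesis using succM_nat step.prems z by (metis rangeI)
    qed
  qed
next
  assume "x \<in> N"
  then obtain n where n: "x = hc_of_nat n" by blast
  have t: "tranM (hc_of_nat k)" for k unfolding tranM_def elts_hc_of_nat by (auto simp: elts_hc_of_nat)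
  have s: "emptyM (hc_of_nat k) \<or> (\<exists>z\<in>M. succM z (hc_of_nat k))" for k
  proof (cases k)
    case 0 then show ?thesis using emptyM_iff[of "hc_of_nat 0"] by simp
  next
    case (Suc j) then show ?thesis using succM_nat[of "hc_of_nat k" j] hn_M by blast
  qed
  show "natM x" unfolding natM_def n using t s by (auto simp: elts_hc_of_nat)
qed

lemma dfb_empty [df_intros]: "dfb M (\<lambda>e. emptyM (e i))" unfolding emptyM_def by (intro df_intros)
lemma dfb_succ [df_intros]: "dfb M (\<lambda>e. succM (e i) (e j))" unfolding succM_def by (intro df_intros)

lemma dfb_N [df_intros]: "dfb M (\<lambda>e. e i \<in> N)"
proof -
  have "dfb M (\<lambda>e. natM (e i))" unfolding natM_def tranM_def by (intro df_intros)
  then show ?thesis by (rule dfb_cong) (use natM_iff in auto)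
qed

definition pairM :: "hc \<Rightarrow> hc \<Rightarrow> hc \<Rightarrow> bool" where
  "pairM x y s \<longleftrightarrow> (\<exists>z\<in>M. z \<in> elts s \<and> (\<exists>a\<in>M. \<exists>b\<in>M. (\<forall>u\<in>M. u \<in> elts z \<longleftrightarrow> u = a \<or> u = b) \<and>
      (\<forall>u\<in>M. u \<in> elts a \<longleftrightarrow> u = x) \<and> (\<forall>u\<in>M. u \<in> elts b \<longleftrightarrow> u = x \<or> u = y)))"

lemma dfb_pairM [df_intros]: "dfb M (\<lambda>e. pairM (e i) (e j) (e k))"
  unfolding pairM_def by (intro df_intros)

lemma pairM_iff: assumes "s \<in> M" "x \<in> M" "y \<in> M" shows "pairM x y s \<longleftrightarrow> hpair x y \<in> elts s"
proof
  assume "pairM x y s"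
  then obtain z a b where z: "z \<in> M" "z \<in> elts s" "a \<in> M" "b \<in> M" "\<forall>u\<in>M. u \<in> elts z \<longleftrightarrow> u = a \<or> u = b"
    "\<forall>u\<in>M. u \<in> elts a \<longleftrightarrow> u = x" "\<forall>u\<in>M. u \<in> elts b \<longleftrightarrow> u = x \<or> u = y"
    unfolding pairM_def by (elim bexE conjE)
  have "elts a = {x}" using z(6) elts_M[OF z(3)] assms by blast
  then have "a = hcset {x}" by (intro hc_eqI) simp
  moreover have "elts b = {x, y}" using z(7) elts_M[OF z(4)] assms by blast
  then have "b = hcset {x, y}" by (intro hc_eqI) simp
  moreover have "elts z = {a, b}" using z(3,4,5) elts_M[OF z(1)] by blast
  ultimately have "z = hpair x y" by (intro hc_eqI) (simp add: hpair_def)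
  then show "hpair x y \<in> elts s" using z by simp
next
  assume h: "hpair x y \<in> elts s"
  then have z: "hpair x y \<in> M" using assms elts_M by blast
  then have "hcset {x} \<in> M" "hcset {x, y} \<in> M" using elts_M[OF z] by (auto simp: hpair_def)
  then show "pairM x y s" unfolding pairM_def using z h
    by (intro bexI[of _ "hpair x y"] conjI bexI[of _ "hcset {x}"] bexI[of _ "hcset {x, y}"]) (auto simp: hpair_def)
qed

definition rN2 :: "(nat \<Rightarrow> nat \<Rightarrow> bool) \<Rightarrow> hc \<Rightarrow> hc \<Rightarrow> bool" where
  "rN2 G x y \<longleftrightarrow> (\<exists>a b. x = hc_of_nat a \<and> y = hc_of_nat b \<and> G a b)"
definition rN3 :: "(nat \<Rightarrow> nat \<Rightarrow> nat \<Rightarrow> bool) \<Rightarrow> hc \<Rightarrow> hc \<Rightarrow> hc \<Rightarrow> bool" where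
  "rN3 G x y z \<longleftrightarrow> (\<exists>a b c. x = hc_of_nat a \<and> y = hc_of_nat b \<and> z = hc_of_nat c \<and> G a b c)"
definition rN4 :: "(nat \<Rightarrow> nat \<Rightarrow> nat \<Rightarrow> nat \<Rightarrow> bool) \<Rightarrow> hc \<Rightarrow> hc \<Rightarrow> hc \<Rightarrow> hc \<Rightarrow> bool" where
  "rN4 G x y z u \<longleftrightarrow> (\<exists>a b c d. x = hc_of_nat a \<and> y = hc_of_nat b \<and> z = hc_of_nat c \<and> u = hc_of_nat d \<and> G a b c d)"

definition df2 :: "(nat \<Rightarrow> nat \<Rightarrow> bool) \<Rightarrow> bool" where "df2 G \<longleftrightarrow> dfb M (\<lambda>e. rN2 G (e 0) (e 1))"
definition df3 :: "(nat \<Rightarrow> nat \<Rightarrow> nat \<Rightarrow> bool) \<Rightarrow> bool" where "df3 G \<longleftrightarrow> dfb M (\<lambda>e. rN3 G (e 0) (e 1) (e 2))"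
definition df4 :: "(nat \<Rightarrow> nat \<Rightarrow> nat \<Rightarrow> nat \<Rightarrow> bool) \<Rightarrow> bool" where
  "df4 G \<longleftrightarrow> dfb M (\<lambda>e. rN4 G (e 0) (e 1) (e 2) (e 3))"

lemma df2D: "df2 G \<Longrightarrow> dfb M (\<lambda>e. rN2 G (e i) (e j))"
  unfolding df2_def by (drule dfb_rename[where f = "\<lambda>n. if n = 0 then i else j"]) simp
lemma df3D: "df3 G \<Longrightarrow> dfb M (\<lambda>e. rN3 G (e i) (e j) (e k))"
  unfolding df3_def by (drule dfb_rename[where f = "\<lambda>n. if n = 0 then i else if n = 1 then j else k"]) simp
lemma df4D: "df4 G \<Longrightarrow> dfb M (\<lambda>e. rN4 G (e i) (e j) (e k) (e l))"
  unfolding df4_def by (drule dfb_rename[where f = "\<lambda>n. if n = 0 then i else if n = 1 then j else if n = 2 then k else l"]) simp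

text \<open>A finite backward-closed set of pairs witnesses a primitive recursion.\<close>

lemma df3_rec:
  assumes G: "df2 G" and D: "df4 D"
    and R0: "\<And>n v. R n 0 v \<longleftrightarrow> G n v"
    and RS: "\<And>n k v. R n (Suc k) v \<longleftrightarrow> (\<exists>a. R n k a \<and> D n k a v)"
  shows "df3 R"
proof -
  define Q where "Q n k v s \<longleftrightarrow> n \<in> N \<and> k \<in> N \<and> v \<in> N \<and> pairM k v s \<and> (\<forall>j\<in>M. \<forall>u\<in>M. pairM j u s \<longrightarrow>
     (emptyM j \<and> rN2 G n u) \<or> (\<exists>i\<in>M. \<exists>a\<in>M. succM i j \<and> pairM i a s \<and> rN4 D n i a u))" for n k v s
  note [df_intros] = df2D[OF G] df4D[OF D]
  have "dfb M (\<lambda>e. \<exists>s\<in>M. Q (e 0) (e 1) (e 2) s)" unfolding Q_def by (intro df_intros)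
  then show ?thesis unfolding df3_def
  proof (rule dfb_cong)
    fix e :: "nat \<Rightarrow> hc" assume "range e \<subseteq> M"
    \<comment> \<open>Here \<open>s\<close> is any set in \<open>M\<close>: each of its pairs is
      justified by a pair one step earlier, so by induction on the first entry all second entries
      are correct values.\<close>
    have one: "R a b c" if s: "s \<in> M" and Q: "Q (hc_of_nat a) (hc_of_nat b) (hc_of_nat c) s" for a b c s
    proof -
      have "\<forall>u. pairM (hc_of_nat j) u s \<longrightarrow> u \<in> M \<longrightarrow> (\<exists>v. u = hc_of_nat v \<and> R a j v)" for j
      proof (induction j)
        case 0
        have "\<not> succM i (hc_of_nat 0)" for i by (simp add: succM_def elts_hc_of_nat)
        then show ?case using Q hn_M unfolding Q_def R0 rN2_def by (metis hc_of_nat_inject)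
      next
        case (Suc j)
        have ne: "\<not> emptyM (hc_of_nat (Suc j))" using emptyM_iff[OF hn_M, of "Suc j"] by simp
        have sc: "succM i (hc_of_nat (Suc j)) \<Longrightarrow> i \<in> N \<Longrightarrow> i = hc_of_nat j" for i
          using succM_nat[OF hn_M] by auto
        show ?case
        proof (intro allI impI)
          fix u assume u: "pairM (hc_of_nat (Suc j)) u s" "u \<in> M"
          then obtain i x where i: "i \<in> M" "x \<in> M" "succM i (hc_of_nat (Suc j))" "pairM i x s" "rN4 D (hc_of_nat a) i x u"
            using Q ne hn_M unfolding Q_def by blast
          then have "i = hc_of_nat j" using sc by (auto simp: rN4_def)
          then show "\<exists>v. u = hc_of_nat v \<and> R a (Suc j) v"
            using Suc i unfolding RS rN4_def by (metis hc_of_nat_inject)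
        qed
      qed
      then show ?thesis using Q unfolding Q_def by (metis hc_of_nat_inject hn_M)
    qed
    have two: "\<exists>s\<in>M. Q (hc_of_nat a) (hc_of_nat b) (hc_of_nat c) s" if "R a b c" for a b c
    proof -
      have "\<exists>f. f b = c \<and> G a (f 0) \<and> (\<forall>j<b. D a j (f j) (f (Suc j)))"
        using that
      proof (induction b arbitrary: c)
        case 0 then show ?case unfolding R0 by (intro exI[of _ "\<lambda>_. c"]) simp
      next
        case (Suc b)
        then obtain x where x: "R a b x" "D a b x c" using RS by blast
        obtain f where f: "f b = x" "G a (f 0)" "\<forall>j<b. D a j (f j) (f (Suc j))" using Suc.IH[OF x(1)] by blast
        show ?case by (rule exI[of _ "f(Suc b := c)"]) (use f x in \<open>auto simp: less_Suc_eq\<close>)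
      qed
      then obtain f where f: "f b = c" "G a (f 0)" "\<forall>j<b. D a j (f j) (f (Suc j))" by blast
      define s where "s = hcset ((\<lambda>j. hpair (hc_of_nat j) (hc_of_nat (f j))) ` {..b})"
      have es: "elts s = (\<lambda>j. hpair (hc_of_nat j) (hc_of_nat (f j))) ` {..b}" by (simp add: s_def)
      have s: "s \<in> M" using Lomega finite_in_Lomega[of s] hpair_in_Lomega hc_of_nat_in_Lomega
        unfolding es by blast
      have ps: "pairM x y s \<longleftrightarrow> (\<exists>j\<le>b. x = hc_of_nat j \<and> y = hc_of_nat (f j))" if "x \<in> M" "y \<in> M" for x y
        unfolding pairM_iff[OF s that] es by (auto simp: hpair_inject)
      have "Q (hc_of_nat a) (hc_of_nat b) (hc_of_nat c) s"
        unfolding Q_def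
      proof (intro conjI ballI impI)
        show "pairM (hc_of_nat b) (hc_of_nat c) s" using ps f(1) by auto
        fix x u assume xu: "x \<in> M" "u \<in> M" "pairM x u s"
        then obtain j where j: "j \<le> b" "x = hc_of_nat j" "u = hc_of_nat (f j)" using ps by blast
        show "emptyM x \<and> rN2 G (hc_of_nat a) u \<or>
           (\<exists>i\<in>M. \<exists>z\<in>M. succM i x \<and> pairM i z s \<and> rN4 D (hc_of_nat a) i z u)"
        proof (cases j)
          case 0
          then show ?thesis using j f(2) emptyM_iff[OF hn_M, of 0] by (auto simp: rN2_def)
        next
          case (Suc i)
          have "succM (hc_of_nat i) x" using succM_nat[OF hn_M] j Suc by simp
          moreover have "pairM (hc_of_nat i) (hc_of_nat (f i)) s" using ps j Suc by auto
          moreover have "rN4 D (hc_of_nat a) (hc_of_nat i) (hc_of_nat (f i)) u"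
            using f(3) j Suc by (auto simp: rN4_def)
          ultimately show ?thesis using hn_M by blast
        qed
      qed auto
      then show ?thesis using s by blast
    qed
    show "rN3 R (e 0) (e 1) (e 2) \<longleftrightarrow> (\<exists>s\<in>M. Q (e 0) (e 1) (e 2) s)"
    proof
      assume "rN3 R (e 0) (e 1) (e 2)" then show "\<exists>s\<in>M. Q (e 0) (e 1) (e 2) s" using two by (auto simp: rN3_def)
    next
      assume "\<exists>s\<in>M. Q (e 0) (e 1) (e 2) s"
      then obtain s where s: "s \<in> M" "Q (e 0) (e 1) (e 2) s" by blast
      then have "e 0 \<in> N" "e 1 \<in> N" "e 2 \<in> N" unfolding Q_def by auto
      then obtain a b c where "e 0 = hc_of_nat a" "e 1 = hc_of_nat b" "e 2 = hc_of_nat c" by blast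
      then show "rN3 R (e 0) (e 1) (e 2)" using one[of s a b c] s unfolding rN3_def by auto
    qed
  qed
qed

lemma df_add: "df3 (\<lambda>n k v. v = n + k)"
proof (rule df3_rec[where G = "\<lambda>n v. v = n" and D = "\<lambda>n k a v. v = Suc a"])
  have "dfb M (\<lambda>e. e 0 \<in> N \<and> e 1 = e 0)" by (intro df_intros)
  then show "df2 (\<lambda>n v. v = n)" unfolding df2_def by (rule dfb_cong) (auto simp: rN2_def)
  have "dfb M (\<lambda>e. e 0 \<in> N \<and> e 1 \<in> N \<and> e 2 \<in> N \<and> e 3 \<in> N \<and> succM (e 2) (e 3))" by (intro df_intros)
  then show "df4 (\<lambda>n k a v. v = Suc a)" unfolding df4_def
    by (rule dfb_cong) (auto simp: rN4_def succM_nat)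
qed auto

text \<open>\<open>prod_encode (a, b)\<close> is \<open>triangle (a + b) + a\<close>, so with
  addition at hand this is what pairing still requires.\<close>

lemma df_triangle: "df3 (\<lambda>n k v. v = triangle k)"
proof (rule df3_rec[where G = "\<lambda>n v. v = 0" and D = "\<lambda>n k a v. v = a + Suc k"])
  have "dfb M (\<lambda>e. e 0 \<in> N \<and> e 1 \<in> N \<and> emptyM (e 1))" by (intro df_intros)
  then show "df2 (\<lambda>n v. v = 0)" unfolding df2_def
    by (rule dfb_cong) (auto simp: rN2_def emptyM_iff)
  note [df_intros] = df3D[OF df_add]
  have "dfb M (\<lambda>e. e 0 \<in> N \<and> e 1 \<in> N \<and> (\<exists>u\<in>M. succM (e 1) u \<and> rN3 (\<lambda>n k v. v = n + k) (e 2) u (e 3)))" by (intro df_intros)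
  then show "df4 (\<lambda>n k a v. v = a + Suc k)" unfolding df4_def
  proof (rule dfb_cong)
    fix e :: "nat \<Rightarrow> hc"
    show "rN4 (\<lambda>n k a v. v = a + Suc k) (e 0) (e 1) (e 2) (e 3) \<longleftrightarrow>
       e 0 \<in> N \<and> e 1 \<in> N \<and> (\<exists>u\<in>M. succM (e 1) u \<and> rN3 (\<lambda>n k v. v = n + k) (e 2) u (e 3))"
      by (auto simp: rN4_def rN3_def succM_nat)
  qed
qed auto

lemma df_pe: "df3 (\<lambda>a b x. x = pe a b)"
proof -
  note [df_intros] = df3D[OF df_add] df3D[OF df_triangle]
  have "dfb M (\<lambda>e. \<exists>c\<in>M. \<exists>t\<in>M. rN3 (\<lambda>n k v. v = n + k) (e 0) (e 1) c \<and> rN3 (\<lambda>n k v. v = triangle k) c c t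
     \<and> rN3 (\<lambda>n k v. v = n + k) t (e 0) (e 2))" by (intro df_intros)
  then show ?thesis unfolding df3_def
  proof (rule dfb_cong)
    fix e :: "nat \<Rightarrow> hc"
    show "rN3 (\<lambda>a b x. x = pe a b) (e 0) (e 1) (e 2) \<longleftrightarrow> (\<exists>c\<in>M. \<exists>t\<in>M. rN3 (\<lambda>n k v. v = n + k) (e 0) (e 1) c \<and> rN3 (\<lambda>n k v. v = triangle k) c c t
     \<and> rN3 (\<lambda>n k v. v = n + k) t (e 0) (e 2))"
      by (auto simp: rN3_def prod_encode_def)
  qed
qed

text \<open>Induction on the program. Primitive recursion is \<open>df3_rec\<close>; for
  \<open>Mu\<close>, the quantifier over smaller arguments is bounded by the number itself, which is
  the set of its predecessors.\<close>

lemma df_eval: "df2 (\<lambda>n v. eval {} c n v)"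
proof (induction c)
  case Zer
  have "dfb M (\<lambda>e. e 0 \<in> N \<and> e 1 \<in> N \<and> emptyM (e 1))" by (intro df_intros)
  then show ?case unfolding df2_def
    by (rule dfb_cong) (auto simp: rN2_def emptyM_iff eval_iffs)
next
  case Oracle
  have "dfb M (\<lambda>e. e 0 \<in> N \<and> e 1 \<in> N \<and> emptyM (e 1))" by (intro df_intros)
  then show ?case unfolding df2_def
    by (rule dfb_cong) (auto simp: rN2_def emptyM_iff eval_iffs)
next
  case Succ
  have "dfb M (\<lambda>e. e 0 \<in> N \<and> e 1 \<in> N \<and> succM (e 0) (e 1))" by (intro df_intros)
  then show ?case unfolding df2_def
    by (rule dfb_cong) (auto simp: rN2_def succM_nat eval_iffs)
next
  case Fst
  note [df_intros] = df3D[OF df_pe]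
  have "dfb M (\<lambda>e. \<exists>b\<in>M. rN3 (\<lambda>a b x. x = pe a b) (e 1) b (e 0))" by (intro df_intros)
  then show ?case unfolding df2_def
    by (rule dfb_cong) (auto simp: rN2_def rN3_def eval_iffs, metis hn_M pe_pfst_psnd)
next
  case Snd
  note [df_intros] = df3D[OF df_pe]
  have "dfb M (\<lambda>e. \<exists>b\<in>M. rN3 (\<lambda>a b x. x = pe a b) b (e 1) (e 0))" by (intro df_intros)
  then show ?case unfolding df2_def
    by (rule dfb_cong) (auto simp: rN2_def rN3_def eval_iffs, metis hn_M pe_pfst_psnd)
next
  case (Pairing c d)
  note [df_intros] = df3D[OF df_pe] df2D[OF Pairing(1)] df2D[OF Pairing(2)]
  have "dfb M (\<lambda>e. \<exists>a\<in>M. \<exists>b\<in>M. rN3 (\<lambda>a b x. x = pe a b) a b (e 1) \<and> rN2 (eval {} c) (e 0) a \<and> rN2 (eval {} d) (e 0) b)"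
    by (intro df_intros)
  then show ?case unfolding df2_def
    by (rule dfb_cong) (auto simp: rN2_def rN3_def eval_iffs, metis hn_M pe_pfst_psnd)
next
  case (Comp c d)
  note [df_intros] = df2D[OF Comp(1)] df2D[OF Comp(2)]
  have "dfb M (\<lambda>e. \<exists>a\<in>M. rN2 (eval {} d) (e 0) a \<and> rN2 (eval {} c) a (e 1))"
    by (intro df_intros)
  then show ?case unfolding df2_def
    by (rule dfb_cong) (auto simp: rN2_def eval_iffs, metis hn_M)
next
  case (Prec c d)
  note [df_intros] = df3D[OF df_pe] df2D[OF Prec(1)] df2D[OF Prec(2)]
  have "df3 (\<lambda>m k v. eval {} (Prec c d) (pe m k) v)"
  proof (rule df3_rec[OF Prec(1), where D = "\<lambda>n k a v. eval {} d (pe n (pe k a)) v"])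
    have "dfb M (\<lambda>e. \<exists>u\<in>M. \<exists>w\<in>M. rN3 (\<lambda>a b x. x = pe a b) (e 1) (e 2) u \<and> rN3 (\<lambda>a b x. x = pe a b) (e 0) u w \<and>
      rN2 (eval {} d) w (e 3))" by (intro df_intros)
    then show "df4 (\<lambda>n k a v. eval {} d (pe n (pe k a)) v)" unfolding df4_def
      by (rule dfb_cong) (auto simp: rN2_def rN3_def rN4_def; metis hn_M)
  qed (auto simp: eval_iffs)
  note [df_intros] = df3D[OF this]
  have "dfb M (\<lambda>e. \<exists>m\<in>M. \<exists>k\<in>M. rN3 (\<lambda>a b x. x = pe a b) m k (e 0) \<and> rN3 (\<lambda>m k v. eval {} (Prec c d) (pe m k) v) m k (e 1))"
    by (intro df_intros)
  then show ?case unfolding df2_def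
    by (rule dfb_cong) (auto simp: rN2_def rN3_def, metis hn_M pe_pfst_psnd)
next
  case (Mu c)
  note [df_intros] = df3D[OF df_pe] df2D[OF Mu(1)]
  define K where "K n j v \<longleftrightarrow> (\<exists>w\<in>M. rN3 (\<lambda>a b x. x = pe a b) n j w \<and> rN2 (eval {} c) w v)" for n j v
  have K: "K (hc_of_nat n) (hc_of_nat j) (hc_of_nat v) \<longleftrightarrow> eval {} c (pe n j) v" for n j v
    unfolding K_def rN3_def rN2_def using hn_M by auto
  have "dfb M (\<lambda>e. e 0 \<in> N \<and> e 1 \<in> N \<and> (\<exists>z\<in>M. z \<in> N \<and> emptyM z \<and> K (e 0) (e 1) z) \<and>
     (\<forall>j\<in>M. j \<in> elts (e 1) \<longrightarrow> (\<exists>v\<in>M. \<exists>u\<in>M. v \<in> N \<and> succM v u \<and> K (e 0) j u)))"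
    unfolding K_def by (intro df_intros)
  then show ?case unfolding df2_def
  proof (rule dfb_cong)
    fix e :: "nat \<Rightarrow> hc"
    have zero: "(\<exists>z\<in>M. z \<in> N \<and> emptyM z \<and> K x y z) \<longleftrightarrow> K x y (hc_of_nat 0)" for x y
      by (auto simp: emptyM_iff)
    have suc: "(\<exists>v\<in>M. \<exists>u\<in>M. v \<in> N \<and> succM v u \<and> K x y u) \<longleftrightarrow> (\<exists>v. K x y (hc_of_nat (Suc v)))" for x y
      by (auto simp: succM_nat) (meson hn_M rangeI succM_nat)
    have all: "(\<forall>j\<in>M. j \<in> elts (hc_of_nat b) \<longrightarrow> (\<exists>v. K x j (hc_of_nat (Suc v)))) \<longleftrightarrow> (\<forall>j<b. \<exists>v. K x (hc_of_nat j) (hc_of_nat (Suc v)))" for x b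
      unfolding elts_hc_of_nat using hn_M by blast
    show "rN2 (eval {} (Mu c)) (e 0) (e 1) \<longleftrightarrow> e 0 \<in> N \<and> e 1 \<in> N \<and> (\<exists>z\<in>M. z \<in> N \<and> emptyM z \<and> K (e 0) (e 1) z) \<and>
     (\<forall>j\<in>M. j \<in> elts (e 1) \<longrightarrow> (\<exists>v\<in>M. \<exists>u\<in>M. v \<in> N \<and> succM v u \<and> K (e 0) j u))"
      unfolding zero suc
    proof -
      have core: "K (hc_of_nat a) (hc_of_nat b) (hc_of_nat 0) \<and>
          (\<forall>j\<in>M. j \<in> elts (hc_of_nat b) \<longrightarrow> (\<exists>v. K (hc_of_nat a) j (hc_of_nat (Suc v)))) \<longleftrightarrow> eval {} (Mu c) a b" for a b
        unfolding all K eval_iffs ..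
      show "rN2 (eval {} (Mu c)) (e 0) (e 1) \<longleftrightarrow> e 0 \<in> N \<and> e 1 \<in> N \<and> K (e 0) (e 1) (hc_of_nat 0) \<and>
         (\<forall>j\<in>M. j \<in> elts (e 1) \<longrightarrow> (\<exists>v. K (e 0) j (hc_of_nat (Suc v))))"
        unfolding rN2_def core[symmetric] by auto
    qed
  qed
qed

lemma df2_recfn: assumes "recfn f" shows "df2 (\<lambda>n v. v = f n)"
proof -
  obtain c where c: "\<And>X n. eval X c n (f n)" using assms by (auto simp: recfn_def)
  have "(\<lambda>n v. v = f n) = (\<lambda>n v. eval {} c n v)" using c eval_deterministic by (intro ext) metis
  then show ?thesis using df_eval by simp
qed

lemma df2_rec2: assumes "rec2 r" shows "df2 r"
proof -
  have "recfn (\<lambda>z. of_bool (r (pfst z) (psnd z)))" using assms by (simp add: rec2_def recp_def)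
  note [df_intros] = df3D[OF df_pe] df2D[OF df2_recfn[OF this]]
  have "dfb M (\<lambda>e. \<exists>w\<in>M. \<exists>v\<in>M. \<exists>z\<in>M. z \<in> N \<and> emptyM z \<and> succM z v \<and> rN3 (\<lambda>a b x. x = pe a b) (e 0) (e 1) w \<and>
     rN2 (\<lambda>z v. v = of_bool (r (pfst z) (psnd z))) w v)" by (intro df_intros)
  then show ?thesis unfolding df2_def
  proof (rule dfb_cong)
    fix e :: "nat \<Rightarrow> hc"
    have "(\<exists>w\<in>M. \<exists>v\<in>M. \<exists>z\<in>M. z \<in> N \<and> emptyM z \<and> succM z v \<and> rN3 (\<lambda>a b x. x = pe a b) (e 0) (e 1) w \<and>
       rN2 (\<lambda>z v. v = of_bool (r (pfst z) (psnd z))) w v) \<longleftrightarrow> (\<exists>w\<in>M. rN3 (\<lambda>a b x. x = pe a b) (e 0) (e 1) w \<and>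
       rN2 (\<lambda>z v. v = of_bool (r (pfst z) (psnd z))) w (hc_of_nat (Suc 0)))"
    proof -
      have "(z \<in> N \<and> emptyM z \<and> succM z v) \<longleftrightarrow> z = hc_of_nat 0 \<and> v = hc_of_nat (Suc 0)" if "z \<in> M" "v \<in> M" for z v
        using that by (auto simp: emptyM_iff succM_nat)
      then show ?thesis using hn_M[of 0] hn_M[of "Suc 0"] by (intro iffI; elim bexE conjE) blast+
    qed
    also have "\<dots> \<longleftrightarrow> rN2 r (e 0) (e 1)"
      unfolding rN2_def rN3_def using hn_M by (auto simp: of_bool_def split: if_splits) (metis pfst_pe psnd_pe)
    finally show "rN2 r (e 0) (e 1) \<longleftrightarrow> (\<exists>w\<in>M. \<exists>v\<in>M. \<exists>z\<in>M. z \<in> N \<and> emptyM z \<and> succM z v \<and> rN3 (\<lambda>a b x. x = pe a b) (e 0) (e 1) w \<and>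
       rN2 (\<lambda>z v. v = of_bool (r (pfst z) (psnd z))) w v)" by simp
  qed
qed

end

section \<open>Levels of the constructible hierarchy along well-orders\<close>

text \<open>The Mostowski collapse of the order: \<open>col R b\<close> is the ordinal of the
  predecessors of \<open>b\<close>, and \<open>ot R\<close> that of the whole order.\<close>

definition col :: "nat rel \<Rightarrow> nat \<Rightarrow> hc" where
  "col R = wfrec (R - Id) (\<lambda>f b. hcset (f ` underS R b))"

definition ot :: "nat rel \<Rightarrow> hc" where "ot R = hcset (col R ` Field R)"

lemma col_eq: assumes "Well_order R" shows "col R b = hcset (col R ` underS R b)"
proof -
  have wf: "wf (R - Id)" using assms by (simp add: well_order_on_def)
  have "cut (col R) (R - Id) b ` underS R b = col R ` underS R b"
    by (rule image_cong) (auto simp: underS_def cut_apply)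
  then show ?thesis unfolding col_def by (subst wfrec[OF wf]) simp
qed

lemma elts_hcset_nat: "elts (hcset (f ` (A :: nat set))) = f ` A"
  by (rule elts_hcset) simp

lemma double_neq_Suc_double [simp]: "2 * x \<noteq> Suc (2 * y)" "Suc (2 * y) \<noteq> 2 * (x :: nat)"
  by presburger+

lemma elts_col: "Well_order R \<Longrightarrow> elts (col R b) = col R ` underS R b"
  by (subst col_eq) (simp_all add: elts_hcset_nat)

lemma elts_ot: "elts (ot R) = col R ` Field R"
  by (simp add: ot_def elts_hcset_nat)

lemma wo_trans: "Well_order R \<Longrightarrow> (a, b) \<in> R \<Longrightarrow> (b, c) \<in> R \<Longrightarrow> (a, c) \<in> R"
  unfolding order_on_defs trans_def by blast

lemma wo_antisym: "Well_order R \<Longrightarrow> (a, b) \<in> R \<Longrightarrow> (b, a) \<in> R \<Longrightarrow> a = b"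
  unfolding order_on_defs antisym_def by blast

lemma wo_refl: "Well_order R \<Longrightarrow> a \<in> Field R \<longleftrightarrow> (a, a) \<in> R"
  by (auto simp: order_on_defs refl_on_def Field_def)

lemma wo_total: "Well_order R \<Longrightarrow> a \<in> Field R \<Longrightarrow> b \<in> Field R \<Longrightarrow> (a, b) \<in> R \<or> (b, a) \<in> R"
  unfolding order_on_defs total_on_def by (metis refl_onD)

lemma underS_trans: "Well_order R \<Longrightarrow> a \<in> underS R b \<Longrightarrow> b \<in> underS R c \<Longrightarrow> a \<in> underS R c"
  unfolding underS_def using wo_trans wo_antisym by (metis (mono_tags, lifting) mem_Collect_eq)

lemma underS_Field1: "a \<in> underS R b \<Longrightarrow> a \<in> Field R" and underS_Field2: "a \<in> underS R b \<Longrightarrow> b \<in> Field R"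
  by (auto simp: underS_def Field_def)

lemma wo_induct [consumes 1, case_names less]:
  assumes "Well_order R" "\<And>b. (\<And>a. a \<in> underS R b \<Longrightarrow> P a) \<Longrightarrow> P b" shows "P b"
proof -
  have "wf (R - Id)" using assms(1) by (simp add: well_order_on_def)
  then show ?thesis
    by (induction b rule: wf_induct_rule) (rule assms(2), auto simp: underS_def)
qed

lemma transitive_col: assumes "Well_order R" shows "transitive (col R b)"
  unfolding transitive_def elts_col[OF assms] using underS_trans[OF assms] by (auto simp: elts_col[OF assms])

lemma ordinal_col: assumes "Well_order R" shows "ordinal (col R b)"
  unfolding ordinal_def using transitive_col[OF assms] by (auto simp: elts_col[OF assms])

lemma is_order_type_ot: assumes "Well_order R" shows "is_order_type R (ot R)"
proof -
  have mem: "a \<in> underS R b \<Longrightarrow> col R a \<in> elts (col R b)" for a b by (simp add: elts_col[OF assms])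
  have iff: "a \<in> underS R b \<longleftrightarrow> col R a \<in> elts (col R b)" if "a \<in> Field R" "b \<in> Field R" for a b
  proof
    assume c: "col R a \<in> elts (col R b)"
    then have "a \<noteq> b" using elts_irrefl by auto
    moreover have "b \<notin> underS R a" using c mem elts_asym by blast
    ultimately show "a \<in> underS R b" using wo_total[OF assms that] by (auto simp: underS_def)
  qed (rule mem)
  have "inj_on (col R) (Field R)"
  proof (rule inj_onI, rule ccontr)
    fix a b assume ab: "a \<in> Field R" "b \<in> Field R" "col R a = col R b" "a \<noteq> b"
    then have "a \<in> underS R b \<or> b \<in> underS R a" using wo_total[OF assms] by (auto simp: underS_def)
    then show False using mem ab(3) elts_irrefl by metis
  qed
  then have "bij_betw (col R) (Field R) (elts (ot R))" by (simp add: bij_betw_def elts_ot)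
  moreover have "transitive (ot R)"
    unfolding transitive_def elts_ot by (auto simp: elts_col[OF assms] dest: underS_Field1)
  then have "ordinal (ot R)"
    using transitive_col[OF assms] unfolding ordinal_def by (auto simp: elts_ot)
  ultimately show ?thesis unfolding is_order_type_def using iff by blast
qed

lemma Lset_omega1ck: "Lset omega1ck = (\<Union>R \<in> {R. computable_wellorder R}. DPow (Lset (ot R)))"
proof -
  have "elts omega1ck = ot ` {R. computable_wellorder R}"
  proof (rule set_eqI)
    fix x
    have "x = ot R \<longleftrightarrow> is_order_type R x" if "computable_wellorder R" for R
      using that is_order_type_ot[of R] is_order_type_unique[of R x "ot R"] by (auto simp: computable_wellorder_def)
    then show "x \<in> elts omega1ck \<longleftrightarrow> x \<in> ot ` {R. computable_wellorder R}"
      unfolding elts_omega1ck computable_ordinal_def by auto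
  qed
  then show ?thesis by (simp add: Lset_eq[of omega1ck])
qed

lemma Lset_col: "Well_order R \<Longrightarrow> Lset (col R b) = (\<Union>a \<in> underS R b. DPow (Lset (col R a)))"
  by (simp add: Lset_eq[of "col R b"] elts_col)

lemma Lset_ot: "Lset (ot R) = (\<Union>a \<in> Field R. DPow (Lset (col R a)))"
  by (simp add: Lset_eq[of "ot R"] elts_ot)

subsection \<open>Sums\<close>

text \<open>\<open>R\<close> on the even numbers, followed by \<open>S\<close> on the odd ones. Sums
  give common upper bounds, and a point \<open>2 * a\<close> keeps its collapse whatever follows, so
  that codes can be fixed before the second summand is known.\<close>

definition osum :: "nat rel \<Rightarrow> nat rel \<Rightarrow> nat rel" where
  "osum R S = {(x, y). (even x \<and> even y \<and> (x div 2, y div 2) \<in> R) \<or>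
      (even x \<and> odd y \<and> x div 2 \<in> Field R \<and> y div 2 \<in> Field S) \<or>
      (odd x \<and> odd y \<and> (x div 2, y div 2) \<in> S)}"

lemma Field_osum: assumes "Well_order R" "Well_order S"
  shows "x \<in> Field (osum R S) \<longleftrightarrow> (if even x then x div 2 \<in> Field R else x div 2 \<in> Field S)"
proof -
  have "(x, x) \<in> osum R S" if "if even x then x div 2 \<in> Field R else x div 2 \<in> Field S" for x
    using that wo_refl[OF assms(1)] wo_refl[OF assms(2)] by (auto simp: osum_def split: if_splits)
  moreover have "if even x then x div 2 \<in> Field R else x div 2 \<in> Field S" if "(x, y) \<in> osum R S \<or> (y, x) \<in> osum R S" for y
    using that by (auto simp: osum_def FieldI1 FieldI2)
  ultimately show ?thesis by (metis Field_iff FieldI1)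
qed

lemma underS_osum_even: "underS (osum R S) (2 * a) = (\<lambda>x. 2 * x) ` underS R a"
  by (auto simp: underS_def osum_def elim!: evenE)

lemma underS_osum_odd: "b \<in> Field S \<Longrightarrow>
   underS (osum R S) (2 * b + 1) = (\<lambda>x. 2 * x) ` Field R \<union> (\<lambda>x. 2 * x + 1) ` underS S b"
  by (auto simp: underS_def osum_def elim!: evenE oddE)

lemma Well_order_osum: assumes R: "Well_order R" and S: "Well_order S" shows "Well_order (osum R S)"
proof -
  let ?O = "osum R S"
  have wf: "wf (R - Id)" "wf (S - Id)" using R S by (simp_all add: well_order_on_def)
  have ev: "2 * a \<in> Wellfounded.acc (?O - Id)" for a
  proof (induction a rule: wf_induct_rule[OF wf(1)])
    case (1 a)
    show ?case by (rule accI) (use 1 in \<open>auto simp: osum_def elim!: evenE\<close>)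
  qed
  have od: "2 * a + 1 \<in> Wellfounded.acc (?O - Id)" for a
  proof (induction a rule: wf_induct_rule[OF wf(2)])
    case (1 a)
    show ?case
    proof (rule accI)
      fix y assume y: "(y, 2 * a + 1) \<in> ?O - Id"
      show "y \<in> Wellfounded.acc (?O - Id)"
      proof (cases "even y")
        case True
        then show ?thesis using ev by (metis evenE)
      next
        case False
        then obtain c where c: "y = 2 * c + 1" by (metis oddE)
        then have "(c, a) \<in> S - Id" using y by (auto simp: osum_def)
        then show ?thesis using 1 c by blast
      qed
    qed
  qed
  have "a \<in> Wellfounded.acc (?O - Id)" for a using ev od by (metis evenE oddE)
  then have "wf (?O - Id)" by (simp add: wf_iff_acc)
  moreover have "refl_on (Field ?O) ?O"
  proof (rule refl_onI)
    fix x assume "x \<in> Field ?O"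
    then show "(x, x) \<in> ?O"
      using Field_osum[OF R S, of x] wo_refl[OF R, of "x div 2"] wo_refl[OF S, of "x div 2"]
      by (auto simp: osum_def split: if_splits)
  qed
  moreover have "trans ?O"
    by (rule transI) (auto simp: osum_def intro: wo_trans[OF R] wo_trans[OF S] FieldI1 FieldI2)
  moreover have "antisym ?O"
  proof (rule antisymI)
    fix x y assume "(x, y) \<in> ?O" "(y, x) \<in> ?O"
    then have "x div 2 = y div 2" "even x \<longleftrightarrow> even y" using wo_antisym[OF R] wo_antisym[OF S] by (auto simp: osum_def)
    then show "x = y" by presburger
  qed
  moreover have "total_on (Field ?O) ?O"
    unfolding total_on_def
  proof (intro ballI impI)
    fix x y assume "x \<in> Field ?O" "y \<in> Field ?O"
    then show "(x, y) \<in> ?O \<or> (y, x) \<in> ?O"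
      using Field_osum[OF R S, of x] Field_osum[OF R S, of y]
        wo_total[OF R, of "x div 2" "y div 2"] wo_total[OF S, of "x div 2" "y div 2"]
      by (cases "even x"; cases "even y"; simp add: osum_def)
  qed
  moreover have "?O \<subseteq> Field ?O \<times> Field ?O" by (auto intro: FieldI1 FieldI2)
  ultimately show ?thesis unfolding order_on_defs by blast
qed

lemma recp_relI: "recp (\<lambda>n. n \<in> prod_encode ` R) \<longleftrightarrow> rec2 (\<lambda>a b. (a, b) \<in> R)"
proof -
  have "n \<in> prod_encode ` R \<longleftrightarrow> (pfst n, psnd n) \<in> R" for n
    by (auto simp: image_iff) (metis pe_pfst_psnd)
  then show ?thesis by (simp add: rec2_def)
qed

lemma computable_wellorder_iff: "computable_wellorder R \<longleftrightarrow> Well_order R \<and> rec2 (\<lambda>a b. (a, b) \<in> R)"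
  by (simp add: computable_wellorder_def computable_iff_recp recp_relI)

lemma computable_wellorder_osum:
  assumes "computable_wellorder R" "computable_wellorder S" shows "computable_wellorder (osum R S)"
proof -
  have R: "Well_order R" "rec2 (\<lambda>a b. (a, b) \<in> R)" and S: "Well_order S" "rec2 (\<lambda>a b. (a, b) \<in> S)"
    using assms by (simp_all add: computable_wellorder_iff)
  note [rec_intros] = rec2_comp[OF R(2)] rec2_comp[OF S(2)]
  have "rec2 (\<lambda>x y. (x, y) \<in> osum R S)"
    unfolding osum_def rec2_def wo_refl[OF R(1)] wo_refl[OF S(1)] mem_Collect_eq prod.case
    by (intro rec_intros)
  then show ?thesis using Well_order_osum R S by (simp add: computable_wellorder_iff)
qed

lemma col_osum_even: assumes "Well_order R" "Well_order S" shows "col (osum R S) (2 * a) = col R a"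
proof (induction a rule: wo_induct[OF assms(1)])
  case (1 a)
  have "elts (col (osum R S) (2 * a)) = elts (col R a)"
    unfolding elts_col[OF Well_order_osum[OF assms]] elts_col[OF assms(1)] underS_osum_even using 1 by (auto simp: image_iff)
  then show ?case by (rule hc_eqI)
qed

section \<open>Comparison of ordinals and of levels along sums\<close>

lemma ordinal_mem: "ordinal x \<Longrightarrow> y \<in> elts x \<Longrightarrow> ordinal y"
  unfolding ordinal_def transitive_def by blast

lemma ordinal_linear: "ordinal x \<Longrightarrow> ordinal y \<Longrightarrow> x \<in> elts y \<or> x = y \<or> y \<in> elts x"
proof (induction x arbitrary: y rule: elts_induct)
  case (step x)
  note IHx = step.IH and ox = step.prems(1)
  from step.prems(2) show ?case
  proof (induction y rule: elts_induct)
    case (step y)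
    note IHy = step.IH and oy = step.prems(1)
    show ?case
    proof (rule ccontr)
      assume n: "\<not> ?case"
      have "elts x \<subseteq> elts y"
      proof
        fix z assume z: "z \<in> elts x"
        from IHx[OF z ordinal_mem[OF ox z] oy] show "z \<in> elts y"
          using n z ox unfolding ordinal_def transitive_def by blast
      qed
      moreover have "elts y \<subseteq> elts x"
      proof
        fix z assume z: "z \<in> elts y"
        from IHy[OF z ordinal_mem[OF oy z]] show "z \<in> elts x"
          using n z oy unfolding ordinal_def transitive_def by blast
      qed
      ultimately have "x = y" by (intro hc_eqI) blast
      then show False using n by blast
    qed
  qed
qed

lemma ordinal_subset: "ordinal x \<Longrightarrow> ordinal y \<Longrightarrow> elts x \<subseteq> elts y \<Longrightarrow> x = y \<or> x \<in> elts y"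
  using ordinal_linear[of x y] elts_irrefl[of y] by blast

lemma ordinal_subset_mem: "ordinal x \<Longrightarrow> ordinal y \<Longrightarrow> elts x \<subseteq> elts y \<Longrightarrow> y \<in> elts z \<Longrightarrow> ordinal z \<Longrightarrow> x \<in> elts z"
  using ordinal_subset[of x y] unfolding ordinal_def[of z] transitive_def[of z] by blast

lemma col_osum_odd_ge: assumes "Well_order R" "Well_order S"
  shows "b \<in> Field S \<longrightarrow> elts (col S b) \<subseteq> elts (col (osum R S) (2 * b + 1))"
proof (induction b rule: wo_induct[OF assms(2)])
  case (1 b)
  note O = Well_order_osum[OF assms]
  show ?case
  proof (intro impI subsetI)
    fix x assume b: "b \<in> Field S" and "x \<in> elts (col S b)"
    then obtain a where a: "a \<in> underS S b" "x = col S a" by (auto simp: elts_col[OF assms(2)])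
    have "elts (col S a) \<subseteq> elts (col (osum R S) (2 * a + 1))" using 1[OF a(1)] underS_Field1[OF a(1)] by blast
    moreover have "col (osum R S) (2 * a + 1) \<in> elts (col (osum R S) (2 * b + 1))"
      unfolding elts_col[OF O] underS_osum_odd[OF b] using a by blast
    ultimately show "x \<in> elts (col (osum R S) (2 * b + 1))"
      using ordinal_subset_mem ordinal_col[OF O] ordinal_col[OF assms(2)] a(2) by blast
  qed
qed

lemma ordinal_ot: "Well_order R \<Longrightarrow> ordinal (ot R)"
  using is_order_type_ot by (auto simp: is_order_type_def)

lemma Lset_osum2: assumes "Well_order R" "Well_order S" shows "Lset (ot S) \<subseteq> Lset (ot (osum R S))"
proof (rule Lset_mono, rule subsetI)
  note O = Well_order_osum[OF assms]
  fix x assume "x \<in> elts (ot S)"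
  then obtain b where b: "b \<in> Field S" "x = col S b" by (auto simp: elts_ot)
  have "2 * b + 1 \<in> Field (osum R S)" using b by (simp add: Field_osum[OF assms])
  then have "col (osum R S) (2 * b + 1) \<in> elts (ot (osum R S))" by (auto simp: elts_ot)
  then show "x \<in> elts (ot (osum R S))"
    using col_osum_odd_ge[OF assms] b ordinal_subset_mem[OF ordinal_col[OF assms(2)] ordinal_col[OF O] _ _ ordinal_ot[OF O]] by blast
qed

lemma Lset_osum1: assumes "Well_order R" "Well_order S" shows "Lset (ot R) \<subseteq> Lset (ot (osum R S))"
proof (rule Lset_mono, rule subsetI)
  fix x assume "x \<in> elts (ot R)"
  then obtain b where b: "b \<in> Field R" "x = col R b" by (auto simp: elts_ot)
  have "2 * b \<in> Field (osum R S)" using b by (simp add: Field_osum[OF assms])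
  then show "x \<in> elts (ot (osum R S))" using b col_osum_even[OF assms, of b] unfolding elts_ot by (metis image_eqI)
qed

section \<open>The order types \<omega> and 1\<close>

definition natle :: "nat rel" where "natle = {(a, b). a \<le> b}"

lemma Field_natle: "Field natle = UNIV" by (auto simp: natle_def Field_def)

lemma cwo_natle: "computable_wellorder natle"
proof -
  have "natle - Id = {(a, b). a < b}" by (auto simp: natle_def)
  then have "wf (natle - Id)" using wf_less by simp
  then have "Well_order natle"
    unfolding order_on_defs Field_natle by (auto simp: natle_def refl_on_def trans_def antisym_def total_on_def)
  moreover have "rec2 (\<lambda>a b. (a, b) \<in> natle)" unfolding natle_def rec2_def mem_Collect_eq prod.case by (intro rec_intros)
  ultimately show ?thesis by (simp add: computable_wellorder_iff)
qed

lemma wo_natle: "Well_order natle" using cwo_natle by (simp add: computable_wellorder_iff)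

lemma col_natle: "col natle n = hc_of_nat n"
proof (induction n rule: less_induct)
  case (less n)
  have "underS natle n = {..<n}" by (auto simp: underS_def natle_def)
  then have "elts (col natle n) = elts (hc_of_nat n)" using less
    by (auto simp: elts_col[OF wo_natle] elts_hc_of_nat)
  then show ?case by (rule hc_eqI)
qed

text \<open>With \<open>natle\<close> in front, every point of the second summand is high enough for
  its level to be a \<open>goodM\<close>.\<close>

lemma Lomega_le_col: assumes "Well_order S" "b \<in> Field S" shows "Lomega \<subseteq> Lset (col (osum natle S) (2 * b + 1))"
proof -
  have "hc_of_nat n \<in> elts (col (osum natle S) (2 * b + 1))" for n
    unfolding elts_col[OF Well_order_osum[OF wo_natle assms(1)]] underS_osum_odd[OF assms(2)] Field_natle
    using col_osum_even[OF wo_natle assms(1), of n] unfolding col_natle by (metis UnI1 image_eqI rangeI)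
  then show ?thesis unfolding Lomega_def using Lset_mono_mem by blast
qed

lemma Lomega_le_ot: assumes "Well_order S" shows "Lomega \<subseteq> Lset (ot (osum natle S))"
proof -
  have "Lset (hc_of_nat n) \<subseteq> Lset (ot natle)" for n
    by (rule Lset_mono_mem) (auto simp: elts_ot Field_natle col_natle)
  then show ?thesis unfolding Lomega_def using Lset_osum1[OF wo_natle assms] by blast
qed

definition onepoint :: "nat rel" where "onepoint = {(0, 0)}"

lemma cwo_onepoint: "computable_wellorder onepoint"
proof -
  have F: "Field onepoint = {0}" by (auto simp: onepoint_def Field_def)
  have "onepoint - Id = {}" by (auto simp: onepoint_def)
  then have "Well_order onepoint"
    unfolding order_on_defs F by (auto simp: onepoint_def refl_on_def trans_def antisym_def total_on_def)
  moreover have "rec2 (\<lambda>a b. a = 0 \<and> b = 0)" unfolding rec2_def by (intro rec_intros)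
  ultimately show ?thesis by (simp add: computable_wellorder_iff onepoint_def)
qed

lemma wo_onepoint: "Well_order onepoint" using cwo_onepoint by (simp add: computable_wellorder_iff)

lemma Field_onepoint: "Field onepoint = {0}" by (auto simp: onepoint_def Field_def)

text \<open>The point 0 of \<open>onepoint\<close> becomes \<open>2 * 0 + 1\<close> and has exactly
  the copy of \<open>R\<close> below it.\<close>

lemma col_top: assumes "Well_order R" shows "col (osum R onepoint) 1 = ot R"
proof (rule hc_eqI)
  have u: "underS onepoint 0 = {}" by (auto simp: underS_def onepoint_def)
  show "elts (col (osum R onepoint) 1) = elts (ot R)"
    using underS_osum_odd[of 0 onepoint R]
    by (simp add: elts_col[OF Well_order_osum[OF assms wo_onepoint]] elts_ot Field_onepoint u
        col_osum_even[OF assms wo_onepoint] image_image)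
qed

lemma DPow_ot_le: assumes "Well_order R" shows "DPow (Lset (ot R)) \<subseteq> Lset (ot (osum R onepoint))"
  by (rule DPow_subset_Lset)
     (auto simp: elts_ot col_top[OF assms, symmetric] Field_osum[OF assms wo_onepoint] Field_onepoint)

section \<open>Hyperarithmetic sets are constructible\<close>

text \<open>The table \<open>tb b\<close> of winning positions up to \<open>b\<close>, in a
  well-order along which the moves descend, is definable over a level containing the tables of the
  smaller points. Once all tables are in \<open>M\<close>, the predicate is read off from
  them.\<close>

theorem ebp_definable:
  assumes "ebp P"
  obtains R where "computable_wellorder R" "Lomega \<subseteq> Lset (ot R)"
    "\<And>M. transM M \<Longrightarrow> Lset (ot R) \<subseteq> M \<Longrightarrow> dfb M (\<lambda>e. \<exists>n. e 0 = hc_of_nat n \<and> P n)"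
proof -
  obtain R m k where R: "computable_wellorder R" and m: "rec2 m" "gwf m" and k: "recfn k"
    and mR: "\<And>p q. m p q \<Longrightarrow> p \<in> Field R \<and> q \<in> underS R p" and kR: "\<And>n. k n \<in> Field R"
    and Pm: "\<And>n. P n \<longleftrightarrow> win m (k n)"
    using ebp_wellorder[OF assms] by blast
  have WO: "Well_order R" and rR: "rec2 (\<lambda>a b. (a, b) \<in> R)" using R by (simp_all add: computable_wellorder_iff)
  let ?le = "\<lambda>a b. (a, b) \<in> R"
  define tb where "tb b = hcset (hc_of_nat ` {n. (n, b) \<in> R \<and> win m n})" for b
  have etb: "elts (tb b) = hc_of_nat ` {n. (n, b) \<in> R \<and> win m n}" for b
    by (simp add: tb_def elts_hcset_nat)
  have winb: "win m n \<longleftrightarrow> (\<exists>q. m n q \<and> hc_of_nat q \<notin> elts (tb b))" if "(n, b) \<in> R" for n b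
  proof -
    have "(q, b) \<in> R" if "m n q" for q using mR[OF that] wo_trans[OF WO _ \<open>(n, b) \<in> R\<close>] by (auto simp: underS_def)
    then show ?thesis using win_iff[OF m(2), of n] by (auto simp: etb)
  qed
  \<comment> \<open>Correct tables are recognised locally: \<open>C t q\<close> states the recursion
    of the game for the positions up to \<open>q\<close>, referring to \<open>t\<close> alone, and
    induction over the game shows that it has only one solution.\<close>
  have corr: "dfb M (\<lambda>e. \<exists>b. (b, b) \<in> R \<and> e 1 = hc_of_nat b \<and> e 0 = tb b)" if g: "goodM M" for M
  proof -
    interpret goodM M by (rule g)
    define C where "C t q \<longleftrightarrow> rN2 ?le q q \<and> (\<forall>y\<in>M. y \<in> elts t \<longleftrightarrow> rN2 ?le y q \<and> (\<exists>z\<in>M. rN2 m y z \<and> z \<notin> elts t))" for t q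
    note [df_intros] = df2D[OF df2_rec2[OF rR]] df2D[OF df2_rec2[OF m(1)]]
    have "dfb M (\<lambda>e. C (e 0) (e 1))" unfolding C_def by (intro df_intros)
    then show ?thesis
    proof (rule dfb_cong)
      fix e :: "nat \<Rightarrow> hc" assume "range e \<subseteq> M"
      then have t: "e 0 \<in> M" by blast
      let ?t = "e 0"
      show "(\<exists>b. (b, b) \<in> R \<and> e 1 = hc_of_nat b \<and> e 0 = tb b) \<longleftrightarrow> C (e 0) (e 1)"
      proof
        assume "\<exists>b. (b, b) \<in> R \<and> e 1 = hc_of_nat b \<and> e 0 = tb b"
        then obtain b where b: "(b, b) \<in> R" "e 1 = hc_of_nat b" "e 0 = tb b" by blast
        have "y \<in> elts (tb b) \<longleftrightarrow> rN2 ?le y (hc_of_nat b) \<and> (\<exists>z\<in>M. rN2 m y z \<and> z \<notin> elts (tb b))" for y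
        proof -
          have "y \<in> elts (tb b) \<longleftrightarrow> (\<exists>n. y = hc_of_nat n \<and> (n, b) \<in> R \<and> (\<exists>q. m n q \<and> hc_of_nat q \<notin> elts (tb b)))"
            using winb[of _ b] by (subst etb) auto
          also have "\<dots> \<longleftrightarrow> rN2 ?le y (hc_of_nat b) \<and> (\<exists>z\<in>M. rN2 m y z \<and> z \<notin> elts (tb b))"
            by (auto simp: rN2_def) (metis hn_M)
          finally show ?thesis .
        qed
        moreover have "rN2 ?le (hc_of_nat b) (hc_of_nat b)" using b(1) by (auto simp: rN2_def)
        ultimately show "C (e 0) (e 1)" unfolding C_def b(2,3) by blast
      next
        assume C: "C (e 0) (e 1)"
        then obtain b where b: "(b, b) \<in> R" "e 1 = hc_of_nat b" by (auto simp: C_def rN2_def)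
        have c: "hc_of_nat n \<in> elts ?t \<longleftrightarrow> (n, b) \<in> R \<and> (\<exists>q. m n q \<and> hc_of_nat q \<notin> elts ?t)" for n
          using C[unfolded C_def, THEN conjunct2, rule_format, of "hc_of_nat n"] unfolding b(2) by (auto simp: rN2_def)
        have w: "(n, b) \<in> R \<longrightarrow> (hc_of_nat n \<in> elts ?t \<longleftrightarrow> win m n)" for n
        proof (induction n rule: gwf_induct[OF m(2)])
          case (1 n)
          show ?case
          proof
            assume n: "(n, b) \<in> R"
            have "(q, b) \<in> R" if "m n q" for q using mR[OF that] wo_trans[OF WO _ n] by (auto simp: underS_def)
            then show "hc_of_nat n \<in> elts ?t \<longleftrightarrow> win m n" using c[of n] n 1 win_iff[OF m(2), of n] by blast
          qed
        qed
        have "y \<in> elts ?t \<Longrightarrow> \<exists>n. y = hc_of_nat n" for y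
          using C elts_M[OF t] unfolding C_def rN2_def by blast
        then have "elts ?t = elts (tb b)" unfolding etb using w c by blast
        then have "?t = tb b" by (rule hc_eqI)
        then show "\<exists>b. (b, b) \<in> R \<and> e 1 = hc_of_nat b \<and> e 0 = tb b" using b by blast
      qed
    qed
  qed
  let ?R = "osum natle R"
  note WR = Well_order_osum[OF wo_natle WO]
  \<comment> \<open>A position up to \<open>b\<close> is won iff it has a move to some
    \<open>q\<close> that is missing from its own table \<open>tb q\<close>. These tables belong to
    points strictly below \<open>b\<close>, so this level already contains them.\<close>
  have tb_in: "b \<in> Field R \<longrightarrow> tb b \<in> DPow (Lset (col ?R (2 * b + 1)))" for b
  proof (induction b rule: wo_induct[OF WO])
    case (1 b)
    show ?case
    proof
      assume b: "b \<in> Field R"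
      let ?M = "Lset (col ?R (2 * b + 1))"
      have g: "goodM ?M" using Lomega_le_col[OF WO b] transM_Lset by unfold_locales
      interpret goodM ?M by (rule g)
      have tq: "tb q \<in> ?M" if "q \<in> underS R b" for q
      proof -
        have "col ?R (2 * q + 1) \<in> elts (col ?R (2 * b + 1))"
          unfolding elts_col[OF WR] underS_osum_odd[OF b] using that by blast
        then show ?thesis using 1[OF that] underS_Field1[OF that] DPow_subset_Lset by blast
      qed
      note [df_intros] = df2D[OF df2_rec2[OF rR]] df2D[OF df2_rec2[OF m(1)]]
      have [df_intros]: "dfb ?M (\<lambda>e. \<exists>b. (b, b) \<in> R \<and> e (Suc 0) = hc_of_nat b \<and> e 0 = tb b)"
        using corr[OF g] by simp
      have "dfb ?M (\<lambda>e. rN2 ?le (e 0) (e 1) \<and> (\<exists>q\<in>?M. \<exists>t\<in>?M. rN2 m (e 0) q \<and>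
           (\<exists>b. (b, b) \<in> R \<and> q = hc_of_nat b \<and> t = tb b) \<and> q \<notin> elts t))" by (intro df_intros)
      then show "tb b \<in> DPow ?M"
      proof (rule DPow_dfbI)
        show "range (\<lambda>_::nat. hc_of_nat b) \<subseteq> ?M" using hn_M by blast
        have "y \<in> elts (tb b) \<longleftrightarrow> y \<in> ?M \<and> rN2 ?le y (hc_of_nat b) \<and>
            (\<exists>q\<in>?M. \<exists>t\<in>?M. rN2 m y q \<and> (\<exists>b. (b, b) \<in> R \<and> q = hc_of_nat b \<and> t = tb b) \<and> q \<notin> elts t)" for y
        proof -
          have *: "win m n \<longleftrightarrow> (\<exists>q\<in>?M. \<exists>t\<in>?M. rN2 m (hc_of_nat n) q \<and> (\<exists>b. (b, b) \<in> R \<and> q = hc_of_nat b \<and> t = tb b) \<and> q \<notin> elts t)"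
            if n: "(n, b) \<in> R" for n
          proof -
            have q: "q \<in> underS R b \<and> (q, q) \<in> R" if "m n q" for q
              using mR[OF that] wo_trans[OF WO _ n] wo_antisym[OF WO _ n] wo_refl[OF WO, of q] underS_Field1[of q R n]
              by (auto simp: underS_def)
            have "win m n \<longleftrightarrow> (\<exists>q. m n q \<and> hc_of_nat q \<notin> elts (tb q))"
              using win_iff[OF m(2), of n] q by (auto simp: etb)
            also have "\<dots> \<longleftrightarrow> (\<exists>q\<in>?M. \<exists>t\<in>?M. rN2 m (hc_of_nat n) q \<and> (\<exists>b. (b, b) \<in> R \<and> q = hc_of_nat b \<and> t = tb b) \<and> q \<notin> elts t)"
            proof
              assume "\<exists>q. m n q \<and> hc_of_nat q \<notin> elts (tb q)"
              then obtain c where c: "m n c" "hc_of_nat c \<notin> elts (tb c)" by blast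
              show "\<exists>q\<in>?M. \<exists>t\<in>?M. rN2 m (hc_of_nat n) q \<and> (\<exists>b. (b, b) \<in> R \<and> q = hc_of_nat b \<and> t = tb b) \<and> q \<notin> elts t"
                by (rule bexI[of _ "hc_of_nat c"], rule bexI[of _ "tb c"])
                   (use c q[OF c(1)] tq[of c] hn_M[of c] in \<open>auto simp: rN2_def\<close>)
            qed (auto simp: rN2_def)
            finally show ?thesis .
          qed
          have "y \<in> elts (tb b) \<longleftrightarrow> (\<exists>n. y = hc_of_nat n \<and> (n, b) \<in> R \<and> win m n)" by (auto simp: etb)
          also have "\<dots> \<longleftrightarrow> y \<in> ?M \<and> rN2 ?le y (hc_of_nat b) \<and>
            (\<exists>q\<in>?M. \<exists>t\<in>?M. rN2 m y q \<and> (\<exists>b. (b, b) \<in> R \<and> q = hc_of_nat b \<and> t = tb b) \<and> q \<notin> elts t)"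
            unfolding rN2_def[of ?le] hc_of_nat_inject using * hn_M by blast
          finally show ?thesis .
        qed
        then show "elts (tb b) = {y \<in> ?M. rN2 ?le (case_nat y (\<lambda>_. hc_of_nat b) 0) (case_nat y (\<lambda>_. hc_of_nat b) 1) \<and>
            (\<exists>q\<in>?M. \<exists>t\<in>?M. rN2 m (case_nat y (\<lambda>_. hc_of_nat b) 0) q \<and> (\<exists>b. (b, b) \<in> R \<and> q = hc_of_nat b \<and> t = tb b) \<and> q \<notin> elts t)}"
          by auto
      qed
    qed
  qed
  have all: "dfb M (\<lambda>e. \<exists>n. e 0 = hc_of_nat n \<and> P n)" if M: "transM M" "Lset (ot ?R) \<subseteq> M" for M
  proof -
    have g: "goodM M" using M Lomega_le_ot[OF WO] by unfold_locales auto
    interpret goodM M by (rule g)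
    have tM: "tb b \<in> M" if "b \<in> Field R" for b
    proof -
      have "2 * b + 1 \<in> Field ?R" using that by (simp add: Field_osum[OF wo_natle WO])
      then show ?thesis using tb_in[of b] that M(2) by (auto simp: Lset_ot)
    qed
    note [df_intros] = df2D[OF df2_recfn[OF k]] corr[OF g, unfolded One_nat_def]
    have "dfb M (\<lambda>e. \<exists>q\<in>M. \<exists>t\<in>M. rN2 (\<lambda>n v. v = k n) (e 0) q \<and> (\<exists>b. (b, b) \<in> R \<and> q = hc_of_nat b \<and> t = tb b) \<and> q \<in> elts t)"
      by (intro df_intros)
    then show ?thesis
    proof (rule dfb_cong)
      fix e :: "nat \<Rightarrow> hc"
      show "(\<exists>n. e 0 = hc_of_nat n \<and> P n) \<longleftrightarrow>
         (\<exists>q\<in>M. \<exists>t\<in>M. rN2 (\<lambda>n v. v = k n) (e 0) q \<and> (\<exists>b. (b, b) \<in> R \<and> q = hc_of_nat b \<and> t = tb b) \<and> q \<in> elts t)"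
        using kR wo_refl[OF WO] tM by (auto simp: Pm rN2_def etb)
    qed
  qed
  have "computable_wellorder ?R" using computable_wellorder_osum[OF cwo_natle R] .
  then show thesis using that Lomega_le_ot[OF WO] all by blast
qed

text \<open>Each section enters one level above the levels that define \<open>K\<close>; a further
  level collects the whole sequence. Such families of sets are what \<open>clause_fm\<close> takes
  as parameters.\<close>

lemma HYP_sections_in_L:
  assumes "ebp2 K"
  shows "hcset (range (\<lambda>j. hc_of_nat_set {x. K j x})) \<in> Lset omega1ck"
    and "hc_of_nat_set {x. K j x} \<in> Lset omega1ck"
proof -
  obtain R where R: "computable_wellorder R" "Lomega \<subseteq> Lset (ot R)"
    and D: "\<And>M. transM M \<Longrightarrow> Lset (ot R) \<subseteq> M \<Longrightarrow> dfb M (\<lambda>e. \<exists>n. e 0 = hc_of_nat n \<and> K (pfst n) (psnd n))"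
    using ebp_definable[OF assms[unfolded ebp2_def]] by blast
  have WO: "Well_order R" using R by (simp add: computable_wellorder_iff)
  have K2: "dfb M (\<lambda>e. \<exists>j x. e 0 = hc_of_nat j \<and> e 1 = hc_of_nat x \<and> K j x)" if M: "transM M" "Lset (ot R) \<subseteq> M" for M
  proof -
    interpret goodM M using M R(2) by unfold_locales auto
    note [df_intros] = df3D[OF df_pe] dfb_rename[OF D[OF M], where f = "\<lambda>_. 0"]
    have "dfb M (\<lambda>e. \<exists>w\<in>M. rN3 (\<lambda>a b x. x = pe a b) (e 0) (e 1) w \<and> (\<exists>n. w = hc_of_nat n \<and> K (pfst n) (psnd n)))"
      by (intro df_intros)
    then show ?thesis by (rule dfb_cong) (auto simp: rN3_def)
  qed
  let ?s = "\<lambda>j. hc_of_nat_set {x. K j x}"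
  have s1: "?s j \<in> DPow (Lset (ot R))" for j
  proof -
    interpret goodM "Lset (ot R)" using transM_Lset R(2) by unfold_locales auto
    have "dfb (Lset (ot R)) (\<lambda>e. \<exists>j x. e 1 = hc_of_nat j \<and> e 0 = hc_of_nat x \<and> K j x)"
      using dfb_rename[OF K2[OF transM_Lset order_refl], where f = "\<lambda>i. if i = 0 then 1 else 0"] by simp
    then show ?thesis
      by (rule DPow_dfbI[where e = "\<lambda>_. hc_of_nat j"]) (auto simp: elts_hc_of_nat_set)
  qed
  then show "hc_of_nat_set {x. K j x} \<in> Lset omega1ck" using R(1) unfolding Lset_omega1ck by blast
  let ?R = "osum R onepoint"
  let ?M = "Lset (ot ?R)"
  have RM: "Lset (ot R) \<subseteq> ?M" "DPow (Lset (ot R)) \<subseteq> ?M"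
    using Lset_osum1[OF WO wo_onepoint] DPow_ot_le[OF WO] by auto
  interpret goodM ?M using transM_Lset R(2) RM by unfold_locales auto
  have [df_intros]: "dfb ?M (\<lambda>e. \<exists>i n. e (Suc 0) = hc_of_nat i \<and> e 0 = hc_of_nat n \<and> K i n)"
    using dfb_rename[OF K2[OF transM_Lset RM(1)], where f = "\<lambda>i. if i = 0 then Suc 0 else 0"] by simp
  have "dfb ?M (\<lambda>e. \<exists>j\<in>?M. j \<in> N \<and> (\<forall>x\<in>?M. x \<in> elts (e 0) \<longleftrightarrow> (\<exists>i n. j = hc_of_nat i \<and> x = hc_of_nat n \<and> K i n)))"
    by (intro df_intros)
  then have "hcset (range ?s) \<in> DPow ?M"
  proof (rule DPow_dfbI[where e = "\<lambda>_. hc_of_nat 0"])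
    have star: "y \<in> range ?s \<longleftrightarrow> y \<in> ?M \<and> (\<exists>j\<in>?M. j \<in> N \<and> (\<forall>x\<in>?M. x \<in> elts y \<longleftrightarrow> (\<exists>i n. j = hc_of_nat i \<and> x = hc_of_nat n \<and> K i n)))" for y
    proof
      assume "y \<in> range ?s"
      then obtain j where y: "y = ?s j" by blast
      then have "y \<in> ?M" using s1 RM by blast
      moreover have "\<forall>x\<in>?M. x \<in> elts y \<longleftrightarrow> (\<exists>i n. hc_of_nat j = hc_of_nat i \<and> x = hc_of_nat n \<and> K i n)"
        by (auto simp: y elts_hc_of_nat_set)
      ultimately show "y \<in> ?M \<and> (\<exists>j\<in>?M. j \<in> N \<and> (\<forall>x\<in>?M. x \<in> elts y \<longleftrightarrow> (\<exists>i n. j = hc_of_nat i \<and> x = hc_of_nat n \<and> K i n)))"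
        using hn_M by blast
    next
      assume y: "y \<in> ?M \<and> (\<exists>j\<in>?M. j \<in> N \<and> (\<forall>x\<in>?M. x \<in> elts y \<longleftrightarrow> (\<exists>i n. j = hc_of_nat i \<and> x = hc_of_nat n \<and> K i n)))"
      then obtain j where j: "\<forall>x\<in>?M. x \<in> elts y \<longleftrightarrow> (\<exists>i n. hc_of_nat j = hc_of_nat i \<and> x = hc_of_nat n \<and> K i n)" by blast
      have "elts y = elts (?s j)"
      proof (rule set_eqI)
        fix x show "x \<in> elts y \<longleftrightarrow> x \<in> elts (?s j)"
          using j elts_M[of y x] y hn_M by (auto simp: elts_hc_of_nat_set)
      qed
      then have "y = ?s j" by (rule hc_eqI)
      then show "y \<in> range ?s" by blast
    qed
    show "elts (hcset (range ?s)) = {y \<in> ?M. \<exists>j\<in>?M. j \<in> N \<and>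
        (\<forall>x\<in>?M. x \<in> elts (case_nat y (\<lambda>_. hc_of_nat 0) 0) \<longleftrightarrow> (\<exists>i n. j = hc_of_nat i \<and> x = hc_of_nat n \<and> K i n))}"
      by (subst elts_hcset, simp, rule set_eqI, unfold mem_Collect_eq nat.case, rule star)
  qed auto
  then show "hcset (range ?s) \<in> Lset omega1ck"
    unfolding Lset_omega1ck using computable_wellorder_osum[OF R(1) cwo_onepoint] by blast
qed

lemma HYP_subset_L: "X \<in> HYP \<Longrightarrow> hc_of_nat_set X \<in> Lset omega1ck"
proof -
  assume "X \<in> HYP"
  then have [eb_intros]: "recfn f \<Longrightarrow> ebp (\<lambda>n. f n \<in> X)" for f using ebp_comp HYP_iff_ebp by blast
  have "ebp2 (\<lambda>j x. x \<in> X)" unfolding ebp2_def by (intro eb_intros rec_intros)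
  from HYP_sections_in_L(2)[OF this] show ?thesis by simp
qed

section \<open>Constructible sets of naturals are hyperarithmetic\<close>

subsection \<open>Codes of formulas and terms\<close>

text \<open>Decoding is total, with all tags from 4 on read as quantifiers, so no test for
  well-formed codes enters the games.\<close>

function dec_fm :: "nat \<Rightarrow> fm" where
  "dec_fm n = (if pfst n = 0 then Mem (pfst (psnd n)) (psnd (psnd n))
     else if pfst n = 1 then Equ (pfst (psnd n)) (psnd (psnd n))
     else if pfst n = 2 then Neg (dec_fm (psnd n))
     else if pfst n = 3 then Conj (dec_fm (pfst (psnd n))) (dec_fm (psnd (psnd n)))
     else Exi (dec_fm (psnd n)))"
  by auto
termination
proof (relation "measure id")
  fix n assume "pfst n \<noteq> 0"
  then have "psnd n < n" by (simp add: psnd_less)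
  moreover have "pfst (psnd n) \<le> psnd n" "psnd (psnd n) \<le> psnd n" by (rule pfst_le psnd_le)+
  ultimately show "(psnd n, n) \<in> measure id" "(pfst (psnd n), n) \<in> measure id" "(psnd (psnd n), n) \<in> measure id"
    by auto
qed (auto simp: psnd_less)

declare dec_fm.simps [simp del]

lemma dec_fm_simps:
  "dec_fm (pe 0 r) = Mem (pfst r) (psnd r)" "dec_fm (pe (Suc 0) r) = Equ (pfst r) (psnd r)"
  "dec_fm (pe 2 r) = Neg (dec_fm r)" "dec_fm (pe 3 r) = Conj (dec_fm (pfst r)) (dec_fm (psnd r))"
  "4 \<le> k \<Longrightarrow> dec_fm (pe k r) = Exi (dec_fm r)"
  by (subst dec_fm.simps, simp)+

lemma dec_fm_surj: "\<exists>n. dec_fm n = p"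
proof (induction p)
  case (Mem i j) show ?case by (rule exI[of _ "pe 0 (pe i j)"]) (simp add: dec_fm_simps)
next
  case (Equ i j) show ?case by (rule exI[of _ "pe 1 (pe i j)"]) (simp add: dec_fm_simps)
next
  case (Neg p) then show ?case by (metis dec_fm_simps(3))
next
  case (Conj p q) then show ?case by (metis dec_fm_simps(4) pfst_pe psnd_pe)
next
  case (Exi p) then show ?case by (metis dec_fm_simps(5) order_refl)
qed

abbreviation lev :: "nat \<Rightarrow> nat" where "lev t \<equiv> pfst t"
abbreviation tfm :: "nat \<Rightarrow> nat" where "tfm t \<equiv> pfst (psnd t)"
abbreviation tps :: "nat \<Rightarrow> nat" where "tps t \<equiv> psnd (psnd t)"

lemma nthc_lt: "i < lenc s \<Longrightarrow> nthc s i < s"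
  by (metis lenc_list_encode list_encode_surj nthc_less nthc_list_encode nth_mem)

lemma pe_0_0: "pe 0 0 = 0" by (simp add: prod_encode_def)

lemma pfst_0 [simp]: "pfst 0 = 0" and psnd_0 [simp]: "psnd 0 = 0"
  by (metis pe_0_0 pfst_pe) (metis pe_0_0 psnd_pe)

text \<open>
  A number \<open>t\<close> codes the subset of the level \<open>lev t\<close> defined by the formula \<open>tfm t\<close>
  with parameters \<open>tps t\<close>. Parameters that are missing or not below \<open>lev t\<close> are read as the
  empty set, so that every number is a code.
\<close>

function tval :: "nat rel \<Rightarrow> nat \<Rightarrow> hc" where
  "tval R t = hcset {y \<in> Lset (col R (lev t)). satsf (Lset (col R (lev t)))
     (case_nat y (\<lambda>i. if i < lenc (tps t) \<and> lev (nthc (tps t) i) \<in> underS R (lev t)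
        then tval R (nthc (tps t) i) else hcset {})) (dec_fm (tfm t))}"
  by auto
termination
proof (relation "measure snd")
  fix R :: "nat rel" and t i
  assume "i < lenc (tps t) \<and> lev (nthc (tps t) i) \<in> underS R (lev t)"
  then have "nthc (tps t) i < tps t" by (simp add: nthc_lt)
  also have "\<dots> \<le> t" using psnd_le[of "psnd t"] psnd_le[of t] by linarith
  finally show "((R, nthc (tps t) i), R, t) \<in> measure snd" by simp
qed auto

declare tval.simps [simp del]

text \<open>The default term 0 matches the default value in \<open>tval\<close>: it denotes the
  empty set when 0 is the least element of the order.\<close>

definition lookup :: "(nat \<Rightarrow> nat \<Rightarrow> bool) \<Rightarrow> nat \<Rightarrow> nat \<Rightarrow> nat \<Rightarrow> nat" where
  "lookup lt b s i = (if i < lenc s \<and> lt (lev (nthc s i)) b then nthc s i else 0)"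

text \<open>Three kinds of statements: truth of the formula \<open>p\<close> at level
  \<open>b\<close> with parameter terms \<open>s\<close>, then membership and inequality of the
  values of two terms. Inequality rather than equality is basic because it has witnesses.\<close>

abbreviation (input) SatP :: "nat \<Rightarrow> nat \<Rightarrow> nat \<Rightarrow> nat" where "SatP b p s \<equiv> pe 0 (pe b (pe p s))"
abbreviation (input) InP :: "nat \<Rightarrow> nat \<Rightarrow> nat" where "InP s t \<equiv> pe 1 (pe s t)"
abbreviation (input) NeP :: "nat \<Rightarrow> nat \<Rightarrow> nat" where "NeP s t \<equiv> pe 2 (pe s t)"

text \<open>\<open>w\<close> is a term witnessing a quantifier, a term of lower level equal to the
  alleged member, or a tagged element on which two sets differ. For atomic formulas it carries the
  looked-up terms: \<open>lookup\<close> depends on \<open>lt\<close>, which may be merely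
  game-definable, while the premises must be recursive in \<open>x\<close> and
  \<open>w\<close>.\<close>

definition LI :: "(nat \<Rightarrow> nat \<Rightarrow> bool) \<Rightarrow> nat \<Rightarrow> nat \<Rightarrow> bool" where
  "LI lt x w \<longleftrightarrow>
     (pfst x = 0 \<and>
        (pfst (pfst (psnd (psnd x))) \<le> 1 \<and>
           pfst w = lookup lt (pfst (psnd x)) (psnd (psnd (psnd x))) (pfst (psnd (pfst (psnd (psnd x))))) \<and>
           psnd w = lookup lt (pfst (psnd x)) (psnd (psnd (psnd x))) (psnd (psnd (pfst (psnd (psnd x))))) \<and>
           lt (lev (pfst w)) (pfst (psnd x)) \<and> lt (lev (psnd w)) (pfst (psnd x)) \<or>
         pfst (pfst (psnd (psnd x))) = 2 \<or> pfst (pfst (psnd (psnd x))) = 3 \<or>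
         4 \<le> pfst (pfst (psnd (psnd x))) \<and> lt (lev w) (pfst (psnd x)))) \<or>
     (pfst x = 1 \<and> lt (lev w) (lev (psnd (psnd x)))) \<or>
     (pfst x = 2 \<and> (pfst w = 0 \<and> lt (lev (psnd w)) (lev (pfst (psnd x))) \<or>
        pfst w \<noteq> 0 \<and> lt (lev (psnd w)) (lev (psnd (psnd x)))))"

definition LA :: "nat \<Rightarrow> nat \<Rightarrow> nat" where
  "LA x w = (let k = pfst x; b = pfst (psnd x); p = pfst (psnd (psnd x)); s = psnd (psnd (psnd x));
       t = pfst (psnd x); u = psnd (psnd x) in
     if k = 0 then
       (if pfst p = 0 then 2 * InP (pfst w) (psnd w)
        else if pfst p = 1 then 2 * NeP (pfst w) (psnd w) + 1
        else if pfst p = 2 then 2 * SatP b (psnd p) s + 1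
        else if pfst p = 3 then 2 * SatP b (pfst (psnd p)) s
        else 2 * SatP b (psnd p) (consc w s))
     else if k = 1 then 2 * NeP w t + 1
     else if pfst w = 0 then 2 * SatP (lev t) (tfm t) (consc (psnd w) (tps t))
     else 2 * SatP (lev u) (tfm u) (consc (psnd w) (tps u)))"

definition LB :: "nat \<Rightarrow> nat \<Rightarrow> nat" where
  "LB x w = (let k = pfst x; b = pfst (psnd x); p = pfst (psnd (psnd x)); s = psnd (psnd (psnd x));
       t = pfst (psnd x); u = psnd (psnd x) in
     if k = 0 then (if pfst p = 3 then 2 * SatP b (psnd (psnd p)) s else LA x w)
     else if k = 1 then 2 * SatP (lev u) (tfm u) (consc w (tps u))
     else if pfst w = 0 then 2 * InP (psnd w) u + 1
     else 2 * InP (psnd w) t + 1)"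

lemma LA_recfn: "recfn (\<lambda>z. LA (pfst z) (psnd z))"
  unfolding LA_def Let_def by (intro rec_intros)

lemma LB_recfn: "recfn (\<lambda>z. LB (pfst z) (psnd z))"
  unfolding LB_def LA_def Let_def by (intro rec_intros)

definition ebp3 :: "(nat \<Rightarrow> nat \<Rightarrow> nat \<Rightarrow> bool) \<Rightarrow> bool" where
  "ebp3 r \<longleftrightarrow> ebp (\<lambda>z. r (pfst z) (pfst (psnd z)) (psnd (psnd z)))"

lemma ebp3_comp: "ebp3 r \<Longrightarrow> recfn f \<Longrightarrow> recfn g \<Longrightarrow> recfn h \<Longrightarrow> ebp (\<lambda>n. r (f n) (g n) (h n))"
  unfolding ebp3_def using ebp_comp[of "\<lambda>z. r (pfst z) (pfst (psnd z)) (psnd (psnd z))" "\<lambda>n. pe (f n) (pe (g n) (h n))"]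
  by (simp add: rec_intros)

text \<open>Uniform in \<open>e\<close>, because a single tree will refer to the truth games along
  all computable linear orders.\<close>

lemma ebp3_Lmv:
  assumes "ebp3 lt" shows "ebp3 (\<lambda>e. rule_mv (LI (lt e)) LA LB)"
proof -
  note [eb_intros] = ebp3_comp[OF assms]
  have lk: "x = lookup l b s i \<longleftrightarrow> (i < lenc s \<and> l (lev (nthc s i)) b \<and> x = nthc s i) \<or> (\<not> (i < lenc s \<and> l (lev (nthc s i)) b) \<and> x = 0)"
    for x l b s i by (auto simp: lookup_def)
  have I: "ebp3 (\<lambda>e. LI (lt e))"
    unfolding ebp3_def LI_def lk by (intro eb_intros rec_intros)
  have [rec_intros]: "recfn f \<Longrightarrow> recfn g \<Longrightarrow> recfn (\<lambda>n. LA (f n) (g n))" for f g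
    using rec_comp[OF LA_recfn, of "\<lambda>n. pe (f n) (g n)"] by (simp add: rec_intros)
  have [rec_intros]: "recfn f \<Longrightarrow> recfn g \<Longrightarrow> recfn (\<lambda>n. LB (f n) (g n))" for f g
    using rec_comp[OF LB_recfn, of "\<lambda>n. pe (f n) (g n)"] by (simp add: rec_intros)
  note [eb_intros] = ebp3_comp[OF I]
  show ?thesis unfolding ebp3_def rule_mv_def by (intro eb_intros rec_intros)
qed

text \<open>Well-foundedness leaves the recursion of a rule system just one solution on a set of
  statements closed under premises.\<close>

lemma rule_holds_eqI:
  assumes wf: "wf (rule_rel I A B)"
    and sem: "\<And>x. good x \<Longrightarrow> sem x \<longleftrightarrow> (\<exists>w. I x w \<and> (sem (A x w div 2) \<longleftrightarrow> even (A x w)) \<and> (sem (B x w div 2) \<longleftrightarrow> even (B x w)))"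
    and closed: "\<And>x w. good x \<Longrightarrow> I x w \<Longrightarrow> good (A x w div 2) \<and> good (B x w div 2)"
  shows "good x \<Longrightarrow> rule_holds I A B x \<longleftrightarrow> sem x"
proof (induction x rule: wf_induct_rule[OF wf])
  case (1 x)
  have "rule_holds I A B (A x w div 2) = sem (A x w div 2)" "rule_holds I A B (B x w div 2) = sem (B x w div 2)"
    if "I x w" for w
    using 1(1)[of "A x w div 2"] 1(1)[of "B x w div 2"] closed[OF 1(2) that] that by (auto simp: rule_rel_def)
  then show ?case unfolding sem[OF 1(2)] rule_holds_iff[OF wf, of x] by blast
qed

lemma hc_neq_iff: "x \<noteq> y \<longleftrightarrow> (\<exists>z. z \<in> elts x \<and> z \<notin> elts y \<or> z \<in> elts y \<and> z \<notin> elts x)"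
proof -
  have "x = y \<longleftrightarrow> elts x = elts y" using hc_eqI by auto
  then show ?thesis by blast
qed

section \<open>Terms for the elements of the levels, and correctness of the truth game\<close>

locale levels =
  fixes R :: "nat rel"
  assumes WO: "Well_order R" and zero: "0 \<in> Field R" "underS R 0 = {}"
begin

abbreviation lt :: "nat \<Rightarrow> nat \<Rightarrow> bool" where "lt a b \<equiv> a \<in> underS R b"
abbreviation Lv :: "nat \<Rightarrow> hc set" where "Lv b \<equiv> Lset (col R b)"

lemma lt_0: assumes "b \<in> Field R" "b \<noteq> 0" shows "lt 0 b"
proof -
  have "b \<notin> underS R 0" using zero(2) by blast
  then show ?thesis using wo_total[OF WO zero(1) assms(1)] assms(2) by (simp add: underS_def)
qed

lemma lt_pos: "lt a b \<Longrightarrow> 0 < b"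
  using zero(2) by (cases "b = 0") auto

lemma Lv_0: "Lv 0 = {}"
  by (simp add: Lset_col[OF WO, of 0] zero)

lemma tval_0: "tval R 0 = hcset {}"
  by (subst tval.simps) (simp add: Lv_0)

lemma tval_eq: "elts (tval R t) = {y \<in> Lv (lev t). satsf (Lv (lev t))
    (case_nat y (\<lambda>i. tval R (lookup lt (lev t) (tps t) i))) (dec_fm (tfm t))}"
proof -
  have "(\<lambda>i. if i < lenc (tps t) \<and> lev (nthc (tps t) i) \<in> underS R (lev t)
        then tval R (nthc (tps t) i) else hcset {}) = (\<lambda>i. tval R (lookup lt (lev t) (tps t) i))"
    by (auto simp: lookup_def tval_0)
  moreover have "countable {y \<in> Lv (lev t). Q y}" for Q
    by (rule countable_subset[OF _ countable_Lset]) auto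
  ultimately show ?thesis by (subst tval.simps) (simp add: elts_hcset)
qed

lemma lookup_lt: "b \<in> Field R \<Longrightarrow> b \<noteq> 0 \<Longrightarrow> lt (lev (lookup lt b s i)) b"
  using lt_0 by (auto simp: lookup_def)

lemma Lv_DPow: "lt a b \<Longrightarrow> DPow (Lv a) \<subseteq> Lv b"
  by (auto simp: Lset_col[OF WO, of b])

lemma lookup_less: "lookup lt b s i = 0 \<or> lookup lt b s i < s"
  using nthc_lt by (auto simp: lookup_def)

lemma tval_in: "lev t \<in> Field R \<Longrightarrow> tval R t \<in> DPow (Lv (lev t))"
proof (induction t rule: less_induct)
  case (less t)
  show ?case
  proof (cases "lev t = 0")
    case True
    then have "elts (tval R t) = {}" by (simp add: tval_eq Lv_0)
    then show ?thesis by (rule empty_in_DPow)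
  next
    case False
    let ?e = "\<lambda>i. tval R (lookup lt (lev t) (tps t) i)"
    have "?e i \<in> Lv (lev t)" for i
    proof -
      let ?u = "lookup lt (lev t) (tps t) i"
      have l: "lt (lev ?u) (lev t)" using lookup_lt less.prems False by blast
      have "tval R ?u \<in> DPow (Lv (lev ?u))"
      proof (cases "?u = 0")
        case True
        then show ?thesis by (simp add: tval_0 empty_in_DPow)
      next
        case nz: False
        then have "?u < tps t" using lookup_less[of "lev t" "tps t" i] by auto
        then have "?u < t" using psnd_le[of "psnd t"] psnd_le[of t] by linarith
        then show ?thesis using less.IH underS_Field1[OF l] by blast
      qed
      then show ?thesis using Lv_DPow[OF l] by blast
    qed
    then show ?thesis using tval_eq[of t] by (intro DPow_satsfI) auto
  qed
qed

lemma tval_Lv: "lt (lev t) b \<Longrightarrow> tval R t \<in> Lv b"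
  using tval_in[of t] Lv_DPow[of "lev t" b] underS_Field1[of "lev t" R b] by blast

lemma DPow_term: "\<forall>x \<in> DPow (Lv a). \<exists>t. lev t = a \<and> tval R t = x"
proof (induction a rule: wo_induct[OF WO])
  case (1 a)
  show ?case
  proof
    fix x assume "x \<in> DPow (Lv a)"
    then obtain p ps where ps: "set ps \<subseteq> Lv a" "arity p \<le> Suc (length ps)"
      "elts x = {y \<in> Lv a. satsf (Lv a) (case_nat y ((!) ps)) p}" by (auto simp: DPow_iff)
    obtain q where q: "dec_fm q = p" using dec_fm_surj by blast
    have "\<exists>t. lt (lev t) a \<and> tval R t = y" if "y \<in> Lv a" for y
      using that 1 unfolding Lset_col[OF WO, of a] by (metis UN_E)
    then obtain g where g: "\<And>y. y \<in> Lv a \<Longrightarrow> lt (lev (g y)) a \<and> tval R (g y) = y" by metis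
    define t where "t = pe a (pe q (list_encode (map g ps)))"
    have lk: "tval R (lookup lt a (tps t) i) = ps ! i" if "i < length ps" for i
    proof -
      have "ps ! i \<in> Lv a" using ps(1) nth_mem[OF that] by blast
      then show ?thesis using that g[of "ps ! i"] by (simp add: t_def lookup_def nthc_list_encode)
    qed
    have "satsf (Lv a) (case_nat y ((!) ps)) p = satsf (Lv a) (case_nat y (\<lambda>i. tval R (lookup lt a (tps t) i))) p" for y
      by (rule satsf_cong) (use lk ps(2) in \<open>auto split: nat.split\<close>)
    then have "elts (tval R t) = elts x" unfolding tval_eq ps(3) by (simp add: t_def q)
    then have "tval R t = x" by (rule hc_eqI)
    then show "\<exists>t. lev t = a \<and> tval R t = x" by (intro exI[of _ t]) (simp add: t_def)
  qed
qed

lemma Lv_eq: "Lv b = {tval R t | t. lt (lev t) b}"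
proof
  show "Lv b \<subseteq> {tval R t | t. lt (lev t) b}"
    using DPow_term unfolding Lset_col[OF WO, of b] by fastforce
  show "{tval R t | t. lt (lev t) b} \<subseteq> Lv b" using tval_Lv by blast
qed

lemma Lot_eq: "Lset (ot R) = {tval R t | t. lev t \<in> Field R}"
proof
  show "Lset (ot R) \<subseteq> {tval R t | t. lev t \<in> Field R}"
    using DPow_term unfolding Lset_ot by fastforce
  show "{tval R t | t. lev t \<in> Field R} \<subseteq> Lset (ot R)" using tval_in by (auto simp: Lset_ot)
qed

text \<open>A statement about two terms is measured by the multiset of their levels, a truth
  statement by its level and then its formula. An atomic formula replaces its level by two smaller
  ones, passing to an element lowers one of two levels, and passing from a term to its defining
  formula drops the other level.\<close>

lemma wf_L: "wf (rule_rel (LI lt) LA LB)"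
proof -
  let ?r = "{(a, b). lt a b}"
  have "?r \<subseteq> R - Id" by (auto simp: underS_def)
  then have "wf ?r" using WO by (meson well_order_on_def wf_subset)
  define f where "f x = (if pfst x = 0 then ({#pfst (psnd x)#}, pfst (psnd (psnd x)))
     else ({#lev (pfst (psnd x)), lev (psnd (psnd x))#}, 0))" for x
  have wf: "wf (inv_image (mult ?r <*lex*> less_than) f)" using wf_mult[OF \<open>wf ?r\<close>] by auto
  have m1: "({#a#}, {#a, b#}) \<in> mult ?r" "({#b#}, {#a, b#}) \<in> mult ?r" for a b
    using one_step_implies_mult[of "{#b#}" "{#}" ?r "{#a#}"] one_step_implies_mult[of "{#a#}" "{#}" ?r "{#b#}"]
    by (auto simp: add_mset_commute[of b a])
  have m2: "({#a, c#}, {#b, c#}) \<in> mult ?r" "({#c, a#}, {#c, b#}) \<in> mult ?r" "({#a, c#}, {#c, b#}) \<in> mult ?r"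
     "({#c, a#}, {#b, c#}) \<in> mult ?r" if "lt a b" for a b c
    using one_step_implies_mult[of "{#b#}" "{#a#}" ?r "{#c#}"] that by (auto simp: add_mset_commute)
  have m3: "({#a, c#}, {#b#}) \<in> mult ?r" if "lt a b" "lt c b" for a b c
    using one_step_implies_mult[of "{#b#}" "{#a, c#}" ?r "{#}"] that by auto
  have p: "psnd p < p" "pfst (psnd p) < p" "psnd (psnd p) < p" if "pfst p \<noteq> 0" for p
    using psnd_less[of p] that pfst_le[of "psnd p"] psnd_le[of "psnd p"] by auto
  have "(LA x w div 2, x) \<in> inv_image (mult ?r <*lex*> less_than) f \<and> (LB x w div 2, x) \<in> inv_image (mult ?r <*lex*> less_than) f"
    if I: "LI lt x w" for x w
  proof -
    obtain k b q s where x: "x = pe k (pe b (pe q s))" by (metis pe_pfst_psnd)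
    consider "k = 0" "pfst q = 0" | "k = 0" "pfst q = 1" | "k = 0" "pfst q = 2" | "k = 0" "pfst q = 3" | "k = 0" "4 \<le> pfst q"
      | "k = 1" | "k = 2" "pfst w = 0" | "k = 2" "pfst w \<noteq> 0"
      using I unfolding x LI_def by simp linarith
    then show ?thesis
      by cases (use I p[of q] m1 m2 m3 in \<open>auto simp: x f_def LI_def LA_def LB_def\<close>)
  qed
  then have "rule_rel (LI lt) LA LB \<subseteq> inv_image (mult ?r <*lex*> less_than) f" unfolding rule_rel_def by blast
  then show ?thesis using wf wf_subset by blast
qed

text \<open>Truth at level 0 is excluded: there \<open>lookup\<close> has no term of smaller level
  to return. A premise about truth at a new level comes with a term of smaller level, so the
  condition persists.\<close>

definition Lgood :: "nat \<Rightarrow> bool" where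
  "Lgood x \<longleftrightarrow> (if pfst x = 0 then pfst (psnd x) \<in> Field R \<and> pfst (psnd x) \<noteq> 0
     else (pfst x = 1 \<or> pfst x = 2) \<and> lev (pfst (psnd x)) \<in> Field R \<and> lev (psnd (psnd x)) \<in> Field R)"

definition Lsem :: "nat \<Rightarrow> bool" where
  "Lsem x \<longleftrightarrow> (if pfst x = 0 then satsf (Lv (pfst (psnd x)))
       (\<lambda>i. tval R (lookup lt (pfst (psnd x)) (psnd (psnd (psnd x))) i)) (dec_fm (pfst (psnd (psnd x))))
     else if pfst x = 1 then tval R (pfst (psnd x)) \<in> elts (tval R (psnd (psnd x)))
     else tval R (pfst (psnd x)) \<noteq> tval R (psnd (psnd x)))"

lemma Lsem_simps:
  "Lsem (SatP b p s) \<longleftrightarrow> satsf (Lv b) (\<lambda>i. tval R (lookup lt b s i)) (dec_fm p)"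
  "Lsem (InP s t) \<longleftrightarrow> tval R s \<in> elts (tval R t)" "Lsem (NeP s t) \<longleftrightarrow> tval R s \<noteq> tval R t"
  by (simp_all add: Lsem_def)

lemma lookup_consc: "lt (lev w) b \<Longrightarrow>
    (\<lambda>i. tval R (lookup lt b (consc w s) i)) = case_nat (tval R w) (\<lambda>i. tval R (lookup lt b s i))"
  by (auto simp: lookup_def split: nat.split)

lemma tval_mem_iff: "x \<in> elts (tval R t) \<longleftrightarrow>
    (\<exists>w. lt (lev w) (lev t) \<and> x = tval R w \<and> Lsem (SatP (lev t) (tfm t) (consc w (tps t))))"
proof -
  have "x \<in> elts (tval R t) \<longleftrightarrow> (\<exists>w. lt (lev w) (lev t) \<and> x = tval R w \<and>
     satsf (Lv (lev t)) (case_nat (tval R w) (\<lambda>i. tval R (lookup lt (lev t) (tps t) i))) (dec_fm (tfm t)))"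
    unfolding tval_eq[of t] Lv_eq[of "lev t"] by blast
  then show ?thesis unfolding Lsem_simps by (simp add: lookup_consc cong: conj_cong)
qed

lemma LT_iff: "Lgood x \<Longrightarrow> rule_holds (LI lt) LA LB x \<longleftrightarrow> Lsem x"
proof (rule rule_holds_eqI[OF wf_L])
  fix x w assume g: "Lgood x" and I: "LI lt x w"
  show "Lgood (LA x w div 2) \<and> Lgood (LB x w div 2)"
  proof -
    obtain k b q s where x: "x = pe k (pe b (pe q s))" by (metis pe_pfst_psnd)
    consider "k = 0" "pfst q = 0" | "k = 0" "pfst q = 1" | "k = 0" "pfst q = 2" | "k = 0" "pfst q = 3" | "k = 0" "4 \<le> pfst q"
      | "k = 1" | "k = 2" "pfst w = 0" | "k = 2" "pfst w \<noteq> 0"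
      using I unfolding x LI_def by simp linarith
    then show ?thesis
      by cases (use I g zero underS_Field1[of _ R] in \<open>auto simp: x Lgood_def LI_def LA_def LB_def dest: lt_pos\<close>)
  qed
next
  fix x assume g: "Lgood x"
  let ?rhs = "\<exists>w. LI lt x w \<and> (Lsem (LA x w div 2) \<longleftrightarrow> even (LA x w)) \<and> (Lsem (LB x w div 2) \<longleftrightarrow> even (LB x w))"
  obtain k b q s where x: "x = pe k (pe b (pe q s))" by (metis pe_pfst_psnd)
  have half: "Suc (2 * n) div 2 = n" for n :: nat by simp
  note Ls = Lsem_simps[unfolded One_nat_def]
  consider "k = 0" | "k = 1" | "k = 2" using g by (fastforce simp: x Lgood_def split: if_splits)
  then show "Lsem x \<longleftrightarrow> ?rhs"
  proof cases
    case 1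
    have b: "b \<in> Field R" "b \<noteq> 0" using g 1 by (auto simp: x Lgood_def)
    obtain j r where q: "q = pe j r" by (metis pe_pfst_psnd)
    let ?a = "lookup lt b s (pfst r)" and ?c = "lookup lt b s (psnd r)"
    have I: "LI lt x w \<longleftrightarrow> w = pe ?a ?c" if "j \<le> 1" for w
    proof -
      have "LI lt x w \<longleftrightarrow> pfst w = ?a \<and> psnd w = ?c \<and> lt (lev (pfst w)) b \<and> lt (lev (psnd w)) b"
        using that by (auto simp: x 1 q LI_def)
      also have "\<dots> \<longleftrightarrow> w = pe ?a ?c"
        using lookup_lt[OF b, of s "pfst r"] lookup_lt[OF b, of s "psnd r"] pe_eq_iff[of ?a ?c w] by metis
      finally show ?thesis .
    qed
    consider "j = 0" | "j = 1" | "j = 2" | "j = 3" | "4 \<le> j" by linarith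
    then show ?thesis
    proof cases
      case j: 1
      then show ?thesis using I by (simp add: x 1 q LA_def LB_def Ls dec_fm_simps)
    next
      case j: 2
      then show ?thesis using I by (simp add: x 1 q LA_def LB_def Ls dec_fm_simps half)
    next
      case j: 3
      show ?thesis by (simp add: x 1 q j LI_def LA_def LB_def Ls dec_fm_simps half)
    next
      case j: 4
      show ?thesis by (simp add: x 1 q j LI_def LA_def LB_def Ls dec_fm_simps)
    next
      case j: 5
      have "Lsem x \<longleftrightarrow> (\<exists>w. lt (lev w) b \<and> satsf (Lv b) (\<lambda>i. tval R (lookup lt b (consc w s) i)) (dec_fm r))"
        unfolding x q using 1 j b Lv_eq[of b] lookup_consc by (simp add: Ls dec_fm_simps) (metis (mono_tags, lifting) mem_Collect_eq)
      then show ?thesis using j by (simp add: x 1 q LI_def LA_def LB_def Ls)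
    qed
  next
    case 2
    have "Lsem x \<longleftrightarrow> (\<exists>w. lt (lev w) (lev (pe q s)) \<and> tval R b = tval R w \<and>
        Lsem (SatP (lev (pe q s)) (tfm (pe q s)) (consc w (tps (pe q s)))))"
      unfolding x 2 Lsem_simps(2) by (rule tval_mem_iff)
    then show ?thesis by (auto simp: x 2 LI_def LA_def LB_def Ls half)
  next
    case 3
    let ?t = b and ?u = "pe q s"
    have "Lsem x \<longleftrightarrow> (\<exists>y. y \<in> elts (tval R ?t) \<and> y \<notin> elts (tval R ?u) \<or> y \<in> elts (tval R ?u) \<and> y \<notin> elts (tval R ?t))"
      unfolding x 3 Lsem_simps(3) by (rule hc_neq_iff)
    also have "\<dots> \<longleftrightarrow> (\<exists>w. lt (lev w) (lev ?t) \<and> Lsem (SatP (lev ?t) (tfm ?t) (consc w (tps ?t))) \<and> \<not> Lsem (InP w ?u)) \<or>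
      (\<exists>w. lt (lev w) (lev ?u) \<and> Lsem (SatP (lev ?u) (tfm ?u) (consc w (tps ?u))) \<and> \<not> Lsem (InP w ?t))"
    proof -
      have ex: "(\<exists>y. y \<in> elts (tval R t) \<and> Q y) \<longleftrightarrow>
          (\<exists>w. lt (lev w) (lev t) \<and> Lsem (SatP (lev t) (tfm t) (consc w (tps t))) \<and> Q (tval R w))" for t Q
        unfolding tval_mem_iff[of _ t] by blast
      show ?thesis by (simp only: ex_disj_distrib ex Lsem_simps(2))
    qed
    also have "\<dots> \<longleftrightarrow> ?rhs"
    proof -
      have "?rhs \<longleftrightarrow> (\<exists>w. pfst w = 0 \<and> lt (lev (psnd w)) (lev ?t) \<and> Lsem (SatP (lev ?t) (tfm ?t) (consc (psnd w) (tps ?t))) \<and> \<not> Lsem (InP (psnd w) ?u)) \<or>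
        (\<exists>w. pfst w \<noteq> 0 \<and> lt (lev (psnd w)) (lev ?u) \<and> Lsem (SatP (lev ?u) (tfm ?u) (consc (psnd w) (tps ?u))) \<and> \<not> Lsem (InP (psnd w) ?t))"
      proof -
        have "LI lt x w \<and> (Lsem (LA x w div 2) \<longleftrightarrow> even (LA x w)) \<and> (Lsem (LB x w div 2) \<longleftrightarrow> even (LB x w)) \<longleftrightarrow>
          (pfst w = 0 \<and> lt (lev (psnd w)) (lev ?t) \<and> Lsem (SatP (lev ?t) (tfm ?t) (consc (psnd w) (tps ?t))) \<and> \<not> Lsem (InP (psnd w) ?u)) \<or>
          (pfst w \<noteq> 0 \<and> lt (lev (psnd w)) (lev ?u) \<and> Lsem (SatP (lev ?u) (tfm ?u) (consc (psnd w) (tps ?u))) \<and> \<not> Lsem (InP (psnd w) ?t))" for w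
          using 3 by (cases "pfst w = 0") (auto simp: x LI_def LA_def LB_def half)
        then show ?thesis by (simp only: ex_disj_distrib)
      qed
      moreover have "(\<exists>w. pfst w = 0 \<and> Q (psnd w)) \<longleftrightarrow> (\<exists>v. Q v)" "(\<exists>w. pfst w \<noteq> 0 \<and> Q (psnd w)) \<longleftrightarrow> (\<exists>v. Q v)" for Q :: "nat \<Rightarrow> bool"
        by (metis pfst_pe psnd_pe) (metis pfst_pe psnd_pe zero_neq_one)
      note this(1)[of "\<lambda>w. lt (lev w) (lev ?t) \<and> Lsem (SatP (lev ?t) (tfm ?t) (consc w (tps ?t))) \<and> \<not> Lsem (InP w ?u)"]
        this(2)[of "\<lambda>w. lt (lev w) (lev ?u) \<and> Lsem (SatP (lev ?u) (tfm ?u) (consc w (tps ?u))) \<and> \<not> Lsem (InP w ?t)"]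
      ultimately show ?thesis by (simp only:)
    qed
    finally show ?thesis .
  qed
qed

lemma L_Sat: "b \<in> Field R \<Longrightarrow> b \<noteq> 0 \<Longrightarrow>
    rule_holds (LI lt) LA LB (SatP b p s) \<longleftrightarrow> satsf (Lv b) (\<lambda>i. tval R (lookup lt b s i)) (dec_fm p)"
  using LT_iff[of "SatP b p s"] by (simp add: Lgood_def Lsem_simps)

lemma L_In: "lev s \<in> Field R \<Longrightarrow> lev t \<in> Field R \<Longrightarrow>
    rule_holds (LI lt) LA LB (InP s t) \<longleftrightarrow> tval R s \<in> elts (tval R t)"
  using LT_iff[of "InP s t"] by (simp add: Lgood_def Lsem_def)

end

subsection \<open>Numerals\<close>

text \<open>The code of \<open>Neg (Conj (Neg (Mem 0 1)) (Neg (Equ 0 1)))\<close>: with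
  \<open>n\<close> as parameter it defines the set of \<open>n\<close> and all its elements, that
  is, \<open>n + 1\<close>.\<close>

abbreviation succ_fm_code :: nat where
  "succ_fm_code \<equiv> pe 2 (pe 3 (pe (pe 2 (pe 0 (pe 0 1))) (pe 2 (pe 1 (pe 0 1)))))"

text \<open>In the double sums below, \<open>natle\<close> sits in the even half of the even half,
  so its point \<open>n\<close> becomes the level \<open>4 * n\<close>.\<close>

definition numc :: "nat \<Rightarrow> nat" where
  "numc n = rec_nat 0 (\<lambda>k a. pe (4 * Suc k) (pe succ_fm_code (consc a 0))) n"

lemma rec_numc [rec_intros]: "recfn f \<Longrightarrow> recfn (\<lambda>n. numc (f n))"
  unfolding numc_def by (intro rec_intros)

lemma hc_of_nat_level: "m < n \<Longrightarrow> hc_of_nat m \<in> Lset (hc_of_nat n)"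
proof (induction n arbitrary: m rule: less_induct)
  case (less n)
  have "hc_of_nat m \<in> DPow (Lset (hc_of_nat m))"
    by (rule finite_in_DPow) (use less in \<open>auto simp: elts_hc_of_nat\<close>)
  then show ?case using DPow_subset_Lset[of "hc_of_nat m" "hc_of_nat n"] less.prems by (auto simp: elts_hc_of_nat)
qed

lemma levels_osum:
  assumes "Well_order S" "Well_order R" shows "levels (osum (osum natle S) R)"
proof
  note O = Well_order_osum[OF wo_natle assms(1)]
  show "Well_order (osum (osum natle S) R)" using Well_order_osum[OF O assms(2)] .
  show "0 \<in> Field (osum (osum natle S) R)"
    by (simp add: Field_osum[OF O assms(2)] Field_osum[OF wo_natle assms(1)] Field_natle)
  have "underS natle 0 = {}" by (auto simp: underS_def natle_def)
  then show "underS (osum (osum natle S) R) 0 = {}"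
    using underS_osum_even[of "osum natle S" R 0] underS_osum_even[of natle S 0] by simp
qed

lemma tval_numc:
  assumes "Well_order S" "Well_order R"
  shows "tval (osum (osum natle S) R) (numc n) = hc_of_nat n" and "lev (numc n) = 4 * n"
    and "lev (numc n) \<in> Field (osum (osum natle S) R)"
proof -
  let ?R = "osum (osum natle S) R"
  interpret levels ?R by (rule levels_osum[OF assms])
  note O = Well_order_osum[OF wo_natle assms(1)]
  have col4: "col ?R (4 * n) = hc_of_nat n" for n
    using col_osum_even[OF O assms(2), of "2 * n"] col_osum_even[OF wo_natle assms(1), of n] by (simp add: col_natle)
  have lev4: "lev (numc n) = 4 * n" for n by (cases n) (simp_all add: numc_def)
  then show "lev (numc n) = 4 * n" .
  have F4: "4 * n \<in> Field ?R" for n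
    by (simp add: Field_osum[OF O assms(2)] Field_osum[OF wo_natle assms(1)] Field_natle)
  then show "lev (numc n) \<in> Field ?R" using lev4 by simp
  have u4: "lt (4 * n) (4 * Suc n)" for n
  proof -
    have "n \<in> underS natle (Suc n)" by (auto simp: underS_def natle_def)
    then have "2 * n \<in> underS (osum natle S) (2 * Suc n)" unfolding underS_osum_even by blast
    then have "2 * (2 * n) \<in> underS ?R (2 * (2 * Suc n))" unfolding underS_osum_even by blast
    moreover have "2 * (2 * k) = 4 * k" for k :: nat by simp
    ultimately show ?thesis by metis
  qed
  show "tval ?R (numc n) = hc_of_nat n"
  proof (induction n)
    case 0
    show ?case by (rule hc_eqI) (simp add: numc_def tval_0 elts_hc_of_nat)
  next
    case (Suc n)
    let ?t = "numc (Suc n)" and ?M = "Lset (hc_of_nat (Suc n))"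
    have t: "?t = pe (4 * Suc n) (pe succ_fm_code (consc (numc n) 0))" by (simp add: numc_def)
    have lk: "tval ?R (lookup lt (lev ?t) (tps ?t) 0) = hc_of_nat n"
      unfolding t using Suc u4[of n] by (simp add: lookup_def lev4)
    have M: "hc_of_nat k \<in> ?M" if "k \<le> n" for k
      by (rule hc_of_nat_level) (use that in simp)
    have "elts (tval ?R ?t) = {y \<in> ?M. y \<in> elts (hc_of_nat n) \<or> y = hc_of_nat n}"
      unfolding tval_eq lev4 col4 using lk unfolding lev4 by (auto simp: t dec_fm_simps)
    also have "\<dots> = elts (hc_of_nat (Suc n))"
      using M by (auto simp: elts_hc_of_nat lessThan_Suc)
    finally show ?case by (rule hc_eqI)
  qed
qed

text \<open>Such a set is the value of some term \<open>t\<close>, and the statement that the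
  numeral of \<open>n\<close> belongs to \<open>t\<close> is obtained recursively from
  \<open>n\<close>.\<close>

theorem L_subset_HYP:
  assumes "hc_of_nat_set X \<in> Lset omega1ck" shows "X \<in> HYP"
proof -
  obtain S where S: "computable_wellorder S" "hc_of_nat_set X \<in> DPow (Lset (ot S))"
    using assms unfolding Lset_omega1ck by blast
  let ?S = "osum S onepoint"
  have cS: "computable_wellorder ?S" by (rule computable_wellorder_osum[OF S(1) cwo_onepoint])
  have wS: "Well_order S" "Well_order ?S" using S cS by (simp_all add: computable_wellorder_iff)
  let ?R = "osum (osum natle onepoint) ?S"
  have cR: "computable_wellorder ?R"
    by (intro computable_wellorder_osum cwo_natle cwo_onepoint cS)
  interpret levels ?R by (rule levels_osum[OF wo_onepoint wS(2)])
  have "hc_of_nat_set X \<in> Lset (ot ?R)"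
    using S(2) DPow_ot_le[OF wS(1)] Lset_osum2[OF Well_order_osum[OF wo_natle wo_onepoint] wS(2)] by blast
  then obtain t where t: "lev t \<in> Field ?R" "tval ?R t = hc_of_nat_set X" unfolding Lot_eq by auto
  have rR: "rec2 (\<lambda>a b. (a, b) \<in> ?R)" using cR by (simp add: computable_wellorder_iff)
  note [rec_intros] = rec2_comp[OF rR]
  have "ebp3 (\<lambda>e. lt)" unfolding ebp3_def underS_def mem_Collect_eq by (intro ebp_rec rec_intros)
  from ebp3_comp[OF ebp3_Lmv[OF this] rec_const rec_pfst[OF rec_id] rec_psnd[OF rec_id]]
  have "ebp2 (rule_mv (LI lt) LA LB)" by (simp add: ebp2_def)
  from ebp_win[OF this gwf_rule_mv[OF wf_L]] have w: "ebp (win (rule_mv (LI lt) LA LB))" .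
  have "recfn (\<lambda>n. pe 0 (InP (numc n) t))" by (intro rec_intros)
  from ebp_comp[OF w this] have "ebp (\<lambda>n. rule_holds (LI lt) LA LB (InP (numc n) t))" by (simp add: rule_holds_def)
  moreover have "rule_holds (LI lt) LA LB (InP (numc n) t) \<longleftrightarrow> n \<in> X" for n
    using L_In[OF tval_numc(3)[OF wo_onepoint wS(2)] t(1), of n] tval_numc(1)[OF wo_onepoint wS(2), of n]
    by (auto simp: t(2) elts_hc_of_nat_set)
  ultimately have "ebp (\<lambda>n. n \<in> X)" by simp
  then show ?thesis by (simp add: HYP_iff_ebp)
qed

section \<open>Codes in HYP\<close>

text \<open>Nodes of a Borel code are extended at the end of a list, whereas \<open>consc\<close>
  adds in front; reversal makes the operations at the end recursive.\<close>

definition revc :: "nat \<Rightarrow> nat" where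
  "revc c = pfst (rec_nat (pe 0 c) (\<lambda>_ st. if psnd st = 0 then st
      else pe (consc (hdc (psnd st)) (pfst st)) (tlc (psnd st))) c)"

lemma revc_list_encode: "revc (list_encode xs) = list_encode (rev xs)"
proof -
  let ?f = "\<lambda>(_::nat) st. if psnd st = 0 then st else pe (consc (hdc (psnd st)) (pfst st)) (tlc (psnd st))"
  have "rec_nat (pe 0 (list_encode xs)) ?f k = pe (list_encode (rev (take k xs))) (list_encode (drop k xs))" for k
  proof (induction k)
    case (Suc k)
    show ?case
    proof (cases "k < length xs")
      case True
      then have d: "drop k xs = xs ! k # drop (Suc k) xs" by (simp add: Cons_nth_drop_Suc)
      show ?thesis using True by (simp add: Suc d take_Suc_conv_app_nth)
    next
      case False
      then show ?thesis by (simp add: Suc)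
    qed
  qed simp
  from this[of "list_encode xs"] show ?thesis
    unfolding revc_def using length_le_list_encode[of xs] by simp
qed

lemma rec_revc [rec_intros]: assumes "recfn f" shows "recfn (\<lambda>n. revc (f n))"
proof -
  have "recfn revc" unfolding revc_def by (intro rec_intros)
  from rec_comp[OF this assms] show ?thesis .
qed

definition snocc :: "nat \<Rightarrow> nat \<Rightarrow> nat" where "snocc c k = revc (consc k (revc c))"
definition takec :: "nat \<Rightarrow> nat \<Rightarrow> nat" where "takec j c = revc (dropc (lenc c - j) (revc c))"

lemma snocc_list_encode: "snocc (list_encode xs) k = list_encode (xs @ [k])"
  unfolding snocc_def revc_list_encode list_encode_Cons[symmetric] by simp

lemma takec_list_encode: "takec j (list_encode xs) = list_encode (take j xs)"
  unfolding takec_def revc_list_encode dropc_list_encode lenc_list_encode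
  by (cases "j \<le> length xs") (simp_all add: rev_drop revc_list_encode)

lemma list_decode_snocc: "list_decode (snocc c k) = list_decode c @ [k]"
  by (metis list_decode_inverse list_encode_inverse snocc_list_encode)

lemma rec_snocc [rec_intros]: "recfn f \<Longrightarrow> recfn g \<Longrightarrow> recfn (\<lambda>n. snocc (f n) (g n))"
  unfolding snocc_def by (intro rec_intros)
lemma rec_takec [rec_intros]: "recfn f \<Longrightarrow> recfn g \<Longrightarrow> recfn (\<lambda>n. takec (f n) (g n))"
  unfolding takec_def by (intro rec_intros)

section \<open>Trees, labelings, maps and paths in \<open>HYP\<close> in terms of games\<close>

lemma path_in_HYP_iff: "path_in_HYP g \<longleftrightarrow> ebp2 (\<lambda>n k. g n = k)"
proof -
  have "n \<in> {prod_encode (n, g n) | n. True} \<longleftrightarrow> g (pfst n) = psnd n" for n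
    by (auto simp: pe_eq_iff) (metis pe_pfst_psnd)
  then show ?thesis unfolding path_in_HYP_def HYP_iff_ebp ebp2_def by simp
qed

lemma tree_in_HYP_iff: "tree_in_HYP T \<longleftrightarrow> ebp (\<lambda>c. list_decode c \<in> T)"
proof -
  have "c \<in> list_encode ` T \<longleftrightarrow> list_decode c \<in> T" for c
    by (metis image_iff list_decode_inverse list_encode_inverse)
  then show ?thesis unfolding tree_in_HYP_def HYP_iff_ebp by simp
qed

definition lab :: "(nat list \<rightharpoonup> label) \<Rightarrow> nat \<Rightarrow> nat \<Rightarrow> bool" where
  "lab l c v \<longleftrightarrow> (\<exists>k. l (list_decode c) = Some k \<and> label_encode k = v)"

lemma labeling_in_HYP_iff: "labeling_in_HYP l \<longleftrightarrow> ebp2 (lab l)"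
proof -
  have "n \<in> {prod_encode (list_encode s, label_encode k) | s k. l s = Some k} \<longleftrightarrow> lab l (pfst n) (psnd n)" for n
    by (auto simp: lab_def) (metis list_decode_inverse pe_pfst_psnd)
  then show ?thesis unfolding labeling_in_HYP_def HYP_iff_ebp ebp2_def by simp
qed

lemma map_in_HYP_iff:
  "map_in_HYP f \<longleftrightarrow> ebp (\<lambda>c. f (list_decode c) = Some True) \<and> ebp (\<lambda>c. f (list_decode c) = Some False)"
proof -
  let ?S = "{prod_encode (list_encode s, of_bool b) | s b. f s = Some b}"
  have S: "n \<in> ?S \<longleftrightarrow> (psnd n = 1 \<and> f (list_decode (pfst n)) = Some True) \<or> (psnd n = 0 \<and> f (list_decode (pfst n)) = Some False)" for n
  proof
    assume "n \<in> ?S"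
    then obtain s b where "n = pe (list_encode s) (of_bool b)" "f s = Some b" by auto
    then show "(psnd n = 1 \<and> f (list_decode (pfst n)) = Some True) \<or> (psnd n = 0 \<and> f (list_decode (pfst n)) = Some False)"
      by (cases b) auto
  next
    assume "(psnd n = 1 \<and> f (list_decode (pfst n)) = Some True) \<or> (psnd n = 0 \<and> f (list_decode (pfst n)) = Some False)"
    then obtain b where b: "psnd n = of_bool b" "f (list_decode (pfst n)) = Some b"
      by (metis of_bool_eq(1) of_bool_eq(2))
    have "n = pe (list_encode (list_decode (pfst n))) (of_bool b)" unfolding b(1)[symmetric] by simp
    then show "n \<in> ?S" using b(2) by blast
  qed
  show ?thesis
  proof
    assume "map_in_HYP f"
    then have "ebp (\<lambda>n. n \<in> ?S)" unfolding map_in_HYP_def HYP_iff_ebp .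
    note e = ebp_comp[OF this]
    have "recfn (\<lambda>c. pe c 1)" "recfn (\<lambda>c. pe c 0)" by (intro rec_intros)+
    from e[OF this(1)] e[OF this(2)]
    show "ebp (\<lambda>c. f (list_decode c) = Some True) \<and> ebp (\<lambda>c. f (list_decode c) = Some False)"
      unfolding S by simp
  next
    assume "ebp (\<lambda>c. f (list_decode c) = Some True) \<and> ebp (\<lambda>c. f (list_decode c) = Some False)"
    then have [eb_intros]: "recfn g \<Longrightarrow> ebp (\<lambda>n. f (list_decode (g n)) = Some True)"
      "recfn g \<Longrightarrow> ebp (\<lambda>n. f (list_decode (g n)) = Some False)" for g
      using ebp_comp[of "\<lambda>c. f (list_decode c) = Some True"] ebp_comp[of "\<lambda>c. f (list_decode c) = Some False"] by auto
    have "ebp (\<lambda>n. n \<in> ?S)" unfolding S by (intro eb_intros rec_intros)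
    then show "map_in_HYP f" unfolding map_in_HYP_def HYP_iff_ebp .
  qed
qed

text \<open>Always taking the least good extension makes the path definable from \<open>good\<close>
  by quantifiers over finite sequences, hence game-definable.\<close>

lemma ebp_path:
  assumes good: "ebp good" and start: "good 0" and step: "\<And>d. good d \<Longrightarrow> \<exists>k. good (snocc d k)"
  obtains p where "ebp2 (\<lambda>n k. p n = k)" "\<And>n. good (list_encode (map p [0..<n]))"
proof -
  note [eb_intros] = ebp_comp[OF good]
  define G where "G d k \<longleftrightarrow> good (snocc d k) \<and> (\<forall>j. j < k \<longrightarrow> \<not> good (snocc d j))" for d k
  have G1: "\<exists>k. G d k" if "good d" for d
    unfolding G_def using step[OF that] exists_least_iff[of "\<lambda>k. good (snocc d k)"] by blast
  have G2: "G d k \<Longrightarrow> G d k' \<Longrightarrow> k = k'" for d k k' unfolding G_def by (meson linorder_neqE_nat)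
  define nx where "nx d = (SOME k. G d k)" for d
  have nx: "good d \<Longrightarrow> G d (nx d)" for d unfolding nx_def using G1 by (metis someI_ex)
  define sg where "sg n = rec_nat 0 (\<lambda>_ d. snocc d (nx d)) n" for n
  define p where "p n = nx (sg n)" for n
  have sg: "sg n = list_encode (map p [0..<n])" for n
    by (induction n) (simp_all add: sg_def p_def snocc_list_encode[symmetric])
  have gsg: "good (sg n)" for n
    by (induction n) (use start nx in \<open>auto simp: sg_def G_def\<close>)
  have "p n = k \<longleftrightarrow> (\<exists>c. lenc c = Suc n \<and> nthc c n = k \<and> (\<forall>j. j < lenc c \<longrightarrow> G (takec j c) (nthc c j)))" for n k
  proof
    assume k: "p n = k"
    show "\<exists>c. lenc c = Suc n \<and> nthc c n = k \<and> (\<forall>j. j < lenc c \<longrightarrow> G (takec j c) (nthc c j))"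
    proof (intro exI conjI allI impI)
      show "lenc (sg (Suc n)) = Suc n" "nthc (sg (Suc n)) n = k"
        using k unfolding sg by (simp_all add: nthc_list_encode del: upt_Suc)
      fix j assume "j < lenc (sg (Suc n))"
      then have j: "j < Suc n" by (simp add: sg)
      have "takec j (sg (Suc n)) = sg j" "nthc (sg (Suc n)) j = p j"
        using j unfolding sg by (simp_all add: nthc_list_encode takec_list_encode take_map take_upt del: upt_Suc)
      then show "G (takec j (sg (Suc n))) (nthc (sg (Suc n)) j)" using nx[OF gsg] by (simp add: p_def)
    qed
  next
    assume "\<exists>c. lenc c = Suc n \<and> nthc c n = k \<and> (\<forall>j. j < lenc c \<longrightarrow> G (takec j c) (nthc c j))"
    then obtain c where c: "lenc c = Suc n" "nthc c n = k" "\<forall>j. j < lenc c \<longrightarrow> G (takec j c) (nthc c j)" by blast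
    obtain xs where xs: "c = list_encode xs" using list_encode_surj by blast
    have "\<forall>j<Suc n. take j xs = map p [0..<j] \<and> xs ! j = p j"
    proof (intro allI)
      fix j show "j < Suc n \<longrightarrow> take j xs = map p [0..<j] \<and> xs ! j = p j"
      proof (induction j rule: less_induct)
        case (less j)
        show ?case
        proof
          assume j: "j < Suc n"
          have len: "length xs = Suc n" using c(1) xs by simp
          have t: "take j xs = map p [0..<j]" using less j len by (intro nth_equalityI) auto
          have "G (list_encode (take j xs)) (xs ! j)" using c(3) j len unfolding xs by (simp add: takec_list_encode nthc_list_encode)
          then have "xs ! j = p j" unfolding t sg[symmetric] p_def using nx[OF gsg] G2 by blast
          then show "take j xs = map p [0..<j] \<and> xs ! j = p j" using t by blast
        qed
      qed
    qed
    then show "p n = k" using c xs by (simp add: nthc_list_encode)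
  qed
  then have "ebp2 (\<lambda>n k. p n = k)" unfolding ebp2_def G_def by (simp only:) (intro eb_intros rec_intros)
  then show thesis using that gsg sg by metis
qed

lemma strategies_agree:
  assumes code: "borel_code_in_HYP T l" and f: "map_in_HYP f" "winning_strategy T l X f" "f [] = Some True"
    and g: "map_in_HYP g" "winning_strategy T l X g" "g [] = Some False"
  shows False
proof -
  \<comment> \<open>The nodes of disagreement. At a union node \<open>f\<close> names a child with
    value 1, to which \<open>g\<close> must give 0; at an intersection node the roles are exchanged;
    no leaf is of this kind, since both maps judge the same \<open>X\<close>.\<close>
  define good where "good d \<longleftrightarrow> f (list_decode d) = Some True \<and> g (list_decode d) = Some False" for d
  have eg: "ebp good" using f(1) g(1) unfolding good_def map_in_HYP_iff by (intro eb_intros) auto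
  have step: "\<exists>k. good (snocc d k)" if "good d" for d
  proof -
    let ?s = "list_decode d"
    have s: "f ?s = Some True" "g ?s = Some False" using that by (auto simp: good_def)
    have sT: "?s \<in> T" using s f(2) by (auto simp: winning_strategy_def)
    have dom: "dom f \<subseteq> T" "dom g \<subseteq> T" using f(2) g(2) by (auto simp: winning_strategy_def)
    have F: "(\<forall>F. l ?s = Some (Clopen F) \<longrightarrow> X \<in> clopen_set F) \<and> (l ?s = Some Union_node \<longrightarrow> (\<exists>n. f (?s @ [n]) = Some True)) \<and>
       (l ?s = Some Inter_node \<longrightarrow> (\<forall>n. ?s @ [n] \<in> T \<longrightarrow> f (?s @ [n]) = Some True))"
      using f(2) sT s unfolding winning_strategy_def by (meson domI)
    have G: "(\<forall>F. l ?s = Some (Clopen F) \<longrightarrow> X \<notin> clopen_set F) \<and> (l ?s = Some Union_node \<longrightarrow> (\<forall>n. ?s @ [n] \<in> T \<longrightarrow> g (?s @ [n]) = Some False)) \<and>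
       (l ?s = Some Inter_node \<longrightarrow> (\<exists>n. g (?s @ [n]) = Some False))"
      using g(2) sT s unfolding winning_strategy_def by (metis domI option.inject)
    have "(\<exists>F. l ?s = Some (Clopen F)) \<or> l ?s = Some Union_node \<or> l ?s = Some Inter_node"
      using code sT unfolding borel_code_in_HYP_def by meson
    then have "\<exists>k. f (?s @ [k]) = Some True \<and> g (?s @ [k]) = Some False"
      using F G dom by blast
    then show ?thesis by (simp add: good_def list_decode_snocc)
  qed
  obtain p where p: "ebp2 (\<lambda>n k. p n = k)" "\<And>n. good (list_encode (map p [0..<n]))"
    using ebp_path[OF eg _ step] f(3) g(3) by (auto simp: good_def)
  have "map p [0..<n] \<in> T" for n
    using p(2)[of n] f(2) by (auto simp: good_def winning_strategy_def)
  then show False using code p(1) unfolding borel_code_in_HYP_def path_in_HYP_iff by blast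
qed

lemma evaluation_map_winning_strategy:
  assumes "borel_code_in_HYP T l" "evaluation_map T l X f" shows "winning_strategy T l X f"
proof -
  have T: "[] \<in> T" using assms(1) by (simp add: borel_code_in_HYP_def)
  have d: "dom f = T" using assms(2) by (simp add: evaluation_map_def)
  have fv: "s \<in> T \<Longrightarrow> f s = Some True \<or> f s = Some False" for s
    unfolding d[symmetric] by (cases "f s") auto
  have n: "f s = Some False \<Longrightarrow> f s \<noteq> Some True" for s by simp
  show ?thesis
    unfolding winning_strategy_def
  proof (intro conjI ballI impI allI)
    fix s n assume s: "s \<in> T" "l s = Some Union_node" "f s = Some False" "s @ [n] \<in> T"
    then show "f (s @ [n]) = Some False"
      using assms(2) fv[OF s(4)] unfolding evaluation_map_def by (metis n)
  next
    fix s assume s: "s \<in> T" "l s = Some Inter_node" "f s = Some False"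
    then show "\<exists>n. f (s @ [n]) = Some False"
      using assms(2) fv unfolding evaluation_map_def by (metis n)
  qed (use assms(2) T d in \<open>auto simp: evaluation_map_def\<close>)
qed

theorem completely_determined_imp_determined:
  assumes "completely_determined_code_for T l A" shows "determined_code_for T l A"
proof -
  have code: "borel_code_in_HYP T l" and ev: "\<And>X. X \<in> HYP \<Longrightarrow> \<exists>f. map_in_HYP f \<and> evaluation_map T l X f"
    and A: "\<And>X. X \<in> HYP \<Longrightarrow> X \<in> A \<longleftrightarrow> (\<exists>f. map_in_HYP f \<and> evaluation_map T l X f \<and> f [] = Some True)"
    using assms unfolding completely_determined_code_for_def completely_determined_in_HYP_def by auto
  note ws = evaluation_map_winning_strategy[OF code]
  have "X \<in> A \<longleftrightarrow> (\<exists>f. map_in_HYP f \<and> winning_strategy T l X f \<and> f [] = Some True)" if X: "X \<in> HYP" for X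
  proof
    assume "\<exists>f. map_in_HYP f \<and> winning_strategy T l X f \<and> f [] = Some True"
    then obtain f where f: "map_in_HYP f" "winning_strategy T l X f" "f [] = Some True" by blast
    obtain g where g: "map_in_HYP g" "evaluation_map T l X g" using ev[OF X] by blast
    have "[] \<in> dom g" using ws[OF g(2)] by (simp add: winning_strategy_def)
    then consider "g [] = Some True" | "g [] = Some False" by fastforce
    then show "X \<in> A"
    proof cases
      case 1
      then show ?thesis using A[OF X] g by blast
    next
      case 2
      then show ?thesis using strategies_agree[OF code f g(1) ws[OF g(2)]] by blast
    qed
  qed (use A[OF X] ws in meson)
  moreover have "\<forall>X\<in>HYP. \<exists>f. map_in_HYP f \<and> winning_strategy T l X f" using ev ws by meson
  ultimately show ?thesis using code unfolding determined_code_for_def determined_in_HYP_def by simp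
qed

section \<open>From determined codes to \<open>\<Delta>\<^sub>1\<close> definitions\<close>

abbreviation BEx :: "nat \<Rightarrow> fm \<Rightarrow> fm" where "BEx i p \<equiv> Exi (Conj (Mem 0 (Suc i)) p)"
abbreviation BAll :: "nat \<Rightarrow> fm \<Rightarrow> fm" where "BAll i p \<equiv> Neg (BEx i (Neg p))"
abbreviation Impl :: "fm \<Rightarrow> fm \<Rightarrow> fm" where "Impl p q \<equiv> Neg (Conj p (Neg q))"

text \<open>
  In the environment \<open>D, X, \<omega>, K, B, Q\<close>: \<open>D\<close> meets every set in \<open>K\<close>, contains no set in \<open>B\<close>,
  and \<open>n \<in> X\<close> iff \<open>m \<in> D\<close> for every \<open>{n, m} \<in> Q\<close> with \<open>n < m\<close>.
\<close>

definition clause_fm :: fm where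
  "clause_fm = Exi (Conj (BAll 1 (Mem 0 3)) (Conj (BAll 0 (Mem 0 3)) (Conj (BAll 3 (BEx 0 (Mem 0 2)))
     (Conj (BAll 4 (BEx 0 (Neg (Mem 0 2))))
       (BAll 5 (BAll 0 (BAll 1 (Impl (Mem 1 0) (Conj (Impl (Mem 1 4) (Mem 0 3)) (Impl (Mem 0 3) (Mem 1 4)))))))))))"

lemma sigma1_clause_fm: "sigma1_fm clause_fm"
  unfolding clause_fm_def by (intro sigma1_fm.intros delta0_fm.intros)

lemma arity_clause_fm: "arity clause_fm = 5"
  by (simp add: clause_fm_def)

lemma sats_clause_fm:
  assumes M: "transM M" and "X \<in> M" "W \<in> M" "K \<in> M" "B \<in> M" "Q \<in> M"
  shows "sats M [X, W, K, B, Q] clause_fm \<longleftrightarrow> (\<exists>D\<in>M. elts X \<subseteq> elts W \<and> elts D \<subseteq> elts W \<and>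
     (\<forall>k\<in>elts K. \<exists>x\<in>elts k. x \<in> elts D) \<and> (\<forall>k\<in>elts B. \<exists>x\<in>elts k. x \<notin> elts D) \<and>
     (\<forall>z\<in>elts Q. \<forall>n\<in>elts z. \<forall>d\<in>elts z. n \<in> elts d \<longrightarrow> (n \<in> elts X \<longleftrightarrow> d \<in> elts D)))"
proof -
  have e: "y \<in> M" if "x \<in> M" "y \<in> elts x" for x y using M that by (auto simp: transM_def)
  have b: "(\<exists>x\<in>M. x \<in> elts y \<and> P x) \<longleftrightarrow> (\<exists>x\<in>elts y. P x)" if "y \<in> M" for y P
    using e that by blast
  have "sats M [X, W, K, B, Q] clause_fm \<longleftrightarrow> (\<exists>D\<in>M. \<not> (\<exists>x\<in>M. x \<in> elts X \<and> x \<notin> elts W) \<and> \<not> (\<exists>x\<in>M. x \<in> elts D \<and> x \<notin> elts W) \<and>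
     \<not> (\<exists>k\<in>M. k \<in> elts K \<and> \<not> (\<exists>x\<in>M. x \<in> elts k \<and> x \<in> elts D)) \<and> \<not> (\<exists>k\<in>M. k \<in> elts B \<and> \<not> (\<exists>x\<in>M. x \<in> elts k \<and> x \<notin> elts D)) \<and>
     \<not> (\<exists>z\<in>M. z \<in> elts Q \<and> (\<exists>n\<in>M. n \<in> elts z \<and> (\<exists>d\<in>M. d \<in> elts z \<and> \<not> (n \<in> elts d \<longrightarrow> (n \<in> elts X \<longleftrightarrow> d \<in> elts D))))))"
    unfolding clause_fm_def by (simp add: numeral_eq_Suc) blast
  also have "\<dots> \<longleftrightarrow> (\<exists>D\<in>M. elts X \<subseteq> elts W \<and> elts D \<subseteq> elts W \<and>
     (\<forall>k\<in>elts K. \<exists>x\<in>elts k. x \<in> elts D) \<and> (\<forall>k\<in>elts B. \<exists>x\<in>elts k. x \<notin> elts D) \<and>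
     (\<forall>z\<in>elts Q. \<forall>n\<in>elts z. \<forall>d\<in>elts z. n \<in> elts d \<longrightarrow> (n \<in> elts X \<longleftrightarrow> d \<in> elts D)))"
  proof (rule bex_cong[OF refl])
    fix D assume D: "D \<in> M"
    have k: "k \<in> elts K \<Longrightarrow> k \<in> M" "k \<in> elts B \<Longrightarrow> k \<in> M" "k \<in> elts Q \<Longrightarrow> k \<in> M" for k
      using e assms by blast+
    show "(\<not> (\<exists>x\<in>M. x \<in> elts X \<and> x \<notin> elts W) \<and> \<not> (\<exists>x\<in>M. x \<in> elts D \<and> x \<notin> elts W) \<and>
     \<not> (\<exists>k\<in>M. k \<in> elts K \<and> \<not> (\<exists>x\<in>M. x \<in> elts k \<and> x \<in> elts D)) \<and> \<not> (\<exists>k\<in>M. k \<in> elts B \<and> \<not> (\<exists>x\<in>M. x \<in> elts k \<and> x \<notin> elts D)) \<and>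
     \<not> (\<exists>z\<in>M. z \<in> elts Q \<and> (\<exists>n\<in>M. n \<in> elts z \<and> (\<exists>d\<in>M. d \<in> elts z \<and> \<not> (n \<in> elts d \<longrightarrow> (n \<in> elts X \<longleftrightarrow> d \<in> elts D)))))) \<longleftrightarrow>
     (elts X \<subseteq> elts W \<and> elts D \<subseteq> elts W \<and>
     (\<forall>k\<in>elts K. \<exists>x\<in>elts k. x \<in> elts D) \<and> (\<forall>k\<in>elts B. \<exists>x\<in>elts k. x \<notin> elts D) \<and>
     (\<forall>z\<in>elts Q. \<forall>n\<in>elts z. \<forall>d\<in>elts z. n \<in> elts d \<longrightarrow> (n \<in> elts X \<longleftrightarrow> d \<in> elts D)))"
      unfolding b[OF \<open>X \<in> M\<close>] b[OF D] b[OF \<open>K \<in> M\<close>] b[OF \<open>B \<in> M\<close>] b[OF \<open>Q \<in> M\<close>]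
      using k by (simp add: b subset_iff) blast
  qed
  finally show ?thesis .
qed

text \<open>A literal is greater than the number it speaks about, so an unordered pair \<open>{n, m}\<close> can link the two.\<close>

definition lit :: "nat set \<Rightarrow> nat set \<Rightarrow> nat \<Rightarrow> bool" where
  "lit X F x \<longleftrightarrow> (\<exists>n. x = 4 * n + 4 \<and> n \<in> X \<or> x = 4 * n + 5 \<and> n \<notin> X \<or> x = 4 * n + 6 \<and> n \<in> F \<or> x = 4 * n + 7 \<and> n \<notin> F)"

lemma lit_simps:
  "lit X F (4 * n + 4) \<longleftrightarrow> n \<in> X" "lit X F (4 * n + 5) \<longleftrightarrow> n \<notin> X" "lit X F (4 * n + 6) \<longleftrightarrow> n \<in> F" "lit X F (4 * n + 7) \<longleftrightarrow> n \<notin> F"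
proof -
  have "4 * n + a \<noteq> 4 * m + b" if "a \<in> {4,5,6,7}" "b \<in> {4,5,6,7}" "a \<noteq> b" for n m a b :: nat
    using that by auto presburger+
  then show "lit X F (4 * n + 4) \<longleftrightarrow> n \<in> X" "lit X F (4 * n + 5) \<longleftrightarrow> n \<notin> X" "lit X F (4 * n + 6) \<longleftrightarrow> n \<in> F" "lit X F (4 * n + 7) \<longleftrightarrow> n \<notin> F"
    unfolding lit_def by auto
qed

lemma lit_cases: fixes x :: nat assumes "4 \<le> x" obtains n where "x = 4 * n + 4" | n where "x = 4 * n + 5" | n where "x = 4 * n + 6" | n where "x = 4 * n + 7"
proof -
  have "x = 4 * ((x - 4) div 4) + 4 + (x - 4) mod 4" "(x - 4) mod 4 < 4" using assms by auto
  then have "x = 4 * ((x - 4) div 4) + 4 \<or> x = 4 * ((x - 4) div 4) + 5 \<or> x = 4 * ((x - 4) div 4) + 6 \<or> x = 4 * ((x - 4) div 4) + 7"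
    by linarith
  then show thesis using that by blast
qed

text \<open>\<open>D\<close> stands for a set of true literals. Meeting every set in
  \<open>K\<close> says that all clauses hold, \<open>B\<close> consists of the complementary pairs,
  and \<open>Q\<close> ties the literals about \<open>X\<close> to \<open>X\<close>. All arithmetic
  is thus moved into the parameters.\<close>

theorem sigma1_clauses:
  assumes J: "ebp J" and K: "ebp2 K" and K4: "\<And>j x. K j x \<Longrightarrow> 4 \<le> x"
  shows "sigma1_definable (Lset omega1ck)
    (hc_of_nat_set ` {X \<in> HYP. \<exists>F\<in>HYP. \<forall>j. J j \<longrightarrow> (\<exists>x. K j x \<and> lit X F x)})"
proof -
  let ?M = "Lset omega1ck"
  note [eb_intros] = ebp_comp[OF J] ebp2_comp[OF K]
  \<comment> \<open>Numbers that index no clause get the clause of all literals, which every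
    \<open>X\<close> and \<open>F\<close> satisfy.\<close>
  define K' where "K' j x \<longleftrightarrow> 4 \<le> x \<and> (J j \<longrightarrow> K j x)" for j x
  define B' where "B' j x \<longleftrightarrow> x = 2 * j + 4 \<or> x = 2 * j + 5" for j x :: nat
  define Q' where "Q' n x \<longleftrightarrow> x = n \<or> x = 4 * n + 4" for n x :: nat
  have ebs: "ebp2 K'" "ebp2 B'" "ebp2 Q'"
    unfolding ebp2_def K'_def B'_def Q'_def by (intro eb_intros rec_intros)+
  define W KK BB QQ where "W = hc_of_nat_set UNIV" and "KK = hcset (range (\<lambda>j. hc_of_nat_set {x. K' j x}))"
    and "BB = hcset (range (\<lambda>j. hc_of_nat_set {x. B' j x}))" and "QQ = hcset (range (\<lambda>j. hc_of_nat_set {x. Q' j x}))"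
  have "ebp2 (\<lambda>j x. True)" unfolding ebp2_def by (intro eb_intros)
  then have ps: "W \<in> ?M" "KK \<in> ?M" "BB \<in> ?M" "QQ \<in> ?M"
    unfolding W_def KK_def BB_def QQ_def using HYP_sections_in_L ebs HYP_sections_in_L(2)[of "\<lambda>j x. True"] by auto
  have el: "elts W = range hc_of_nat" "elts KK = range (\<lambda>j. hc_of_nat_set {x. K' j x})"
    "elts BB = range (\<lambda>j. hc_of_nat_set {x. B' j x})" "elts QQ = range (\<lambda>j. hc_of_nat_set {x. Q' j x})"
    unfolding W_def KK_def BB_def QQ_def by (simp_all add: elts_hc_of_nat_set elts_hcset_nat)
  have hm: "hc_of_nat n \<in> elts (hc_of_nat_set E) \<longleftrightarrow> n \<in> E" for n E by (auto simp: elts_hc_of_nat_set)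
  have hh: "hc_of_nat n \<in> elts (hc_of_nat m) \<longleftrightarrow> n < m" for n m by (auto simp: elts_hc_of_nat)
  have core: "(\<forall>k\<in>elts KK. \<exists>x\<in>elts k. x \<in> elts (hc_of_nat_set E)) \<and> (\<forall>k\<in>elts BB. \<exists>x\<in>elts k. x \<notin> elts (hc_of_nat_set E)) \<and>
     (\<forall>z\<in>elts QQ. \<forall>n\<in>elts z. \<forall>d\<in>elts z. n \<in> elts d \<longrightarrow> (n \<in> elts (hc_of_nat_set X) \<longleftrightarrow> d \<in> elts (hc_of_nat_set E))) \<longleftrightarrow>
     (\<forall>j. \<exists>x. K' j x \<and> x \<in> E) \<and> (\<forall>j. 2 * j + 4 \<notin> E \<or> 2 * j + 5 \<notin> E) \<and> (\<forall>n. n \<in> X \<longleftrightarrow> 4 * n + 4 \<in> E)" for X E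
  proof -
    have a: "(\<forall>k\<in>elts KK. \<exists>x\<in>elts k. x \<in> elts (hc_of_nat_set E)) \<longleftrightarrow> (\<forall>j. \<exists>x. K' j x \<and> x \<in> E)"
      unfolding el by (auto simp: elts_hc_of_nat_set inj_image_mem_iff[OF inj_hc_of_nat])
    have b: "(\<forall>k\<in>elts BB. \<exists>x\<in>elts k. x \<notin> elts (hc_of_nat_set E)) \<longleftrightarrow> (\<forall>j. 2 * j + 4 \<notin> E \<or> 2 * j + 5 \<notin> E)"
      unfolding el by (auto simp: elts_hc_of_nat_set inj_image_mem_iff[OF inj_hc_of_nat] B'_def)
    have c: "(\<forall>z\<in>elts QQ. \<forall>n\<in>elts z. \<forall>d\<in>elts z. n \<in> elts d \<longrightarrow> (n \<in> elts (hc_of_nat_set X) \<longleftrightarrow> d \<in> elts (hc_of_nat_set E))) \<longleftrightarrow>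
      (\<forall>n. n \<in> X \<longleftrightarrow> 4 * n + 4 \<in> E)"
    proof -
      have "(\<forall>z\<in>elts QQ. \<forall>n\<in>elts z. \<forall>d\<in>elts z. n \<in> elts d \<longrightarrow> (n \<in> elts (hc_of_nat_set X) \<longleftrightarrow> d \<in> elts (hc_of_nat_set E))) \<longleftrightarrow>
        (\<forall>i n d. Q' i n \<longrightarrow> Q' i d \<longrightarrow> n < d \<longrightarrow> (n \<in> X \<longleftrightarrow> d \<in> E))"
        unfolding el by (auto simp: elts_hc_of_nat_set hh inj_image_mem_iff[OF inj_hc_of_nat])
      also have "\<dots> \<longleftrightarrow> (\<forall>n. n \<in> X \<longleftrightarrow> 4 * n + 4 \<in> E)"
        unfolding Q'_def by auto
      finally show ?thesis .
    qed
    show ?thesis unfolding a b c ..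
  qed
  have "defined_by ?M clause_fm [W, KK, BB, QQ] = hc_of_nat_set ` {X \<in> HYP. \<exists>F\<in>HYP. \<forall>j. J j \<longrightarrow> (\<exists>x. K j x \<and> lit X F x)}"
  proof (intro equalityI subsetI)
    fix y assume "y \<in> defined_by ?M clause_fm [W, KK, BB, QQ]"
    then have y: "y \<in> ?M" "sats ?M [y, W, KK, BB, QQ] clause_fm" by (auto simp: defined_by_def)
    then obtain D where D: "D \<in> ?M" "elts y \<subseteq> elts W" "elts D \<subseteq> elts W"
      and cl: "(\<forall>k\<in>elts KK. \<exists>x\<in>elts k. x \<in> elts D) \<and> (\<forall>k\<in>elts BB. \<exists>x\<in>elts k. x \<notin> elts D) \<and>
     (\<forall>z\<in>elts QQ. \<forall>n\<in>elts z. \<forall>d\<in>elts z. n \<in> elts d \<longrightarrow> (n \<in> elts y \<longleftrightarrow> d \<in> elts D))"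
      unfolding sats_clause_fm[OF transM_Lset y(1) ps] by blast
    define X where "X = {n. hc_of_nat n \<in> elts y}"
    define E where "E = {n. hc_of_nat n \<in> elts D}"
    have yX: "y = hc_of_nat_set X" by (rule hc_eqI) (use D(2) in \<open>auto simp: X_def el elts_hc_of_nat_set\<close>)
    have DE: "D = hc_of_nat_set E" by (rule hc_eqI) (use D(3) in \<open>auto simp: E_def el elts_hc_of_nat_set\<close>)
    have XE: "X \<in> HYP" "E \<in> HYP" using L_subset_HYP y(1) D(1) yX DE by auto
    from cl[unfolded yX DE core] have c: "\<And>j. \<exists>x. K' j x \<and> x \<in> E" "\<And>j. 2 * j + 4 \<notin> E \<or> 2 * j + 5 \<notin> E" "\<And>n. n \<in> X \<longleftrightarrow> 4 * n + 4 \<in> E"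
      by auto
    \<comment> \<open>\<open>E\<close> may leave literals about \<open>F\<close> undecided, so
      \<open>F\<close> is read off from the positive ones; the complementary pairs then make every
      literal in \<open>E\<close> true.\<close>
    define F where "F = {n. 4 * n + 6 \<in> E}"
    have "ebp (\<lambda>n. n \<in> F)"
      unfolding F_def mem_Collect_eq by (rule ebp_comp[of "\<lambda>n. n \<in> E"]) (use XE HYP_iff_ebp in \<open>auto intro!: rec_intros\<close>)
    then have F: "F \<in> HYP" by (simp add: HYP_iff_ebp)
    have "lit X F x" if x: "x \<in> E" "4 \<le> x" for x
      using x(2)
    proof (cases rule: lit_cases)
      case (1 n) then show ?thesis using c(3) x by (simp add: lit_simps)
    next
      case (2 n) then show ?thesis using c(3)[of n] c(2)[of "2 * n"] x by (simp add: lit_simps)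
    next
      case (3 n) then show ?thesis using x by (simp add: lit_simps F_def)
    next
      case (4 n)
      have "2 * (2 * n + 1) + 4 = 4 * n + 6" "2 * (2 * n + 1) + 5 = 4 * n + 7" by auto
      then have "4 * n + 6 \<notin> E" using c(2)[of "2 * n + 1"] x 4 by metis
      then show ?thesis using 4 by (simp add: lit_simps F_def)
    qed
    then have "\<forall>j. J j \<longrightarrow> (\<exists>x. K j x \<and> lit X F x)" using c(1) unfolding K'_def by blast
    then show "y \<in> hc_of_nat_set ` {X \<in> HYP. \<exists>F\<in>HYP. \<forall>j. J j \<longrightarrow> (\<exists>x. K j x \<and> lit X F x)}" using yX XE F by blast
  next
    fix y assume "y \<in> hc_of_nat_set ` {X \<in> HYP. \<exists>F\<in>HYP. \<forall>j. J j \<longrightarrow> (\<exists>x. K j x \<and> lit X F x)}"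
    then obtain X F where X: "y = hc_of_nat_set X" "X \<in> HYP" "F \<in> HYP" "\<forall>j. J j \<longrightarrow> (\<exists>x. K j x \<and> lit X F x)" by blast
    define E where "E = {x. lit X F x}"
    have [eb_intros]: "recfn f \<Longrightarrow> ebp (\<lambda>n. f n \<in> X)" "recfn f \<Longrightarrow> ebp (\<lambda>n. f n \<in> F)" for f
      using ebp_comp X HYP_iff_ebp by blast+
    have "ebp (\<lambda>x. x \<in> E)" unfolding E_def mem_Collect_eq lit_def by (intro eb_intros rec_intros)
    then have E: "hc_of_nat_set E \<in> ?M" using HYP_subset_L HYP_iff_ebp by blast
    have y: "y \<in> ?M" using X HYP_subset_L by blast
    have c1: "\<exists>x. K' j x \<and> x \<in> E" for j
    proof (cases "J j")
      case True
      then obtain x where "K j x" "lit X F x" using X(4) by blast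
      then show ?thesis using K4[of j x] by (intro exI[of _ x]) (simp add: K'_def E_def)
    next
      case False
      have "lit X F (4 * 0 + 4) \<or> lit X F (4 * 0 + 5)" unfolding lit_simps by blast
      then have "lit X F 4 \<or> lit X F 5" by simp
      then show ?thesis
        using False by (elim disjE) (intro exI[of _ 4], simp add: K'_def E_def, intro exI[of _ 5], simp add: K'_def E_def)
    qed
    have c2: "2 * j + 4 \<notin> E \<or> 2 * j + 5 \<notin> E" for j
    proof (cases "even j")
      case True
      then obtain n where "j = 2 * n" by blast
      then have "2 * j + 4 = 4 * n + 4" "2 * j + 5 = 4 * n + 5" by auto
      then show ?thesis unfolding E_def mem_Collect_eq by (metis lit_simps(1,2))
    next
      case False
      then obtain n where "j = 2 * n + 1" by (metis oddE)
      then have "2 * j + 4 = 4 * n + 6" "2 * j + 5 = 4 * n + 7" by auto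
      then show ?thesis unfolding E_def mem_Collect_eq by (metis lit_simps(3,4))
    qed
    have c3: "n \<in> X \<longleftrightarrow> 4 * n + 4 \<in> E" for n by (simp add: E_def lit_simps)
    have "(\<forall>j. \<exists>x. K' j x \<and> x \<in> E) \<and> (\<forall>j. 2 * j + 4 \<notin> E \<or> 2 * j + 5 \<notin> E) \<and> (\<forall>n. n \<in> X \<longleftrightarrow> 4 * n + 4 \<in> E)"
      using c1 c2 c3 by blast
    note cl = this[folded core, folded X(1)]
    have "sats ?M [y, W, KK, BB, QQ] clause_fm"
      unfolding sats_clause_fm[OF transM_Lset y ps]
      by (rule bexI[of _ "hc_of_nat_set E"]) (use E cl in \<open>auto simp: X(1) el elts_hc_of_nat_set\<close>)
    then show "y \<in> defined_by ?M clause_fm [W, KK, BB, QQ]" using y by (simp add: defined_by_def)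
  qed
  then show ?thesis
    unfolding sigma1_definable_def using sigma1_clause_fm arity_clause_fm ps
    by (intro exI[of _ clause_fm] exI[of _ "[W, KK, BB, QQ]"]) auto
qed

section \<open>Winning strategies as solutions of clauses\<close>

definition longc :: "nat \<Rightarrow> nat \<Rightarrow> bool" where
  "longc C u \<longleftrightarrow> (\<forall>m<lenc C. lenc (nthc C m) \<le> lenc u)"

definition matchc :: "nat \<Rightarrow> nat \<Rightarrow> bool" where
  "matchc C u \<longleftrightarrow> (\<exists>m<lenc C. \<forall>i<lenc (nthc C m). nthc (nthc C m) i = 1 \<longleftrightarrow> nthc u i = 1)"

text \<open>A clopen condition on \<open>X\<close> is not a literal. It becomes one clause for each
  string \<open>u\<close> long enough to decide it: \<open>X\<close> differs from \<open>u\<close>,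
  or the leaf does not get the value that \<open>u\<close> rules out. Every \<open>X\<close> agrees
  with some such string by \<open>long_approx\<close>, so together these clauses are exact.\<close>

definition differs :: "nat set \<Rightarrow> nat \<Rightarrow> bool" where
  "differs X u \<longleftrightarrow> (\<exists>i<lenc u. i \<in> X \<longleftrightarrow> nthc u i \<noteq> 1)"

definition clopen_code :: "bool list list \<Rightarrow> nat" where
  "clopen_code F = list_encode (map (\<lambda>s. list_encode (map of_bool s)) F)"

lemma nthc_clopen_code: "m < length F \<Longrightarrow> nthc (clopen_code F) m = list_encode (map of_bool (F ! m))"
  by (simp add: clopen_code_def nthc_list_encode)

lemma lenc_clopen_code: "lenc (clopen_code F) = length F"
  by (simp add: clopen_code_def)

lemma label_encode_Clopen: "label_encode (Clopen F) = 2 + clopen_code F"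
  by (simp add: clopen_code_def)

lemma matchc_iff:
  assumes "longc (clopen_code F) u" "\<not> differs X u"
  shows "matchc (clopen_code F) u \<longleftrightarrow> X \<in> clopen_set F"
proof -
  have "(\<forall>i<length (F ! m). nthc (nthc (clopen_code F) m) i = 1 \<longleftrightarrow> nthc u i = 1) \<longleftrightarrow> (\<forall>i<length (F ! m). F ! m ! i \<longleftrightarrow> i \<in> X)"
    if m: "m < length F" for m
  proof -
    have "length (F ! m) \<le> lenc u" using assms(1) m by (auto simp: longc_def lenc_clopen_code nthc_clopen_code)
    then have "nthc u i = 1 \<longleftrightarrow> i \<in> X" if "i < length (F ! m)" for i
      using assms(2) that unfolding differs_def by (meson less_le_trans)
    moreover have "nthc (nthc (clopen_code F) m) i = of_bool (F ! m ! i)" if "i < length (F ! m)" for i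
      using that m by (simp add: nthc_clopen_code nthc_list_encode)
    ultimately show ?thesis by auto
  qed
  note eq = this
  have len: "lenc (nthc (clopen_code F) m) = length (F ! m)" if "m < length F" for m
    using that by (simp add: nthc_clopen_code)
  have "matchc (clopen_code F) u \<longleftrightarrow> (\<exists>m<length F. \<forall>i<length (F ! m). F ! m ! i \<longleftrightarrow> i \<in> X)"
    unfolding matchc_def lenc_clopen_code by (intro ex_cong1 conj_cong refl) (simp only: len eq)
  also have "\<dots> \<longleftrightarrow> X \<in> clopen_set F" unfolding clopen_set_def mem_Collect_eq by (metis in_set_conv_nth)
  finally show ?thesis .
qed

lemma long_approx: "\<exists>u. longc C u \<and> \<not> differs X u"
proof -
  define N where "N = (\<Sum>m<lenc C. lenc (nthc C m))"
  define u where "u = list_encode (map (\<lambda>i. of_bool (i \<in> X)) [0..<N])"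
  have "lenc (nthc C m) \<le> N" if "m < lenc C" for m
    unfolding N_def using member_le_sum[of m "{..<lenc C}" "\<lambda>m. lenc (nthc C m)"] that by simp
  then have "longc C u" by (simp add: longc_def u_def)
  moreover have "\<not> differs X u" by (auto simp: differs_def u_def nthc_list_encode)
  ultimately show ?thesis by blast
qed

text \<open>The clauses saying that \<open>F\<close>, as a set of pairs of a node and a truth value, is a winning strategy with value \<open>b\<close> at the root.\<close>

context
  fixes T :: "nat list set" and l :: "nat list \<rightharpoonup> label" and b :: nat
begin

text \<open>Tags: 0 the value at the root, 1 single-valuedness, 2 the domain, 3 and 4 the leaves, 5
  and 6 the union nodes, 7 and 8 the intersection nodes.\<close>

definition cJ :: "nat \<Rightarrow> bool" where
  "cJ j \<longleftrightarrow> (let k = pfst j; d = psnd j; c = pfst d; v = pfst (psnd d); u = psnd (psnd d); n = psnd d in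
     k = 0 \<or> k = 1 \<or> k = 2 \<and> list_decode c \<notin> T \<or>
     k = 3 \<and> lab l c v \<and> 2 \<le> v \<and> longc (v - 2) u \<and> \<not> matchc (v - 2) u \<or>
     k = 4 \<and> lab l c v \<and> 2 \<le> v \<and> longc (v - 2) u \<and> matchc (v - 2) u \<or>
     k = 5 \<and> lab l d 0 \<or> k = 6 \<and> lab l c 0 \<and> list_decode (snocc c n) \<in> T \<or>
     k = 7 \<and> lab l d 1 \<or> k = 8 \<and> lab l c 1 \<and> list_decode (snocc c n) \<in> T)"

definition cK :: "nat \<Rightarrow> nat \<Rightarrow> bool" where
  "cK j x \<longleftrightarrow> (let k = pfst j; d = psnd j; c = pfst d; u = psnd (psnd d); n = psnd d in
     k = 0 \<and> x = 4 * pe 0 b + 6 \<or>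
     k = 1 \<and> (x = 4 * pe d 1 + 7 \<or> x = 4 * pe d 0 + 7) \<or>
     k = 2 \<and> x = 4 * d + 7 \<or>
     k = 3 \<and> (x = 4 * pe c 1 + 7 \<or> (\<exists>i. i < lenc u \<and> (nthc u i = 1 \<and> x = 4 * i + 5 \<or> nthc u i \<noteq> 1 \<and> x = 4 * i + 4))) \<or>
     k = 4 \<and> (x = 4 * pe c 0 + 7 \<or> (\<exists>i. i < lenc u \<and> (nthc u i = 1 \<and> x = 4 * i + 5 \<or> nthc u i \<noteq> 1 \<and> x = 4 * i + 4))) \<or>
     k = 5 \<and> (x = 4 * pe d 1 + 7 \<or> (\<exists>n. x = 4 * pe (snocc d n) 1 + 6)) \<or>
     k = 6 \<and> (x = 4 * pe c 0 + 7 \<or> x = 4 * pe (snocc c n) 0 + 6) \<or>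
     k = 7 \<and> (x = 4 * pe d 0 + 7 \<or> (\<exists>n. x = 4 * pe (snocc d n) 0 + 6)) \<or>
     k = 8 \<and> (x = 4 * pe c 1 + 7 \<or> x = 4 * pe (snocc c n) 1 + 6))"

lemma ebp_cJ: assumes "ebp (\<lambda>c. list_decode c \<in> T)" "ebp2 (lab l)" shows "ebp cJ"
proof -
  note [eb_intros] = ebp_comp[OF assms(1)] ebp2_comp[OF assms(2)]
  show ?thesis unfolding cJ_def Let_def longc_def matchc_def by (intro eb_intros rec_intros)
qed

lemma ebp_cK: "ebp2 cK"
  unfolding ebp2_def cK_def Let_def by (intro eb_intros rec_intros)

lemma cK_ge: "cK j x \<Longrightarrow> 4 \<le> x"
  unfolding cK_def Let_def by auto

definition Sat :: "nat set \<Rightarrow> nat set \<Rightarrow> bool" where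
  "Sat X F \<longleftrightarrow> (\<forall>j. cJ j \<longrightarrow> (\<exists>x. cK j x \<and> lit X F x))"

lemma lits_disj: "(\<exists>x. (x = p \<or> x = q) \<and> P x) \<longleftrightarrow> P p \<or> P q" "(\<exists>x. (x = p \<or> (\<exists>n. x = f n)) \<and> P x) \<longleftrightarrow> P p \<or> (\<exists>n. P (f n))"
  by blast+

lemma lits_differs: "(\<exists>x. (x = p \<or> (\<exists>i. i < lenc u \<and> (nthc u i = 1 \<and> x = 4 * i + 5 \<or> nthc u i \<noteq> 1 \<and> x = 4 * i + 4))) \<and> lit X F x) \<longleftrightarrow>
   lit X F p \<or> differs X u"
proof -
  have "(\<exists>x. (x = p \<or> (\<exists>i. i < lenc u \<and> (nthc u i = 1 \<and> x = 4 * i + 5 \<or> nthc u i \<noteq> 1 \<and> x = 4 * i + 4))) \<and> lit X F x) \<longleftrightarrow>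
    lit X F p \<or> (\<exists>i<lenc u. nthc u i = 1 \<and> lit X F (4 * i + 5) \<or> nthc u i \<noteq> 1 \<and> lit X F (4 * i + 4))" by blast
  then show ?thesis unfolding lit_simps differs_def by auto
qed

lemma Sat_iff: "Sat X F \<longleftrightarrow> pe 0 b \<in> F \<and> (\<forall>c. pe c 1 \<notin> F \<or> pe c 0 \<notin> F) \<and> (\<forall>c y. list_decode c \<notin> T \<longrightarrow> pe c y \<notin> F) \<and>
   (\<forall>c v u. lab l c v \<longrightarrow> 2 \<le> v \<longrightarrow> longc (v - 2) u \<longrightarrow> \<not> matchc (v - 2) u \<longrightarrow> pe c 1 \<notin> F \<or> differs X u) \<and>
   (\<forall>c v u. lab l c v \<longrightarrow> 2 \<le> v \<longrightarrow> longc (v - 2) u \<longrightarrow> matchc (v - 2) u \<longrightarrow> pe c 0 \<notin> F \<or> differs X u) \<and>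
   (\<forall>c. lab l c 0 \<longrightarrow> pe c 1 \<notin> F \<or> (\<exists>n. pe (snocc c n) 1 \<in> F)) \<and>
   (\<forall>c n. lab l c 0 \<longrightarrow> list_decode (snocc c n) \<in> T \<longrightarrow> pe c 0 \<notin> F \<or> pe (snocc c n) 0 \<in> F) \<and>
   (\<forall>c. lab l c 1 \<longrightarrow> pe c 0 \<notin> F \<or> (\<exists>n. pe (snocc c n) 0 \<in> F)) \<and>
   (\<forall>c n. lab l c 1 \<longrightarrow> list_decode (snocc c n) \<in> T \<longrightarrow> pe c 1 \<notin> F \<or> pe (snocc c n) 1 \<in> F)"
proof -
  let ?P = "\<lambda>k d. cJ (pe k d) \<longrightarrow> (\<exists>x. cK (pe k d) x \<and> lit X F x)"
  have all: "Sat X F \<longleftrightarrow> (\<forall>k d. ?P k d)" unfolding Sat_def by (metis pe_pfst_psnd)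
  have split: "(\<forall>k d. ?P k d) \<longleftrightarrow> (\<forall>d. ?P 0 d) \<and> (\<forall>d. ?P 1 d) \<and> (\<forall>d. ?P 2 d) \<and> (\<forall>d. ?P 3 d) \<and> (\<forall>d. ?P 4 d) \<and>
      (\<forall>d. ?P 5 d) \<and> (\<forall>d. ?P 6 d) \<and> (\<forall>d. ?P 7 d) \<and> (\<forall>d. ?P 8 d)"
  proof -
    have big: "\<not> cJ (pe k d)" if "k \<ge> 9" for k d using that unfolding cJ_def Let_def by auto
    have small: "k = 0 \<or> k = 1 \<or> k = 2 \<or> k = 3 \<or> k = 4 \<or> k = 5 \<or> k = 6 \<or> k = 7 \<or> k = 8 \<or> k \<ge> 9" for k :: nat by linarith
    show ?thesis
    proof
      assume h: "(\<forall>d. ?P 0 d) \<and> (\<forall>d. ?P 1 d) \<and> (\<forall>d. ?P 2 d) \<and> (\<forall>d. ?P 3 d) \<and> (\<forall>d. ?P 4 d) \<and>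
        (\<forall>d. ?P 5 d) \<and> (\<forall>d. ?P 6 d) \<and> (\<forall>d. ?P 7 d) \<and> (\<forall>d. ?P 8 d)"
      show "\<forall>k d. ?P k d"
      proof (intro allI)
        fix k d show "?P k d" using small[of k] h big[of k d] by (elim disjE conjE) (simp_all only:, blast+)
      qed
    qed (intro conjI; intro allI; drule spec; drule spec; assumption)
  qed
  have pairs: "(\<forall>d. Q d) \<longleftrightarrow> (\<forall>c n. Q (pe c n))" for Q :: "nat \<Rightarrow> bool" by (metis pe_pfst_psnd)
  have trip: "(\<forall>d. Q d) \<longleftrightarrow> (\<forall>c n u. Q (pe c (pe n u)))" for Q :: "nat \<Rightarrow> bool" by (metis pe_pfst_psnd)
  have p0: "(\<forall>d. ?P 0 d) \<longleftrightarrow> pe 0 b \<in> F" by (simp add: cJ_def cK_def lit_simps)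
  have p1: "(\<forall>d. ?P 1 d) \<longleftrightarrow> (\<forall>c. pe c 1 \<notin> F \<or> pe c 0 \<notin> F)" by (simp add: cJ_def cK_def lits_disj lit_simps)
  have p2: "(\<forall>d. ?P 2 d) \<longleftrightarrow> (\<forall>c y. list_decode c \<notin> T \<longrightarrow> pe c y \<notin> F)"
    by (subst pairs) (simp add: cJ_def cK_def lit_simps)
  have p3: "(\<forall>d. ?P 3 d) \<longleftrightarrow> (\<forall>c v u. lab l c v \<longrightarrow> 2 \<le> v \<longrightarrow> longc (v - 2) u \<longrightarrow> \<not> matchc (v - 2) u \<longrightarrow> pe c 1 \<notin> F \<or> differs X u)"
    by (subst trip) (simp add: cJ_def cK_def lits_differs[unfolded One_nat_def] lit_simps, blast)
  have p4: "(\<forall>d. ?P 4 d) \<longleftrightarrow> (\<forall>c v u. lab l c v \<longrightarrow> 2 \<le> v \<longrightarrow> longc (v - 2) u \<longrightarrow> matchc (v - 2) u \<longrightarrow> pe c 0 \<notin> F \<or> differs X u)"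
    by (subst trip) (simp add: cJ_def cK_def lits_differs[unfolded One_nat_def] lit_simps, blast)
  have p5: "(\<forall>d. ?P 5 d) \<longleftrightarrow> (\<forall>c. lab l c 0 \<longrightarrow> pe c 1 \<notin> F \<or> (\<exists>n. pe (snocc c n) 1 \<in> F))"
    by (simp add: cJ_def cK_def lits_disj lit_simps)
  have p6: "(\<forall>d. ?P 6 d) \<longleftrightarrow> (\<forall>c n. lab l c 0 \<longrightarrow> list_decode (snocc c n) \<in> T \<longrightarrow> pe c 0 \<notin> F \<or> pe (snocc c n) 0 \<in> F)"
    by (subst pairs) (simp add: cJ_def cK_def lits_disj lit_simps, blast)
  have p7: "(\<forall>d. ?P 7 d) \<longleftrightarrow> (\<forall>c. lab l c 1 \<longrightarrow> pe c 0 \<notin> F \<or> (\<exists>n. pe (snocc c n) 0 \<in> F))"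
    by (simp add: cJ_def cK_def lits_disj lit_simps)
  have p8: "(\<forall>d. ?P 8 d) \<longleftrightarrow> (\<forall>c n. lab l c 1 \<longrightarrow> list_decode (snocc c n) \<in> T \<longrightarrow> pe c 1 \<notin> F \<or> pe (snocc c n) 1 \<in> F)"
    by (subst pairs) (simp add: cJ_def cK_def lits_disj lit_simps, blast)
  show ?thesis unfolding all split p0 p1 p2 p3 p4 p5 p6 p7 p8 ..
qed

end

lemma lab_0: "lab l c 0 \<longleftrightarrow> l (list_decode c) = Some Union_node"
  and lab_1: "lab l c 1 \<longleftrightarrow> l (list_decode c) = Some Inter_node"
  and lab_ge2: "2 \<le> v \<Longrightarrow> lab l c v \<longleftrightarrow> (\<exists>F. l (list_decode c) = Some (Clopen F) \<and> v = 2 + clopen_code F)"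
proof -
  show "lab l c 0 \<longleftrightarrow> l (list_decode c) = Some Union_node"
    unfolding lab_def by (auto; case_tac k; auto)
  show "lab l c 1 \<longleftrightarrow> l (list_decode c) = Some Inter_node"
    unfolding lab_def by (auto; case_tac k; auto)
  show "2 \<le> v \<Longrightarrow> lab l c v \<longleftrightarrow> (\<exists>F. l (list_decode c) = Some (Clopen F) \<and> v = 2 + clopen_code F)"
    unfolding lab_def by (auto simp: label_encode_Clopen simp del: label_encode.simps(3); case_tac k; auto simp: clopen_code_def)
qed

lemma Sat_of_strategy:
  assumes ws: "winning_strategy T l X f" and root: "f [] = Some \<beta>"
  shows "Sat T l (of_bool \<beta>) X {n. psnd n = 1 \<and> f (list_decode (pfst n)) = Some True \<or> psnd n = 0 \<and> f (list_decode (pfst n)) = Some False}"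
proof -
  let ?F = "{n. psnd n = 1 \<and> f (list_decode (pfst n)) = Some True \<or> psnd n = 0 \<and> f (list_decode (pfst n)) = Some False}"
  have F1: "pe c 1 \<in> ?F \<longleftrightarrow> f (list_decode c) = Some True" and F0: "pe c 0 \<in> ?F \<longleftrightarrow> f (list_decode c) = Some False" for c by auto
  have dom: "dom f \<subseteq> T" using ws by (simp add: winning_strategy_def)
  have leafc: "f s = Some True \<longrightarrow> X \<in> clopen_set G" "f s = Some False \<longrightarrow> X \<notin> clopen_set G" if "l s = Some (Clopen G)" for s G
    using ws that dom unfolding winning_strategy_def by (metis domI in_mono option.inject)+
  have un: "(f s = Some True \<longrightarrow> (\<exists>n. f (s @ [n]) = Some True)) \<and> (f s = Some False \<longrightarrow> (\<forall>n. s @ [n] \<in> T \<longrightarrow> f (s @ [n]) = Some False))"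
    if "l s = Some Union_node" for s
    using ws that dom unfolding winning_strategy_def by (metis domI in_mono)
  have int: "(f s = Some False \<longrightarrow> (\<exists>n. f (s @ [n]) = Some False)) \<and> (f s = Some True \<longrightarrow> (\<forall>n. s @ [n] \<in> T \<longrightarrow> f (s @ [n]) = Some True))"
    if "l s = Some Inter_node" for s
    using ws that dom unfolding winning_strategy_def by (metis domI in_mono)
  show ?thesis
    unfolding Sat_iff F1 F0 list_decode_snocc
  proof (intro conjI allI impI)
    show "pe 0 (of_bool \<beta>) \<in> ?F" using root by (cases \<beta>) auto
    show "pe c y \<notin> ?F" if "list_decode c \<notin> T" for c y using that dom by auto
    fix c v u assume lv: "lab l c v" "2 \<le> v" "longc (v - 2) u"
    then obtain G where G: "l (list_decode c) = Some (Clopen G)" "v - 2 = clopen_code G" using lab_ge2 by fastforce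
    show "f (list_decode c) \<noteq> Some True \<or> differs X u" if "\<not> matchc (v - 2) u"
      using matchc_iff[of G u X] lv(3) that G(2) leafc(1)[OF G(1)] by auto
    show "f (list_decode c) \<noteq> Some False \<or> differs X u" if "matchc (v - 2) u"
      using matchc_iff[of G u X] lv(3) that G(2) leafc(2)[OF G(1)] by auto
  qed (use un int in \<open>auto simp: lab_0 lab_1[unfolded One_nat_def]\<close>)
qed

lemma strategy_of_Sat:
  assumes S: "Sat T l (of_bool \<beta>) X F"
  defines "f \<equiv> \<lambda>s. if pe (list_encode s) 1 \<in> F then Some True else if pe (list_encode s) 0 \<in> F then Some False else None"
  shows "winning_strategy T l X f" "f [] = Some \<beta>"
proof -
  have f1: "f s = Some True \<longleftrightarrow> pe (list_encode s) 1 \<in> F" for s by (simp add: f_def)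
  have f0: "f s = Some False \<longleftrightarrow> pe (list_encode s) 0 \<in> F" for s
    using S unfolding Sat_iff f_def by auto
  note S' = S[unfolded Sat_iff]
  show root: "f [] = Some \<beta>"
    using S' f1[of "[]"] f0[of "[]"] by (cases \<beta>) auto
  have dom: "dom f \<subseteq> T"
  proof
    fix s assume "s \<in> dom f"
    then have "pe (list_encode s) 1 \<in> F \<or> pe (list_encode s) 0 \<in> F" by (auto simp: f_def split: if_splits)
    then show "s \<in> T" using S' by (metis list_encode_inverse)
  qed
  have cl: "f s = Some True \<longrightarrow> X \<in> clopen_set G" "f s = Some False \<longrightarrow> X \<notin> clopen_set G" if G: "l s = Some (Clopen G)" for s G
  proof -
    \<comment> \<open>A string that \<open>X\<close> agrees with turns the leaf clauses into
      statements about \<open>f\<close> alone.\<close>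
    obtain u where u: "longc (clopen_code G) u" "\<not> differs X u" using long_approx by blast
    have la: "lab l (list_encode s) (2 + clopen_code G)" using G by (simp add: lab_ge2)
    have "\<not> matchc (clopen_code G) u \<longrightarrow> pe (list_encode s) 1 \<notin> F" "matchc (clopen_code G) u \<longrightarrow> pe (list_encode s) 0 \<notin> F"
      using S' la u by (metis add_diff_cancel_left' le_add1)+
    then show "f s = Some True \<longrightarrow> X \<in> clopen_set G" "f s = Some False \<longrightarrow> X \<notin> clopen_set G"
      unfolding f1 f0 using matchc_iff[OF u] by auto
  qed
  have un: "(f s = Some True \<longrightarrow> (\<exists>n. f (s @ [n]) = Some True)) \<and> (f s = Some False \<longrightarrow> (\<forall>n. s @ [n] \<in> T \<longrightarrow> f (s @ [n]) = Some False))"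
    if "l s = Some Union_node" for s
    using S' that unfolding f1 f0 snocc_list_encode[symmetric] by (metis lab_0 list_decode_snocc list_encode_inverse)
  have int: "(f s = Some False \<longrightarrow> (\<exists>n. f (s @ [n]) = Some False)) \<and> (f s = Some True \<longrightarrow> (\<forall>n. s @ [n] \<in> T \<longrightarrow> f (s @ [n]) = Some True))"
    if "l s = Some Inter_node" for s
    using S' that unfolding f1 f0 snocc_list_encode[symmetric] by (metis lab_1 list_decode_snocc list_encode_inverse)
  show "winning_strategy T l X f"
    unfolding winning_strategy_def
  proof (intro conjI ballI allI impI)
    fix s G assume G: "l s = Some (Clopen G)" "s \<in> dom f"
    then have "f s = Some True \<or> f s = Some False" by (auto simp: f_def split: if_splits)
    then show "f s = Some True \<longleftrightarrow> X \<in> clopen_set G" using cl[OF G(1)] by auto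
  qed (use dom root un int in auto)
qed

theorem determined_imp_delta1:
  assumes A: "A \<subseteq> HYP" and det: "determined_code_for T l A"
  shows "delta1_L_omega1ck A"
proof -
  have code: "borel_code_in_HYP T l" and ex: "\<And>X. X \<in> HYP \<Longrightarrow> \<exists>f. map_in_HYP f \<and> winning_strategy T l X f"
    and AX: "\<And>X. X \<in> HYP \<Longrightarrow> X \<in> A \<longleftrightarrow> (\<exists>f. map_in_HYP f \<and> winning_strategy T l X f \<and> f [] = Some True)"
    using det unfolding determined_code_for_def determined_in_HYP_def by auto
  have eT: "ebp (\<lambda>c. list_decode c \<in> T)" and el: "ebp2 (lab l)"
    using code unfolding borel_code_in_HYP_def tree_in_HYP_iff labeling_in_HYP_iff by auto
  have Sat: "(\<exists>F\<in>HYP. Sat T l (of_bool \<beta>) X F) \<longleftrightarrow> (\<exists>f. map_in_HYP f \<and> winning_strategy T l X f \<and> f [] = Some \<beta>)" for \<beta> X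
  proof
    assume "\<exists>F\<in>HYP. Sat T l (of_bool \<beta>) X F"
    then obtain F where F: "F \<in> HYP" "Sat T l (of_bool \<beta>) X F" by blast
    define f where "f s = (if pe (list_encode s) 1 \<in> F then Some True else if pe (list_encode s) 0 \<in> F then Some False else None)" for s
    have [eb_intros]: "recfn g \<Longrightarrow> ebp (\<lambda>n. g n \<in> F)" for g using ebp_comp F(1) HYP_iff_ebp by blast
    have f1: "f (list_decode c) = Some True \<longleftrightarrow> pe c 1 \<in> F" "f (list_decode c) = Some False \<longleftrightarrow> pe c 1 \<notin> F \<and> pe c 0 \<in> F" for c
      by (auto simp: f_def)
    have "map_in_HYP f" unfolding map_in_HYP_iff f1 by (intro conjI eb_intros rec_intros)
    then show "\<exists>f. map_in_HYP f \<and> winning_strategy T l X f \<and> f [] = Some \<beta>"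
      using strategy_of_Sat[OF F(2)] unfolding f_def by blast
  next
    assume "\<exists>f. map_in_HYP f \<and> winning_strategy T l X f \<and> f [] = Some \<beta>"
    then obtain f where f: "map_in_HYP f" "winning_strategy T l X f" "f [] = Some \<beta>" by blast
    have [eb_intros]: "recfn g \<Longrightarrow> ebp (\<lambda>n. f (list_decode (g n)) = Some True)" "recfn g \<Longrightarrow> ebp (\<lambda>n. f (list_decode (g n)) = Some False)" for g
      using f(1) ebp_comp[of "\<lambda>c. f (list_decode c) = Some True"] ebp_comp[of "\<lambda>c. f (list_decode c) = Some False"]
      unfolding map_in_HYP_iff by auto
    let ?F = "{n. psnd n = 1 \<and> f (list_decode (pfst n)) = Some True \<or> psnd n = 0 \<and> f (list_decode (pfst n)) = Some False}"
    have "?F \<in> HYP" unfolding HYP_iff_ebp mem_Collect_eq by (intro eb_intros rec_intros)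
    then show "\<exists>F\<in>HYP. Sat T l (of_bool \<beta>) X F" using Sat_of_strategy[OF f(2,3)] by blast
  qed
  \<comment> \<open>With the root value 0 the same clauses define the complement: by determinacy
    some strategy exists, and strategies in \<open>HYP\<close> with different root values exclude
    each other.\<close>
  have sig: "sigma1_definable (Lset omega1ck) (hc_of_nat_set ` {X \<in> HYP. \<exists>f. map_in_HYP f \<and> winning_strategy T l X f \<and> f [] = Some \<beta>})" for \<beta>
    using sigma1_clauses[OF ebp_cJ[OF eT el] ebp_cK cK_ge, of "of_bool \<beta>"] unfolding Sat[symmetric] Sat_def .
  have "{X \<in> HYP. \<exists>f. map_in_HYP f \<and> winning_strategy T l X f \<and> f [] = Some True} = A"
    using A AX by blast
  moreover have "{X \<in> HYP. \<exists>f. map_in_HYP f \<and> winning_strategy T l X f \<and> f [] = Some False} = HYP - A"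
  proof (intro equalityI subsetI)
    fix X assume "X \<in> {X \<in> HYP. \<exists>f. map_in_HYP f \<and> winning_strategy T l X f \<and> f [] = Some False}"
    then show "X \<in> HYP - A" using AX strategies_agree[OF code] by blast
  next
    fix X assume X: "X \<in> HYP - A"
    then obtain f where f: "map_in_HYP f" "winning_strategy T l X f" using ex by blast
    then have "[] \<in> dom f" by (simp add: winning_strategy_def)
    then obtain y where y: "f [] = Some y" by blast
    then have "y = False" using X AX f by (cases y) auto
    then show "X \<in> {X \<in> HYP. \<exists>f. map_in_HYP f \<and> winning_strategy T l X f \<and> f [] = Some False}" using X f y by blast
  qed
  ultimately show ?thesis using sig[of True] sig[of False] unfolding delta1_L_omega1ck_def by simp
qed

section \<open>\<open>\<Sigma>\<^sub>1\<close> sets as classes of trees without paths\<close>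

subsection \<open>An enumeration of the computable linear orders\<close>

definition evalc :: "nat \<Rightarrow> nat \<Rightarrow> nat \<Rightarrow> bool" where
  "evalc e n y \<longleftrightarrow> (\<exists>g. goedel g = e \<and> eval {} g n y)"

lemma ebp3_evalc: "ebp3 evalc"
  unfolding ebp3_def evalc_def by (rule ebp_eval)

definition cvalid :: "nat \<Rightarrow> bool" where
  "cvalid e \<longleftrightarrow> (\<forall>n. evalc e n 0 \<or> evalc e n 1) \<and>
     (\<forall>a b. evalc e (pe a b) 1 \<longrightarrow> evalc e (pe a a) 1 \<and> evalc e (pe b b) 1) \<and>
     (\<forall>a b c. evalc e (pe a b) 1 \<longrightarrow> evalc e (pe b c) 1 \<longrightarrow> evalc e (pe a c) 1) \<and>
     (\<forall>a b. evalc e (pe a b) 1 \<longrightarrow> evalc e (pe b a) 1 \<longrightarrow> a = b) \<and>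
     (\<forall>a b. evalc e (pe a a) 1 \<longrightarrow> evalc e (pe b b) 1 \<longrightarrow> evalc e (pe a b) 1 \<or> evalc e (pe b a) 1)"

text \<open>Indices that fail the test get the empty order, so every index denotes a linear order.
  Well-foundedness is kept out of the test, which has to stay game-definable.\<close>

definition Re :: "nat \<Rightarrow> nat rel" where
  "Re e = {(a, b). cvalid e \<and> evalc e (pe a b) 1}"

lemma ebp3_Re: "ebp3 (\<lambda>e a b. (a, b) \<in> Re e)"
proof -
  note [eb_intros] = ebp3_comp[OF ebp3_evalc]
  show ?thesis unfolding ebp3_def Re_def cvalid_def mem_Collect_eq prod.case by (intro eb_intros rec_intros)
qed

lemma Field_Re: "a \<in> Field (Re e) \<longleftrightarrow> (a, a) \<in> Re e"
proof
  assume "a \<in> Field (Re e)"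
  then obtain b where "cvalid e" "evalc e (pe a b) 1 \<or> evalc e (pe b a) 1" by (auto simp: Field_def Re_def)
  then have "evalc e (pe a a) 1" unfolding cvalid_def by blast
  then show "(a, a) \<in> Re e" using \<open>cvalid e\<close> by (simp add: Re_def)
qed (auto simp: Field_def)

lemma computable_wellorder_Re: assumes "wf (Re e - Id)" shows "computable_wellorder (Re e)"
proof -
  have "refl_on (Field (Re e)) (Re e)" by (rule refl_onI) (simp only: Field_Re)
  moreover have "trans (Re e)"
    unfolding trans_def Re_def mem_Collect_eq prod.case cvalid_def by meson
  moreover have "antisym (Re e)"
    unfolding antisym_def Re_def mem_Collect_eq prod.case cvalid_def by meson
  moreover have "total_on (Field (Re e)) (Re e)"
    unfolding total_on_def Ball_def Field_Re unfolding Re_def mem_Collect_eq prod.case cvalid_def by meson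
  moreover have "Re e \<subseteq> Field (Re e) \<times> Field (Re e)" by (auto intro: FieldI1 FieldI2)
  ultimately have "Well_order (Re e)" using assms unfolding order_on_defs by blast
  moreover have "computable (prod_encode ` Re e)"
  proof (cases "cvalid e")
    case False
    then have "Re e = {}" by (auto simp: Re_def)
    then show ?thesis by (simp add: computable_iff_recp recp_const)
  next
    case True
    then obtain g where g: "goedel g = e" unfolding cvalid_def evalc_def by blast
    have ev: "evalc e n y \<longleftrightarrow> eval {} g n y" for n y using g goedel_inject unfolding evalc_def by blast
    have "eval {} g n (of_bool (n \<in> prod_encode ` Re e))" for n
    proof -
      have m: "n \<in> prod_encode ` Re e \<longleftrightarrow> eval {} g n 1"
      proof -
        have "n \<in> prod_encode ` Re e \<longleftrightarrow> (pfst n, psnd n) \<in> Re e" by (auto simp: image_iff) (metis pe_pfst_psnd)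
        then show ?thesis using True by (simp add: Re_def ev)
      qed
      have "eval {} g n 0 \<or> eval {} g n 1" using True unfolding cvalid_def ev by blast
      then show ?thesis using m by auto
    qed
    then show ?thesis unfolding computable_def turing_le_def by blast
  qed
  ultimately show ?thesis by (simp add: computable_wellorder_def)
qed

lemma Re_surj: assumes "computable_wellorder R" shows "\<exists>e. Re e = R"
proof -
  have WO: "Well_order R" and C: "computable (prod_encode ` R)" using assms by (auto simp: computable_wellorder_def)
  obtain g where g: "\<And>n. eval {} g n (of_bool (n \<in> prod_encode ` R))"
    using C unfolding computable_def turing_le_def by blast
  have inR: "pe a b \<in> prod_encode ` R \<longleftrightarrow> (a, b) \<in> R" for a b
    by (auto simp: inj_image_mem_iff[OF inj_prod_encode[of UNIV]])
  have ev: "evalc (goedel g) n y \<longleftrightarrow> y = of_bool (n \<in> prod_encode ` R)" for n y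
    unfolding evalc_def using goedel_inject g eval_deterministic by metis
  have le: "evalc (goedel g) (pe a b) 1 \<longleftrightarrow> (a, b) \<in> R" for a b unfolding ev inR by auto
  have "cvalid (goedel g)"
    unfolding cvalid_def le
  proof (intro conjI allI impI)
    show "evalc (goedel g) n 0 \<or> evalc (goedel g) n 1" for n unfolding ev by auto
    fix a b c
    show "(a, a) \<in> R" "(b, b) \<in> R" if "(a, b) \<in> R"
      using wo_refl[OF WO] FieldI1[OF that] FieldI2[OF that] by blast+
    show "(a, c) \<in> R" if "(a, b) \<in> R" "(b, c) \<in> R" using wo_trans[OF WO] that by blast
    show "a = b" if "(a, b) \<in> R" "(b, a) \<in> R" using wo_antisym[OF WO] that by blast
    show "(a, b) \<in> R \<or> (b, a) \<in> R" if "(a, a) \<in> R" "(b, b) \<in> R"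
      using wo_total[OF WO, of a b] FieldI1[OF that(1)] FieldI1[OF that(2)] by blast
  qed
  then have "Re (goedel g) = R" unfolding Re_def le by auto
  then show ?thesis by blast
qed

subsection \<open>Absoluteness\<close>

lemma delta0_absolute:
  assumes "delta0_fm p" "transM N" "transM M" "N \<subseteq> M" "set env \<subseteq> N" "arity p \<le> length env"
  shows "sats N env p \<longleftrightarrow> sats M env p"
  using assms(1,5,6)
proof (induction arbitrary: env rule: delta0_fm.induct)
  case (bounded_Exi p i)
  have i: "i < length env" "arity p \<le> Suc (length env)" using bounded_Exi.prems(2) by auto
  then have ei: "elts (env ! i) \<subseteq> N" using bounded_Exi.prems(1) assms(2) nth_mem unfolding transM_def by blast
  have "sats N env (Exi (Conj (Mem 0 (Suc i)) p)) \<longleftrightarrow> (\<exists>x\<in>elts (env ! i). sats N (x # env) p)"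
    using ei by auto
  also have "\<dots> \<longleftrightarrow> (\<exists>x\<in>elts (env ! i). sats M (x # env) p)"
  proof (rule bex_cong[OF refl])
    fix x assume "x \<in> elts (env ! i)"
    then show "sats N (x # env) p \<longleftrightarrow> sats M (x # env) p"
      using ei bounded_Exi.prems(1) i(2) by (intro bounded_Exi.IH) auto
  qed
  also have "\<dots> \<longleftrightarrow> sats M env (Exi (Conj (Mem 0 (Suc i)) p))"
    using ei assms(4) by auto
  finally show ?case .
qed auto

lemma sigma1_upward:
  assumes "sigma1_fm p" "transM N" "transM M" "N \<subseteq> M" "set env \<subseteq> N" "arity p \<le> length env" "sats N env p"
  shows "sats M env p"
  using assms(1,5,6,7)
proof (induction arbitrary: env rule: sigma1_fm.induct)
  case (1 p)
  then show ?case using delta0_absolute assms(2,3,4) by blast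
next
  case (2 p)
  then obtain x where x: "x \<in> N" "sats N (x # env) p" by auto
  have "sats M (x # env) p" by (rule 2) (use x 2 in auto)
  then show ?case using x(1) assms(4) by auto
qed

lemma L_bound2:
  assumes "computable_wellorder R" "computable_wellorder S"
  shows "\<exists>Q. computable_wellorder Q \<and> Lset (ot R) \<subseteq> Lset (ot Q) \<and> Lset (ot S) \<subseteq> Lset (ot Q)"
  using computable_wellorder_osum[OF assms] Lset_osum1[of R S] Lset_osum2[of R S] assms
  by (auto simp: computable_wellorder_def)

lemma L_bound1:
  assumes "x \<in> Lset omega1ck" shows "\<exists>Q. computable_wellorder Q \<and> x \<in> Lset (ot Q)"
proof -
  obtain R where R: "computable_wellorder R" "x \<in> DPow (Lset (ot R))" using assms unfolding Lset_omega1ck by blast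
  then show ?thesis using computable_wellorder_osum[OF R(1) cwo_onepoint] DPow_ot_le[of R]
    by (auto simp: computable_wellorder_def)
qed

lemma L_bound_list:
  assumes "set xs \<subseteq> Lset omega1ck" shows "\<exists>Q. computable_wellorder Q \<and> set xs \<subseteq> Lset (ot Q)"
  using assms
proof (induction xs)
  case Nil then show ?case using cwo_onepoint by auto
next
  case (Cons x xs)
  then obtain R where R: "computable_wellorder R" "set xs \<subseteq> Lset (ot R)" by auto
  obtain S where S: "computable_wellorder S" "x \<in> Lset (ot S)" using L_bound1 Cons.prems by auto
  show ?case using L_bound2[OF R(1) S(1)] R S by (metis insert_subset list.simps(15) subset_trans subsetD)
qed

lemma L_ot_le: "computable_wellorder R \<Longrightarrow> Lset (ot R) \<subseteq> Lset omega1ck"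
  using transM_subset_DPow[OF transM_Lset] unfolding Lset_omega1ck by blast

text \<open>Each witness already lies in some level along a computable well-order, and every larger
  transitive set contains it too; the bounded part is absolute.\<close>

lemma sigma1_reflect:
  assumes "sigma1_fm p" "set env \<subseteq> Lset omega1ck" "arity p \<le> length env" "sats (Lset omega1ck) env p"
  shows "\<exists>R. computable_wellorder R \<and> (\<forall>N. transM N \<longrightarrow> Lset (ot R) \<subseteq> N \<longrightarrow> N \<subseteq> Lset omega1ck \<longrightarrow> set env \<subseteq> N \<longrightarrow> sats N env p)"
  using assms
proof (induction arbitrary: env rule: sigma1_fm.induct)
  case (1 p)
  then show ?case using delta0_absolute[OF 1(1) _ transM_Lset] cwo_onepoint by blast
next
  case (2 p)
  then obtain x where x: "x \<in> Lset omega1ck" "sats (Lset omega1ck) (x # env) p" by auto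
  have "set (x # env) \<subseteq> Lset omega1ck" "arity p \<le> length (x # env)" using 2 x by auto
  from 2(2)[OF this x(2)] obtain R where R: "computable_wellorder R"
    "\<And>N. transM N \<Longrightarrow> Lset (ot R) \<subseteq> N \<Longrightarrow> N \<subseteq> Lset omega1ck \<Longrightarrow> set (x # env) \<subseteq> N \<Longrightarrow> sats N (x # env) p" by blast
  obtain S where S: "computable_wellorder S" "x \<in> Lset (ot S)" using L_bound1[OF x(1)] by blast
  obtain Q where Q: "computable_wellorder Q" "Lset (ot R) \<subseteq> Lset (ot Q)" "Lset (ot S) \<subseteq> Lset (ot Q)"
    using L_bound2[OF R(1) S(1)] by blast
  have "sats N env (Exi p)" if "transM N" "Lset (ot Q) \<subseteq> N" "N \<subseteq> Lset omega1ck" "set env \<subseteq> N" for N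
  proof -
    have "x \<in> N" using that S Q by blast
    moreover have "sats N (x # env) p" by (rule R(2)) (use that Q \<open>x \<in> N\<close> in auto)
    ultimately show ?thesis by auto
  qed
  then show ?case using Q(1) by blast
qed

subsection \<open>Trees\<close>

text \<open>Terms whose level lies in the first summand never look at the second. Codes of the
  parameters can thus be fixed once and serve for every order \<open>Re e\<close>.\<close>

lemma tval_independent:
  assumes S: "Well_order S" and R: "Well_order R" "Well_order R'"
  shows "even (lev t) \<Longrightarrow> tval (osum S R) t = tval (osum S R') t"
proof (induction t rule: less_induct)
  case (less t)
  obtain a where a: "lev t = 2 * a" using less.prems by blast
  have c: "col (osum S R) (2 * a) = col (osum S R') (2 * a)"
    using col_osum_even[OF S R(1)] col_osum_even[OF S R(2)] by simp
  have u: "underS (osum S R) (2 * a) = underS (osum S R') (2 * a)" by (simp add: underS_osum_even)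
  have "(\<lambda>i. if i < lenc (tps t) \<and> lev (nthc (tps t) i) \<in> underS (osum S R) (2 * a) then tval (osum S R) (nthc (tps t) i) else hcset {}) =
     (\<lambda>i. if i < lenc (tps t) \<and> lev (nthc (tps t) i) \<in> underS (osum S R') (2 * a) then tval (osum S R') (nthc (tps t) i) else hcset {})"
  proof
    fix i
    have "tval (osum S R) (nthc (tps t) i) = tval (osum S R') (nthc (tps t) i)"
      if i: "i < lenc (tps t)" "lev (nthc (tps t) i) \<in> underS (osum S R') (2 * a)"
    proof (rule less.IH)
      have "nthc (tps t) i < tps t" using i(1) by (rule nthc_lt)
      then show "nthc (tps t) i < t" using psnd_le[of "psnd t"] psnd_le[of t] by linarith
      show "even (lev (nthc (tps t) i))" using i(2) unfolding underS_osum_even by auto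
    qed
    then show "(if i < lenc (tps t) \<and> lev (nthc (tps t) i) \<in> underS (osum S R) (2 * a) then tval (osum S R) (nthc (tps t) i) else hcset {}) =
     (if i < lenc (tps t) \<and> lev (nthc (tps t) i) \<in> underS (osum S R') (2 * a) then tval (osum S R') (nthc (tps t) i) else hcset {})"
      unfolding u by auto
  qed
  then show ?case unfolding tval.simps[of _ t] a c by simp
qed

text \<open>Even places of a path hold the characteristic function of \<open>X\<close>, odd places
  three interleaved kinds of justification, told apart by \<open>k\<close>.\<close>

abbreviation ix :: "nat \<Rightarrow> nat \<Rightarrow> nat" where "ix k z \<equiv> 2 * pe k z + 1"

text \<open>
  \<open>evid lt r q ps L v\<close> says of the values of \<open>v\<close> below \<open>L\<close>: \<open>v (ix 0 (e, _))\<close> is a descending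
  sequence in the order \<open>r e\<close>, or else \<open>v (ix 1 (e, _))\<close> is evidence for the truth game of the
  levels along \<open>e\<close> and \<open>v (ix 2 (e, _))\<close> refutes every term \<open>t\<close> as a witness that the set with
  characteristic function \<open>\<lambda>n. v (2 * n)\<close> satisfies the formula \<open>q\<close>, by a point where the two
  sets differ or by the evidence itself.
\<close>

definition evid :: "(nat \<Rightarrow> nat \<Rightarrow> nat \<Rightarrow> bool) \<Rightarrow> (nat \<Rightarrow> nat \<Rightarrow> nat \<Rightarrow> bool) \<Rightarrow> nat \<Rightarrow> nat \<Rightarrow> nat \<Rightarrow> (nat \<Rightarrow> nat) \<Rightarrow> bool" where
  "evid lt r q ps L v \<longleftrightarrow>
    (\<forall>e n. ix 0 (pe e n) < L \<longrightarrow> ix 0 (pe e (Suc n)) < L \<longrightarrow> v (ix 0 (pe e n)) \<noteq> 0 \<longrightarrow>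
       v (ix 0 (pe e (Suc n))) \<noteq> 0 \<and> r e (v (ix 0 (pe e (Suc n))) - 1) (v (ix 0 (pe e n)) - 1)) \<and>
    (\<forall>e p q. ix 0 (pe e 0) < L \<longrightarrow> ix 1 (pe e p) < L \<longrightarrow> ix 1 (pe e q) < L \<longrightarrow> v (ix 0 (pe e 0)) = 0 \<longrightarrow>
       (v (ix 1 (pe e p)) = Suc q \<longrightarrow> rule_mv (LI (lt e)) LA LB p q \<and> v (ix 1 (pe e q)) = 0) \<and>
       (v (ix 1 (pe e p)) = 0 \<longrightarrow> rule_mv (LI (lt e)) LA LB p q \<longrightarrow> v (ix 1 (pe e q)) \<noteq> 0)) \<and>
    (\<forall>e b t. ix 0 (pe e 0) < L \<longrightarrow> ix 2 (pe e (pe b t)) < L \<longrightarrow> ix 1 (pe e (pe 0 (SatP b q (consc t ps)))) < L \<longrightarrow>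
       v (ix 0 (pe e 0)) = 0 \<longrightarrow> odd b \<longrightarrow> lt e (lev t) b \<longrightarrow> v (ix 2 (pe e (pe b t))) = 0 \<longrightarrow>
       v (ix 1 (pe e (pe 0 (SatP b q (consc t ps))))) = 0) \<and>
    (\<forall>e b t n. ix 0 (pe e 0) < L \<longrightarrow> ix 2 (pe e (pe b t)) < L \<longrightarrow> ix 1 (pe e (pe 0 (InP (numc n) t))) < L \<longrightarrow> 2 * n < L \<longrightarrow>
       v (ix 0 (pe e 0)) = 0 \<longrightarrow> odd b \<longrightarrow> lt e (lev t) b \<longrightarrow> v (ix 2 (pe e (pe b t))) = Suc n \<longrightarrow>
       (v (2 * n) \<noteq> 0 \<longleftrightarrow> v (ix 1 (pe e (pe 0 (InP (numc n) t)))) = 0))"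

lemma evid_cong:
  assumes "\<And>k. k < L \<Longrightarrow> v k = v' k" shows "evid lt r q ps L v \<longleftrightarrow> evid lt r q ps L v'"
  unfolding evid_def by (intro arg_cong2[where f = conj] all_cong1 imp_cong refl) (simp_all only: assms)

text \<open>A condition applies only when all the places it inspects lie below the bound; this is
  what turns \<open>evid\<close> into a tree.\<close>

lemma evid_mono: "evid lt r q ps L v \<Longrightarrow> K \<le> L \<Longrightarrow> evid lt r q ps K v"
  unfolding evid_def by (meson less_le_trans)

lemma ebp_evid:
  assumes "ebp3 lt" "ebp3 r" shows "ebp (\<lambda>s. evid lt r q ps (lenc s) (nthr s))"
proof -
  note [eb_intros] = ebp3_comp[OF assms(2)] ebp3_comp[OF assms(1)] ebp3_comp[OF ebp3_Lmv[OF assms(1)]]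
  show ?thesis unfolding evid_def by (intro eb_intros rec_intros)
qed

lemma evid_all: "(\<forall>L. evid lt r q ps L v) \<longleftrightarrow>
    (\<forall>e n. v (ix 0 (pe e n)) \<noteq> 0 \<longrightarrow>
       v (ix 0 (pe e (Suc n))) \<noteq> 0 \<and> r e (v (ix 0 (pe e (Suc n))) - 1) (v (ix 0 (pe e n)) - 1)) \<and>
    (\<forall>e p q. v (ix 0 (pe e 0)) = 0 \<longrightarrow>
       (v (ix 1 (pe e p)) = Suc q \<longrightarrow> rule_mv (LI (lt e)) LA LB p q \<and> v (ix 1 (pe e q)) = 0) \<and>
       (v (ix 1 (pe e p)) = 0 \<longrightarrow> rule_mv (LI (lt e)) LA LB p q \<longrightarrow> v (ix 1 (pe e q)) \<noteq> 0)) \<and>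
    (\<forall>e b t. v (ix 0 (pe e 0)) = 0 \<longrightarrow> odd b \<longrightarrow> lt e (lev t) b \<longrightarrow> v (ix 2 (pe e (pe b t))) = 0 \<longrightarrow>
       v (ix 1 (pe e (pe 0 (SatP b q (consc t ps))))) = 0) \<and>
    (\<forall>e b t n. v (ix 0 (pe e 0)) = 0 \<longrightarrow> odd b \<longrightarrow> lt e (lev t) b \<longrightarrow> v (ix 2 (pe e (pe b t))) = Suc n \<longrightarrow>
       (v (2 * n) \<noteq> 0 \<longleftrightarrow> v (ix 1 (pe e (pe 0 (InP (numc n) t)))) = 0))" (is "_ \<longleftrightarrow> ?P1 \<and> ?P2 \<and> ?P3 \<and> ?P4")
proof
  assume A: "\<forall>L. evid lt r q ps L v"
  have B: "\<exists>L. a < L \<and> b < L \<and> c < L \<and> d < L" for a b c d :: nat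
    by (rule exI[of _ "a + b + c + d + 1"]) auto
  show "?P1 \<and> ?P2 \<and> ?P3 \<and> ?P4"
  proof (intro conjI)
    show ?P1
    proof (intro allI)
      fix e n
      obtain L where L: "ix 0 (pe e n) < L" "ix 0 (pe e (Suc n)) < L" using B by blast
      show "v (ix 0 (pe e n)) \<noteq> 0 \<longrightarrow>
         v (ix 0 (pe e (Suc n))) \<noteq> 0 \<and> r e (v (ix 0 (pe e (Suc n))) - 1) (v (ix 0 (pe e n)) - 1)"
        using A[rule_format, of L, unfolded evid_def, THEN conjunct1] L by blast
    qed
    show ?P2
    proof (intro allI)
      fix e p q
      obtain L where L: "ix 0 (pe e 0) < L" "ix 1 (pe e p) < L" "ix 1 (pe e q) < L" using B by blast
      show "v (ix 0 (pe e 0)) = 0 \<longrightarrow>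
       (v (ix 1 (pe e p)) = Suc q \<longrightarrow> rule_mv (LI (lt e)) LA LB p q \<and> v (ix 1 (pe e q)) = 0) \<and>
       (v (ix 1 (pe e p)) = 0 \<longrightarrow> rule_mv (LI (lt e)) LA LB p q \<longrightarrow> v (ix 1 (pe e q)) \<noteq> 0)"
        using A[rule_format, of L, unfolded evid_def, THEN conjunct2, THEN conjunct1] L by blast
    qed
    show ?P3
    proof (intro allI)
      fix e b t
      obtain L where L: "ix 0 (pe e 0) < L" "ix 2 (pe e (pe b t)) < L" "ix 1 (pe e (pe 0 (SatP b q (consc t ps)))) < L" using B by blast
      show "v (ix 0 (pe e 0)) = 0 \<longrightarrow> odd b \<longrightarrow> lt e (lev t) b \<longrightarrow> v (ix 2 (pe e (pe b t))) = 0 \<longrightarrow>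
         v (ix 1 (pe e (pe 0 (SatP b q (consc t ps))))) = 0"
        using A[rule_format, of L, unfolded evid_def, THEN conjunct2, THEN conjunct2, THEN conjunct1] L by blast
    qed
    show ?P4
    proof (intro allI)
      fix e b t n
      obtain L where L: "ix 0 (pe e 0) < L" "ix 2 (pe e (pe b t)) < L" "ix 1 (pe e (pe 0 (InP (numc n) t))) < L" "2 * n < L" using B by blast
      show "v (ix 0 (pe e 0)) = 0 \<longrightarrow> odd b \<longrightarrow> lt e (lev t) b \<longrightarrow> v (ix 2 (pe e (pe b t))) = Suc n \<longrightarrow>
         (v (2 * n) \<noteq> 0 \<longleftrightarrow> v (ix 1 (pe e (pe 0 (InP (numc n) t)))) = 0)"
        using A[rule_format, of L, unfolded evid_def, THEN conjunct2, THEN conjunct2, THEN conjunct2] L by blast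
    qed
  qed
next
  assume "?P1 \<and> ?P2 \<and> ?P3 \<and> ?P4"
  then show "\<forall>L. evid lt r q ps L v" unfolding evid_def by blast
qed

text \<open>A path for \<open>X\<close> certifies that \<open>X\<close> is not in \<open>S\<close>.
  Alleged evidence along an ill-founded order may be false, which does no harm: only well-founded
  orders, along which evidence is forced to be correct, serve to refute a path.\<close>

theorem sigma1_tree:
  assumes S: "sigma1_definable (Lset omega1ck) S" "S \<subseteq> range hc_of_nat_set"
  obtains T where "ebp T" "T 0" "\<And>x s. T (consc x s) \<Longrightarrow> T s"
    "\<And>X. X \<in> HYP \<Longrightarrow> hc_of_nat_set X \<in> S \<longleftrightarrow> \<not> (\<exists>F. (\<forall>n. F (2 * n) \<noteq> 0 \<longleftrightarrow> n \<in> X) \<and> (\<forall>n. T (segc F n)))"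
proof -
  let ?M = "Lset omega1ck"
  obtain p ps where p: "sigma1_fm p" "set ps \<subseteq> ?M" "arity p \<le> Suc (length ps)" and Sp: "S = defined_by ?M p ps"
    using S(1) unfolding sigma1_definable_def by blast
  obtain R0 where R0: "computable_wellorder R0" "set ps \<subseteq> Lset (ot R0)" using L_bound_list[OF p(2)] by blast
  \<comment> \<open>The fixed first summand provides the numerals and all parameters; the odd points
    of \<open>osum S0 (Re e)\<close>, which are those required in \<open>evid\<close>, lie above
    it.\<close>
  define S0 where "S0 = osum natle R0"
  have cS0: "computable_wellorder S0" unfolding S0_def by (rule computable_wellorder_osum[OF cwo_natle R0(1)])
  have wR0: "Well_order R0" and wS0: "Well_order S0" and rS0: "rec2 (\<lambda>a b. (a, b) \<in> S0)"
    using R0 cS0 by (simp_all add: computable_wellorder_iff)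
  have we: "Well_order {}" by simp
  have "\<exists>t. even (lev t) \<and> lev t div 2 \<in> Field S0 \<and> tval (osum S0 {}) t = y" if y: "y \<in> set ps" for y
  proof -
    interpret E: levels "osum S0 {}" unfolding S0_def by (rule levels_osum[OF wR0 we])
    have "y \<in> Lset (ot (osum S0 {}))"
      using y R0(2) Lset_osum2[OF wo_natle wR0] Lset_osum1[OF wS0 we] unfolding S0_def by blast
    then obtain t where t: "lev t \<in> Field (osum S0 {})" "tval (osum S0 {}) t = y" unfolding E.Lot_eq by blast
    then show ?thesis using Field_osum[OF wS0 we, of "lev t"] by (auto split: if_splits)
  qed
  then obtain g where g: "\<And>y. y \<in> set ps \<Longrightarrow> even (lev (g y)) \<and> lev (g y) div 2 \<in> Field S0 \<and> tval (osum S0 {}) (g y) = y"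
    by metis
  define psl where "psl = list_encode (map g ps)"
  obtain q where q: "dec_fm q = p" using dec_fm_surj by blast
  define lt where "lt e a b \<longleftrightarrow> a \<in> underS (osum S0 (Re e)) b" for e a b
  define r where "r e a b \<longleftrightarrow> (a, b) \<in> Re e \<and> a \<noteq> b" for e a b
  note [eb_intros] = ebp3_comp[OF ebp3_Re] ebp_rec[OF rec2_comp[OF rS0]]
  have eblt: "ebp3 lt"
    unfolding ebp3_def lt_def underS_def osum_def wo_refl[OF wS0] Field_Re mem_Collect_eq prod.case by (intro eb_intros rec_intros)
  have ebr: "ebp3 r" unfolding ebp3_def r_def by (intro eb_intros rec_intros)
  define T where "T s \<longleftrightarrow> evid lt r q psl (lenc s) (nthr s)" for s
  have Tseg: "T (segc F n) \<longleftrightarrow> evid lt r q psl n F" for F n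
    unfolding T_def lenc_segc by (rule evid_cong) simp
  have closed: "T s" if "T (consc x s)" for x s
  proof -
    have "evid lt r q psl (lenc s) (nthr (consc x s))"
      using evid_mono[of lt r q psl "lenc (consc x s)"] that by (simp add: T_def)
    then show ?thesis unfolding T_def by (subst (asm) evid_cong[where v' = "nthr s"]) (auto simp: nthr_consc)
  qed
  have lv: "levels (osum S0 (Re e))" if "wf (Re e - Id)" for e
    unfolding S0_def using levels_osum[OF wR0] computable_wellorder_Re[OF that] by (simp add: computable_wellorder_def)
  have lte: "lt e = (\<lambda>a b. a \<in> underS (osum S0 (Re e)) b)" for e by (intro ext) (simp add: lt_def)
  have sem: "Lset (col (osum S0 (Re e)) b) \<subseteq> ?M \<and> set ps \<subseteq> Lset (col (osum S0 (Re e)) b) \<and>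
     (win (rule_mv (LI (lt e)) LA LB) (pe 0 (SatP b q (consc t psl))) \<longleftrightarrow>
        sats (Lset (col (osum S0 (Re e)) b)) (tval (osum S0 (Re e)) t # ps) p) \<and>
     (win (rule_mv (LI (lt e)) LA LB) (pe 0 (InP (numc n) t)) \<longleftrightarrow> hc_of_nat n \<in> elts (tval (osum S0 (Re e)) t)) \<and>
     tval (osum S0 (Re e)) t \<in> Lset (col (osum S0 (Re e)) b)"
    if wf: "wf (Re e - Id)" and b: "odd b" and t: "lt e (lev t) b" for e b t n
  proof -
    let ?R = "osum S0 (Re e)" and ?N = "Lset (col (osum S0 (Re e)) b)"
    have cRe: "computable_wellorder (Re e)" and wRe: "Well_order (Re e)"
      using computable_wellorder_Re[OF wf] by (auto simp: computable_wellorder_def)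
    interpret L: levels ?R by (rule lv[OF wf])
    have t': "lev t \<in> underS ?R b" using t by (simp add: lt_def)
    have bF: "b \<in> Field ?R" "b \<noteq> 0" "lev t \<in> Field ?R" using underS_Field2[OF t'] underS_Field1[OF t'] b by (auto elim: oddE)
    then have b2: "b div 2 \<in> Field (Re e)" using Field_osum[OF wS0 wRe, of b] b by simp
    have bb: "b = 2 * (b div 2) + 1" using b by simp
    have "?N \<subseteq> Lset (ot ?R)" using bF(1) by (intro Lset_mono_mem) (auto simp: elts_ot)
    also have "\<dots> \<subseteq> ?M" by (rule L_ot_le[OF computable_wellorder_osum[OF cS0 cRe]])
    finally have NM: "?N \<subseteq> ?M" .
    have gy: "lev (g y) \<in> underS ?R b \<and> tval ?R (g y) = y" if "y \<in> set ps" for y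
    proof -
      have gy: "even (lev (g y))" "lev (g y) div 2 \<in> Field S0" "tval (osum S0 {}) (g y) = y" using g[OF that] by auto
      have "2 * (lev (g y) div 2) \<in> underS ?R (2 * (b div 2) + 1)" unfolding underS_osum_odd[OF b2] using gy(2) by blast
      moreover have "2 * (lev (g y) div 2) = lev (g y)" using gy(1) by simp
      ultimately have "lev (g y) \<in> underS ?R b" using bb by simp
      moreover have "tval ?R (g y) = y" using tval_independent[OF wS0 wRe we gy(1)] gy(3) by simp
      ultimately show ?thesis by blast
    qed
    have psN: "set ps \<subseteq> ?N" using gy L.tval_Lv by (metis subsetI)
    have lk: "tval ?R (lookup L.lt b psl i) = ps ! i" if "i < length ps" for i
      using gy[OF nth_mem[OF that]] that by (simp add: psl_def lookup_def nthc_list_encode)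
    have "win (rule_mv (LI (lt e)) LA LB) (pe 0 (SatP b q (consc t psl))) \<longleftrightarrow>
      satsf ?N (\<lambda>i. tval ?R (lookup L.lt b (consc t psl) i)) p"
      using L.L_Sat[OF bF(1,2), of q "consc t psl"] unfolding rule_holds_def lte q .
    also have "\<dots> \<longleftrightarrow> satsf ?N (case_nat (tval ?R t) (\<lambda>i. tval ?R (lookup L.lt b psl i))) p"
      by (subst L.lookup_consc[OF t']) (rule refl)
    also have "\<dots> \<longleftrightarrow> satsf ?N (case_nat (tval ?R t) ((!) ps)) p"
      by (rule satsf_cong) (use p(3) lk in \<open>auto split: nat.split\<close>)
    also have "\<dots> \<longleftrightarrow> sats ?N (tval ?R t # ps) p" unfolding sats_eq_satsf nth_Cons_case_nat ..
    finally have s1: "win (rule_mv (LI (lt e)) LA LB) (pe 0 (SatP b q (consc t psl))) \<longleftrightarrow> sats ?N (tval ?R t # ps) p" .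
    have s2: "win (rule_mv (LI (lt e)) LA LB) (pe 0 (InP (numc n) t)) \<longleftrightarrow> hc_of_nat n \<in> elts (tval ?R t)"
      using L.L_In[OF _ bF(3), of "numc n"] tval_numc[OF wR0 wRe, of n] unfolding rule_holds_def lte S0_def by simp
    show ?thesis using NM psN s1 s2 L.tval_Lv[OF t'] by blast
  qed
  have gm: "gwf (rule_mv (LI (lt e)) LA LB)" if "wf (Re e - Id)" for e
    using gwf_rule_mv[OF levels.wf_L[OF lv[OF that]]] unfolding lte .
  have main: "hc_of_nat_set X \<in> S \<longleftrightarrow> \<not> (\<exists>F. (\<forall>n. F (2 * n) \<noteq> 0 \<longleftrightarrow> n \<in> X) \<and> (\<forall>n. T (segc F n)))" if X: "X \<in> HYP" for X
  proof
    assume XS: "hc_of_nat_set X \<in> S"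
    let ?x = "hc_of_nat_set X"
    have xM: "?x \<in> ?M" "sats ?M (?x # ps) p" using XS unfolding Sp defined_by_def by auto
    obtain R where R: "computable_wellorder R"
      and refl: "\<And>N. transM N \<Longrightarrow> Lset (ot R) \<subseteq> N \<Longrightarrow> N \<subseteq> ?M \<Longrightarrow> set (?x # ps) \<subseteq> N \<Longrightarrow> sats N (?x # ps) p"
      using sigma1_reflect[OF p(1), of "?x # ps"] xM p by auto
    obtain Rx where Rx: "computable_wellorder Rx" "?x \<in> Lset (ot Rx)" using L_bound1[OF xM(1)] by blast
    obtain Q where Q: "computable_wellorder Q" "Lset (ot R) \<subseteq> Lset (ot Q)" "Lset (ot Rx) \<subseteq> Lset (ot Q)"
      using L_bound2[OF R Rx(1)] by blast
    have wQ: "Well_order Q" using Q(1) by (simp add: computable_wellorder_def)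
    obtain e where e: "Re e = osum Q onepoint"
      using Re_surj[OF computable_wellorder_osum[OF Q(1) cwo_onepoint]] by blast
    have wRe: "Well_order (Re e)" unfolding e by (rule Well_order_osum[OF wQ wo_onepoint])
    then have wf: "wf (Re e - Id)" by (simp add: well_order_on_def)
    \<comment> \<open>The last point of \<open>osum Q onepoint\<close> is 1; in the second summand
      of \<open>osum S0 (Re e)\<close> it becomes \<open>2 * 1 + 1\<close>.\<close>
    let ?N = "Lset (col (osum S0 (Re e)) 3)"
    have one: "1 \<in> Field (Re e)" unfolding e by (simp add: Field_osum[OF wQ wo_onepoint] Field_onepoint)
    have "elts (ot Q) \<subseteq> elts (col (osum S0 (Re e)) (2 * 1 + 1))"
      using col_osum_odd_ge[OF wS0 wRe, of 1] one col_top[OF wQ] e by simp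
    then have QN: "Lset (ot Q) \<subseteq> ?N" using Lset_mono by (simp add: numeral_eq_Suc)
    interpret L: levels "osum S0 (Re e)" by (rule lv[OF wf])
    have xN: "?x \<in> ?N" using Rx(2) Q(3) QN by blast
    have "\<exists>t. ?x = tval (osum S0 (Re e)) t \<and> lev t \<in> underS (osum S0 (Re e)) 3"
      using xN[unfolded L.Lv_eq mem_Collect_eq] .
    then obtain t where t: "lev t \<in> underS (osum S0 (Re e)) 3" "tval (osum S0 (Re e)) t = ?x" by metis
    have tlt: "lt e (lev t) 3" using t(1) by (simp add: lt_def)
    note sm = sem[OF wf _ tlt]
    have "sats ?N (?x # ps) p"
      by (rule refl[OF transM_Lset]) (use sm QN Q(2) xN in auto)
    then have winS: "win (rule_mv (LI (lt e)) LA LB) (pe 0 (SatP 3 q (consc t psl)))" using sm t(2) by simp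
    have winI: "win (rule_mv (LI (lt e)) LA LB) (pe 0 (InP (numc n) t)) \<longleftrightarrow> n \<in> X" for n
      using sm[of n] t(2) by (auto simp: elts_hc_of_nat_set)
    show "\<not> (\<exists>F. (\<forall>n. F (2 * n) \<noteq> 0 \<longleftrightarrow> n \<in> X) \<and> (\<forall>n. T (segc F n)))"
    proof
      assume "\<exists>F. (\<forall>n. F (2 * n) \<noteq> 0 \<longleftrightarrow> n \<in> X) \<and> (\<forall>n. T (segc F n))"
      then obtain F where FX: "\<And>n. F (2 * n) \<noteq> 0 \<longleftrightarrow> n \<in> X" and FT: "\<forall>n. evid lt r q psl n F" unfolding Tseg by blast
      note ev = FT[unfolded evid_all]
      have D0: "F (ix 0 (pe e 0)) = 0"
      proof (rule ccontr)
        assume d0: "F (ix 0 (pe e 0)) \<noteq> 0"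
        have d: "F (ix 0 (pe e n)) \<noteq> 0" for n by (induction n) (use d0 ev in auto)
        have "(F (ix 0 (pe e (Suc n))) - 1, F (ix 0 (pe e n)) - 1) \<in> Re e - Id" for n
          using ev d[of n] by (auto simp: r_def)
        then show False using wf unfolding wf_iff_no_infinite_down_chain
          by (elim notE) (rule exI[of _ "\<lambda>n. F (ix 0 (pe e n)) - 1"], blast)
      qed
      have E: "F (ix 1 (pe e z)) \<noteq> 0 \<longleftrightarrow> win (rule_mv (LI (lt e)) LA LB) z" for z
        by (rule evidence_win[OF gm[OF wf], of "\<lambda>z. F (ix 1 (pe e z))"]) (use ev D0 in blast)+
      show False
      proof (cases "F (ix 2 (pe e (pe 3 t)))")
        case 0
        then have "F (ix 1 (pe e (pe 0 (SatP 3 q (consc t psl))))) = 0" using ev D0 tlt by (metis odd_numeral)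
        then show False using E winS by blast
      next
        case (Suc n)
        then have "F (2 * n) \<noteq> 0 \<longleftrightarrow> F (ix 1 (pe e (pe 0 (InP (numc n) t)))) = 0" using ev D0 tlt by (metis odd_numeral)
        then show False using E[of "pe 0 (InP (numc n) t)"] winI FX by blast
      qed
    qed
  next
    assume no: "\<not> (\<exists>F. (\<forall>n. F (2 * n) \<noteq> 0 \<longleftrightarrow> n \<in> X) \<and> (\<forall>n. T (segc F n)))"
    show "hc_of_nat_set X \<in> S"
    proof (rule ccontr)
      assume XS: "hc_of_nat_set X \<notin> S"
      \<comment> \<open>The path is assembled index by index: a descending sequence for each
        ill-founded order, evidence and refutations for each well-founded one.\<close>
      have "\<exists>d. \<not> wf (Re e - Id) \<longrightarrow> (\<forall>n. (d (Suc n), d n) \<in> Re e - Id)" for e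
        unfolding wf_iff_no_infinite_down_chain by auto
      then obtain d where d: "\<And>e n. \<not> wf (Re e - Id) \<Longrightarrow> (d e (Suc n), d e n) \<in> Re e - Id" by metis
      have "\<exists>h. wf (Re e - Id) \<longrightarrow> evidence (rule_mv (LI (lt e)) LA LB) h" for e using evidence_exists gm by blast
      then obtain h where h: "\<And>e. wf (Re e - Id) \<Longrightarrow> evidence (rule_mv (LI (lt e)) LA LB) (h e)" by metis
      have hw: "h e z \<noteq> 0 \<longleftrightarrow> win (rule_mv (LI (lt e)) LA LB) z" if "wf (Re e - Id)" for e z
        using evidence_win[OF gm[OF that], of "h e"] h[OF that] unfolding evidence_def by blast
      have "\<exists>w. wf (Re e - Id) \<longrightarrow> odd b \<longrightarrow> lt e (lev t) b \<longrightarrow>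
         (w = 0 \<longrightarrow> h e (pe 0 (SatP b q (consc t psl))) = 0) \<and> (\<forall>n. w = Suc n \<longrightarrow> (n \<in> X \<longleftrightarrow> h e (pe 0 (InP (numc n) t)) = 0))" for e b t
      proof (cases "wf (Re e - Id) \<and> odd b \<and> lt e (lev t) b \<and> h e (pe 0 (SatP b q (consc t psl))) \<noteq> 0")
        case True
        then have c: "wf (Re e - Id)" "odd b" "lt e (lev t) b" by auto
        let ?N = "Lset (col (osum S0 (Re e)) b)" and ?y = "tval (osum S0 (Re e)) t"
        note sm = sem[OF c]
        have sN: "sats ?N (?y # ps) p" using True hw sm by blast
        \<comment> \<open>\<Sigma>1 formulas persist upwards, so a term satisfying the formula has
          its value in \<open>S\<close>. That value is then a set of naturals other than
          \<open>X\<close>, and a number on which they differ refutes the term.\<close>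
        have "sats ?M (?y # ps) p"
          by (rule sigma1_upward[OF p(1) transM_Lset transM_Lset _ _ _ sN]) (use sm p(3) in auto)
        then have "?y \<in> S" unfolding Sp defined_by_def using sm by blast
        then obtain Y where Y: "?y = hc_of_nat_set Y" using S(2) by blast
        then have "Y \<noteq> X" using \<open>?y \<in> S\<close> XS by auto
        then obtain n where n: "n \<in> Y \<longleftrightarrow> n \<notin> X" by blast
        have "h e (pe 0 (InP (numc n) t)) \<noteq> 0 \<longleftrightarrow> n \<in> Y" using hw[OF c(1)] sm[of n] Y by (auto simp: elts_hc_of_nat_set)
        then show ?thesis using n by (intro exI[of _ "Suc n"]) auto
      next
        case False
        then show ?thesis by (intro exI[of _ 0]) auto
      qed
      then obtain w where w: "\<And>e b t. wf (Re e - Id) \<Longrightarrow> odd b \<Longrightarrow> lt e (lev t) b \<Longrightarrow>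
         (w e b t = 0 \<longrightarrow> h e (pe 0 (SatP b q (consc t psl))) = 0) \<and> (\<forall>n. w e b t = Suc n \<longrightarrow> (n \<in> X \<longleftrightarrow> h e (pe 0 (InP (numc n) t)) = 0))"
        by metis
      define gf where "gf m = (let k = pfst m; e = pfst (psnd m); z = psnd (psnd m) in
         if k = 0 then (if wf (Re e - Id) then 0 else Suc (d e z)) else if k = 1 then h e z else w e (pfst z) (psnd z))" for m
      define F where "F n = (if even n then of_bool (n div 2 \<in> X) else gf (n div 2))" for n
      have F: "F (ix 0 (pe e n)) = (if wf (Re e - Id) then 0 else Suc (d e n))" "F (ix 1 (pe e z)) = h e z"
        "F (ix 2 (pe e (pe b t))) = w e b t" "F (2 * n) = of_bool (n \<in> X)" for e n z b t
        by (simp_all add: F_def gf_def)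
      have "\<forall>L. evid lt r q psl L F"
        unfolding evid_all F
      proof (intro conjI allI impI)
        fix e n assume "(if wf (Re e - Id) then 0 else Suc (d e n)) \<noteq> 0"
        then have nw: "\<not> wf (Re e - Id)" by (auto split: if_splits)
        then show "(if wf (Re e - Id) then 0 else Suc (d e (Suc n))) \<noteq> 0"
          "r e ((if wf (Re e - Id) then 0 else Suc (d e (Suc n))) - 1) ((if wf (Re e - Id) then 0 else Suc (d e n)) - 1)"
          using d[OF nw, of n] by (auto simp: r_def)
      next
        fix e z z' assume "(if wf (Re e - Id) then 0 else Suc (d e 0)) = 0"
        then have wf: "wf (Re e - Id)" by (auto split: if_splits)
        show "rule_mv (LI (lt e)) LA LB z z'" "h e z' = 0" if "h e z = Suc z'"
          using h[OF wf] that unfolding evidence_def by blast+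
        show "h e z' \<noteq> 0" if "h e z = 0" "rule_mv (LI (lt e)) LA LB z z'"
          using h[OF wf] that unfolding evidence_def by blast
      next
        fix e b t assume "(if wf (Re e - Id) then 0 else Suc (d e 0)) = 0" "odd b" "lt e (lev t) b" "w e b t = 0"
        then show "h e (pe 0 (SatP b q (consc t psl))) = 0" using w by (auto split: if_splits)
      next
        fix e b t n assume "(if wf (Re e - Id) then 0 else Suc (d e 0)) = 0" "odd b" "lt e (lev t) b" "w e b t = Suc n"
        then show "(of_bool (n \<in> X) \<noteq> (0::nat)) \<longleftrightarrow> (h e (pe 0 (InP (numc n) t)) = 0)" using w by (auto split: if_splits)
      qed
      then have "\<forall>n. T (segc F n)" unfolding Tseg .
      moreover have "\<forall>n. F (2 * n) \<noteq> 0 \<longleftrightarrow> n \<in> X" unfolding F by auto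
      ultimately show False using no by blast
    qed
  qed
  have "T 0" by (simp add: T_def evid_def)
  moreover have "ebp T" unfolding T_def by (rule ebp_evid[OF eblt ebr])
  ultimately show thesis using that closed main by blast
qed

section \<open>From \<open>\<Delta>\<^sub>1\<close> definitions to completely determined codes\<close>

lemma length_list_decode: "length (list_decode c) = lenc c"
  by (metis lenc_list_encode list_decode_inverse)

lemma nth_list_decode: "k < lenc c \<Longrightarrow> list_decode c ! k = nthc c k"
  by (metis lenc_list_encode list_decode_inverse nthc_list_encode)

lemma list_eq_map_iff: "xs = map f ys \<longleftrightarrow> length xs = length ys \<and> (\<forall>i<length ys. xs ! i = f (ys ! i))"
  by (auto simp: list_eq_iff_nth_eq)

lemma eq_of_bool_iff: "(n :: nat) = of_bool P \<longleftrightarrow> n = 1 \<and> P \<or> n = 0 \<and> \<not> P"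
  by auto

lemma segc_cong: "(\<And>k. k < n \<Longrightarrow> f k = g k) \<Longrightarrow> segc f n = segc g n"
  by (induction n) auto

lemma snocc_iff: "c = snocc d z \<longleftrightarrow> list_decode c = list_decode d @ [z]"
  by (metis list_decode_inverse list_decode_snocc)

section \<open>Positions of the comparison game\<close>

definition fst_part :: "nat list \<Rightarrow> nat \<Rightarrow> nat" where "fst_part u k = u ! (2 * k) - 1"
definition snd_part :: "nat list \<Rightarrow> nat \<Rightarrow> nat" where "snd_part u k = u ! (2 * k + 1) div 2"
definition fst_len :: "nat list \<Rightarrow> nat" where "fst_len u = Suc (length u) div 2"
definition snd_len :: "nat list \<Rightarrow> nat" where "snd_len u = length u div 2"

lemma fst_part_append: "k < fst_len u \<Longrightarrow> fst_part (u @ [z]) k = fst_part u k"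
  by (auto simp: fst_part_def fst_len_def nth_append)

lemma snd_part_append: "k < snd_len u \<Longrightarrow> snd_part (u @ [z]) k = snd_part u k"
  by (auto simp: snd_part_def snd_len_def nth_append)

lemma len_append_even: "even (length u) \<Longrightarrow> fst_len (u @ [z]) = Suc (fst_len u) \<and> snd_len (u @ [z]) = snd_len u \<and>
    fst_part (u @ [z]) (fst_len u) = z - 1 \<and> fst_len u = snd_len u"
  by (auto simp: fst_len_def snd_len_def fst_part_def elim!: evenE)

lemma len_append_odd: "odd (length u) \<Longrightarrow> fst_len (u @ [z]) = fst_len u \<and> snd_len (u @ [z]) = Suc (snd_len u) \<and>
    snd_part (u @ [z]) (snd_len u) = z div 2 \<and> fst_len u = Suc (snd_len u)"
  by (auto simp: fst_len_def snd_len_def snd_part_def nth_append elim!: oddE)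

lemma segc_fst_append: "segc (fst_part (u @ [z])) (fst_len u) = segc (fst_part u) (fst_len u)"
  by (rule segc_cong) (rule fst_part_append)

lemma segc_snd_append: "segc (snd_part (u @ [z])) (snd_len u) = segc (snd_part u) (snd_len u)"
  by (rule segc_cong) (rule snd_part_append)

definition compat :: "nat set \<Rightarrow> nat list \<Rightarrow> bool" where
  "compat X u \<longleftrightarrow> (\<forall>n. 2 * n < fst_len u \<longrightarrow> (fst_part u (2 * n) \<noteq> 0 \<longleftrightarrow> n \<in> X))"

lemma compat_even: assumes "even (length u)"
  shows "compat X (u @ [z]) \<longleftrightarrow> compat X u \<and> (\<forall>n. fst_len u = 2 * n \<longrightarrow> (z - 1 \<noteq> 0 \<longleftrightarrow> n \<in> X))"
proof -
  note l = len_append_even[OF assms, of z]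
  have "compat X (u @ [z]) \<longleftrightarrow> (\<forall>n. 2 * n < fst_len u \<or> 2 * n = fst_len u \<longrightarrow> (fst_part (u @ [z]) (2 * n) \<noteq> 0 \<longleftrightarrow> n \<in> X))"
    unfolding compat_def using l by (simp add: less_Suc_eq)
  also have "\<dots> \<longleftrightarrow> (\<forall>n. 2 * n < fst_len u \<longrightarrow> (fst_part (u @ [z]) (2 * n) \<noteq> 0 \<longleftrightarrow> n \<in> X)) \<and>
      (\<forall>n. fst_len u = 2 * n \<longrightarrow> (fst_part (u @ [z]) (fst_len u) \<noteq> 0 \<longleftrightarrow> n \<in> X))" by metis
  also have "\<dots> \<longleftrightarrow> compat X u \<and> (\<forall>n. fst_len u = 2 * n \<longrightarrow> (z - 1 \<noteq> 0 \<longleftrightarrow> n \<in> X))"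
    unfolding compat_def using l fst_part_append[of _ u z] by auto
  finally show ?thesis .
qed

lemma compat_odd: assumes "odd (length u)" shows "compat X (u @ [z]) \<longleftrightarrow> compat X u"
  using len_append_odd[OF assms, of z] fst_part_append[of _ u z] unfolding compat_def by auto

lemma compat_Nil: "compat X []" by (simp add: compat_def fst_len_def)

text \<open>
  A position of the rank comparison game between two trees is a list: its even entries, decreased
  by one, form a node of the first tree, and its odd entries, halved, a node of the second one.
  Both nodes carry the same approximation to \<open>X\<close> at their even places. The entries \<open>0\<close> at even
  and \<open>2 * k\<close> at odd places lead to leaves: the whole space, and the set of all \<open>X\<close> that leave the
  approximation at \<open>k\<close>.
\<close>

locale two_trees =
  fixes T1 T0 :: "nat \<Rightarrow> bool" and A :: "nat set set"
  assumes eb: "ebp T1" "ebp T0" and root: "T1 0" "T0 0"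
    and closed: "\<And>x s. T1 (consc x s) \<Longrightarrow> T1 s" "\<And>x s. T0 (consc x s) \<Longrightarrow> T0 s"
    and path1: "\<And>X. X \<in> HYP \<Longrightarrow> X \<in> A \<longleftrightarrow> \<not> (\<exists>F. (\<forall>n. F (2 * n) \<noteq> 0 \<longleftrightarrow> n \<in> X) \<and> (\<forall>n. T1 (segc F n)))"
    and path0: "\<And>X. X \<in> HYP \<Longrightarrow> X \<notin> A \<longleftrightarrow> \<not> (\<exists>F. (\<forall>n. F (2 * n) \<noteq> 0 \<longleftrightarrow> n \<in> X) \<and> (\<forall>n. T0 (segc F n)))"
begin

definition inner :: "nat list \<Rightarrow> bool" where
  "inner u \<longleftrightarrow> (\<forall>k<length u. if even k then u ! k \<noteq> 0 else odd (u ! k)) \<and>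
     T1 (segc (fst_part u) (fst_len u)) \<and> T0 (segc (snd_part u) (snd_len u)) \<and>
     (\<forall>n. 2 * n < snd_len u \<longrightarrow> (fst_part u (2 * n) \<noteq> 0 \<longleftrightarrow> snd_part u (2 * n) \<noteq> 0))"

lemma inner_Nil: "inner []" using root by (simp add: inner_def fst_len_def snd_len_def)

lemma all_less_append: "(\<forall>k<length (u @ [z]). P k ((u @ [z]) ! k)) \<longleftrightarrow> (\<forall>k<length u. P k (u ! k)) \<and> P (length u) z"
  by (auto simp: nth_append less_Suc_eq)

lemma inner_even: assumes e: "even (length u)"
  shows "inner (u @ [z]) \<longleftrightarrow> inner u \<and> z \<noteq> 0 \<and> T1 (consc (z - 1) (segc (fst_part u) (fst_len u)))"
proof -
  note l = len_append_even[OF e, of z]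
  have a: "(\<forall>n. 2 * n < snd_len u \<longrightarrow> (fst_part (u @ [z]) (2 * n) \<noteq> 0 \<longleftrightarrow> snd_part (u @ [z]) (2 * n) \<noteq> 0)) \<longleftrightarrow>
    (\<forall>n. 2 * n < snd_len u \<longrightarrow> (fst_part u (2 * n) \<noteq> 0 \<longleftrightarrow> snd_part u (2 * n) \<noteq> 0))"
    using l fst_part_append[of _ u z] snd_part_append[of _ u z] by auto
  have t: "segc (fst_part (u @ [z])) (fst_len (u @ [z])) = consc (z - 1) (segc (fst_part u) (fst_len u))"
    "segc (snd_part (u @ [z])) (snd_len (u @ [z])) = segc (snd_part u) (snd_len u)" "snd_len (u @ [z]) = snd_len u"
    using l segc_fst_append[of u z] segc_snd_append[of u z] segc.simps(2)[of "fst_part (u @ [z])" "fst_len u"] by metis+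
  have "inner (u @ [z]) \<longleftrightarrow> ((\<forall>k<length u. if even k then u ! k \<noteq> 0 else odd (u ! k)) \<and> z \<noteq> 0) \<and>
     T1 (consc (z - 1) (segc (fst_part u) (fst_len u))) \<and> T0 (segc (snd_part u) (snd_len u)) \<and>
     (\<forall>n. 2 * n < snd_len u \<longrightarrow> (fst_part u (2 * n) \<noteq> 0 \<longleftrightarrow> snd_part u (2 * n) \<noteq> 0))"
    unfolding inner_def all_less_append[of u z "\<lambda>k y. if even k then y \<noteq> 0 else odd y"]
    unfolding t(1,2) unfolding t(3) a using e by simp
  then show ?thesis unfolding inner_def using closed(1) by blast
qed

lemma inner_odd: assumes e: "odd (length u)"
  shows "inner (u @ [z]) \<longleftrightarrow> inner u \<and> odd z \<and> T0 (consc (z div 2) (segc (snd_part u) (snd_len u))) \<and>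
     (\<forall>n. snd_len u = 2 * n \<longrightarrow> (fst_part u (2 * n) \<noteq> 0 \<longleftrightarrow> z div 2 \<noteq> 0))"
proof -
  note l = len_append_odd[OF e, of z]
  have a: "(\<forall>n. 2 * n < Suc (snd_len u) \<longrightarrow> (fst_part (u @ [z]) (2 * n) \<noteq> 0 \<longleftrightarrow> snd_part (u @ [z]) (2 * n) \<noteq> 0)) \<longleftrightarrow>
    (\<forall>n. 2 * n < snd_len u \<longrightarrow> (fst_part u (2 * n) \<noteq> 0 \<longleftrightarrow> snd_part u (2 * n) \<noteq> 0)) \<and>
    (\<forall>n. snd_len u = 2 * n \<longrightarrow> (fst_part u (2 * n) \<noteq> 0 \<longleftrightarrow> z div 2 \<noteq> 0))"
  proof -
    have "(\<forall>n. 2 * n < Suc (snd_len u) \<longrightarrow> (fst_part (u @ [z]) (2 * n) \<noteq> 0 \<longleftrightarrow> snd_part (u @ [z]) (2 * n) \<noteq> 0)) \<longleftrightarrow>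
      (\<forall>n. 2 * n < snd_len u \<longrightarrow> (fst_part (u @ [z]) (2 * n) \<noteq> 0 \<longleftrightarrow> snd_part (u @ [z]) (2 * n) \<noteq> 0)) \<and>
      (\<forall>n. snd_len u = 2 * n \<longrightarrow> (fst_part (u @ [z]) (2 * n) \<noteq> 0 \<longleftrightarrow> snd_part (u @ [z]) (snd_len u) \<noteq> 0))"
      unfolding less_Suc_eq by metis
    then show ?thesis using l fst_part_append[of _ u z] snd_part_append[of _ u z] by auto
  qed
  have t: "segc (fst_part (u @ [z])) (fst_len (u @ [z])) = segc (fst_part u) (fst_len u)"
    "segc (snd_part (u @ [z])) (snd_len (u @ [z])) = consc (z div 2) (segc (snd_part u) (snd_len u))" "snd_len (u @ [z]) = Suc (snd_len u)"
    using l segc_fst_append[of u z] segc_snd_append[of u z] segc.simps(2)[of "snd_part (u @ [z])" "snd_len u"] by metis+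
  have "inner (u @ [z]) \<longleftrightarrow> ((\<forall>k<length u. if even k then u ! k \<noteq> 0 else odd (u ! k)) \<and> odd z) \<and>
     T1 (segc (fst_part u) (fst_len u)) \<and> T0 (consc (z div 2) (segc (snd_part u) (snd_len u))) \<and>
     (\<forall>n. 2 * n < snd_len u \<longrightarrow> (fst_part u (2 * n) \<noteq> 0 \<longleftrightarrow> snd_part u (2 * n) \<noteq> 0)) \<and>
    (\<forall>n. snd_len u = 2 * n \<longrightarrow> (fst_part u (2 * n) \<noteq> 0 \<longleftrightarrow> z div 2 \<noteq> 0))"
    unfolding inner_def all_less_append[of u z "\<lambda>k y. if even k then y \<noteq> 0 else odd y"]
    unfolding t(1,2) unfolding t(3) a using e by simp
  then show ?thesis unfolding inner_def using closed(2) by blast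
qed

lemma inner_appendD: "inner (u @ [z]) \<Longrightarrow> inner u"
  using inner_even inner_odd by blast

text \<open>Besides recording departures from the approximation, these moves give every inner
  position a child, as a node labeled by a union or an intersection must have one.\<close>

definition leafmove :: "nat list \<Rightarrow> nat \<Rightarrow> bool" where
  "leafmove u z \<longleftrightarrow> inner u \<and> (even (length u) \<and> z = 0 \<or> odd (length u) \<and> even z \<and> z < fst_len u)"

lemma leafmove_not_inner: "leafmove u z \<Longrightarrow> \<not> inner (u @ [z])"
  unfolding leafmove_def using inner_even inner_odd by blast

definition TT :: "nat list set" where
  "TT = {u. inner u} \<union> {u @ [z] | u z. leafmove u z}"

lemma TT_snoc: "u @ [z] \<in> TT \<longleftrightarrow> inner (u @ [z]) \<or> leafmove u z"
  by (auto simp: TT_def)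

lemma TT_snocD: "u @ [z] \<in> TT \<Longrightarrow> inner u"
  using inner_appendD by (auto simp: TT_snoc leafmove_def)

definition leaf_clopen :: "nat list \<Rightarrow> nat \<Rightarrow> bool list list" where
  "leaf_clopen u z = (if even (length u) then [[]]
     else [map (\<lambda>i. fst_part u (2 * i) \<noteq> 0) [0..<z div 2] @ [fst_part u (2 * (z div 2)) = 0]])"

text \<open>Intersection nodes are the turns of the player who extends the first tree, union nodes
  those of the player who extends the second; so along positions compatible with \<open>X\<close>,
  the value 1 means that the second player wins.\<close>

definition ll :: "nat list \<rightharpoonup> label" where
  "ll v = (if inner v then Some (if even (length v) then Inter_node else Union_node)
     else if v \<in> TT then Some (Clopen (leaf_clopen (butlast v) (last v))) else None)"

lemma ll_leaf: "leafmove u z \<Longrightarrow> ll (u @ [z]) = Some (Clopen (leaf_clopen u z))"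
  by (simp add: ll_def leafmove_not_inner TT_snoc)

lemma ll_cases: "v \<in> TT \<Longrightarrow> (inner v \<Longrightarrow> P) \<Longrightarrow> (\<And>u z. v = u @ [z] \<Longrightarrow> leafmove u z \<Longrightarrow> P) \<Longrightarrow> P"
  by (auto simp: TT_def)

lemma leaf_clopen_odd: "odd (length u) \<Longrightarrow> X \<in> clopen_set (leaf_clopen u z) \<longleftrightarrow>
    (\<forall>i<z div 2. fst_part u (2 * i) \<noteq> 0 \<longleftrightarrow> i \<in> X) \<and> \<not> (fst_part u (2 * (z div 2)) \<noteq> 0 \<longleftrightarrow> z div 2 \<in> X)"
  by (auto simp: leaf_clopen_def clopen_set_def less_Suc_eq nth_append)

lemma leaf_clopen_even: "even (length u) \<Longrightarrow> X \<in> clopen_set (leaf_clopen u z)"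
  by (simp add: leaf_clopen_def clopen_set_def)

section \<open>Tree and labeling are hyperarithmetic\<close>

lemma ebp_inner: "ebp (\<lambda>c. inner (list_decode c))"
proof -
  note [eb_intros] = ebp_comp[OF eb(1)] ebp_comp[OF eb(2)]
  have seg: "P (segc f n) \<longleftrightarrow> (\<exists>s. lenc s = n \<and> (\<forall>k. k < lenc s \<longrightarrow> nthr s k = f k) \<and> P s)" for P f n
    using segc_unique[of _ n f] by (metis lenc_segc nthr_segc)
  have "inner (list_decode c) \<longleftrightarrow> (\<forall>k. k < lenc c \<longrightarrow> (even k \<longrightarrow> nthc c k \<noteq> 0) \<and> (odd k \<longrightarrow> odd (nthc c k))) \<and>
     (\<exists>s. lenc s = Suc (lenc c) div 2 \<and> (\<forall>k. k < lenc s \<longrightarrow> nthr s k = nthc c (2 * k) - 1) \<and> T1 s) \<and>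
     (\<exists>s. lenc s = lenc c div 2 \<and> (\<forall>k. k < lenc s \<longrightarrow> nthr s k = nthc c (2 * k + 1) div 2) \<and> T0 s) \<and>
     (\<forall>n. 2 * n < lenc c div 2 \<longrightarrow> (nthc c (2 * (2 * n)) - 1 \<noteq> 0 \<longleftrightarrow> nthc c (2 * (2 * n) + 1) div 2 \<noteq> 0))" for c
  proof -
    have f: "fst_part (list_decode c) k = nthc c (2 * k) - 1" if "k < Suc (lenc c) div 2" for k
      using that by (simp add: fst_part_def nth_list_decode)
    have s: "snd_part (list_decode c) k = nthc c (2 * k + 1) div 2" if "k < lenc c div 2" for k
      using that by (simp add: snd_part_def nth_list_decode)
    have "(\<forall>k<lenc c. if even k then list_decode c ! k \<noteq> 0 else odd (list_decode c ! k)) \<longleftrightarrow>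
       (\<forall>k. k < lenc c \<longrightarrow> (even k \<longrightarrow> nthc c k \<noteq> 0) \<and> (odd k \<longrightarrow> odd (nthc c k)))"
      by (auto simp: nth_list_decode)
    moreover have "T1 (segc (fst_part (list_decode c)) (Suc (lenc c) div 2)) \<longleftrightarrow>
       (\<exists>s. lenc s = Suc (lenc c) div 2 \<and> (\<forall>k. k < lenc s \<longrightarrow> nthr s k = nthc c (2 * k) - 1) \<and> T1 s)"
      unfolding seg[of T1] using f by auto
    moreover have "T0 (segc (snd_part (list_decode c)) (lenc c div 2)) \<longleftrightarrow>
       (\<exists>s. lenc s = lenc c div 2 \<and> (\<forall>k. k < lenc s \<longrightarrow> nthr s k = nthc c (2 * k + 1) div 2) \<and> T0 s)"
      unfolding seg[of T0] using s by auto
    moreover have "(\<forall>n. 2 * n < lenc c div 2 \<longrightarrow> (fst_part (list_decode c) (2 * n) \<noteq> 0 \<longleftrightarrow> snd_part (list_decode c) (2 * n) \<noteq> 0)) \<longleftrightarrow>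
       (\<forall>n. 2 * n < lenc c div 2 \<longrightarrow> (nthc c (2 * (2 * n)) - 1 \<noteq> 0 \<longleftrightarrow> nthc c (2 * (2 * n) + 1) div 2 \<noteq> 0))"
    proof -
      have "fst_part (list_decode c) (2 * n) = nthc c (2 * (2 * n)) - 1 \<and> snd_part (list_decode c) (2 * n) = nthc c (2 * (2 * n) + 1) div 2"
        if "2 * n < lenc c div 2" for n using f[of "2 * n"] s[of "2 * n"] that by auto
      then show ?thesis by auto
    qed
    ultimately show ?thesis unfolding inner_def fst_len_def snd_len_def length_list_decode by blast
  qed
  then show ?thesis by (simp only:) (intro eb_intros rec_intros)
qed

lemma ebp_leafmove: "ebp2 (\<lambda>d z. leafmove (list_decode d) z)"
proof -
  note [eb_intros] = ebp_comp[OF ebp_inner]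
  show ?thesis unfolding ebp2_def leafmove_def length_list_decode fst_len_def by (intro eb_intros rec_intros)
qed

lemma tree_TT: "tree_in_HYP TT"
proof -
  note [eb_intros] = ebp_comp[OF ebp_inner] ebp2_comp[OF ebp_leafmove]
  have "list_decode c \<in> TT \<longleftrightarrow> inner (list_decode c) \<or> (\<exists>d z. c = snocc d z \<and> leafmove (list_decode d) z)" for c
    unfolding snocc_iff TT_def by (auto, metis list_encode_inverse)
  then show ?thesis unfolding tree_in_HYP_iff by (simp only:) (intro eb_intros rec_intros)
qed

lemma labeling_ll: "labeling_in_HYP ll"
proof -
  note [eb_intros] = ebp_comp[OF ebp_inner] ebp2_comp[OF ebp_leafmove]
  \<comment> \<open>The label of a leaf is described through its code, entry by entry, so that only
    recursive functions and quantifiers over numbers occur.\<close>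
  have code: "v = label_encode (Clopen (leaf_clopen (list_decode d) z)) \<longleftrightarrow>
      even (lenc d) \<and> v = label_encode (Clopen [[]]) \<or> odd (lenc d) \<and> (\<exists>w. v = Suc (Suc (consc w 0)) \<and> lenc w = Suc (z div 2) \<and>
       (\<forall>i. i < z div 2 \<longrightarrow> (nthc w i = 1 \<and> nthc d (2 * (2 * i)) - 1 \<noteq> 0 \<or> nthc w i = 0 \<and> nthc d (2 * (2 * i)) - 1 = 0)) \<and>
       (nthc w (z div 2) = 1 \<and> nthc d (2 * (2 * (z div 2))) - 1 = 0 \<or> nthc w (z div 2) = 0 \<and> nthc d (2 * (2 * (z div 2))) - 1 \<noteq> 0))"
    if lm: "leafmove (list_decode d) z" for v d z
  proof (cases "even (lenc d)")
    case True
    then show ?thesis by (simp add: leaf_clopen_def length_list_decode)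
  next
    case False
    let ?bits = "map (\<lambda>i. fst_part (list_decode d) (2 * i) \<noteq> 0) [0..<z div 2] @ [fst_part (list_decode d) (2 * (z div 2)) = 0]"
    have zl: "z < Suc (lenc d) div 2" "even z" using lm False by (auto simp: leafmove_def fst_len_def length_list_decode)
    have fp: "fst_part (list_decode d) (2 * i) = nthc d (2 * (2 * i)) - 1" if "i \<le> z div 2" for i
    proof -
      have "2 * (2 * i) < lenc d" using that zl by auto
      then show ?thesis by (simp add: fst_part_def nth_list_decode)
    qed
    have lc: "label_encode (Clopen (leaf_clopen (list_decode d) z)) = Suc (Suc (consc (list_encode (map of_bool ?bits)) 0))"
      using False by (simp add: leaf_clopen_def length_list_decode)
    have "w = list_encode (map of_bool ?bits) \<longleftrightarrow> lenc w = Suc (z div 2) \<and>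
       (\<forall>i. i < z div 2 \<longrightarrow> (nthc w i = 1 \<and> nthc d (2 * (2 * i)) - 1 \<noteq> 0 \<or> nthc w i = 0 \<and> nthc d (2 * (2 * i)) - 1 = 0)) \<and>
       (nthc w (z div 2) = 1 \<and> nthc d (2 * (2 * (z div 2))) - 1 = 0 \<or> nthc w (z div 2) = 0 \<and> nthc d (2 * (2 * (z div 2))) - 1 \<noteq> 0)" for w
    proof -
      have lb: "length ?bits = Suc (z div 2)" by simp
      obtain xs where xs: "w = list_encode xs" using list_encode_surj by blast
      have "w = list_encode (map of_bool ?bits) \<longleftrightarrow> xs = map of_bool ?bits" unfolding xs by (metis list_encode_inverse)
      also have "\<dots> \<longleftrightarrow> length xs = Suc (z div 2) \<and> (\<forall>i<Suc (z div 2). xs ! i = of_bool (?bits ! i))"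
        unfolding list_eq_map_iff lb ..
      also have "\<dots> \<longleftrightarrow> length xs = Suc (z div 2) \<and> (\<forall>i<z div 2. xs ! i = of_bool (fst_part (list_decode d) (2 * i) \<noteq> 0)) \<and>
          xs ! (z div 2) = of_bool (fst_part (list_decode d) (2 * (z div 2)) = 0)"
      proof -
        have "?bits ! i \<longleftrightarrow> fst_part (list_decode d) (2 * i) \<noteq> 0" if "i < z div 2" for i
          using that by (simp add: nth_append)
        then have "(\<forall>i<z div 2. xs ! i = of_bool (?bits ! i)) \<longleftrightarrow> (\<forall>i<z div 2. xs ! i = of_bool (fst_part (list_decode d) (2 * i) \<noteq> 0))"
          by (intro all_cong1 imp_cong refl) (simp only:)
        moreover have "?bits ! (z div 2) \<longleftrightarrow> fst_part (list_decode d) (2 * (z div 2)) = 0" by (simp add: nth_append)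
        ultimately show ?thesis unfolding All_less_Suc by (simp only: conj_ac)
      qed
      also have "\<dots> \<longleftrightarrow> lenc w = Suc (z div 2) \<and> (\<forall>i<z div 2. nthc w i = of_bool (nthc d (2 * (2 * i)) - 1 \<noteq> 0)) \<and>
          nthc w (z div 2) = of_bool (nthc d (2 * (2 * (z div 2))) - 1 = 0)"
        using fp by (auto simp: xs nthc_list_encode)
      also have "\<dots> \<longleftrightarrow> lenc w = Suc (z div 2) \<and>
         (\<forall>i. i < z div 2 \<longrightarrow> (nthc w i = 1 \<and> nthc d (2 * (2 * i)) - 1 \<noteq> 0 \<or> nthc w i = 0 \<and> nthc d (2 * (2 * i)) - 1 = 0)) \<and>
         (nthc w (z div 2) = 1 \<and> nthc d (2 * (2 * (z div 2))) - 1 = 0 \<or> nthc w (z div 2) = 0 \<and> nthc d (2 * (2 * (z div 2))) - 1 \<noteq> 0)"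
        unfolding eq_of_bool_iff not_not ..
      finally show ?thesis .
    qed
    note this[symmetric]
    then show ?thesis unfolding lc using False by (simp only: simp_thms) blast
  qed
  have "lab ll c v \<longleftrightarrow> inner (list_decode c) \<and> (even (lenc c) \<and> v = 1 \<or> odd (lenc c) \<and> v = 0) \<or>
     (\<exists>d z. c = snocc d z \<and> leafmove (list_decode d) z \<and> v = label_encode (Clopen (leaf_clopen (list_decode d) z)))" for c v
  proof (cases "inner (list_decode c)")
    case True
    then have "\<not> (\<exists>d z. c = snocc d z \<and> leafmove (list_decode d) z)" unfolding snocc_iff using leafmove_not_inner by metis
    then show ?thesis using True by (auto simp: lab_def ll_def length_list_decode)
  next
    case False
    have "lab ll c v \<longleftrightarrow> (\<exists>u z. list_decode c = u @ [z] \<and> leafmove u z \<and> v = label_encode (Clopen (leaf_clopen u z)))"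
      using False unfolding lab_def
      by (auto simp: ll_leaf simp del: label_encode.simps) (auto simp: ll_def TT_def simp del: label_encode.simps split: if_splits)
    then show ?thesis using False unfolding snocc_iff by (metis list_encode_inverse)
  qed
  then have "lab ll c v \<longleftrightarrow> inner (list_decode c) \<and> (even (lenc c) \<and> v = 1 \<or> odd (lenc c) \<and> v = 0) \<or>
     (\<exists>d z. c = snocc d z \<and> leafmove (list_decode d) z \<and> (even (lenc d) \<and> v = label_encode (Clopen [[]]) \<or>
       odd (lenc d) \<and> (\<exists>w. v = Suc (Suc (consc w 0)) \<and> lenc w = Suc (z div 2) \<and>
       (\<forall>i. i < z div 2 \<longrightarrow> (nthc w i = 1 \<and> nthc d (2 * (2 * i)) - 1 \<noteq> 0 \<or> nthc w i = 0 \<and> nthc d (2 * (2 * i)) - 1 = 0)) \<and>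
       (nthc w (z div 2) = 1 \<and> nthc d (2 * (2 * (z div 2))) - 1 = 0 \<or> nthc w (z div 2) = 0 \<and> nthc d (2 * (2 * (z div 2))) - 1 \<noteq> 0))))" for c v
    by (simp only: code cong: conj_cong)
  then show ?thesis unfolding labeling_in_HYP_iff ebp2_def by (simp only:) (intro eb_intros rec_intros)
qed

section \<open>The code has no hyperarithmetic path\<close>

lemma no_double_path:
  assumes "X \<in> HYP" "\<And>n. F (2 * n) \<noteq> 0 \<longleftrightarrow> n \<in> X" "\<And>n. T1 (segc F n)" "\<And>n. G (2 * n) \<noteq> 0 \<longleftrightarrow> n \<in> X" "\<And>n. T0 (segc G n)"
  shows False
  using path1[OF assms(1)] path0[OF assms(1)] assms by blast

lemma parts_of_path:
  assumes "\<And>n. inner (map g [0..<n])"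
  shows "T1 (segc (\<lambda>k. g (2 * k) - 1) n)" "T0 (segc (\<lambda>k. g (2 * k + 1) div 2) n)"
    "g (2 * (2 * n)) - 1 \<noteq> 0 \<longleftrightarrow> g (2 * (2 * n) + 1) div 2 \<noteq> 0"
proof -
  let ?u = "\<lambda>n. map g [0..<n]"
  have f: "fst_part (?u m) k = g (2 * k) - 1" if "2 * k < m" for k m using that by (simp add: fst_part_def)
  have s: "snd_part (?u m) k = g (2 * k + 1) div 2" if "2 * k + 1 < m" for k m using that by (simp add: snd_part_def)
  have l: "fst_len (?u (2 * n)) = n" "snd_len (?u (2 * n)) = n" for n by (auto simp: fst_len_def snd_len_def)
  have i: "inner (?u (2 * n))" for n using assms by blast
  have "segc (fst_part (?u (2 * n))) n = segc (\<lambda>k. g (2 * k) - 1) n" by (rule segc_cong) (simp add: f)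
  then show "T1 (segc (\<lambda>k. g (2 * k) - 1) n)" using i[of n] unfolding inner_def l by simp
  have "segc (snd_part (?u (2 * n))) n = segc (\<lambda>k. g (2 * k + 1) div 2) n" by (rule segc_cong) (simp add: s)
  then show "T0 (segc (\<lambda>k. g (2 * k + 1) div 2) n)" using i[of n] unfolding inner_def l by simp
  have "2 * n < snd_len (?u (2 * (2 * n + 1)))" unfolding l by simp
  then have "fst_part (?u (2 * (2 * n + 1))) (2 * n) \<noteq> 0 \<longleftrightarrow> snd_part (?u (2 * (2 * n + 1))) (2 * n) \<noteq> 0"
    using i[of "2 * n + 1"] unfolding inner_def by blast
  moreover have "fst_part (?u (2 * (2 * n + 1))) (2 * n) = g (2 * (2 * n)) - 1" by (rule f) simp
  moreover have "snd_part (?u (2 * (2 * n + 1))) (2 * n) = g (2 * (2 * n) + 1) div 2" by (rule s) simp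
  ultimately show "g (2 * (2 * n)) - 1 \<noteq> 0 \<longleftrightarrow> g (2 * (2 * n) + 1) div 2 \<noteq> 0" by (simp only:)
qed

lemma borel_code_TT: "borel_code_in_HYP TT ll"
proof -
  have sub: "inner u \<Longrightarrow> u \<in> TT" for u by (simp add: TT_def)
  have pre: "s @ t \<in> TT \<Longrightarrow> s \<in> TT" for s t
  proof (induction t rule: rev_induct)
    case (snoc z t)
    then have "inner (s @ t)" using TT_snocD[of "s @ t" z] by simp
    then show ?case using snoc.IH sub by blast
  qed simp
  have nopath: "\<not> (\<exists>g. path_in_HYP g \<and> (\<forall>n. map g [0..<n] \<in> TT))"
  proof
    assume "\<exists>g. path_in_HYP g \<and> (\<forall>n. map g [0..<n] \<in> TT)"
    then obtain g where g: "ebp2 (\<lambda>n k. g n = k)" "\<And>n. map g [0..<n] \<in> TT" unfolding path_in_HYP_iff by blast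
    have "inner (map g [0..<n])" for n using TT_snocD[of "map g [0..<n]" "g n"] g(2)[of "Suc n"] by simp
    note pt = parts_of_path[OF this]
    \<comment> \<open>A path through \<open>TT\<close> stays among the inner positions, and the two
      nodes it builds agree on their approximation. The limit is hyperarithmetic because the path
      is, so both trees would have a path for this \<open>X\<close>.\<close>
    define X where "X = {n. g (2 * (2 * n)) - 1 \<noteq> 0}"
    note [eb_intros] = ebp2_comp[OF g(1)]
    have "ebp (\<lambda>n. \<exists>k. g (2 * (2 * n)) = k \<and> k - 1 \<noteq> 0)" by (intro eb_intros rec_intros)
    then have "X \<in> HYP" unfolding HYP_iff_ebp X_def by simp
    then show False
      by (rule no_double_path[where F = "\<lambda>k. g (2 * k) - 1" and G = "\<lambda>k. g (2 * k + 1) div 2"])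
         (use pt in \<open>auto simp: X_def\<close>)
  qed
  have lf: "if leaf TT s then \<exists>F. ll s = Some (Clopen F) else ll s = Some Union_node \<or> ll s = Some Inter_node" if s: "s \<in> TT" for s
    using s
  proof (rule ll_cases)
    assume i: "inner s"
    have "s @ [0] \<in> TT"
    proof (cases "even (length s)")
      case True then show ?thesis using i by (simp add: TT_snoc leafmove_def)
    next
      case False
      then show ?thesis using i by (simp add: TT_snoc leafmove_def fst_len_def)
    qed
    then have "\<not> leaf TT s" by (auto simp: leaf_def)
    then show ?thesis using i by (simp add: ll_def)
  next
    fix u z assume u: "s = u @ [z]" "leafmove u z"
    then have "\<not> inner s" using leafmove_not_inner by blast
    then have "leaf TT s" using s TT_snocD by (auto simp: leaf_def)
    then show ?thesis using u ll_leaf by auto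
  qed
  have "dom ll = TT" using sub by (auto simp: ll_def dom_def)
  then show ?thesis
    unfolding borel_code_in_HYP_def using tree_TT labeling_ll sub[OF inner_Nil] pre nopath lf by blast
qed

section \<open>The comparison game for one set \<open>X\<close>\<close>

definition mvX :: "nat set \<Rightarrow> nat \<Rightarrow> nat \<Rightarrow> bool" where
  "mvX X c d \<longleftrightarrow> (\<exists>z. d = snocc c z) \<and> inner (list_decode d) \<and> compat X (list_decode d)"

lemma mvX_code: "mvX X (list_encode u) d \<longleftrightarrow> (\<exists>z. d = list_encode (u @ [z]) \<and> inner (u @ [z]) \<and> compat X (u @ [z]))"
  unfolding mvX_def snocc_list_encode by auto

text \<open>Infinite plays of any complexity are excluded here: compatibility forces the
  approximation they build to be the given \<open>X\<close>, which is in \<open>HYP\<close>.\<close>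

lemma gwf_mvX: assumes X: "X \<in> HYP" shows "gwf (mvX X)"
  unfolding gwf_def
proof (rule ccontr)
  assume "\<not> wf {(q, p). mvX X p q}"
  then obtain c where c: "\<And>i. mvX X (c i) (c (Suc i))" unfolding wf_iff_no_infinite_down_chain by auto
  define L where "L i = list_decode (c (Suc i))" for i
  have L: "inner (L i)" "compat X (L i)" for i using c[of i] by (auto simp: mvX_def L_def)
  have "\<exists>z. L (Suc i) = L i @ [z]" for i using c[of "Suc i"] by (auto simp: mvX_def L_def list_decode_snocc)
  then obtain z where z: "\<And>i. L (Suc i) = L i @ [z i]" by metis
  have len: "length (L i) = length (L 0) + i" for i by (induction i) (auto simp: z)
  have coh: "k < length (L i) \<Longrightarrow> L (i + j) ! k = L i ! k" for i j k
  proof (induction j)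
    case (Suc j)
    have "k < length (L (i + j))" using Suc.prems len[of i] len[of "i + j"] by linarith
    then show ?case using Suc by (simp add: z nth_append)
  qed simp
  define g where "g k = L (Suc k) ! k" for k
  have gL: "L i ! k = g k" if "k < length (L i)" for i k
  proof -
    have "k < length (L (Suc k))" using len[of "Suc k"] by simp
    then show ?thesis using coh[of k "Suc k" i] coh[of k i "Suc k"] that by (simp add: g_def add.commute)
  qed
  have Lg: "L i = map g [0..<length (L i)]" for i by (rule nth_equalityI) (use gL in auto)
  have pre: "inner (map g [0..<n + m]) \<Longrightarrow> inner (map g [0..<n])" for n m
    by (induction m) (use inner_appendD in auto)
  have in_g: "inner (map g [0..<n])" for n
  proof -
    have "inner (map g [0..<n + length (L 0)])" using L(1)[of n] Lg[of n] len[of n] by (simp add: add.commute)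
    then show ?thesis by (rule pre)
  qed
  note pt = parts_of_path[OF in_g]
  have FX: "g (2 * (2 * n)) - 1 \<noteq> 0 \<longleftrightarrow> n \<in> X" for n
  proof -
    let ?i = "4 * n + 2"
    have l: "4 * n + 2 \<le> length (L ?i)" using len[of ?i] by simp
    then have "2 * n < fst_len (L ?i)" by (simp add: fst_len_def)
    then have "fst_part (L ?i) (2 * n) \<noteq> 0 \<longleftrightarrow> n \<in> X" using L(2)[of ?i] unfolding compat_def by blast
    then show ?thesis using gL[of "2 * (2 * n)" ?i] l by (simp add: fst_part_def)
  qed
  show False
    by (rule no_double_path[OF X, where F = "\<lambda>k. g (2 * k) - 1" and G = "\<lambda>k. g (2 * k + 1) div 2"])
       (use pt FX in auto)
qed

lemma ebp_compat: assumes "X \<in> HYP" shows "ebp (\<lambda>c. compat X (list_decode c))"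
proof -
  have [eb_intros]: "recfn f \<Longrightarrow> ebp (\<lambda>n. f n \<in> X)" for f using ebp_comp assms HYP_iff_ebp by blast
  have "compat X (list_decode c) \<longleftrightarrow> (\<forall>n. 2 * n < Suc (lenc c) div 2 \<longrightarrow> (nthc c (2 * (2 * n)) - 1 \<noteq> 0 \<longleftrightarrow> n \<in> X))" for c
  proof -
    have "fst_part (list_decode c) (2 * n) = nthc c (2 * (2 * n)) - 1" if "2 * n < Suc (lenc c) div 2" for n
      using that by (simp add: fst_part_def nth_list_decode)
    then show ?thesis unfolding compat_def fst_len_def length_list_decode by auto
  qed
  then show ?thesis by (simp only:) (intro eb_intros rec_intros)
qed

lemma ebp_mvX: assumes "X \<in> HYP" shows "ebp2 (mvX X)"
proof -
  note [eb_intros] = ebp_comp[OF ebp_inner] ebp_comp[OF ebp_compat[OF assms]]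
  show ?thesis unfolding ebp2_def mvX_def by (intro eb_intros rec_intros)
qed

text \<open>Inner positions incompatible with \<open>X\<close> get the value 1: a union node has the
  leaf of the first disagreement as a child with this value, and at an intersection node every child
  is the whole space or again incompatible.\<close>

definition evX :: "nat set \<Rightarrow> nat list \<rightharpoonup> bool" where
  "evX X v = (if inner v then Some (compat X v \<longrightarrow> (win (mvX X) (list_encode v) \<longleftrightarrow> odd (length v)))
     else if v \<in> TT then Some (X \<in> clopen_set (leaf_clopen (butlast v) (last v))) else None)"

lemma evX_leaf: "leafmove u z \<Longrightarrow> evX X (u @ [z]) = Some (X \<in> clopen_set (leaf_clopen u z))"
  by (simp add: evX_def leafmove_not_inner TT_snoc)

lemma win_mvX: assumes "X \<in> HYP"
  shows "win (mvX X) (list_encode u) \<longleftrightarrow> (\<exists>z. inner (u @ [z]) \<and> compat X (u @ [z]) \<and> \<not> win (mvX X) (list_encode (u @ [z])))"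
  unfolding win_iff[OF gwf_mvX[OF assms], of "list_encode u"] mvX_code by blast

lemma evX_map: assumes X: "X \<in> HYP" shows "map_in_HYP (evX X)"
proof -
  note [eb_intros] = ebp_comp[OF ebp_inner] ebp_comp[OF ebp_compat[OF X]] ebp2_comp[OF ebp_leafmove]
    ebp_comp[OF ebp_win[OF ebp_mvX[OF X] gwf_mvX[OF X]]]
  have [eb_intros]: "recfn f \<Longrightarrow> ebp (\<lambda>n. f n \<in> X)" for f using ebp_comp X HYP_iff_ebp by blast
  define lv where "lv d z \<longleftrightarrow> even (lenc d) \<or> (\<forall>i. i < z div 2 \<longrightarrow> (nthc d (2 * (2 * i)) - 1 \<noteq> 0 \<longleftrightarrow> i \<in> X)) \<and>
     \<not> (nthc d (2 * (2 * (z div 2))) - 1 \<noteq> 0 \<longleftrightarrow> z div 2 \<in> X)" for d z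
  have lv: "X \<in> clopen_set (leaf_clopen (list_decode d) z) \<longleftrightarrow> lv d z" if lm: "leafmove (list_decode d) z" for d z
  proof (cases "even (lenc d)")
    case True then show ?thesis by (simp add: lv_def leaf_clopen_even length_list_decode)
  next
    case False
    have zl: "z < Suc (lenc d) div 2" "even z" using lm False by (auto simp: leafmove_def fst_len_def length_list_decode)
    have fp: "fst_part (list_decode d) (2 * i) = nthc d (2 * (2 * i)) - 1" if "i \<le> z div 2" for i
    proof -
      have "2 * (2 * i) < lenc d" using that zl by auto
      then show ?thesis by (simp add: fst_part_def nth_list_decode)
    qed
    show ?thesis using False fp by (simp add: lv_def leaf_clopen_odd length_list_decode)
  qed
  have val: "evX X (list_decode c) = Some b \<longleftrightarrow>
     (inner (list_decode c) \<and> (b \<longleftrightarrow> (compat X (list_decode c) \<longrightarrow> (win (mvX X) c \<longleftrightarrow> odd (lenc c))))) \<or>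
     (\<exists>d z. c = snocc d z \<and> leafmove (list_decode d) z \<and> (b \<longleftrightarrow> lv d z))" for c b
  proof (cases "inner (list_decode c)")
    case True
    then have "\<not> (\<exists>d z. c = snocc d z \<and> leafmove (list_decode d) z)" unfolding snocc_iff using leafmove_not_inner by metis
    then show ?thesis using True by (auto simp: evX_def length_list_decode)
  next
    case False
    have "evX X (list_decode c) = Some b \<longleftrightarrow> (\<exists>u z. list_decode c = u @ [z] \<and> leafmove u z \<and> (b \<longleftrightarrow> X \<in> clopen_set (leaf_clopen u z)))"
      using False by (auto simp: evX_leaf) (auto simp: evX_def TT_def split: if_splits)
    also have "\<dots> \<longleftrightarrow> (\<exists>d z. c = snocc d z \<and> leafmove (list_decode d) z \<and> (b \<longleftrightarrow> lv d z))"
      unfolding snocc_iff using lv by (metis list_encode_inverse)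
    finally show ?thesis using False by blast
  qed
  show ?thesis unfolding map_in_HYP_iff val lv_def by (intro conjI eb_intros rec_intros)
qed

lemma evX_eval: assumes X: "X \<in> HYP" shows "evaluation_map TT ll X (evX X)"
proof -
  have dom: "dom (evX X) = TT" by (auto simp: evX_def dom_def TT_def)
  have child: "u @ [z] \<in> TT \<longleftrightarrow> inner (u @ [z]) \<or> leafmove u z" for u z by (rule TT_snoc)
  have un: "evX X u = Some True \<longleftrightarrow> (\<exists>n. evX X (u @ [n]) = Some True)" if i: "inner u" and o: "odd (length u)" for u
  proof (cases "compat X u")
    case False
    define P where "P n \<longleftrightarrow> 2 * n < fst_len u \<and> \<not> (fst_part u (2 * n) \<noteq> 0 \<longleftrightarrow> n \<in> X)" for n
    have "\<exists>n. P n" using False unfolding compat_def P_def by blast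
    \<comment> \<open>The least disagreement is taken because the leaf \<open>2 * k\<close> also
      asks for agreement before \<open>k\<close>.\<close>
    then obtain k where k: "P k" "\<forall>j<k. \<not> P j" using exists_least_iff[of P] by blast
    have lm: "leafmove u (2 * k)" using i o k(1) by (simp add: leafmove_def P_def)
    have "X \<in> clopen_set (leaf_clopen u (2 * k))"
      unfolding leaf_clopen_odd[OF o] using k unfolding P_def by auto
    then have "evX X (u @ [2 * k]) = Some True" using evX_leaf[OF lm] by simp
    moreover have "evX X u = Some True" using i False by (simp add: evX_def)
    ultimately show ?thesis by blast
  next
    case True
    have lf: "evX X (u @ [n]) = Some False" if lm: "leafmove u n" for n
    proof -
      have "2 * (n div 2) < fst_len u" using lm o by (auto simp: leafmove_def)
      then have "X \<notin> clopen_set (leaf_clopen u n)" unfolding leaf_clopen_odd[OF o] using True unfolding compat_def by blast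
      then show ?thesis using evX_leaf[OF lm] by simp
    qed
    have inn: "evX X (u @ [n]) = Some True \<longleftrightarrow> \<not> win (mvX X) (list_encode (u @ [n]))" if "inner (u @ [n])" for n
      using that True o compat_odd[OF o] by (simp add: evX_def)
    have "evX X u = Some True \<longleftrightarrow> win (mvX X) (list_encode u)" using i True o by (simp add: evX_def)
    also have "\<dots> \<longleftrightarrow> (\<exists>z. inner (u @ [z]) \<and> \<not> win (mvX X) (list_encode (u @ [z])))"
      unfolding win_mvX[OF X, of u] compat_odd[OF o] using True by blast
    also have "\<dots> \<longleftrightarrow> (\<exists>n. evX X (u @ [n]) = Some True)"
    proof
      assume "\<exists>n. evX X (u @ [n]) = Some True"
      then obtain n where n: "evX X (u @ [n]) = Some True" by blast
      then have "u @ [n] \<in> TT" using dom by blast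
      then have "inner (u @ [n])" using child lf n by fastforce
      then show "\<exists>z. inner (u @ [z]) \<and> \<not> win (mvX X) (list_encode (u @ [z]))" using inn n by blast
    qed (use inn in blast)
    finally show ?thesis .
  qed
  have int: "evX X u = Some True \<longleftrightarrow> (\<forall>n. u @ [n] \<in> TT \<longrightarrow> evX X (u @ [n]) = Some True)" if i: "inner u" and e: "even (length u)" for u
  proof -
    have lf: "evX X (u @ [n]) = Some True" if "leafmove u n" for n
      using evX_leaf[OF that] leaf_clopen_even[OF e] by simp
    have inn: "evX X (u @ [n]) = Some True \<longleftrightarrow> (compat X (u @ [n]) \<longrightarrow> win (mvX X) (list_encode (u @ [n])))" if "inner (u @ [n])" for n
      using that e by (simp add: evX_def)
    have "(\<forall>n. u @ [n] \<in> TT \<longrightarrow> evX X (u @ [n]) = Some True) \<longleftrightarrow>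
        (\<forall>n. inner (u @ [n]) \<longrightarrow> compat X (u @ [n]) \<longrightarrow> win (mvX X) (list_encode (u @ [n])))"
      using child lf inn by blast
    also have "\<dots> \<longleftrightarrow> (compat X u \<longrightarrow> \<not> win (mvX X) (list_encode u))"
      unfolding win_mvX[OF X, of u] compat_even[OF e] by blast
    also have "\<dots> \<longleftrightarrow> evX X u = Some True" using i e by (simp add: evX_def)
    finally show ?thesis by simp
  qed
  show ?thesis
    unfolding evaluation_map_def
  proof (intro conjI ballI allI impI)
    show "dom (evX X) = TT" by (rule dom)
    fix s assume s: "s \<in> TT"
    show "evX X s = Some True \<longleftrightarrow> X \<in> clopen_set F" if F: "ll s = Some (Clopen F)" for F
      using s
    proof (rule ll_cases)
      assume "inner s" then show ?thesis using F by (simp add: ll_def split: if_splits)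
    next
      fix u z assume u: "s = u @ [z]" "leafmove u z"
      then have "F = leaf_clopen u z" using F ll_leaf by simp
      then show ?thesis using u evX_leaf by simp
    qed
    show "evX X s = Some True \<longleftrightarrow> (\<exists>n. evX X (s @ [n]) = Some True)" if "ll s = Some Union_node"
      using that un by (auto simp: ll_def split: if_splits)
    show "evX X s = Some True \<longleftrightarrow> (\<forall>n. s @ [n] \<in> TT \<longrightarrow> evX X (s @ [n]) = Some True)" if "ll s = Some Inter_node"
      using that int by (auto simp: ll_def split: if_splits)
  qed
qed

lemma evX_root: assumes X: "X \<in> HYP" shows "evX X [] = Some (X \<in> A)"
proof -
  let ?W = "\<lambda>u. win (mvX X) (list_encode u)"
  note wf = gwf_mvX[OF X]
  let ?r = "{(q, p). mvX X p q}"
  have wf2: "wf (trancl ?r)" using wf by (simp add: gwf_def wf_trancl)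
  have step2: "(list_encode (u @ [z, y]), list_encode u) \<in> trancl ?r"
    if "inner (u @ [z])" "compat X (u @ [z])" "inner (u @ [z, y])" "compat X (u @ [z, y])" for u z y
  proof -
    have "(list_encode (u @ [z]), list_encode u) \<in> ?r" using that by (auto simp: mvX_code)
    moreover have "(list_encode (u @ [z, y]), list_encode (u @ [z])) \<in> ?r" using that mvX_code[of X "u @ [z]"] by auto
    ultimately show ?thesis by (meson r_into_trancl trancl_trans)
  qed
  have "evX X [] = Some (\<not> ?W [])" using inner_Nil compat_Nil by (simp add: evX_def)
  moreover have "?W [] \<longleftrightarrow> X \<notin> A"
  proof (cases "X \<in> A")
    case True
    then obtain G where G: "\<And>n. G (2 * n) \<noteq> 0 \<longleftrightarrow> n \<in> X" "\<And>n. T0 (segc G n)" using path0[OF X] by blast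
    \<comment> \<open>The player of the second tree answers along the path \<open>G\<close> for
      \<open>X\<close>; the invariant is that the second node is an initial segment of
      \<open>G\<close>. A round consists of two moves, hence the transitive closure.\<close>
    have key: "\<forall>u. c = list_encode u \<longrightarrow> inner u \<longrightarrow> compat X u \<longrightarrow> even (length u) \<longrightarrow> segc (snd_part u) (snd_len u) = segc G (snd_len u) \<longrightarrow> \<not> ?W u" for c
    proof (induction c rule: wf_induct_rule[OF wf2])
      case (1 c)
      show ?case
      proof (intro allI impI notI)
        fix u assume u: "c = list_encode u" "inner u" "compat X u" "even (length u)" "segc (snd_part u) (snd_len u) = segc G (snd_len u)" and W: "?W u"
        obtain z where z: "inner (u @ [z])" "compat X (u @ [z])" "\<not> ?W (u @ [z])" using W win_mvX[OF X, of u] by blast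
        let ?d = "u @ [z]" and ?m = "snd_len u"
        let ?y = "2 * G ?m + 1"
        have od: "odd (length ?d)" using u(4) by simp
        have lu: "snd_len ?d = ?m" "fst_len ?d = Suc ?m" using len_append_even[OF u(4), of z] by auto
        have sd: "segc (snd_part ?d) (snd_len ?d) = segc G ?m" using segc_snd_append[of u z] u(5) lu by simp
        have inn: "inner (?d @ [?y])"
          unfolding inner_odd[OF od]
        proof (intro conjI allI impI)
          show "inner ?d" by (rule z(1))
          show "odd ?y" by simp
          show "T0 (consc (?y div 2) (segc (snd_part ?d) (snd_len ?d)))" using G(2)[of "Suc ?m"] unfolding sd by simp
          fix n assume n: "snd_len ?d = 2 * n"
          have "2 * n < fst_len ?d" using lu n by simp
          then have "fst_part ?d (2 * n) \<noteq> 0 \<longleftrightarrow> n \<in> X" using z(2) unfolding compat_def by blast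
          then show "fst_part ?d (2 * n) \<noteq> 0 \<longleftrightarrow> ?y div 2 \<noteq> 0" using G(1)[of n] n lu by simp
        qed
        have cmp: "compat X (?d @ [?y])" using compat_odd[OF od] z(2) by blast
        have "(list_encode (u @ [z, ?y]), c) \<in> trancl ?r" unfolding u(1) by (rule step2) (use z inn cmp in auto)
        moreover have "segc (snd_part (?d @ [?y])) (snd_len (?d @ [?y])) = segc G (snd_len (?d @ [?y]))"
        proof -
          note lo = len_append_odd[OF od, of ?y]
          have "segc (snd_part (?d @ [?y])) (Suc (snd_len ?d)) = consc (G ?m) (segc (snd_part ?d) (snd_len ?d))"
            using lo segc_snd_append[of ?d ?y] by simp
          then show ?thesis using lo sd lu by simp
        qed
        ultimately have "\<not> ?W (?d @ [?y])" using 1[of "list_encode (?d @ [?y])"] inn cmp u(4) by auto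
        then have "?W ?d" using win_mvX[OF X, of ?d] inn cmp by blast
        then show False using z(3) by blast
      qed
    qed
    have "\<not> ?W []" by (rule key[rule_format, OF refl inner_Nil compat_Nil]) (simp_all add: snd_len_def)
    then show ?thesis using True by blast
  next
    case False
    then obtain F where F: "\<And>n. F (2 * n) \<noteq> 0 \<longleftrightarrow> n \<in> X" "\<And>n. T1 (segc F n)" using path1[OF X] by blast
    \<comment> \<open>Now the first tree has a path \<open>F\<close> for \<open>X\<close>. The
      player to move extends the first node along it, so by well-foundedness the opponent is the one
      to get stuck.\<close>
    have key: "\<forall>u. c = list_encode u \<longrightarrow> inner u \<longrightarrow> compat X u \<longrightarrow> even (length u) \<longrightarrow> segc (fst_part u) (fst_len u) = segc F (fst_len u) \<longrightarrow> ?W u" for c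
    proof (induction c rule: wf_induct_rule[OF wf2])
      case (1 c)
      show ?case
      proof (intro allI impI)
        fix u assume u: "c = list_encode u" "inner u" "compat X u" "even (length u)" "segc (fst_part u) (fst_len u) = segc F (fst_len u)"
        let ?m = "fst_len u"
        let ?z = "Suc (F ?m)"
        let ?d = "u @ [?z]"
        note le = len_append_even[OF u(4), of ?z]
        have od: "odd (length ?d)" using u(4) by simp
        have inn: "inner ?d" unfolding inner_even[OF u(4)] using u F(2)[of "Suc ?m"] by simp
        have cmp: "compat X ?d" unfolding compat_even[OF u(4)] using u(3) F(1) by auto
        have sd: "segc (fst_part ?d) (fst_len ?d) = segc F (Suc ?m)"
        proof -
          have "fst_part ?d ?m = F ?m" "fst_len ?d = Suc ?m" using le by auto
          then show ?thesis by (simp only: segc.simps segc_fst_append u(5))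
        qed
        have "?W (?d @ [y])" if y: "inner (?d @ [y])" "compat X (?d @ [y])" for y
        proof -
          have "(list_encode (u @ [?z, y]), c) \<in> trancl ?r" unfolding u(1) by (rule step2) (use inn cmp y in auto)
          moreover have "segc (fst_part (?d @ [y])) (fst_len (?d @ [y])) = segc F (fst_len (?d @ [y]))"
          proof -
            have l: "fst_len (?d @ [y]) = fst_len ?d" "fst_len ?d = Suc ?m" using len_append_odd[OF od, of y] le by blast+
            show ?thesis unfolding l(1) segc_fst_append sd unfolding l(2) ..
          qed
          ultimately show ?thesis using 1[of "list_encode (?d @ [y])"] y u(4) by auto
        qed
        then have "\<not> ?W ?d" using win_mvX[OF X, of ?d] by blast
        then show "?W u" using win_mvX[OF X, of u] inn cmp by blast
      qed
    qed
    have "?W []" by (rule key[rule_format, OF refl inner_Nil compat_Nil]) (simp_all add: fst_len_def)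
    then show ?thesis using False by blast
  qed
  ultimately show ?thesis by simp
qed

lemma completely_determined: "completely_determined_code_for TT ll A"
proof -
  have "X \<in> A \<longleftrightarrow> (\<exists>f. map_in_HYP f \<and> evaluation_map TT ll X f \<and> f [] = Some True)" if X: "X \<in> HYP" for X
  proof
    assume "X \<in> A"
    then show "\<exists>f. map_in_HYP f \<and> evaluation_map TT ll X f \<and> f [] = Some True"
      using evX_map[OF X] evX_eval[OF X] evX_root[OF X] by auto
  next
    assume "\<exists>f. map_in_HYP f \<and> evaluation_map TT ll X f \<and> f [] = Some True"
    then obtain f where f: "map_in_HYP f" "evaluation_map TT ll X f" "f [] = Some True" by blast
    show "X \<in> A"
    proof (rule ccontr)
      assume "X \<notin> A"
      then have "evX X [] = Some False" using evX_root[OF X] by simp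
      then show False
        using strategies_agree[OF borel_code_TT f(1) _ f(3) evX_map[OF X]]
          evaluation_map_winning_strategy[OF borel_code_TT] f(2) evX_eval[OF X] by blast
    qed
  qed
  moreover have "\<exists>f. map_in_HYP f \<and> evaluation_map TT ll X f" if "X \<in> HYP" for X
    using evX_map[OF that] evX_eval[OF that] by blast
  ultimately show ?thesis
    unfolding completely_determined_code_for_def completely_determined_in_HYP_def
    using borel_code_TT by (intro conjI ballI)
qed

end

theorem delta1_imp_completely_determined:
  assumes A: "A \<subseteq> HYP" and D: "delta1_L_omega1ck A"
  shows "\<exists>T l. completely_determined_code_for T l A"
proof -
  have img: "hc_of_nat_set X \<in> hc_of_nat_set ` B \<longleftrightarrow> X \<in> B" for X B by (auto simp: hc_of_nat_set_inject)
  have s: "sigma1_definable (Lset omega1ck) (hc_of_nat_set ` A)" "sigma1_definable (Lset omega1ck) (hc_of_nat_set ` (HYP - A))"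
    using D by (auto simp: delta1_L_omega1ck_def)
  obtain T1 where T1: "ebp T1" "T1 0" "\<And>x s. T1 (consc x s) \<Longrightarrow> T1 s"
    "\<And>X. X \<in> HYP \<Longrightarrow> hc_of_nat_set X \<in> hc_of_nat_set ` A \<longleftrightarrow> \<not> (\<exists>F. (\<forall>n. F (2 * n) \<noteq> 0 \<longleftrightarrow> n \<in> X) \<and> (\<forall>n. T1 (segc F n)))"
    by (rule sigma1_tree[OF s(1) image_mono[OF subset_UNIV]]) (rule that)
  obtain T0 where T0: "ebp T0" "T0 0" "\<And>x s. T0 (consc x s) \<Longrightarrow> T0 s"
    "\<And>X. X \<in> HYP \<Longrightarrow> hc_of_nat_set X \<in> hc_of_nat_set ` (HYP - A) \<longleftrightarrow> \<not> (\<exists>F. (\<forall>n. F (2 * n) \<noteq> 0 \<longleftrightarrow> n \<in> X) \<and> (\<forall>n. T0 (segc F n)))"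
    by (rule sigma1_tree[OF s(2) image_mono[OF subset_UNIV]]) (rule that)
  interpret two_trees T1 T0 A
  proof
    fix X assume X: "X \<in> HYP"
    show "X \<in> A \<longleftrightarrow> \<not> (\<exists>F. (\<forall>n. F (2 * n) \<noteq> 0 \<longleftrightarrow> n \<in> X) \<and> (\<forall>n. T1 (segc F n)))"
      using T1(4)[OF X] unfolding img .
    have "X \<in> HYP - A \<longleftrightarrow> X \<notin> A" using X by blast
    then show "X \<notin> A \<longleftrightarrow> \<not> (\<exists>F. (\<forall>n. F (2 * n) \<noteq> 0 \<longleftrightarrow> n \<in> X) \<and> (\<forall>n. T0 (segc F n)))"
      using T0(4)[OF X] unfolding img by (simp only:)
  qed (use T1(1-3) T0(1-3) in blast)+
  show ?thesis using completely_determined by blast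
qed

theorem theorem4p1:
  fixes A :: "nat set set"
  assumes "A \<subseteq> HYP"
  shows "((\<exists>T l. completely_determined_code_for T l A) \<longleftrightarrow> (\<exists>T l. determined_code_for T l A)) \<and>
         ((\<exists>T l. determined_code_for T l A) \<longleftrightarrow> delta1_L_omega1ck A)"
  using completely_determined_imp_determined determined_imp_delta1[OF assms]
    delta1_imp_completely_determined[OF assms] by blast

end
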